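(* Let $T>0$, $n,k\in\mathbb{N}$, $y_0\in\mathbb{R}^n$, and let $A:[0,T]\times\mathbb{R}^n\times\mathbb{R}^k\to\mathbb{R}^n$, $f:[0,T]\times\mathbb{R}^n\times\mathbb{R}^k\to\mathbb{R}\cup\{+\infty\}$, $g:\mathbb{R}^n\to\mathbb{R}\cup\{+\infty\}$. Assume: (1) for all $t\in[0,T]$, $y\in\mathbb{R}^n$, $u\in\mathbb{R}^k$ with $|u|=1$, the limits $\lim_{\lambda\to\infty} f(t,y,\lambda u)/\lambda$ and $\lim_{\lambda\to\infty}A(t,y,\lambda u)/\lambda$ exist; (2) $A$ is continuous in $t$; there is $L\in\mathbb{R}$ with $|A(t,y_1,u)-A(t,y_2,u)|\le L|y_1-y_2|$ for all $t\in[0,T]$, $u\in\mathbb{R}^k$, $y_1,y_2\in\mathbb{R}^n$; and there is $C>0$ with $|A(t,y,u)|\le C(|u|+1)$ for all $t,y,u$; (3) $f$ is equicontinuous in $t$ and $y$ (i.e. the functions $(t,y)\mapsto f(t,y,u)$, $u\in\mathbb{R}^k$, are equicontinuous); there is $c>0$ with $f(t,y,u)\ge c(|u|-1)$ for all $t,y,u$; and $g$ is continuous and bounded from below. Then the fully relaxed problem has a minimizer $(\tilde t,\tilde y,\mu_s)$ (on some interval $[0,S]$, where $S>0$ is free).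
   Context: Relaxed right-hand side and integrand: for $\tilde t\in[0,T]$, $\tilde y\in\mathbb{R}^n$, $\tilde u\in\mathbb{R}^k$ and $\tilde v>0$ put $\tilde A(\tilde t,\tilde y,\tilde v,\tilde u):=\tilde v A(\tilde t,\tilde y,\tilde u/\tilde v)$ and $\tilde f(\tilde t,\tilde y,\tilde v,\tilde u):=\tilde v f(\tilde t,\tilde y,\tilde u/\tilde v)$; for $\tilde v=0$ both are defined as the limit $\tilde v\searrow0$ of these expressions. $L^\infty$-Young measure: a family $\mu_s$, $s\in[0,S]$, of Radon measures on $\mathbb{R}^m$ such that there is a sequence of equibounded $L^\infty$ functions $w_j:[0,S]\to\mathbb{R}^m$ with $\delta_{w_j(s)}\rightharpoonup\mu_s$ in the sense of measures, i.e. $\int_0^S\varphi(s,w_j(s))\,ds\to\int_0^S\int_{\mathbb{R}^m}\varphi(s,w)\,d\mu_s(w)\,ds$ for all $\varphi\in C_c([0,S]\times\mathbb{R}^m)$. The sequence is said to generate $\mu_s$. A Young measure is on a set $K$ if it is generated by functions with values in $K$. Fully relaxed problem: minimize $$\tilde{\mathcal F}(\tilde t,\tilde y,\mu_s):=\int_0^S\int_{\mathbb{R}^{k+1}}\tilde f(\tilde t(s),\tilde y(s),\tilde v,\tilde u)\,d\mu_s(\tilde v,\tilde u)\,ds+g(\tilde y(S))$$ over all $S>0$, all $L^\infty$-Young measures $\mu_s$, $s\in[0,S]$, on the set $[0,1]\times \overline{B_1(0)}\subset\mathbb{R}^{k+1}$ (with $B_1(0)\subset\mathbb{R}^k$ the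 unit ball), and all $\tilde t\in W^{1,\infty}([0,S];[0,T])$, $\tilde y\in W^{1,\infty}([0,S];\mathbb{R}^n)$ such that for almost every $s\in[0,S]$ $$\tilde y'(s)=\int_{\mathbb{R}^{k+1}}\tilde A(\tilde t(s),\tilde y(s),\tilde v,\tilde u)\,d\mu_s(\tilde v,\tilde u),\qquad \tilde t'(s)=\int_{\mathbb{R}^{k+1}}\tilde v\,d\mu_s(\tilde v,\tilde u),$$ and $\tilde y(0)=y_0$, $\tilde t(0)=0$, $\tilde t(S)=T$.
   Formalization: Added, as the claim fails without it (A=0, g=0, f=|u| for u≠0, f(t,y,0)=1): for each y, Ã(·,y,·,·) is continuous on [0,T]×[0,1]×closed B_1; for each t,y, f̃(t,y,·,·) is lower semicontinuous on ([0,1]×closed B_1) minus the origin. *)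

theory Defs
  imports "HOL-Analysis.Analysis"
begin

section \<open>The space \<open>W\<^sup>1\<^sup>,\<^sup>\<infinity>\<close> on an interval\<close>

text \<open>Test functions of class \<open>C\<^sub>c\<^sup>1(0,S)\<close>, extended by zero to the real line; the second
  argument is the derivative.\<close>

definition C1c_test :: "real \<Rightarrow> (real \<Rightarrow> real) \<Rightarrow> (real \<Rightarrow> real) \<Rightarrow> bool" where
  "C1c_test S \<phi> \<phi>' \<longleftrightarrow>
     (\<forall>x. (\<phi> has_real_derivative \<phi>' x) (at x)) \<and> continuous_on UNIV \<phi>' \<and>
     (\<exists>a b. 0 < a \<and> b < S \<and> (\<forall>x. x \<notin> {a..b} \<longrightarrow> \<phi> x = 0))"

text \<open>\<open>W1inf S y d\<close>: the function \<open>y\<close> is the continuous representative of an element of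
  \<open>W\<^sup>1\<^sup>,\<^sup>\<infinity>([0,S])\<close> with weak derivative \<open>d\<close>.  The continuous representative is needed for the
  point values at the end points; \<open>d\<close> is determined up to null sets.\<close>

definition W1inf :: "real \<Rightarrow> (real \<Rightarrow> 'a::euclidean_space) \<Rightarrow> (real \<Rightarrow> 'a) \<Rightarrow> bool" where
  "W1inf S y d \<longleftrightarrow>
     continuous_on {0..S} y \<and>
     d \<in> borel_measurable (lebesgue_on {0..S}) \<and>
     (\<exists>M. AE s in lebesgue_on {0..S}. norm (d s) \<le> M) \<and>
     (\<forall>\<phi> \<phi>'. C1c_test S \<phi> \<phi>' \<longrightarrow>
        (\<integral>s. \<phi>' s *\<^sub>R y s \<partial>lebesgue_on {0..S}) = - (\<integral>s. \<phi> s *\<^sub>R d s \<partial>lebesgue_on {0..S}))"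

section \<open>\<open>L\<^sup>\<infinity>\<close>-Young measures\<close>

text \<open>On a Euclidean space every locally finite Borel measure is regular, hence Radon.\<close>

definition radon_measure :: "'a::euclidean_space measure \<Rightarrow> bool" where
  "radon_measure M \<longleftrightarrow> sets M = sets borel \<and> (\<forall>K. compact K \<longrightarrow> emeasure M K < \<infinity>)"

definition Cc_test :: "real \<Rightarrow> (real \<times> 'a::euclidean_space \<Rightarrow> real) \<Rightarrow> bool" where
  "Cc_test S \<phi> \<longleftrightarrow> continuous_on ({0..S} \<times> UNIV) \<phi> \<and>
     compact (closure {p \<in> {0..S} \<times> UNIV. \<phi> p \<noteq> 0})"

text \<open>The integrability clause says that the limit integral is meaningful (weak measurability
  of the family).  It is required with respect to Lebesgue measurable sets, so changing the
  family on a null set of parameters is harmless.\<close>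

definition generates_young ::
    "real \<Rightarrow> (nat \<Rightarrow> real \<Rightarrow> 'a::euclidean_space) \<Rightarrow> (real \<Rightarrow> 'a measure) \<Rightarrow> bool" where
  "generates_young S w \<mu> \<longleftrightarrow>
     (\<forall>j. w j \<in> borel_measurable (lebesgue_on {0..S})) \<and>
     (\<exists>M. \<forall>j. AE s in lebesgue_on {0..S}. norm (w j s) \<le> M) \<and>
     (\<forall>\<phi>. Cc_test S \<phi> \<longrightarrow>
        integrable (lebesgue_on {0..S}) (\<lambda>s. \<integral>x. \<phi> (s, x) \<partial>\<mu> s) \<and>
        (\<lambda>j. \<integral>s. \<phi> (s, w j s) \<partial>lebesgue_on {0..S})
          \<longlonglongrightarrow> (\<integral>s. (\<integral>x. \<phi> (s, x) \<partial>\<mu> s) \<partial>lebesgue_on {0..S}))"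

definition Linf_young_measure_on ::
    "real \<Rightarrow> 'a::euclidean_space set \<Rightarrow> (real \<Rightarrow> 'a measure) \<Rightarrow> bool" where
  "Linf_young_measure_on S K \<mu> \<longleftrightarrow>
     (\<forall>s\<in>{0..S}. radon_measure (\<mu> s)) \<and>
     (\<exists>w. generates_young S w \<mu> \<and> (\<forall>j. AE s in lebesgue_on {0..S}. w j s \<in> K))"

section \<open>The fully relaxed problem\<close>

text \<open>Both functions are meaningful for \<open>v \<ge> 0\<close> only; the measures below do not charge \<open>v < 0\<close>.\<close>

definition relaxed_rhs ::
    "(real \<Rightarrow> real^'n \<Rightarrow> real^'k \<Rightarrow> real^'n) \<Rightarrow> real \<Rightarrow> real^'n \<Rightarrow> real \<Rightarrow> real^'k \<Rightarrow> real^'n" where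
  "relaxed_rhs A t y v u =
     (if v > 0 then v *\<^sub>R A t y (u /\<^sub>R v)
      else Lim (at_right 0) (\<lambda>v. v *\<^sub>R A t y (u /\<^sub>R v)))"

definition relaxed_integrand ::
    "(real \<Rightarrow> real^'n \<Rightarrow> real^'k \<Rightarrow> ereal) \<Rightarrow> real \<Rightarrow> real^'n \<Rightarrow> real \<Rightarrow> real^'k \<Rightarrow> ereal" where
  "relaxed_integrand f t y v u =
     (if v > 0 then ereal v * f t y (u /\<^sub>R v)
      else Lim (at_right 0) (\<lambda>v. ereal v * f t y (u /\<^sub>R v)))"

text \<open>Lebesgue integral of an extended real function, as integral of the positive part minus
  integral of the negative part (\<open>e2ennreal\<close> maps negative arguments to \<open>0\<close>).\<close>

definition ereal_integral :: "'a measure \<Rightarrow> ('a \<Rightarrow> ereal) \<Rightarrow> ereal" where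
  "ereal_integral M h =
     enn2ereal (\<integral>\<^sup>+x. e2ennreal (h x) \<partial>M) - enn2ereal (\<integral>\<^sup>+x. e2ennreal (- h x) \<partial>M)"

definition relaxed_cost ::
    "(real \<Rightarrow> real^'n \<Rightarrow> real^'k \<Rightarrow> ereal) \<Rightarrow> (real^'n \<Rightarrow> ereal) \<Rightarrow> real \<Rightarrow>
     (real \<Rightarrow> real) \<Rightarrow> (real \<Rightarrow> real^'n) \<Rightarrow> (real \<Rightarrow> (real \<times> (real^'k)) measure) \<Rightarrow> ereal" where
  "relaxed_cost f g S t y \<mu> =
     ereal_integral (lebesgue_on {0..S})
       (\<lambda>s. ereal_integral (\<mu> s) (\<lambda>(v, u). relaxed_integrand f (t s) (y s) v u))
     + g (y S)"

definition relaxed_admissible ::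
    "real \<Rightarrow> real^'n \<Rightarrow> (real \<Rightarrow> real^'n \<Rightarrow> real^'k \<Rightarrow> real^'n) \<Rightarrow> real \<Rightarrow>
     (real \<Rightarrow> real) \<Rightarrow> (real \<Rightarrow> real^'n) \<Rightarrow> (real \<Rightarrow> (real \<times> (real^'k)) measure) \<Rightarrow> bool" where
  "relaxed_admissible T y0 A S t y \<mu> \<longleftrightarrow>
     S > 0 \<and>
     Linf_young_measure_on S ({0..1} \<times> cball 0 1) \<mu> \<and>
     t ` {0..S} \<subseteq> {0..T} \<and>
     (\<exists>t' y'. W1inf S t t' \<and> W1inf S y y' \<and>
        (AE s in lebesgue_on {0..S}.
           y' s = (\<integral>(v, u). relaxed_rhs A (t s) (y s) v u \<partial>\<mu> s) \<and>
           t' s = (\<integral>(v, u). v \<partial>\<mu> s))) \<and>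
     y 0 = y0 \<and> t 0 = 0 \<and> t S = T"

definition relaxed_minimizer ::
    "real \<Rightarrow> real^'n \<Rightarrow> (real \<Rightarrow> real^'n \<Rightarrow> real^'k \<Rightarrow> real^'n) \<Rightarrow>
     (real \<Rightarrow> real^'n \<Rightarrow> real^'k \<Rightarrow> ereal) \<Rightarrow> (real^'n \<Rightarrow> ereal) \<Rightarrow> real \<Rightarrow>
     (real \<Rightarrow> real) \<Rightarrow> (real \<Rightarrow> real^'n) \<Rightarrow> (real \<Rightarrow> (real \<times> (real^'k)) measure) \<Rightarrow> bool" where
  "relaxed_minimizer T y0 A f g S t y \<mu> \<longleftrightarrow>
     relaxed_admissible T y0 A S t y \<mu> \<and>
     (\<forall>S' t' y' \<mu>'. relaxed_admissible T y0 A S' t' y' \<mu>' \<longrightarrow>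
        relaxed_cost f g S t y \<mu> \<le> relaxed_cost f g S' t' y' \<mu>')"

section \<open>Regularity of the data\<close>

text \<open>The growth and continuity conditions on \<open>A\<close> and \<open>f\<close> in \<open>t\<close> and \<open>y\<close>, together with existence
  of the radial limits, do not control the dependence on \<open>u\<close>, nor the way the radial limits are
  attained.  Existence fails without such control: for \<open>A = 0\<close>, \<open>g = 0\<close> and \<open>f t y u = norm u\<close>
  for \<open>u \<noteq> 0\<close>, \<open>f t y 0 = 1\<close>, the infimum is \<open>0\<close> and is not attained.  The theorem therefore also
  assumes that the relaxed right-hand side is continuous and the relaxed integrand lower
  semicontinuous up to \<open>v = 0\<close>.  The origin is left out for the integrand: there its value is \<open>0\<close>
  or \<open>\<infinity>\<close>, and lower semicontinuity at \<open>(0,0)\<close> would exclude the case \<open>f t y 0 = \<infinity>\<close>.\<close>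

text \<open>Equicontinuity of the functions \<open>(t,y) \<mapsto> f t y u\<close> at every point of \<open>[0,T] \<times> \<real>\<^sup>n\<close>.
  The two inequalities express that the values differ by at most \<open>\<epsilon>\<close>; if one of them is infinite,
  then so is the other.\<close>

definition equicontinuous_ty ::
    "real \<Rightarrow> (real \<Rightarrow> 'a::metric_space \<Rightarrow> 'b \<Rightarrow> ereal) \<Rightarrow> bool" where
  "equicontinuous_ty T f \<longleftrightarrow>
     (\<forall>t\<in>{0..T}. \<forall>y. \<forall>\<epsilon>>0. \<exists>\<delta>>0. \<forall>t'\<in>{0..T}. \<forall>y'. dist (t', y') (t, y) < \<delta> \<longrightarrow>
        (\<forall>u. f t' y' u \<le> f t y u + ereal \<epsilon> \<and> f t y u \<le> f t' y' u + ereal \<epsilon>))"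

definition lsc_on :: "'a::topological_space set \<Rightarrow> ('a \<Rightarrow> ereal) \<Rightarrow> bool" where
  "lsc_on X h \<longleftrightarrow> (\<forall>x\<in>X. h x \<le> Liminf (at x within X) h)"

end

theory Submission
  imports Defs "HOL-Probability.Probability" "HOL-Complex_Analysis.Great_Picard"
begin

text \<open>A Young measure is the family of laws of \<open>X (s, \<omega>)\<close>, where \<open>\<omega>\<close> is uniform on \<open>[0,1)\<close> and
  \<open>X\<close> is a Borel map into the control set \<open>K\<close>; integrated over time it becomes a measure on
  \<open>[0,S] \<times> K\<close> with Lebesgue time marginal.  These measures are weakly sequentially compact, limits
  are again of this form, and they are generated by functions.  The state and the clock solve
  integral equations which are linear in the measure.

  Right-hand side and integrand are positively one-homogeneous in \<open>(v,u)\<close>, so a trajectory may be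
  reparametrised until \<open>v + norm u\<close> is constant.  The total of \<open>v\<close> is \<open>T\<close>, and by coercivity the
  cost controls the total of \<open>norm u\<close>.  A minimising sequence can therefore be moved to one fixed
  time interval, with controls bounded away from the origin, the only point where lower
  semicontinuity may fail.  Weak compactness and the theorem of Arzela and Ascoli then yield a
  limit; the dynamics pass to the limit by continuity, the cost by lower semicontinuity.\<close>

section \<open>Densities and time measures\<close>

text \<open>Nothing bounds \<open>S\<close> along a minimising sequence: time may pass at controls
  near the origin, where clock and state hardly move. The time integral of
  \<open>v + norm u\<close>, however, does not change under reparametrisation. It is at least
  \<open>T\<close>, and at most \<open>B = T + b / c\<close> when the nonnegative shifted cost is at
  most \<open>b\<close>. Spread evenly over an interval of length \<open>B\<close>, it gives
  controls of constant size between \<open>T / B\<close> and 1: small enough for the box, and away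
  from the origin.

  A Young measure is known through time integrals only. As the time marginal is Lebesgue measure,
  the mass of a fixed cell of controls up to time \<open>s\<close> is a monotone Lipschitz function
  of \<open>s\<close> and has a density. Countably many such densities, consistent for almost every
  \<open>s\<close>, serve for weak compactness and disintegration at once.

  Semicontinuity is assumed in the control alone, for frozen \<open>t\<close> and \<open>y\<close>.
  Equicontinuity of \<open>f\<close>, uniform in \<open>u\<close>, makes it joint. In the same way
  the Lipschitz bound on \<open>A\<close> supplies joint continuity in \<open>y\<close>.\<close>

lemma UN_Ioc_eq_UNIV: "(\<Union>n::nat. {- real n<..real n}) = UNIV"
proof -
  have "\<exists>n::nat. x \<in> {- real n<..real n}" for x
  proof -
    obtain n :: nat where "\<bar>x\<bar> < real n" using reals_Archimedean2 by blast
    then show ?thesis by (intro exI[of _ n]) auto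
  qed
  then show ?thesis by auto
qed

lemma ident_measurable_lebesgue_on: "(\<lambda>x. x) \<in> borel_measurable (lebesgue_on A)"
  by (rule measurable_restrict_space1) (simp add: measurable_completion)

lemma AE_lebesgue_on_neq:
  fixes a :: real
  assumes "A \<in> sets lebesgue"
  shows "AE s in lebesgue_on A. s \<noteq> a"
proof -
  have "AE s in lebesgue. s \<noteq> a" by (rule AE_completion) (rule AE_lborel_singleton)
  then show ?thesis using assms by (subst AE_restrict_space_iff) (auto elim: eventually_mono)
qed

text \<open>The Stieltjes measures of \<open>H\<close> and of \<open>x - H x\<close> add up to Lebesgue measure, hence the former
  is absolutely continuous.\<close>

lemma density_of_monotone_lipschitz:
  fixes H :: "real \<Rightarrow> real"
  assumes mono: "\<And>a b. a \<le> b \<Longrightarrow> H a \<le> H b"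
    and lip: "\<And>a b. a \<le> b \<Longrightarrow> H b - H a \<le> b - a"
  obtains h :: "real \<Rightarrow> real" where "h \<in> borel_measurable borel" "\<And>x. 0 \<le> h x"
    "\<And>a b. a \<le> b \<Longrightarrow> (\<integral>\<^sup>+x\<in>{a<..b}. ennreal (h x) \<partial>lborel) = ennreal (H b - H a)"
proof -
  have lipH: "1-lipschitz_on UNIV H"
  proof (rule lipschitz_onI)
    fix x y :: real
    show "dist (H x) (H y) \<le> 1 * dist x y"
      using mono[of x y] mono[of y x] lip[of x y] lip[of y x]
      by (cases "x \<le> y") (auto simp: dist_real_def)
  qed simp
  have contH: "continuous_on UNIV H" by (rule lipschitz_on_continuous_on[OF lipH])
  define H2 where "H2 x = x - H x" for x
  have contH2: "continuous_on UNIV H2" unfolding H2_def by (intro continuous_intros contH)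
  have mono2: "a \<le> b \<Longrightarrow> H2 a \<le> H2 b" for a b using lip[of a b] by (simp add: H2_def)
  have rc: "continuous (at_right a) H" "continuous (at_right a) H2" for a
    using contH contH2 by (auto simp: continuous_on_eq_continuous_at continuous_at_imp_continuous_at_within)
  define M1 where "M1 = interval_measure H"
  define M2 where "M2 = interval_measure H2"
  define M where "M = measure_of UNIV (sets borel) (\<lambda>E. emeasure M1 E + emeasure M2 E)"
  have E1: "a \<le> b \<Longrightarrow> emeasure M1 {a<..b} = ennreal (H b - H a)" for a b
    unfolding M1_def by (rule emeasure_interval_measure_Ioc) (auto intro: mono rc)
  have E2: "a \<le> b \<Longrightarrow> emeasure M2 {a<..b} = ennreal (H2 b - H2 a)" for a b
    unfolding M2_def by (rule emeasure_interval_measure_Ioc) (auto intro: mono2 rc)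
  have setsM: "sets M = sets borel"
    unfolding M_def by (metis sets.sigma_sets_eq sets_measure_of sets.space_closed space_borel)
  have EM: "emeasure M E = emeasure M1 E + emeasure M2 E" if "E \<in> sets borel" for E
  proof (subst M_def, rule emeasure_measure_of_sigma)
    show "sigma_algebra UNIV (sets (borel::real measure))" by (metis sets.sigma_algebra_axioms space_borel)
    show "positive (sets borel) (\<lambda>E. emeasure M1 E + emeasure M2 E)" by (simp add: positive_def)
    show "countably_additive (sets borel) (\<lambda>E. emeasure M1 E + emeasure M2 E)"
    proof (rule countably_additiveI)
      fix A :: "nat \<Rightarrow> real set" assume A: "range A \<subseteq> sets borel" "disjoint_family A" "(\<Union>i. A i) \<in> sets borel"
      have "(\<Sum>i. emeasure M1 (A i) + emeasure M2 (A i)) = (\<Sum>i. emeasure M1 (A i)) + (\<Sum>i. emeasure M2 (A i))"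
        by (rule suminf_add[symmetric]) auto
      also have "\<dots> = emeasure M1 (\<Union>i. A i) + emeasure M2 (\<Union>i. A i)"
        using A by (subst (1 2) suminf_emeasure) (auto simp: M1_def M2_def)
      finally show "(\<Sum>i. emeasure M1 (A i) + emeasure M2 (A i)) = emeasure M1 (\<Union>i. A i) + emeasure M2 (\<Union>i. A i)" .
    qed
  qed (fact that)
  have "M = lborel"
  proof (rule sym, rule measure_eqI_generator_eq)
    let ?E = "range (\<lambda>(a,b). {a<..b::real})"
    show "Int_stable ?E" by (auto simp: Int_stable_def)
    show "?E \<subseteq> Pow UNIV" by auto
    show "sets lborel = sigma_sets UNIV ?E" "sets M = sigma_sets UNIV ?E"
      by (simp_all add: setsM borel_sigma_sets_Ioc)
    show "range (\<lambda>n::nat. {- real n<..real n}) \<subseteq> ?E" by auto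
    show "(\<Union>n::nat. {- real n<..real n}) = UNIV" by (rule UN_Ioc_eq_UNIV)
    show "emeasure lborel {- real n<..real n} \<noteq> \<infinity>" for n by simp
    fix X assume "X \<in> ?E"
    then obtain a b where X: "X = {a<..b}" by auto
    show "emeasure lborel X = emeasure M X"
    proof (cases "a \<le> b")
      case True
      then have "ennreal (H b - H a) + ennreal (H2 b - H2 a) = ennreal (b - a)"
        using mono[OF True] mono2[OF True]
        by (subst ennreal_plus[symmetric]) (auto simp: H2_def)
      then show ?thesis using True by (simp add: X EM E1 E2)
    qed (simp add: X)
  qed
  then have "emeasure M1 E \<le> emeasure lborel E" if "E \<in> sets borel" for E
    using EM[OF that] by simp
  then have "absolutely_continuous lborel M1"
    unfolding absolutely_continuous_def null_sets_def M1_def by force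
  then obtain f where f[measurable]: "f \<in> borel_measurable borel" and fd: "density lborel f = M1"
    using sigma_finite_measure.Radon_Nikodym[OF sigma_finite_lborel, of M1] by (auto simp: M1_def)
  have If: "(\<integral>\<^sup>+x\<in>{a<..b}. f x \<partial>lborel) = ennreal (H b - H a)" if "a \<le> b" for a b
    using E1[OF that] unfolding fd[symmetric] by (simp add: emeasure_density)
  \<comment> \<open>The Radon-Nikodym density is \<open>ennreal\<close> valued. Finite integrals
    over bounded intervals make it finite almost everywhere, so its real part can replace
    it.\<close>
  have "AE x in lborel. \<forall>n::nat. x \<in> {- real n<..real n} \<longrightarrow> f x \<noteq> \<infinity>"
  proof (rule AE_all_countable[THEN iffD2], rule allI)
    fix n :: nat
    have "AE x in lborel. f x * indicator {- real n<..real n} x \<noteq> \<infinity>"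
      by (rule nn_integral_PInf_AE) (auto simp: If)
    then show "AE x in lborel. x \<in> {- real n<..real n} \<longrightarrow> f x \<noteq> \<infinity>"
      by eventually_elim (auto simp: indicator_def)
  qed
  then have fin: "AE x in lborel. f x \<noteq> \<infinity>"
  proof eventually_elim
    fix x assume *: "\<forall>n::nat. x \<in> {- real n<..real n} \<longrightarrow> f x \<noteq> \<infinity>"
    obtain n :: nat where "\<bar>x\<bar> < real n" using reals_Archimedean2 by blast
    then have "x \<in> {- real n<..real n}" by auto
    with * show "f x \<noteq> \<infinity>" by blast
  qed
  show thesis
  proof
    show "(\<lambda>x. enn2real (f x)) \<in> borel_measurable borel" by measurable
    show "0 \<le> enn2real (f x)" for x by simp
    fix a b :: real assume "a \<le> b"
    have "(\<integral>\<^sup>+x\<in>{a<..b}. ennreal (enn2real (f x)) \<partial>lborel) = (\<integral>\<^sup>+x\<in>{a<..b}. f x \<partial>lborel)"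
      by (rule nn_integral_cong_AE) (use fin in \<open>auto elim!: eventually_mono simp: less_top\<close>)
    then show "(\<integral>\<^sup>+x\<in>{a<..b}. ennreal (enn2real (f x)) \<partial>lborel) = ennreal (H b - H a)"
      using If[OF \<open>a \<le> b\<close>] by simp
  qed
qed

text \<open>Half-open intervals form an intersection-stable generator that exhausts the line, so the
  two densities define the same measure; densities for a sigma-finite measure are unique.\<close>

lemma AE_eq_of_interval_integrals_eq:
  fixes f g :: "real \<Rightarrow> ennreal"
  assumes [measurable]: "f \<in> borel_measurable borel" "g \<in> borel_measurable borel"
    and eq: "\<And>a b. a \<le> b \<Longrightarrow> (\<integral>\<^sup>+x\<in>{a<..b}. f x \<partial>lborel) = (\<integral>\<^sup>+x\<in>{a<..b}. g x \<partial>lborel)"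
    and fin: "\<And>a b. a \<le> b \<Longrightarrow> (\<integral>\<^sup>+x\<in>{a<..b}. f x \<partial>lborel) < \<infinity>"
  shows "AE x in lborel. f x = g x"
proof (rule sigma_finite_measure.density_unique[OF sigma_finite_lborel])
  show "density lborel f = density lborel g"
  proof (rule measure_eqI_generator_eq)
    let ?E = "range (\<lambda>(a,b). {a<..b::real})"
    show "Int_stable ?E" by (auto simp: Int_stable_def)
    show "?E \<subseteq> Pow UNIV" by auto
    show "sets (density lborel f) = sigma_sets UNIV ?E" "sets (density lborel g) = sigma_sets UNIV ?E"
      by (simp_all add: borel_sigma_sets_Ioc)
    show "range (\<lambda>n::nat. {- real n<..real n}) \<subseteq> ?E" by auto
    show "(\<Union>n::nat. {- real n<..real n}) = UNIV" by (rule UN_Ioc_eq_UNIV)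
    show "emeasure (density lborel f) {- real n<..real n} \<noteq> \<infinity>" for n
      using fin[of "- real n" "real n"] by (subst emeasure_density) auto
    fix X assume "X \<in> ?E"
    then obtain a b where X: "X = {a<..b}" by auto
    show "emeasure (density lborel f) X = emeasure (density lborel g) X"
      using eq[of a b] by (cases "a \<le> b") (auto simp: X emeasure_density)
  qed
qed auto

text \<open>Positive and negative part of a Borel version have equal integrals over all intervals,
  hence agree almost everywhere. At each point one of them is 0, so both vanish.\<close>

lemma AE_zero_of_interval_integrals_zero_real:
  fixes u :: "real \<Rightarrow> real"
  assumes int: "integrable (lebesgue_on {0..S}) u"
    and zero: "\<And>a b. 0 \<le> a \<Longrightarrow> a \<le> b \<Longrightarrow> b \<le> S \<Longrightarrow> (\<integral>s. indicator {a<..b} s * u s \<partial>lebesgue_on {0..S}) = 0"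
  shows "AE s in lebesgue_on {0..S}. u s = 0"
proof -
  define u0 where "u0 x = indicator {0..S} x * u x" for x
  have int0: "integrable lebesgue u0"
    using int by (subst (asm) integrable_restrict_space) (auto simp: u0_def[abs_def])
  obtain u' where u'[measurable]: "u' \<in> borel_measurable lborel" and ae: "AE x in lborel. u0 x = u' x"
    using completion_ex_borel_measurable_real[OF borel_measurable_integrable[OF int0]] by auto
  have ae': "AE x in lebesgue. u0 x = u' x" using ae by (rule AE_completion)
  have "integrable lebesgue u'"
    using int0 ae' by (subst integrable_cong_AE[of _ _ u0]) (auto simp: measurable_completion elim: eventually_mono)
  then have int': "integrable lborel u'" by (simp add: integrable_completion)
  have null: "(\<integral>x. indicator {a<..b} x * u' x \<partial>lborel) = 0" if "a \<le> b" for a b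
  proof -
    have "(\<integral>x. indicator {a<..b} x * u' x \<partial>lborel) = (\<integral>x. indicator {a<..b} x * u' x \<partial>lebesgue)"
      by (rule integral_completion[symmetric]) measurable
    also have "\<dots> = (\<integral>x. indicator {a<..b} x * u0 x \<partial>lebesgue)"
    proof (rule integral_cong_AE)
      have [measurable]: "u0 \<in> borel_measurable lebesgue" using int0 by auto
      have [measurable]: "u' \<in> borel_measurable lebesgue" by (rule measurable_completion) simp
      have [measurable]: "{a<..b} \<in> sets lebesgue" by simp
      show "(\<lambda>x. indicator {a<..b} x * u' x) \<in> borel_measurable lebesgue"
        "(\<lambda>x. indicator {a<..b} x * u0 x) \<in> borel_measurable lebesgue" by measurable
      show "AE x in lebesgue. indicator {a<..b} x * u' x = indicator {a<..b} x * u0 x"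
        using ae' by eventually_elim simp
    qed
    \<comment> \<open>\<open>u0\<close> vanishes outside \<open>{0..S}\<close>, so the two
      integrands can differ at 0 only.\<close>
    also have "\<dots> = (\<integral>x. indicator {max a 0<..min b S} x * u0 x \<partial>lebesgue)"
    proof (rule integral_cong_AE)
      have [measurable]: "u0 \<in> borel_measurable lebesgue" using int0 by auto
      have [measurable]: "{a<..b} \<in> sets lebesgue" "{max a 0<..min b S} \<in> sets lebesgue" by simp_all
      show "(\<lambda>x. indicator {a<..b} x * u0 x) \<in> borel_measurable lebesgue"
        "(\<lambda>x. indicator {max a 0<..min b S} x * u0 x) \<in> borel_measurable lebesgue" by measurable
      have "AE x in lebesgue. x \<noteq> (0::real)"
        by (rule AE_completion) (rule AE_lborel_singleton)
      then show "AE x in lebesgue. indicator {a<..b} x * u0 x = indicator {max a 0<..min b S} x * u0 x"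
        by eventually_elim (auto simp: u0_def indicator_def)
    qed
    also have "\<dots> = (\<integral>x. indicator {max a 0<..min b S} x * u x \<partial>lebesgue_on {0..S})"
      by (subst integral_restrict_space) (auto simp: u0_def mult_ac)
    also have "\<dots> = 0"
    proof (cases "max a 0 \<le> min b S")
      case True then show ?thesis by (intro zero) auto
    next
      case False then have "{max a 0<..min b S} = {}" by (intro equals0I) auto
      then show ?thesis by (simp only:) simp
    qed
    finally show ?thesis .
  qed
  \<comment> \<open>\<open>ennreal\<close> sends negative numbers to 0, so the two sides are the
    positive and the negative part.\<close>
  have "AE x in lborel. ennreal (u' x) = ennreal (- u' x)"
  proof (rule AE_eq_of_interval_integrals_eq)
    fix a b :: real assume ab: "a \<le> b"
    have i: "integrable lborel (\<lambda>x. indicator {a<..b} x * max 0 (u' x))"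
      "integrable lborel (\<lambda>x. indicator {a<..b} x * max 0 (- u' x))"
      using integrable_mult_indicator[of "{a<..b}" lborel "\<lambda>x. max 0 (u' x)"]
        integrable_mult_indicator[of "{a<..b}" lborel "\<lambda>x. max 0 (- u' x)"] int' by auto
    have eq: "(\<integral>x. indicator {a<..b} x * max 0 (u' x) \<partial>lborel) = (\<integral>x. indicator {a<..b} x * max 0 (- u' x) \<partial>lborel)"
    proof -
      have "(\<integral>x. indicator {a<..b} x * max 0 (u' x) \<partial>lborel) - (\<integral>x. indicator {a<..b} x * max 0 (- u' x) \<partial>lborel)
        = (\<integral>x. indicator {a<..b} x * u' x \<partial>lborel)"
        by (subst Bochner_Integration.integral_diff[symmetric, OF i])
          (auto intro!: Bochner_Integration.integral_cong simp: max_def indicator_def)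
      then show ?thesis using null[OF ab] by simp
    qed
    have n1: "(\<integral>\<^sup>+x\<in>{a<..b}. ennreal (u' x) \<partial>lborel) = ennreal (\<integral>x. indicator {a<..b} x * max 0 (u' x) \<partial>lborel)"
      by (subst nn_integral_eq_integral[symmetric, OF i(1)])
        (auto intro!: nn_integral_cong simp: indicator_def max_def ennreal_neg)
    have n2: "(\<integral>\<^sup>+x\<in>{a<..b}. ennreal (- u' x) \<partial>lborel) = ennreal (\<integral>x. indicator {a<..b} x * max 0 (- u' x) \<partial>lborel)"
      by (subst nn_integral_eq_integral[symmetric, OF i(2)])
        (auto intro!: nn_integral_cong simp: indicator_def max_def ennreal_neg)
    show "(\<integral>\<^sup>+x\<in>{a<..b}. ennreal (u' x) \<partial>lborel) = (\<integral>\<^sup>+x\<in>{a<..b}. ennreal (- u' x) \<partial>lborel)"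
      using n1 n2 eq by simp
    show "(\<integral>\<^sup>+x\<in>{a<..b}. ennreal (u' x) \<partial>lborel) < \<infinity>" using n1 by simp
  qed (use u' in simp_all)
  with ae have "AE x in lborel. u0 x = 0"
  proof eventually_elim
    case (elim x)
    then show ?case
      by (cases "u' x \<le> 0") (auto simp: ennreal_neg ennreal_eq_0_iff eq_commute[of 0] dest: sym)
  qed
  then have "AE x in lebesgue. u0 x = 0" by (rule AE_completion)
  then show ?thesis
    by (subst AE_restrict_space_iff) (auto elim!: eventually_mono simp: u0_def)
qed

section \<open>The uniform measure on [0,1) and approximation of integrals by finite
  partitions\<close>

definition unit_meas :: "real measure" where
  "unit_meas = uniform_measure lborel {0..<1}"

lemma sets_unit_meas [simp, measurable_cong]: "sets unit_meas = sets borel"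
  by (simp add: unit_meas_def)

lemma space_unit_meas [simp]: "space unit_meas = UNIV"
  by (simp add: unit_meas_def)

interpretation unit_meas: prob_space unit_meas
  unfolding unit_meas_def by (rule prob_space_uniform_measure) auto

lemma emeasure_unit_meas: "A \<in> sets borel \<Longrightarrow> emeasure unit_meas A = emeasure lborel ({0..<1} \<inter> A)"
  unfolding unit_meas_def by (subst emeasure_uniform_measure) (auto simp: divide_ennreal_def)

lemma AE_unit_meas: "AE \<omega> in unit_meas. 0 \<le> \<omega> \<and> \<omega> < 1"
  unfolding unit_meas_def by (rule AE_uniform_measureI) auto

interpretation time_meas: finite_measure "lebesgue_on {a..b::real}" for a b
  by (rule finite_measure_lebesgue_on) simp

lemma nn_integral_lebesgue_on_borel:
  assumes [measurable]: "f \<in> borel_measurable borel" "A \<in> sets borel"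
  shows "(\<integral>\<^sup>+x. f x \<partial>lebesgue_on A) = (\<integral>\<^sup>+x\<in>A. f x \<partial>lborel)"
proof -
  have "(\<integral>\<^sup>+x. f x \<partial>lebesgue_on A) = (\<integral>\<^sup>+x\<in>A. f x \<partial>lebesgue)"
    by (subst nn_integral_restrict_space) auto
  also have "\<dots> = (\<integral>\<^sup>+x\<in>A. f x \<partial>lborel)"
    by (rule nn_integral_completion)
  finally show ?thesis .
qed

text \<open>The label \<open>q\<close> reduces an integral to finitely many masses. Two measures on
  different spaces become comparable once their labels have nearly the same masses.\<close>

lemma integral_approx_by_simple_partition:
  fixes \<phi> :: "'a \<Rightarrow> real"
  assumes "finite_measure M" and q[measurable]: "q \<in> measurable M (count_space UNIV)"
    and int: "integrable M \<phi>" and "finite J"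
    and J: "AE z in M. q z \<in> J \<and> \<bar>\<phi> z - a (q z)\<bar> \<le> \<epsilon>"
  shows "\<bar>(\<integral>z. \<phi> z \<partial>M) - (\<Sum>j\<in>J. a j * measure M {z\<in>space M. q z = j})\<bar> \<le> \<epsilon> * measure M (space M)"
proof -
  interpret finite_measure M by fact
  let ?s = "\<lambda>z. \<Sum>j\<in>J. a j * indicator {z\<in>space M. q z = j} z"
  have ints: "integrable M ?s"
    by (intro Bochner_Integration.integrable_sum integrable_mult_right integrable_real_indicator) (auto simp: emeasure_eq_measure)
  have "(\<integral>z. ?s z \<partial>M) = (\<Sum>j\<in>J. a j * measure M {z\<in>space M. q z = j})"
    by (subst Bochner_Integration.integral_sum) (auto simp: emeasure_eq_measure intro!: integrable_mult_right integrable_real_indicator)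
  moreover have "\<bar>(\<integral>z. \<phi> z - ?s z \<partial>M)\<bar> \<le> (\<integral>z. \<bar>\<phi> z - ?s z\<bar> \<partial>M)"
    by (rule integral_abs_bound)
  moreover have "(\<integral>z. \<bar>\<phi> z - ?s z\<bar> \<partial>M) \<le> (\<integral>z. \<epsilon> \<partial>M)"
  proof (rule integral_mono_AE)
    show "integrable M (\<lambda>z. \<bar>\<phi> z - ?s z\<bar>)" using int ints by auto
    show "AE z in M. \<bar>\<phi> z - ?s z\<bar> \<le> \<epsilon>"
      using J AE_space
    proof eventually_elim
      case (elim z)
      then have "?s z = (\<Sum>j\<in>J. if j = q z then a j else 0)"
        by (intro sum.cong) (auto simp: indicator_def)
      also have "\<dots> = a (q z)" using elim \<open>finite J\<close> by simp
      finally show ?case using elim by simp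
    qed
  qed simp
  ultimately show ?thesis using int ints by (simp add: mult.commute)
qed

section \<open>Nested partitions and spacetime measures\<close>

text \<open>\<open>c n x\<close> is the address of \<open>x\<close> truncated to \<open>n\<close> binary digits, the last digit being the lowest.\<close>

definition cell_coding :: "'a::metric_space set \<Rightarrow> (nat \<Rightarrow> 'a \<Rightarrow> nat) \<Rightarrow> bool" where
  "cell_coding K c \<longleftrightarrow>
     (\<forall>n. c n \<in> measurable borel (count_space UNIV)) \<and> (\<forall>x. c 0 x = 0) \<and>
     (\<forall>n x. c (Suc n) x div 2 = c n x) \<and>
     (\<forall>\<epsilon>>0. \<exists>n. \<forall>x\<in>K. \<forall>y\<in>K. c n x = c n y \<longrightarrow> dist x y < \<epsilon>)"

text \<open>Digit \<open>k\<close> records membership in the \<open>k\<close>-th set of a countable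
  basis. By compactness finitely many small basis sets cover \<open>K\<close>; once all their
  indices have been read, points with equal addresses share one of these sets.\<close>

lemma cell_coding_exists:
  fixes K :: "'a::{metric_space, second_countable_topology} set"
  assumes "compact K"
  obtains c where "cell_coding K c"
proof -
  obtain B :: "'a set set" where B: "countable B" "topological_basis B"
    using ex_countable_basis by blast
  \<comment> \<open>The empty set is inserted so that there is something to enumerate even if
    \<open>B\<close> is empty.\<close>
  define U where "U = from_nat_into (insert {} B)"
  have rU: "range U = insert {} B"
    unfolding U_def using B(1) by (intro range_from_nat_into) auto
  have openU: "open (U n)" for n
    using rU B(2) by (metis insert_iff open_empty rangeI topological_basis_open)
  define c :: "nat \<Rightarrow> 'a \<Rightarrow> nat" where
    "c n x = rec_nat 0 (\<lambda>k r. 2 * r + of_bool (x \<in> U k)) n" for n x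
  have c0: "c 0 x = 0" and cSuc: "c (Suc n) x = 2 * c n x + of_bool (x \<in> U n)" for n x
    by (simp_all add: c_def)
  have meas: "c n \<in> measurable borel (count_space UNIV)" for n
  proof (induction n)
    case 0 show ?case by (simp add: c0[abs_def])
  next
    case (Suc n)
    have [measurable]: "U n \<in> sets borel" using openU by simp
    note Suc[measurable]
    show ?case unfolding cSuc[abs_def] by measurable
  qed
  have bits: "c n x = c n y \<Longrightarrow> k < n \<Longrightarrow> x \<in> U k \<longleftrightarrow> y \<in> U k" for n k x y
  proof (induction n)
    case (Suc n)
    have "c (Suc n) x div 2 = c (Suc n) y div 2" "c (Suc n) x mod 2 = c (Suc n) y mod 2"
      using Suc.prems by auto
    then have "c n x = c n y" "x \<in> U n \<longleftrightarrow> y \<in> U n" by (auto simp: cSuc of_bool_def split: if_splits)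
    then show ?case using Suc by (auto simp: less_Suc_eq)
  qed simp
  have fine: "\<exists>n. \<forall>x\<in>K. \<forall>y\<in>K. c n x = c n y \<longrightarrow> dist x y < \<epsilon>" if "\<epsilon> > 0" for \<epsilon> :: real
  proof -
    have "\<exists>k. x \<in> U k \<and> U k \<subseteq> ball x (\<epsilon>/2)" for x
    proof -
      obtain V where "V \<in> B" "x \<in> V" "V \<subseteq> ball x (\<epsilon>/2)"
        using topological_basisE[OF B(2), of "ball x (\<epsilon>/2)" x] \<open>\<epsilon> > 0\<close> by auto
      moreover then obtain k where "U k = V" using rU by (metis insertI2 rangeE)
      ultimately show ?thesis by auto
    qed
    then obtain k where k: "\<And>x. x \<in> U (k x)" "\<And>x. U (k x) \<subseteq> ball x (\<epsilon>/2)" by metis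
    obtain F where F: "F \<subseteq> K" "finite F" "K \<subseteq> (\<Union>x\<in>F. U (k x))"
    proof -
      have "\<exists>F\<subseteq>K. finite F \<and> K \<subseteq> (\<Union>x\<in>F. U (k x))"
        by (rule compactE_image[OF assms, of K "\<lambda>x. U (k x)"]) (use openU k(1) in auto)
      then show thesis using that by blast
    qed
    obtain n where n: "\<And>x. x \<in> F \<Longrightarrow> k x < n"
      using finite_nat_set_iff_bounded[of "k ` F"] F(2) by auto
    show ?thesis
    proof (intro exI[of _ n] ballI impI)
      fix x y assume xy: "x \<in> K" "y \<in> K" "c n x = c n y"
      then obtain z where z: "z \<in> F" "x \<in> U (k z)" using F(3) by blast
      then have "y \<in> U (k z)" using bits[OF xy(3) n] by blast
      then have "dist z x < \<epsilon>/2" "dist z y < \<epsilon>/2" using z k(2)[of z] by (auto simp: subset_iff)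
      then show "dist x y < \<epsilon>" by (metis dist_commute dist_triangle_half_l)
    qed
  qed
  show thesis
    by (rule that[of c]) (auto simp: cell_coding_def meas c0 cSuc fine)
qed

lemma cell_coding_less:
  assumes "cell_coding K c" shows "c n x < 2 ^ n"
proof (induction n)
  case 0 then show ?case using assms by (simp add: cell_coding_def)
next
  case (Suc n)
  moreover have "c (Suc n) x div 2 = c n x" using assms by (simp add: cell_coding_def)
  ultimately show ?case by simp
qed

lemma cell_coding_coarser:
  assumes "cell_coding K c" "n \<le> m" shows "c n x = c m x div 2 ^ (m - n)"
  using assms(2)
proof (induction m rule: dec_induct)
  case (step m)
  have "c m x = c (Suc m) x div 2" using assms(1) by (simp add: cell_coding_def)
  then show ?case using step by (simp add: Suc_diff_le div_mult2_eq)
qed simp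

text \<open>The measures live on the restricted space, so that functions continuous on \<open>{0..S} \<times> K\<close>
  only are measurable for them.\<close>

definition spacetime :: "real \<Rightarrow> 'a::euclidean_space set \<Rightarrow> (real \<times> 'a) measure \<Rightarrow> bool" where
  "spacetime S K N \<longleftrightarrow> sets N = sets (restrict_space borel ({0..S} \<times> K)) \<and>
     (\<forall>s\<in>{0..S}. emeasure N ({0..s} \<times> K) = ennreal s)"

lemma
  assumes "spacetime S K N"
  shows spacetime_sets: "sets N = sets (restrict_space borel ({0..S} \<times> K))"
    and spacetime_space: "space N = {0..S} \<times> K"
proof -
  show *: "sets N = sets (restrict_space borel ({0..S} \<times> K))" using assms by (simp add: spacetime_def)
  show "space N = {0..S} \<times> K" using sets_eq_imp_space_eq[OF *] by (simp add: space_restrict_space)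
qed

lemma spacetime_finite:
  assumes "spacetime S K N" "0 \<le> S"
  shows "finite_measure N" "measure N (space N) = S"
proof -
  have *: "emeasure N (space N) = ennreal S" using assms by (simp add: spacetime_space) (simp add: spacetime_def)
  then show "finite_measure N" by (intro finite_measureI) simp
  show "measure N (space N) = S" using * assms(2) by (simp add: measure_def)
qed

lemma spacetime_measurable:
  assumes "spacetime S K N" "f \<in> measurable (restrict_space borel ({0..S} \<times> K)) M"
  shows "f \<in> measurable N M"
  using assms by (simp cong: measurable_cong_sets add: spacetime_sets)

lemma spacetime_measurable_borel:
  assumes "spacetime S K N" "f \<in> measurable borel M"
  shows "f \<in> measurable N M"
  by (rule spacetime_measurable[OF assms(1)]) (rule measurable_restrict_space1[OF assms(2)])

lemma spacetime_measurable_continuous: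
  assumes "spacetime S K N" "continuous_on ({0..S} \<times> K) f"
  shows "f \<in> borel_measurable N"
  by (rule spacetime_measurable[OF assms(1)]) (rule borel_measurable_continuous_on_restrict[OF assms(2)])

lemma spacetime_fst:
  assumes "spacetime S K N" shows "fst \<in> borel_measurable N"
  by (rule spacetime_measurable_borel[OF assms]) (intro borel_measurable_continuous_onI continuous_intros)

lemma spacetime_snd:
  assumes "spacetime S K N" shows "snd \<in> borel_measurable N"
  by (rule spacetime_measurable_borel[OF assms]) (intro borel_measurable_continuous_onI continuous_intros)

lemma spacetime_integrable:
  fixes f :: "real \<times> 'a::euclidean_space \<Rightarrow> 'b::{banach, second_countable_topology}"
  assumes "spacetime S K N" "0 \<le> S" "compact K" "continuous_on ({0..S} \<times> K) f"
  shows "integrable N f"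
proof -
  interpret finite_measure N by (rule spacetime_finite[OF assms(1,2)])
  have "compact (f ` ({0..S} \<times> K))"
    using assms by (intro compact_continuous_image compact_Times) auto
  then obtain B where "\<And>p. p \<in> {0..S} \<times> K \<Longrightarrow> norm (f p) \<le> B"
    by (meson bounded_iff compact_imp_bounded image_eqI)
  then show ?thesis using spacetime_measurable_continuous[OF assms(1,4)]
    by (intro integrable_const_bound[of _ B]) (auto simp: spacetime_space[OF assms(1)])
qed

lemma spacetime_interval:
  assumes N: "spacetime S K N" and S: "0 \<le> S"
  shows "a \<le> b \<Longrightarrow> measure N {p\<in>space N. a < fst p \<and> fst p \<le> b} \<le> b - a"
    and "0 \<le> a \<Longrightarrow> a \<le> b \<Longrightarrow> b \<le> S \<Longrightarrow> measure N {p\<in>space N. a < fst p \<and> fst p \<le> b} = b - a"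
    and "0 \<le> b \<Longrightarrow> b \<le> S \<Longrightarrow> measure N {p\<in>space N. fst p \<le> b} = b"
    and "measure N {p\<in>space N. fst p \<le> b} = max 0 (min b S)"
proof -
  interpret finite_measure N by (rule spacetime_finite[OF N S])
  have [measurable]: "fst \<in> borel_measurable N" by (rule spacetime_fst[OF N])
  have le: "measure N {p\<in>space N. fst p \<le> s} = max 0 (min s S)" for s
  proof -
    consider "s < 0" | "0 \<le> s" "s \<le> S" | "S < s" by linarith
    then show ?thesis
    proof cases
      case 1
      then have e: "{p\<in>space N. fst p \<le> s} = {}" by (auto simp: spacetime_space[OF N])
      show ?thesis using 1 by (subst e) simp
    next
      case 2
      then have e: "{p\<in>space N. fst p \<le> s} = {0..s} \<times> K" by (auto simp: spacetime_space[OF N])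
      show ?thesis using 2 N by (subst e) (simp add: spacetime_def measure_def)
    next
      case 3
      then have e: "{p\<in>space N. fst p \<le> s} = space N" by (auto simp: spacetime_space[OF N])
      show ?thesis using 3 S by (subst e) (simp add: spacetime_finite[OF N S])
    qed
  qed
  show "measure N {p\<in>space N. fst p \<le> b} = max 0 (min b S)" by (rule le)
  then show "0 \<le> b \<Longrightarrow> b \<le> S \<Longrightarrow> measure N {p\<in>space N. fst p \<le> b} = b" by simp
  have diff: "measure N {p\<in>space N. a < fst p \<and> fst p \<le> b} = max 0 (min b S) - max 0 (min a S)" if "a \<le> b"
  proof -
    have "{p\<in>space N. a < fst p \<and> fst p \<le> b} = {p\<in>space N. fst p \<le> b} - {p\<in>space N. fst p \<le> a}" by auto
    also have "measure N \<dots> = measure N {p\<in>space N. fst p \<le> b} - measure N {p\<in>space N. fst p \<le> a}"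
      using that by (intro finite_measure_Diff) auto
    finally show ?thesis by (simp add: le)
  qed
  show "measure N {p\<in>space N. a < fst p \<and> fst p \<le> b} \<le> b - a" if "a \<le> b"
    using diff[OF that] that S by (auto simp: max_def min_def)
  show "measure N {p\<in>space N. a < fst p \<and> fst p \<le> b} = b - a" if "0 \<le> a" "a \<le> b" "b \<le> S"
    using diff[OF that(2)] that by simp
qed

text \<open>A distribution function in time, one for each cell. Compactness is obtained by passing
  to the limit in these countably many functions.\<close>

definition cell_mass :: "(real \<times> 'a) measure \<Rightarrow> (nat \<Rightarrow> 'a \<Rightarrow> nat) \<Rightarrow> nat \<Rightarrow> nat \<Rightarrow> real \<Rightarrow> real" where
  "cell_mass N c n i s = measure N {p\<in>space N. fst p \<le> s \<and> c n (snd p) = i}"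

context
  fixes S :: real and K :: "'a::euclidean_space set" and N and c
  assumes N: "spacetime S K N" and S: "0 \<le> S" and c: "cell_coding K c"
begin

interpretation N: finite_measure N by (rule spacetime_finite[OF N S])

lemma cell_meas: "(\<lambda>p. c n (snd p)) \<in> measurable N (count_space UNIV)"
proof -
  have "c n \<in> measurable borel (count_space UNIV)" using c by (simp add: cell_coding_def)
  from measurable_compose[OF spacetime_snd[OF N] this] show ?thesis .
qed

lemma cell_mass_diff:
  assumes "a \<le> b"
  shows "cell_mass N c n i b - cell_mass N c n i a = measure N {p\<in>space N. a < fst p \<and> fst p \<le> b \<and> c n (snd p) = i}"
proof -
  note [measurable] = spacetime_fst[OF N] cell_meas
  have "{p\<in>space N. a < fst p \<and> fst p \<le> b \<and> c n (snd p) = i} =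
    {p\<in>space N. fst p \<le> b \<and> c n (snd p) = i} - {p\<in>space N. fst p \<le> a \<and> c n (snd p) = i}" by auto
  also have "measure N \<dots> = cell_mass N c n i b - cell_mass N c n i a"
    unfolding cell_mass_def using assms by (intro N.finite_measure_Diff) auto
  finally show ?thesis by simp
qed

lemma cell_mass_mono: "a \<le> b \<Longrightarrow> cell_mass N c n i a \<le> cell_mass N c n i b"
  using cell_mass_diff[of a b n i] measure_nonneg[of N] by (smt (verit))

lemma cell_mass_lipschitz: "a \<le> b \<Longrightarrow> cell_mass N c n i b - cell_mass N c n i a \<le> b - a"
proof -
  note [measurable] = spacetime_fst[OF N] cell_meas
  assume ab: "a \<le> b"
  have "measure N {p\<in>space N. a < fst p \<and> fst p \<le> b \<and> c n (snd p) = i} \<le> measure N {p\<in>space N. a < fst p \<and> fst p \<le> b}"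
    by (rule N.finite_measure_mono) auto
  then show ?thesis using spacetime_interval(1)[OF N S ab] cell_mass_diff[OF ab] by simp
qed

lemma cell_mass_split: "cell_mass N c (Suc n) (2 * i) s + cell_mass N c (Suc n) (2 * i + 1) s = cell_mass N c n i s"
proof -
  note [measurable] = spacetime_fst[OF N] cell_meas
  have "c n x = i \<longleftrightarrow> c (Suc n) x = 2 * i \<or> c (Suc n) x = 2 * i + 1" for x
  proof -
    have "c (Suc n) x div 2 = c n x" using c by (simp add: cell_coding_def)
    then show ?thesis by presburger
  qed
  then have "{p\<in>space N. fst p \<le> s \<and> c n (snd p) = i} =
    {p\<in>space N. fst p \<le> s \<and> c (Suc n) (snd p) = 2 * i} \<union> {p\<in>space N. fst p \<le> s \<and> c (Suc n) (snd p) = 2 * i + 1}"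
    by auto
  then show ?thesis unfolding cell_mass_def
    by (subst N.finite_measure_Union[symmetric]) auto
qed

lemma cell_mass_0: "cell_mass N c 0 0 s = max 0 (min s S)"
proof -
  have "c 0 x = 0" for x using c by (simp add: cell_coding_def)
  then show ?thesis unfolding cell_mass_def using spacetime_interval(4)[OF N S, of s] by simp
qed

lemma cell_mass_empty: "(\<And>x. x \<in> K \<Longrightarrow> c n x \<noteq> i) \<Longrightarrow> cell_mass N c n i s = 0"
proof -
  assume "\<And>x. x \<in> K \<Longrightarrow> c n x \<noteq> i"
  then have "{p\<in>space N. fst p \<le> s \<and> c n (snd p) = i} = {}" by (auto simp: spacetime_space[OF N])
  then show ?thesis unfolding cell_mass_def by (simp only: measure_empty)
qed

lemma cell_mass_bound: "\<bar>cell_mass N c n i s\<bar> \<le> S"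
  using N.bounded_measure[of "{p\<in>space N. fst p \<le> s \<and> c n (snd p) = i}"] spacetime_finite(2)[OF N S]
  unfolding cell_mass_def by simp

lemma cell_mass_nonpos: "s \<le> 0 \<Longrightarrow> cell_mass N c n i s = 0"
proof -
  note [measurable] = spacetime_fst[OF N] cell_meas
  assume s: "s \<le> 0"
  have "cell_mass N c n i s \<le> measure N {p\<in>space N. fst p \<le> s}"
    unfolding cell_mass_def by (rule N.finite_measure_mono) auto
  then show ?thesis using s S spacetime_interval(4)[OF N S, of s] by (simp add: cell_mass_def measure_le_0_iff)
qed

end

text \<open>A rational time within \<open>e/3\<close> of \<open>s\<close> transfers the Cauchy
  property, since the Lipschitz constant 1 is common to all \<open>j\<close>.\<close>

lemma convergent_if_lipschitz_and_rational:
  fixes g :: "nat \<Rightarrow> real \<Rightarrow> real"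
  assumes lip: "\<And>j x y. \<bar>g j x - g j y\<bar> \<le> \<bar>x - y\<bar>"
    and rat: "\<And>q. convergent (\<lambda>j. g j (of_rat q))"
  shows "convergent (\<lambda>j. g j s)"
proof (rule Cauchy_convergent, rule metric_CauchyI)
  fix e :: real assume "e > 0"
  obtain q where q: "s < of_rat q" "of_rat q < s + e/3" using of_rat_dense[of s "s + e/3"] \<open>e > 0\<close> by auto
  have "Cauchy (\<lambda>j. g j (of_rat q))" using rat by (rule convergent_Cauchy)
  then obtain M where M: "\<And>m n. m \<ge> M \<Longrightarrow> n \<ge> M \<Longrightarrow> dist (g m (of_rat q)) (g n (of_rat q)) < e/3"
    using \<open>e > 0\<close> by (meson metric_CauchyD divide_pos_pos zero_less_numeral)
  show "\<exists>M. \<forall>m\<ge>M. \<forall>n\<ge>M. dist (g m s) (g n s) < e"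
  proof (intro exI allI impI)
    fix m n assume "m \<ge> M" "n \<ge> M"
    from M[OF this] lip[of m s "of_rat q"] lip[of n s "of_rat q"] q
    show "dist (g m s) (g n s) < e" unfolding dist_real_def by linarith
  qed
qed

text \<open>Helly selection. The triples of level, cell and rational time are countable, so one
  diagonal subsequence serves them all; the common Lipschitz bound then reaches every real
  time.\<close>

lemma cell_mass_limit:
  fixes K :: "'a::euclidean_space set"
  assumes N: "\<And>j. spacetime S K (N j)" and S: "0 \<le> S" and c: "cell_coding K c"
  obtains r :: "nat \<Rightarrow> nat" and L where "strict_mono r"
    "\<And>n i s. (\<lambda>j. cell_mass (N (r j)) c n i s) \<longlonglongrightarrow> L n i s"
proof -
  let ?f = "\<lambda>j (n, i, q). cell_mass (N j) c n i (of_rat q)"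
  have bound: "norm (?f j x) \<le> S" for j x
    using cell_mass_bound[OF N S c] by (cases x) simp
  obtain r :: "nat \<Rightarrow> nat" where r: "strict_mono r"
    "\<And>x. x \<in> UNIV \<Longrightarrow> \<exists>l. (\<lambda>j. ?f (r j) x) \<longlonglongrightarrow> l"
    by (rule function_convergent_subsequence[of "UNIV :: (nat \<times> nat \<times> rat) set" ?f S])
      (use bound in \<open>blast intro: countableI_type\<close>)+
  have "convergent (\<lambda>j. cell_mass (N (r j)) c n i s)" for n i s
  proof (rule convergent_if_lipschitz_and_rational)
    fix q show "convergent (\<lambda>j. cell_mass (N (r j)) c n i (of_rat q))"
      using r(2)[of "(n, i, q)"] by (auto simp: convergent_def)
  next
    fix j x y
    show "\<bar>cell_mass (N (r j)) c n i x - cell_mass (N (r j)) c n i y\<bar> \<le> \<bar>x - y\<bar>"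
      using cell_mass_lipschitz[OF N S c, of x y "r j" n i] cell_mass_mono[OF N S c, of x y "r j" n i]
        cell_mass_lipschitz[OF N S c, of y x "r j" n i] cell_mass_mono[OF N S c, of y x "r j" n i]
      by linarith
  qed
  then show thesis
    by (intro that[OF r(1), of "\<lambda>n i s. lim (\<lambda>j. cell_mass (N (r j)) c n i s)"])
      (simp add: convergent_LIMSEQ_iff)
qed

text \<open>The default \<open>x0\<close> for cells that miss \<open>K\<close> keeps every
  representative in \<open>K\<close> without a side condition.\<close>

definition cell_rep :: "'a set \<Rightarrow> 'a \<Rightarrow> (nat \<Rightarrow> 'a \<Rightarrow> nat) \<Rightarrow> nat \<Rightarrow> nat \<Rightarrow> 'a" where
  "cell_rep K x0 c n i = (if \<exists>x\<in>K. c n x = i then SOME x. x \<in> K \<and> c n x = i else x0)"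

lemma cell_rep_in: "x0 \<in> K \<Longrightarrow> cell_rep K x0 c n i \<in> K"
  unfolding cell_rep_def using someI_ex[of "\<lambda>x. x \<in> K \<and> c n x = i"] by auto

lemma cell_rep_code: "x \<in> K \<Longrightarrow> c n x = i \<Longrightarrow> c n (cell_rep K x0 c n i) = i"
  unfolding cell_rep_def using someI_ex[of "\<lambda>x. x \<in> K \<and> c n x = i"] by auto

text \<open>Inverse transform sampling along the tree of cells.  If \<open>g n i s\<close> is the conditional mass of
  cell \<open>i\<close> of level \<open>n\<close> at time \<open>s\<close>, then \<open>[0,1)\<close> is cut into consecutive intervals of these
  lengths.  A number \<open>\<omega>\<close> selects one cell of each level, these cells are nested, and
  \<open>limit_fun (s, \<omega>)\<close> is the point to which they shrink.\<close>

locale cell_kernel =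
  fixes K :: "'a::euclidean_space set" and c :: "nat \<Rightarrow> 'a \<Rightarrow> nat" and g :: "nat \<Rightarrow> nat \<Rightarrow> real \<Rightarrow> real"
    and good :: "real \<Rightarrow> bool" and x0 :: 'a
  assumes K: "compact K" "x0 \<in> K" and c: "cell_coding K c"
    and g_measurable[measurable]: "\<And>n i. g n i \<in> borel_measurable borel" and g_nonneg: "\<And>n i s. 0 \<le> g n i s"
    and good_measurable[measurable]: "Measurable.pred borel good"
    and good_0: "\<And>s. good s \<Longrightarrow> g 0 0 s = 1"
    and good_split: "\<And>s n i. good s \<Longrightarrow> g (Suc n) (2 * i) s + g (Suc n) (2 * i + 1) s = g n i s"
    and good_empty: "\<And>s n i. good s \<Longrightarrow> (\<And>x. x \<in> K \<Longrightarrow> c n x \<noteq> i) \<Longrightarrow> g n i s = 0"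
begin

definition cumul :: "nat \<Rightarrow> nat \<Rightarrow> real \<Rightarrow> real" where
  "cumul n i s = (\<Sum>k<i. g n k s)"

definition digit :: "nat \<Rightarrow> real \<Rightarrow> real \<Rightarrow> nat" where
  "digit n s \<omega> = (LEAST i. \<omega> < cumul n (Suc i) s)"

abbreviation rep :: "nat \<Rightarrow> nat \<Rightarrow> 'a" where
  "rep \<equiv> cell_rep K x0 c"

text \<open>The consistency conditions on \<open>g\<close> hold for almost every time only. The
  constant \<open>x0\<close> at the other times keeps the map total and \<open>K\<close>
  valued.\<close>

definition approx_fun :: "nat \<Rightarrow> real \<times> real \<Rightarrow> 'a" where
  "approx_fun n = (\<lambda>(s, \<omega>). if good s \<and> 0 \<le> \<omega> \<and> \<omega> < 1 then rep n (digit n s \<omega>) else x0)"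

definition limit_fun :: "real \<times> real \<Rightarrow> 'a" where
  "limit_fun z = lim (\<lambda>n. approx_fun n z)"

lemmas rep_in = cell_rep_in[OF K(2)]

lemma cumul_measurable [measurable]: "cumul n i \<in> borel_measurable borel"
  unfolding cumul_def[abs_def] by measurable

lemma digit_measurable [measurable]: "(\<lambda>z. digit n (fst z) (snd z)) \<in> measurable (borel \<Otimes>\<^sub>M borel) (count_space UNIV)"
  unfolding digit_def by measurable

lemma cumul_mono: "i \<le> j \<Longrightarrow> cumul n i s \<le> cumul n j s"
  unfolding cumul_def by (rule sum_mono2) (auto simp: g_nonneg)

text \<open>The interval of a cell is split in place into those of its two children, so end points
  of one level survive at the next. This makes the selected cells nested.\<close>

lemma cumul_coarser: "good s \<Longrightarrow> cumul (Suc n) (2 * i) s = cumul n i s"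
proof (induction i)
  case (Suc i)
  have "cumul (Suc n) (2 * Suc i) s = cumul (Suc n) (2 * i) s + (g (Suc n) (2 * i) s + g (Suc n) (2 * i + 1) s)"
    by (simp add: cumul_def)
  also have "\<dots> = cumul n i s + g n i s"
    using Suc by (simp only: good_split)
  finally show ?case by (simp add: cumul_def)
qed (simp add: cumul_def)

lemma cumul_total: "good s \<Longrightarrow> cumul n (2 ^ n) s = 1"
proof (induction n)
  case 0 then show ?case by (simp add: cumul_def good_0)
next
  case (Suc n) then show ?case using cumul_coarser[of s n "2 ^ n"] by simp
qed

text \<open>By \<open>cumul_total\<close> the intervals reach up to 1, hence the
  \<open>LEAST\<close> in \<open>digit\<close> is attained. Cells of mass 0 have empty intervals and
  are never selected.\<close>

lemma digit_eq_iff: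
  assumes "good s" "0 \<le> \<omega>" "\<omega> < 1"
  shows "digit n s \<omega> = i \<longleftrightarrow> cumul n i s \<le> \<omega> \<and> \<omega> < cumul n (Suc i) s"
proof -
  obtain m where "2 ^ n = Suc m" by (metis not0_implies_Suc power_not_zero zero_neq_numeral)
  with cumul_total[OF assms(1), of n] assms(3) have "\<omega> < cumul n (Suc m) s" by simp
  then have up: "\<omega> < cumul n (Suc (digit n s \<omega>)) s" unfolding digit_def by (rule LeastI)
  have low: "cumul n (digit n s \<omega>) s \<le> \<omega>"
  proof (cases "digit n s \<omega>")
    case 0 then show ?thesis using assms(2) by (simp add: cumul_def)
  next
    case (Suc k)
    then have "\<not> \<omega> < cumul n (Suc k) s" unfolding digit_def by (intro not_less_Least) auto
    then show ?thesis by (simp add: Suc)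
  qed
  show ?thesis
  proof
    assume *: "cumul n i s \<le> \<omega> \<and> \<omega> < cumul n (Suc i) s"
    then have "cumul n i s < cumul n (Suc (digit n s \<omega>)) s" "cumul n (digit n s \<omega>) s < cumul n (Suc i) s"
      using up low by auto
    then show "digit n s \<omega> = i"
      using cumul_mono[of "Suc i" "digit n s \<omega>"  n s] cumul_mono[of "Suc (digit n s \<omega>)" i n s]
      by (metis antisym_conv not_less not_less_eq_eq)
  qed (use up low in auto)
qed

lemma digit_less: "good s \<Longrightarrow> 0 \<le> \<omega> \<Longrightarrow> \<omega> < 1 \<Longrightarrow> digit n s \<omega> < 2 ^ n"
  using cumul_mono[of "2 ^ n" "digit n s \<omega>" n s] cumul_total[of s n] digit_eq_iff[of s \<omega> n "digit n s \<omega>"]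
  by (metis not_less order_trans)

lemma digit_div: 
  assumes "good s" "0 \<le> \<omega>" "\<omega> < 1"
  shows "digit (Suc n) s \<omega> div 2 = digit n s \<omega>"
proof -
  let ?i = "digit (Suc n) s \<omega>"
  have i: "cumul (Suc n) ?i s \<le> \<omega>" "\<omega> < cumul (Suc n) (Suc ?i) s"
    using digit_eq_iff[OF assms, of "Suc n" ?i] by auto
  have "cumul n (?i div 2) s = cumul (Suc n) (2 * (?i div 2)) s" using cumul_coarser[OF assms(1)] by simp
  also have "\<dots> \<le> cumul (Suc n) ?i s" by (rule cumul_mono) simp
  finally have 1: "cumul n (?i div 2) s \<le> \<omega>" using i by simp
  have "cumul (Suc n) (Suc ?i) s \<le> cumul (Suc n) (2 * (Suc (?i div 2))) s" by (rule cumul_mono) simp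
  also have "\<dots> = cumul n (Suc (?i div 2)) s" by (rule cumul_coarser[OF assms(1)])
  finally have 2: "\<omega> < cumul n (Suc (?i div 2)) s" using i by simp
  show ?thesis using digit_eq_iff[OF assms, of n "?i div 2"] 1 2 by simp
qed

text \<open>The interval of a selected cell contains \<omega> and so has positive length. The cell
  then has positive mass, and by \<open>good_empty\<close> it meets \<open>K\<close>.\<close>

lemma code_rep_digit:
  assumes "good s" "0 \<le> \<omega>" "\<omega> < 1"
  shows "c n (rep n (digit n s \<omega>)) = digit n s \<omega>"
proof -
  have "cumul n (digit n s \<omega>) s < cumul n (Suc (digit n s \<omega>)) s"
    using digit_eq_iff[OF assms, of n "digit n s \<omega>"] by auto
  then have "g n (digit n s \<omega>) s \<noteq> 0" by (simp add: cumul_def)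
  then show ?thesis using good_empty[OF assms(1)] cell_rep_code by metis
qed

lemma approx_fun_in: "approx_fun n z \<in> K"
  by (auto simp: approx_fun_def rep_in K split: prod.split)

lemma code_approx_fun:
  assumes "good s" "0 \<le> \<omega>" "\<omega> < 1" "n \<le> m"
  shows "c n (approx_fun m (s, \<omega>)) = digit n s \<omega>"
proof -
  have "c n (approx_fun m (s, \<omega>)) = c m (approx_fun m (s, \<omega>)) div 2 ^ (m - n)"
    by (rule cell_coding_coarser[OF c assms(4)])
  also have "c m (approx_fun m (s, \<omega>)) = digit m s \<omega>"
    using code_rep_digit[OF assms(1-3)] assms by (simp add: approx_fun_def)
  also have "digit m s \<omega> div 2 ^ (m - n) = digit n s \<omega>"
    using assms(4)
  proof (induction m rule: dec_induct)
    case (step m)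
    then show ?case using digit_div[OF assms(1-3), of m, symmetric]
      by (simp add: Suc_diff_le div_mult2_eq)
  qed simp
  finally show ?thesis .
qed

lemma approx_fun_close:
  assumes n: "\<forall>x\<in>K. \<forall>y\<in>K. c n x = c n y \<longrightarrow> dist x y < \<epsilon>" and "\<epsilon> > 0" "n \<le> m" "n \<le> m'"
  shows "dist (approx_fun m z) (approx_fun m' z) < \<epsilon>"
proof (cases z)
  case (Pair s \<omega>)
  show ?thesis
  proof (cases "good s \<and> 0 \<le> \<omega> \<and> \<omega> < 1")
    case True
    then have "c n (approx_fun m z) = c n (approx_fun m' z)"
      using code_approx_fun assms unfolding Pair by simp
    then show ?thesis using n approx_fun_in by blast
  qed (auto simp: Pair approx_fun_def \<open>\<epsilon> > 0\<close>)
qed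

lemma approx_fun_LIMSEQ: "(\<lambda>n. approx_fun n z) \<longlonglongrightarrow> limit_fun z"
proof -
  have "Cauchy (\<lambda>n. approx_fun n z)"
  proof (rule metric_CauchyI)
    fix e :: real assume "e > 0"
    then obtain n where "\<forall>x\<in>K. \<forall>y\<in>K. c n x = c n y \<longrightarrow> dist x y < e"
      using c unfolding cell_coding_def by blast
    then show "\<exists>M. \<forall>m\<ge>M. \<forall>n\<ge>M. dist (approx_fun m z) (approx_fun n z) < e"
      using approx_fun_close \<open>e > 0\<close> by blast
  qed
  then show ?thesis unfolding limit_fun_def by (simp add: Cauchy_convergent_iff convergent_LIMSEQ_iff)
qed

lemma limit_fun_in: "limit_fun z \<in> K"
  using closed_sequentially[OF compact_imp_closed[OF K(1)] _ approx_fun_LIMSEQ] approx_fun_in by blast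

text \<open>Cells need not be closed, so the limit may leave the cells that led to it. It still
  stays within the diameter bound, at the price of a weak inequality.\<close>

lemma limit_fun_close:
  assumes n: "\<forall>x\<in>K. \<forall>y\<in>K. c n x = c n y \<longrightarrow> dist x y < \<epsilon>" and "\<epsilon> > 0"
    and "good s" "0 \<le> \<omega>" "\<omega> < 1"
  shows "dist (limit_fun (s, \<omega>)) (rep n (digit n s \<omega>)) \<le> \<epsilon>"
proof -
  have "(\<lambda>m. dist (approx_fun m (s, \<omega>)) (approx_fun n (s, \<omega>))) \<longlonglongrightarrow> dist (limit_fun (s, \<omega>)) (approx_fun n (s, \<omega>))"
    by (intro tendsto_intros approx_fun_LIMSEQ)
  moreover have "\<forall>m\<ge>n. dist (approx_fun m (s, \<omega>)) (approx_fun n (s, \<omega>)) \<le> \<epsilon>"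
    using approx_fun_close[OF n \<open>\<epsilon> > 0\<close>] by (auto intro: less_imp_le)
  ultimately have "dist (limit_fun (s, \<omega>)) (approx_fun n (s, \<omega>)) \<le> \<epsilon>"
    by (intro LIMSEQ_le_const2) auto
  then show ?thesis using assms by (simp add: approx_fun_def)
qed

lemma limit_fun_measurable: "limit_fun \<in> borel_measurable (borel \<Otimes>\<^sub>M borel)"
proof (rule borel_measurable_LIMSEQ_metric[OF _ approx_fun_LIMSEQ])
  fix n
  have 1: "rep n \<in> measurable (count_space UNIV) borel" by simp
  have [measurable]: "(\<lambda>z. rep n (digit n (fst z) (snd z))) \<in> borel_measurable (borel \<Otimes>\<^sub>M borel)"
    by (rule measurable_compose[OF digit_measurable 1])
  show "approx_fun n \<in> borel_measurable (borel \<Otimes>\<^sub>M borel)"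
    unfolding approx_fun_def case_prod_beta by measurable
qed

lemma emeasure_digit:
  assumes "good s" "i < 2 ^ n"
  shows "emeasure unit_meas {\<omega>. digit n s \<omega> = i} = ennreal (g n i s)"
proof -
  have [measurable]: "Measurable.pred borel (\<lambda>\<omega>. digit n s \<omega> = i)"
    unfolding digit_def by measurable
  have 0: "0 \<le> cumul n i s" using cumul_mono[of 0 i n s] by (simp add: cumul_def)
  have 1: "cumul n (Suc i) s \<le> 1" using cumul_mono[of "Suc i" "2 ^ n" n s] assms cumul_total[of s n] by simp
  have "emeasure unit_meas {\<omega>. digit n s \<omega> = i} = emeasure lborel ({0..<1} \<inter> {\<omega>. digit n s \<omega> = i})"
    by (rule emeasure_unit_meas) measurable
  also have "{0..<1} \<inter> {\<omega>. digit n s \<omega> = i} = {cumul n i s..<cumul n (Suc i) s}"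
  proof (intro set_eqI)
    fix \<omega>
    show "\<omega> \<in> {0..<1} \<inter> {\<omega>. digit n s \<omega> = i} \<longleftrightarrow> \<omega> \<in> {cumul n i s..<cumul n (Suc i) s}"
    proof (cases "0 \<le> \<omega> \<and> \<omega> < 1")
      case True then show ?thesis using digit_eq_iff[OF assms(1), of \<omega> n i] by simp
    next
      case False then show ?thesis using 0 1 by auto
    qed
  qed
  also have "emeasure lborel \<dots> = ennreal (g n i s)"
    using cumul_mono[of i "Suc i" n s] by (simp add: cumul_def)
  finally show ?thesis .
qed

end

text \<open>The maps constructed above are Borel on the plane, so all their sections in \<omega> are
  measurable; the time integrals of the problem refer to the completed measure.\<close>

lemma measurable_time_unit:
  fixes A :: "real set"
  shows "f \<in> measurable (borel \<Otimes>\<^sub>M borel) M \<Longrightarrow> f \<in> measurable (lebesgue_on A \<Otimes>\<^sub>M unit_meas) M"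
proof -
  assume f: "f \<in> measurable (borel \<Otimes>\<^sub>M borel) M"
  have id: "(\<lambda>x. x) \<in> measurable (lebesgue_on A) (borel :: real measure)"
    by (rule ident_measurable_lebesgue_on)
  have fst': "fst \<in> measurable (lebesgue_on A \<Otimes>\<^sub>M unit_meas) borel"
    using measurable_compose[OF measurable_fst id] .
  have snd': "snd \<in> measurable (lebesgue_on A \<Otimes>\<^sub>M unit_meas) borel"
    using measurable_snd by (simp cong: measurable_cong_sets)
  have "(\<lambda>z. (fst z, snd z)) \<in> measurable (lebesgue_on A \<Otimes>\<^sub>M unit_meas) (borel \<Otimes>\<^sub>M borel)"
    by (rule measurable_Pair[OF fst' snd'])
  from measurable_compose[OF this f] show ?thesis by simp
qed

lemma measurable_time_unit_fst:
  fixes A :: "real set"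
  shows "fst \<in> measurable (lebesgue_on A \<Otimes>\<^sub>M unit_meas) borel"
  by (rule measurable_time_unit) simp

lemma finite_measure_time_unit: "finite_measure (lebesgue_on {a..b::real} \<Otimes>\<^sub>M unit_meas)"
proof
  have "emeasure (lebesgue_on {a..b} \<Otimes>\<^sub>M unit_meas) (space (lebesgue_on {a..b} \<Otimes>\<^sub>M unit_meas))
    = emeasure (lebesgue_on {a..b}) {a..b} * emeasure unit_meas UNIV"
    unfolding space_pair_measure
    by (subst unit_meas.emeasure_pair_measure_Times) (auto simp: space_restrict_space sets_restrict_space_iff)
  also have "\<dots> \<noteq> \<infinity>"
    using time_meas.emeasure_finite[of a b "{a..b}"] by (simp add: unit_meas.emeasure_space_1[simplified])
  finally show "emeasure (lebesgue_on {a..b} \<Otimes>\<^sub>M unit_meas) (space (lebesgue_on {a..b} \<Otimes>\<^sub>M unit_meas)) \<noteq> \<infinity>" .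
qed

section \<open>Spacetime laws of control maps\<close>

definition law :: "real \<Rightarrow> 'a::euclidean_space set \<Rightarrow> (real \<times> real \<Rightarrow> 'a) \<Rightarrow> (real \<times> 'a) measure" where
  "law S K X = distr (lebesgue_on {0..S} \<Otimes>\<^sub>M unit_meas) (restrict_space borel ({0..S} \<times> K)) (\<lambda>z. (fst z, X z))"

context
  fixes S :: real and K :: "'a::euclidean_space set" and X
  assumes X: "X \<in> borel_measurable (lebesgue_on {0..S} \<Otimes>\<^sub>M unit_meas)" "\<And>z. X z \<in> K"
begin

lemma law_map_measurable:
  "(\<lambda>z. (fst z, X z)) \<in> measurable (lebesgue_on {0..S} \<Otimes>\<^sub>M unit_meas) (restrict_space borel ({0..S} \<times> K))"
proof (rule measurable_restrict_space2)
  show "(\<lambda>z. (fst z, X z)) \<in> space (lebesgue_on {0..S} \<Otimes>\<^sub>M unit_meas) \<rightarrow> {0..S} \<times> K"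
    using X(2) by (auto simp: space_pair_measure)
  have "(\<lambda>z. (fst z, X z)) \<in> measurable (lebesgue_on {0..S} \<Otimes>\<^sub>M unit_meas) (borel \<Otimes>\<^sub>M borel)"
    by (rule measurable_Pair[OF measurable_time_unit_fst X(1)])
  then show "(\<lambda>z. (fst z, X z)) \<in> borel_measurable (lebesgue_on {0..S} \<Otimes>\<^sub>M unit_meas)"
    by (simp add: borel_prod)
qed

lemma integral_law:
  fixes f :: "real \<times> 'a \<Rightarrow> 'b::{banach, second_countable_topology}"
  assumes "f \<in> borel_measurable (restrict_space borel ({0..S} \<times> K))"
  shows "(\<integral>p. f p \<partial>law S K X) = (\<integral>z. f (fst z, X z) \<partial>(lebesgue_on {0..S} \<Otimes>\<^sub>M unit_meas))"
  unfolding law_def using assms law_map_measurable by (subst integral_distr) auto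

lemma nn_integral_law:
  assumes "f \<in> borel_measurable (restrict_space borel ({0..S} \<times> K))"
  shows "(\<integral>\<^sup>+p. f p \<partial>law S K X) = (\<integral>\<^sup>+s. \<integral>\<^sup>+\<omega>. f (s, X (s, \<omega>)) \<partial>unit_meas \<partial>lebesgue_on {0..S})"
proof -
  have "(\<lambda>z. f (fst z, X z)) \<in> borel_measurable (lebesgue_on {0..S} \<Otimes>\<^sub>M unit_meas)"
    by (rule measurable_compose[OF law_map_measurable assms])
  then show ?thesis
    unfolding law_def using assms law_map_measurable
    by (subst nn_integral_distr) (auto simp: unit_meas.nn_integral_fst[symmetric])
qed

lemma spacetime_law:
  assumes K: "K \<in> sets borel"
  shows "spacetime S K (law S K X)"
  unfolding spacetime_def
proof
  show "sets (law S K X) = sets (restrict_space borel ({0..S} \<times> K))" by (simp add: law_def)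
  show "\<forall>s\<in>{0..S}. emeasure (law S K X) ({0..s} \<times> K) = ennreal s"
  proof
    fix s assume s: "s \<in> {0..S}"
    have D: "{0..S} \<times> K \<in> sets borel" "{0..s} \<times> K \<in> sets borel"
      using K by (auto intro!: pair_measureI simp: borel_prod[symmetric])
    have "{0..s} \<times> K \<in> sets (restrict_space borel ({0..S} \<times> K))"
      using D s by (auto simp: sets_restrict_space_iff)
    then have "emeasure (law S K X) ({0..s} \<times> K) =
      emeasure (lebesgue_on {0..S} \<Otimes>\<^sub>M unit_meas) ((\<lambda>z. (fst z, X z)) -` ({0..s} \<times> K) \<inter> space (lebesgue_on {0..S} \<Otimes>\<^sub>M unit_meas))"
      unfolding law_def by (intro emeasure_distr law_map_measurable)
    also have "(\<lambda>z. (fst z, X z)) -` ({0..s} \<times> K) \<inter> space (lebesgue_on {0..S} \<Otimes>\<^sub>M unit_meas) = {0..s} \<times> UNIV"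
      using s X(2) by (auto simp: space_pair_measure space_restrict_space)
    also have "emeasure (lebesgue_on {0..S} \<Otimes>\<^sub>M unit_meas) \<dots> = emeasure (lebesgue_on {0..S}) {0..s} * emeasure unit_meas UNIV"
      using s by (intro unit_meas.emeasure_pair_measure_Times) (auto simp: sets_restrict_space_iff)
    also have "\<dots> = ennreal s"
      using s by (simp add: emeasure_restrict_space unit_meas.emeasure_space_1[simplified])
    finally show "emeasure (law S K X) ({0..s} \<times> K) = ennreal s" .
  qed
qed

end

text \<open>Slots are closed on the right, to fit distribution functions that count times up to and
  including \<open>s\<close>. Among the times in \<open>{0..S}\<close>, slot 0 contains the time 0
  only.\<close>

definition slot :: "real \<Rightarrow> nat \<Rightarrow> real \<Rightarrow> nat" where
  "slot S p s = nat \<lceil>s * real p / S\<rceil>"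

lemma slot_measurable [measurable]: "slot S p \<in> measurable borel (count_space UNIV)"
  unfolding slot_def[abs_def] by measurable

lemma slot_eq_iff:
  assumes "0 < S" "0 < p" "0 \<le> s"
  shows "slot S p s = l \<longleftrightarrow> (real l - 1) * S / p < s \<and> s \<le> real l * S / p"
proof -
  have "0 \<le> s * real p / S" using assms by simp
  then have "slot S p s = l \<longleftrightarrow> \<lceil>s * real p / S\<rceil> = int l" unfolding slot_def by linarith
  also have "\<dots> \<longleftrightarrow> real l - 1 < s * real p / S \<and> s * real p / S \<le> real l" by (simp add: ceiling_eq_iff)
  also have "\<dots> \<longleftrightarrow> (real l - 1) * S / p < s \<and> s \<le> real l * S / p" using assms by (simp add: field_simps)
  finally show ?thesis .
qed

lemma slot_props:
  assumes "0 < S" "0 < p" "s \<in> {0..S}"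
  shows "slot S p s \<le> p" "\<bar>s - real (slot S p s) * S / p\<bar> \<le> S / p" "real (slot S p s) * S / p \<in> {0..S}"
proof -
  have *: "(real (slot S p s) - 1) * S / p < s" "s \<le> real (slot S p s) * S / p"
    using slot_eq_iff[OF assms(1,2), of s "slot S p s"] assms by auto
  have "s * real p / S \<le> real p" using assms by (simp add: field_simps)
  then show 1: "slot S p s \<le> p" unfolding slot_def by (simp add: ceiling_le_iff)
  show "\<bar>s - real (slot S p s) * S / p\<bar> \<le> S / p" using * by (simp add: diff_divide_distrib left_diff_distrib)
  show "real (slot S p s) * S / p \<in> {0..S}" using 1 assms by (auto simp: field_simps mult_right_mono)
qed

lemma dist_Pair_le: "dist (a, b) (c, d) \<le> dist a c + dist b d"
  by (simp add: dist_Pair_Pair sqrt_sum_squares_le_sum)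

text \<open>Valid for every grid \<open>q\<close> finer than \<open>p\<close>: the compactness proof
  uses one fixed grid, whereas the generating functions refine theirs with the index.\<close>

lemma uniform_continuity_grid:
  fixes \<phi> :: "real \<times> 'a::euclidean_space \<Rightarrow> real"
  assumes "compact K" "continuous_on ({0..S} \<times> K) \<phi>" "0 < S" "0 < \<epsilon>" "cell_coding K c"
  obtains \<eta> n p where "0 < \<eta>" "0 < (p::nat)" "\<forall>x\<in>K. \<forall>y\<in>K. c n x = c n y \<longrightarrow> dist x y < \<eta>"
    "\<And>q s x y. p \<le> q \<Longrightarrow> s \<in> {0..S} \<Longrightarrow> x \<in> K \<Longrightarrow> y \<in> K \<Longrightarrow> dist x y \<le> \<eta> \<Longrightarrow>
      \<bar>\<phi> (s, x) - \<phi> (real (slot S q s) * S / q, y)\<bar> \<le> \<epsilon>"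
proof -
  have "uniformly_continuous_on ({0..S} \<times> K) \<phi>"
    using assms by (intro compact_uniformly_continuous compact_Times) auto
  then obtain \<delta> where \<delta>: "\<delta> > 0" "\<And>p q. p \<in> {0..S} \<times> K \<Longrightarrow> q \<in> {0..S} \<times> K \<Longrightarrow> dist p q < \<delta> \<Longrightarrow> \<bar>\<phi> p - \<phi> q\<bar> < \<epsilon>"
    using \<open>0 < \<epsilon>\<close> unfolding uniformly_continuous_on_def dist_real_def by metis
  obtain n where n: "\<forall>x\<in>K. \<forall>y\<in>K. c n x = c n y \<longrightarrow> dist x y < \<delta>/3"
    using assms(5) \<open>\<delta> > 0\<close> unfolding cell_coding_def by (meson divide_pos_pos zero_less_numeral)
  obtain p :: nat where p: "S / (\<delta>/3) < real p" using reals_Archimedean2 by blast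
  have "0 < S / (\<delta>/3)" using assms(3) \<delta>(1) by simp
  then have p0: "0 < p" using p by linarith
  have Sp: "S / p < \<delta>/3" using p p0 \<delta>(1) by (simp add: field_simps)
  show thesis
  proof (rule that[of "\<delta>/3" p n])
    fix q s x y assume *: "p \<le> q" "s \<in> {0..S}" "x \<in> K" "y \<in> K" "dist x y \<le> \<delta>/3"
    have q0: "0 < q" using p0 *(1) by simp
    have "S / q \<le> S / p" using *(1) p0 assms(3) by (simp add: frac_le)
    with Sp have Sq: "S / q < \<delta>/3" by linarith
    have "dist (s, x) (real (slot S q s) * S / q, y) \<le> dist s (real (slot S q s) * S / q) + dist x y"
      by (rule dist_Pair_le)
    also have "\<dots> \<le> S / q + \<delta>/3" using slot_props(2)[OF assms(3) q0 *(2)] * by (intro add_mono) (auto simp: dist_real_def)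
    also have "\<dots> < \<delta>" using Sq \<delta>(1) by linarith
    finally have "\<bar>\<phi> (s, x) - \<phi> (real (slot S q s) * S / q, y)\<bar> < \<epsilon>"
      using * slot_props(3)[OF assms(3) q0 *(2)] by (intro \<delta>) auto
    then show "\<bar>\<phi> (s, x) - \<phi> (real (slot S q s) * S / q, y)\<bar> \<le> \<epsilon>" by simp
  qed (use \<delta> p0 n in auto)
qed

section \<open>Compactness and disintegration\<close>

interpretation time_unit: pair_sigma_finite "lebesgue_on {a..b::real}" unit_meas for a b
  by unfold_locales

text \<open>The limits of the cell masses inherit monotonicity, the Lipschitz bound and the tree
  identities. Their densities therefore satisfy the hypotheses of \<open>cell_kernel\<close>, which
  turns them into \<open>X\<close>. The limit law need not give a cell the limit of its masses,
  because cell boundaries may be charged. The proof compares the cells under \<open>N\<close> with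
  the digits of \<omega> instead, and continuous functions cannot tell the two apart beyond
  \<epsilon>.\<close>

lemma spacetime_compactness:
  fixes K :: "'a::euclidean_space set" and N :: "nat \<Rightarrow> (real \<times> 'a) measure"
  assumes K: "compact K" "x0 \<in> K" and S: "0 < S" and N: "\<And>j. spacetime S K (N j)"
  obtains r :: "nat \<Rightarrow> nat" and X where "strict_mono r" "X \<in> borel_measurable (borel \<Otimes>\<^sub>M borel)" "\<And>z. X z \<in> K"
    "\<And>\<phi> :: real \<times> 'a \<Rightarrow> real. continuous_on ({0..S} \<times> K) \<phi> \<Longrightarrow>
       (\<lambda>j. \<integral>p. \<phi> p \<partial>N (r j)) \<longlonglongrightarrow> (\<integral>p. \<phi> p \<partial>law S K X)"
proof -
  have S0: "0 \<le> S" using S by simp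
  obtain c where c: "cell_coding K c" using cell_coding_exists[OF K(1)] .
  obtain r :: "nat \<Rightarrow> nat" and L where r: "strict_mono r"
    and L: "\<And>n i s. (\<lambda>j. cell_mass (N (r j)) c n i s) \<longlonglongrightarrow> L n i s"
  proof (rule cell_mass_limit[where N = N, OF N S0 c])
    fix r :: "nat \<Rightarrow> nat" and L
    assume "strict_mono r" "\<And>n i s. (\<lambda>j. cell_mass (N (r j)) c n i s) \<longlonglongrightarrow> L n i s"
    then show thesis by (rule that)
  qed
  have L_mono: "L n i a \<le> L n i b" if "a \<le> b" for n i a b
    by (rule LIMSEQ_le[OF L L]) (intro exI allI impI cell_mass_mono[OF N S0 c that])
  have L_lip: "L n i b - L n i a \<le> b - a" if "a \<le> b" for n i a b
    by (rule LIMSEQ_le_const2[OF tendsto_diff[OF L L]]) (intro exI allI impI cell_mass_lipschitz[OF N S0 c that])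
  have L_split: "L (Suc n) (2 * i) s + L (Suc n) (2 * i + 1) s = L n i s" for n i s
  proof (rule LIMSEQ_unique)
    show "(\<lambda>j. cell_mass (N (r j)) c n i s) \<longlonglongrightarrow> L (Suc n) (2 * i) s + L (Suc n) (2 * i + 1) s"
      using tendsto_add[OF L[of "Suc n" "2 * i" s] L[of "Suc n" "2 * i + 1" s]]
      by (simp only: cell_mass_split[OF N S0 c])
  qed (rule L)
  have L_0: "L 0 0 s = max 0 (min s S)" for s
    using L[of 0 0 s] by (simp add: cell_mass_0[OF N S0 c] LIMSEQ_const_iff)
  have L_nonpos: "L n i s = 0" if "s \<le> 0" for n i s
    using L[of n i s] by (simp add: cell_mass_nonpos[OF N S0 c that] LIMSEQ_const_iff)
  have L_empty: "L n i s = 0" if "\<And>x. x \<in> K \<Longrightarrow> c n x \<noteq> i" for n i s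
    using L[of n i s] cell_mass_empty[OF N S0 c that] by (simp add: LIMSEQ_const_iff)
  have "\<exists>h. h \<in> borel_measurable borel \<and> (\<forall>x. 0 \<le> h x) \<and>
    (\<forall>a b. a \<le> b \<longrightarrow> (\<integral>\<^sup>+x\<in>{a<..b}. ennreal (h x) \<partial>lborel) = ennreal (L n i b - L n i a))" for n i
    using density_of_monotone_lipschitz[of "L n i", OF L_mono L_lip] by metis
  then obtain g where g[measurable]: "\<And>n i. g n i \<in> borel_measurable borel" and g0: "\<And>n i x. (0::real) \<le> g n i x"
    and g_int: "\<And>n i a b. a \<le> b \<Longrightarrow> (\<integral>\<^sup>+x\<in>{a<..b}. ennreal (g n i x) \<partial>lborel) = ennreal (L n i b - L n i a)"
    by metis
  \<comment> \<open>Countably many conditions, each of which \<open>ae0\<close>, \<open>ae1\<close>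
    or \<open>ae2\<close> establishes almost everywhere; so almost every time in
    \<open>{0..S}\<close> is good.\<close>
  define good where "good s \<longleftrightarrow> g 0 0 s = 1 \<and> (\<forall>n i. g (Suc n) (2 * i) s + g (Suc n) (2 * i + 1) s = g n i s) \<and>
    (\<forall>n i. (\<forall>x\<in>K. c n x \<noteq> i) \<longrightarrow> g n i s = 0)" for s
  have good_meas: "Measurable.pred borel good"
    unfolding good_def[abs_def] by measurable
  interpret cell_kernel K c g good x0
    by unfold_locales (use K c g0 good_meas in \<open>auto simp: good_def\<close>)
  have ae0: "AE s in lborel. 0 < s \<and> s \<le> S \<longrightarrow> g 0 0 s = 1"
  proof -
    have "AE s in lborel. ennreal (g 0 0 s) = indicator {0<..S} s"
    proof (rule AE_eq_of_interval_integrals_eq)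
      fix a b :: real assume ab: "a \<le> b"
      have "(\<integral>\<^sup>+x\<in>{a<..b}. indicator {0<..S} x \<partial>lborel) = (\<integral>\<^sup>+x. indicator ({a<..b} \<inter> {0<..S}) x \<partial>lborel)"
        by (intro nn_integral_cong) (auto simp: indicator_def)
      also have "\<dots> = emeasure lborel ({a<..b} \<inter> {0<..S})" by (rule nn_integral_indicator) auto
      also have "{a<..b} \<inter> {0<..S} = {max a 0<..min b S}" by auto
      also have "emeasure lborel \<dots> = ennreal (L 0 0 b - L 0 0 a)"
        using ab S by (cases "max a 0 \<le> min b S") (auto simp: L_0 max_def min_def split: if_splits)
      finally show "(\<integral>\<^sup>+x\<in>{a<..b}. ennreal (g 0 0 x) \<partial>lborel) = (\<integral>\<^sup>+x\<in>{a<..b}. indicator {0<..S} x \<partial>lborel)"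
        using g_int[OF ab] by simp
      show "(\<integral>\<^sup>+x\<in>{a<..b}. ennreal (g 0 0 x) \<partial>lborel) < \<infinity>" using g_int[OF ab] by simp
    qed auto
    then show ?thesis by eventually_elim auto
  qed
  have ae1: "AE s in lborel. g (Suc n) (2 * i) s + g (Suc n) (2 * i + 1) s = g n i s" for n i
  proof -
    have "AE s in lborel. ennreal (g (Suc n) (2 * i) s) + ennreal (g (Suc n) (2 * i + 1) s) = ennreal (g n i s)"
    proof (rule AE_eq_of_interval_integrals_eq)
      fix a b :: real assume ab: "a \<le> b"
      have "(\<integral>\<^sup>+x\<in>{a<..b}. ennreal (g (Suc n) (2 * i) x) + ennreal (g (Suc n) (2 * i + 1) x) \<partial>lborel) =
        ennreal (L (Suc n) (2 * i) b - L (Suc n) (2 * i) a) + ennreal (L (Suc n) (2 * i + 1) b - L (Suc n) (2 * i + 1) a)"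
        using g_int[OF ab, of "Suc n" "2 * i"] g_int[OF ab, of "Suc n" "2 * i + 1"]
        by (simp add: distrib_right nn_integral_add)
      also have "\<dots> = ennreal (L n i b - L n i a)"
        using L_mono[OF ab] L_split[of n i a] L_split[of n i b]
        by (subst ennreal_plus[symmetric]) (auto simp: algebra_simps)
      finally show "(\<integral>\<^sup>+x\<in>{a<..b}. (ennreal (g (Suc n) (2 * i) x) + ennreal (g (Suc n) (2 * i + 1) x)) \<partial>lborel)
         = (\<integral>\<^sup>+x\<in>{a<..b}. ennreal (g n i x) \<partial>lborel)"
        and "(\<integral>\<^sup>+x\<in>{a<..b}. (ennreal (g (Suc n) (2 * i) x) + ennreal (g (Suc n) (2 * i + 1) x)) \<partial>lborel) < \<infinity>"
        using g_int[OF ab] by simp_all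
    qed auto
    then show ?thesis
      by eventually_elim (use g0 in \<open>simp add: ennreal_plus[symmetric] del: ennreal_plus\<close>)
  qed
  have ae2: "AE s in lborel. (\<forall>x\<in>K. c n x \<noteq> i) \<longrightarrow> g n i s = 0" for n i
  proof (cases "\<forall>x\<in>K. c n x \<noteq> i")
    case True
    then have L0: "L n i s = 0" for s using L_empty by blast
    have "AE s in lborel. ennreal (g n i s) = 0"
    proof (rule AE_eq_of_interval_integrals_eq)
      fix a b :: real assume ab: "a \<le> b"
      show "(\<integral>\<^sup>+x\<in>{a<..b}. ennreal (g n i x) \<partial>lborel) = (\<integral>\<^sup>+x\<in>{a<..b}. 0 \<partial>lborel)"
        "(\<integral>\<^sup>+x\<in>{a<..b}. ennreal (g n i x) \<partial>lborel) < \<infinity>" using g_int[OF ab, of n i] by (simp_all add: L0)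
    qed auto
    then show ?thesis by eventually_elim (use g0 in \<open>simp add: ennreal_eq_0_iff antisym\<close>)
  qed auto
  have "AE s in lborel. (0 < s \<and> s \<le> S \<longrightarrow> g 0 0 s = 1) \<and> (\<forall>n i. g (Suc n) (2 * i) s + g (Suc n) (2 * i + 1) s = g n i s) \<and>
      (\<forall>n i. (\<forall>x\<in>K. c n x \<noteq> i) \<longrightarrow> g n i s = 0) \<and> s \<noteq> 0"
    using ae0 ae1 ae2 by (intro AE_conjI AE_all_countable[THEN iffD2] allI AE_lborel_singleton) auto
  then have "AE s in lborel. s \<in> {0..S} \<longrightarrow> good s"
    by eventually_elim (auto simp: good_def)
  then have "AE s in lebesgue. s \<in> {0..S} \<longrightarrow> good s" by (rule AE_completion)
  then have ae_good: "AE s in lebesgue_on {0..S}. good s"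
    by (subst AE_restrict_space_iff) auto
  let ?P = "lebesgue_on {0..S} \<Otimes>\<^sub>M unit_meas"
  interpret P: finite_measure ?P by (rule finite_measure_time_unit)
  have Xm: "limit_fun \<in> borel_measurable ?P" by (rule measurable_time_unit[OF limit_fun_measurable])
  have dm[measurable]: "(\<lambda>z. digit n (fst z) (snd z)) \<in> measurable ?P (count_space UNIV)" for n
    by (rule measurable_time_unit) (rule digit_measurable)
  have fm[measurable]: "fst \<in> borel_measurable ?P" by (rule measurable_time_unit_fst)
  note idm[measurable] = ident_measurable_lebesgue_on[of "{0..S}"]
  have ae_P: "AE z in ?P. good (fst z) \<and> 0 \<le> snd z \<and> snd z < 1 \<and> fst z \<in> {0..S}"
  proof -
    have pm: "Measurable.pred ?P (\<lambda>z. good (fst z) \<and> 0 \<le> snd z \<and> snd z < 1 \<and> fst z \<in> {0..S})"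
      using good_meas by measurable
    show ?thesis
    proof (rule time_unit.AE_pair_measure)
      show "{x \<in> space ?P. good (fst x) \<and> 0 \<le> snd x \<and> snd x < 1 \<and> fst x \<in> {0..S}} \<in> sets ?P"
        by (rule predE[OF pm])
      show "AE x in lebesgue_on {0..S}. AE y in unit_meas.
          good (fst (x, y)) \<and> 0 \<le> snd (x, y) \<and> snd (x, y) < 1 \<and> fst (x, y) \<in> {0..S}"
        using ae_good AE_space
      proof eventually_elim
        case (elim s)
        show ?case by (rule eventually_mono[OF AE_unit_meas]) (use elim in \<open>simp add: space_restrict_space\<close>)
      qed
    qed
  qed
  \<comment> \<open>The joint label of time slot and digit has exactly the limit mass of the joint
    label of time slot and cell.\<close>
  have digit_mass: "measure ?P {z \<in> space ?P. (slot S p (fst z), digit n (fst z) (snd z)) = (l, i)}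
      = L n i (real l * S / p) - L n i ((real l - 1) * S / p)" (is "measure ?P ?E = _")
    if p: "0 < p" and li: "l \<le> p" "i < 2 ^ n" for p n l i
  proof -
    have E[measurable]: "?E \<in> sets ?P" by measurable
    have ab: "(real l - 1) * S / p \<le> real l * S / p" using S p by (intro divide_right_mono mult_right_mono) auto
    have "emeasure ?P ?E = (\<integral>\<^sup>+s. emeasure unit_meas (Pair s -` ?E) \<partial>lebesgue_on {0..S})"
      by (rule unit_meas.emeasure_pair_measure_alt[OF E])
    also have "\<dots> = (\<integral>\<^sup>+s. ennreal (g n i s) * indicator {(real l - 1) * S / p<..real l * S / p} s \<partial>lebesgue_on {0..S})"
    proof (rule nn_integral_cong_AE, use ae_good AE_space in eventually_elim)
      case (elim s)
      then have s: "s \<in> {0..S}" by (simp add: space_restrict_space)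
      have "Pair s -` ?E = (if slot S p s = l then {\<omega>. digit n s \<omega> = i} else {})"
        using s by (auto simp: space_pair_measure space_restrict_space)
      then show ?case
        using emeasure_digit[OF elim(1) li(2)] slot_eq_iff[OF S p, of s l] s by (auto simp: indicator_def)
    qed
    also have "\<dots> = (\<integral>\<^sup>+s. ennreal (g n i s) * indicator {(real l - 1) * S / p<..real l * S / p} s * indicator {0..S} s \<partial>lborel)"
      by (rule nn_integral_lebesgue_on_borel) auto
    also have "\<dots> = ennreal (L n i (real l * S / p) - L n i ((real l - 1) * S / p))"
    \<comment> \<open>Slot 0 is the null set consisting of the time 0, and \<open>L n i\<close>
      vanishes up to 0, so both sides are 0.\<close>
    proof (cases "l = 0")
      case True
      have "(\<integral>\<^sup>+s. ennreal (g n i s) * indicator {(real l - 1) * S / p<..real l * S / p} s * indicator {0..S} s \<partial>lborel) = nn_integral lborel (\<lambda>s::real. 0)"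
        by (rule nn_integral_cong_AE) (use AE_lborel_singleton[of 0] True in \<open>auto simp: indicator_def elim: eventually_mono\<close>)
      then show ?thesis using True L_nonpos ab by simp
    next
      case False
      then have "1 \<le> real l" by simp
      then have "0 \<le> (real l - 1) * S / p" using S by simp
      moreover have "real l * S / p \<le> S" using li S p by (simp add: field_simps)
      ultimately have "(\<integral>\<^sup>+s. ennreal (g n i s) * indicator {(real l - 1) * S / p<..real l * S / p} s * indicator {0..S} s \<partial>lborel)
        = (\<integral>\<^sup>+s\<in>{(real l - 1) * S / p<..real l * S / p}. ennreal (g n i s) \<partial>lborel)"
        by (intro nn_integral_cong) (auto simp: indicator_def)
      then show ?thesis using g_int[OF ab] by simp
    qed
    finally show ?thesis using L_mono[OF ab] by (simp add: measure_def)
  qed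
  show thesis
  proof (rule that[OF r limit_fun_measurable limit_fun_in])
    fix \<phi> :: "real \<times> 'a \<Rightarrow> real" assume \<phi>: "continuous_on ({0..S} \<times> K) \<phi>"
    have \<phi>m: "\<phi> \<in> borel_measurable (restrict_space borel ({0..S} \<times> K))"
      by (rule borel_measurable_continuous_on_restrict[OF \<phi>])
    have Il: "(\<integral>p. \<phi> p \<partial>law S K limit_fun) = (\<integral>z. \<phi> (fst z, limit_fun z) \<partial>?P)"
      by (rule integral_law[OF Xm limit_fun_in \<phi>m])
    have int\<phi>: "integrable ?P (\<lambda>z. \<phi> (fst z, limit_fun z))"
    proof -
      have "spacetime S K (law S K limit_fun)"
        by (rule spacetime_law[OF Xm limit_fun_in]) (simp add: K(1) borel_compact)
      from spacetime_integrable[OF this S0 K(1) \<phi>] show ?thesis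
        unfolding law_def using \<phi>m law_map_measurable[OF Xm limit_fun_in]
        by (subst (asm) integrable_distr_eq) auto
    qed
    have PS: "measure ?P (space ?P) = S"
    proof -
      have "spacetime S K (law S K limit_fun)"
        by (rule spacetime_law[OF Xm limit_fun_in]) (simp add: K(1) borel_compact)
      from spacetime_finite(2)[OF this S0]
      have "measure ?P ((\<lambda>z. (fst z, limit_fun z)) -` space (restrict_space borel ({0..S} \<times> K)) \<inter> space ?P) = S"
        unfolding law_def space_distr by (subst (asm) measure_distr[OF law_map_measurable[OF Xm limit_fun_in] sets.top])
      moreover have "(\<lambda>z. (fst z, limit_fun z)) -` space (restrict_space borel ({0..S} \<times> K)) \<inter> space ?P = space ?P"
        using measurable_space[OF law_map_measurable[OF Xm limit_fun_in]] by blast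
      ultimately show ?thesis by simp
    qed
    show "(\<lambda>j. \<integral>p. \<phi> p \<partial>N (r j)) \<longlonglongrightarrow> (\<integral>p. \<phi> p \<partial>law S K limit_fun)"
    proof (rule LIMSEQ_I)
      fix e :: real assume "e > 0"
      \<comment> \<open>Two partition errors of size \<open>\<epsilon> * S\<close> and one error
        \<epsilon> from the convergence of finitely many masses must stay below
        \<open>e\<close>.\<close>
      define \<epsilon> where "\<epsilon> = e / (2 * S + 2)"
      have \<epsilon>1: "\<epsilon> > 0" "\<epsilon> * (2 * S + 2) = e" using \<open>e > 0\<close> S unfolding \<epsilon>_def by auto
      moreover have "2 * (\<epsilon> * S) + \<epsilon> = \<epsilon> * (2 * S + 2) - \<epsilon>" by (simp add: algebra_simps)
      ultimately have \<epsilon>: "\<epsilon> > 0" "2 * (\<epsilon> * S) + \<epsilon> < e" by linarith+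
      obtain \<eta> n p where \<eta>: "0 < \<eta>" "0 < (p::nat)" and cell: "\<forall>x\<in>K. \<forall>y\<in>K. c n x = c n y \<longrightarrow> dist x y < \<eta>"
        and close': "\<And>q s x y. p \<le> q \<Longrightarrow> s \<in> {0..S} \<Longrightarrow> x \<in> K \<Longrightarrow> y \<in> K \<Longrightarrow> dist x y \<le> \<eta> \<Longrightarrow>
          \<bar>\<phi> (s, x) - \<phi> (real (slot S q s) * S / q, y)\<bar> \<le> \<epsilon>"
        by (rule uniform_continuity_grid[OF K(1) \<phi> S \<epsilon>(1) c]) (rule that)
      note close = close'[OF order_refl]
      define J where "J = {..p} \<times> {..<(2::nat) ^ n}"
      define a where "a = (\<lambda>(l, i). \<phi> (real l * S / p, rep n i))"
      define m where "m M = (\<lambda>(l, i). cell_mass M c n i (real l * S / p) - cell_mass M c n i ((real l - 1) * S / p))" for M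
      define m' where "m' = (\<lambda>(l, i). L n i (real l * S / p) - L n i ((real l - 1) * S / p))"
      \<comment> \<open>The estimate is uniform in \<open>j\<close>, which leaves only a finite sum
        of cell masses to converge.\<close>
      have approxN: "\<bar>(\<integral>p. \<phi> p \<partial>N j) - (\<Sum>q\<in>J. a q * m (N j) q)\<bar> \<le> \<epsilon> * S" for j
      proof -
        interpret Nj: finite_measure "N j" by (rule spacetime_finite[OF N S0])
        let ?q = "\<lambda>z. (slot S p (fst z), c n (snd z))"
        note sp = spacetime_space[OF N, of j]
        have qm[measurable]: "?q \<in> measurable (N j) (count_space UNIV)"
        proof -
          note [measurable] = cell_meas[OF N S0 c, of n j] spacetime_fst[OF N, of j]
          show ?thesis by measurable
        qed
        have "\<bar>(\<integral>p. \<phi> p \<partial>N j) - (\<Sum>q\<in>J. a q * measure (N j) {z\<in>space (N j). ?q z = q})\<bar> \<le> \<epsilon> * measure (N j) (space (N j))"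
        proof (rule integral_approx_by_simple_partition[OF Nj.finite_measure_axioms qm spacetime_integrable[OF N S0 K(1) \<phi>]])
          show "finite J" by (simp add: J_def)
          show "AE z in N j. ?q z \<in> J \<and> \<bar>\<phi> z - a (?q z)\<bar> \<le> \<epsilon>"
          proof (rule AE_I2)
            fix z assume z: "z \<in> space (N j)"
            then obtain s x where zz: "z = (s, x)" "s \<in> {0..S}" "x \<in> K" by (auto simp: sp)
            have "dist x (rep n (c n x)) \<le> \<eta>"
              using cell zz rep_in cell_rep_code[of x K c n "c n x"] by (metis less_imp_le)
            then show "?q z \<in> J \<and> \<bar>\<phi> z - a (?q z)\<bar> \<le> \<epsilon>"
              using close[of s x "rep n (c n x)"] zz slot_props(1)[OF S \<eta>(2), of s] cell_coding_less[OF c]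
              by (auto simp: J_def a_def rep_in)
          qed
        qed
        moreover have "measure (N j) {z\<in>space (N j). ?q z = q} = m (N j) q" if "q \<in> J" for q
        proof (cases q)
          case (Pair l i)
          have "(real l - 1) * S / p \<le> real l * S / p" using S \<eta> by (intro divide_right_mono mult_right_mono) auto
          then have "m (N j) q = measure (N j) {z\<in>space (N j). (real l - 1) * S / p < fst z \<and> fst z \<le> real l * S / p \<and> c n (snd z) = i}"
            unfolding m_def Pair by (simp add: cell_mass_diff[OF N S0 c])
          also have "{z\<in>space (N j). (real l - 1) * S / p < fst z \<and> fst z \<le> real l * S / p \<and> c n (snd z) = i} = {z\<in>space (N j). ?q z = q}"
          proof (rule Collect_cong)
            fix z
            show "(z \<in> space (N j) \<and> (real l - 1) * S / p < fst z \<and> fst z \<le> real l * S / p \<and> c n (snd z) = i) \<longleftrightarrow>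
              (z \<in> space (N j) \<and> ?q z = q)"
              using slot_eq_iff[OF S \<eta>(2), of "fst z" l] by (cases z) (auto simp: sp Pair)
          qed
          finally show ?thesis by simp
        qed
        ultimately show ?thesis by (simp add: spacetime_finite(2)[OF N S0])
      qed
      have approxP: "\<bar>(\<integral>z. \<phi> (fst z, limit_fun z) \<partial>?P) - (\<Sum>q\<in>J. a q * m' q)\<bar> \<le> \<epsilon> * S"
      proof -
        let ?q = "\<lambda>z. (slot S p (fst z), digit n (fst z) (snd z))"
        have qm[measurable]: "?q \<in> measurable ?P (count_space UNIV)" by measurable
        have "\<bar>(\<integral>z. \<phi> (fst z, limit_fun z) \<partial>?P) - (\<Sum>q\<in>J. a q * measure ?P {z\<in>space ?P. ?q z = q})\<bar> \<le> \<epsilon> * measure ?P (space ?P)"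
        proof (rule integral_approx_by_simple_partition[OF P.finite_measure_axioms qm int\<phi>])
          show "finite J" by (simp add: J_def)
          show "AE z in ?P. ?q z \<in> J \<and> \<bar>\<phi> (fst z, limit_fun z) - a (?q z)\<bar> \<le> \<epsilon>"
            using ae_P
          proof eventually_elim
            case (elim z)
            obtain s \<omega> where zz: "z = (s, \<omega>)" by (cases z)
            have *: "good s" "0 \<le> \<omega>" "\<omega> < 1" "s \<in> {0..S}" using elim zz by auto
            show ?case
              using close[OF *(4) limit_fun_in rep_in limit_fun_close[OF cell \<eta>(1) *(1-3)]]
                slot_props(1)[OF S \<eta>(2) *(4)] digit_less[OF *(1-3)]
              by (auto simp: J_def a_def zz)
          qed
        qed
        moreover have "measure ?P {z\<in>space ?P. ?q z = q} = m' q" if "q \<in> J" for q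
          using that digit_mass[OF \<eta>(2)] by (cases q) (auto simp: J_def m'_def)
        ultimately show ?thesis by (simp add: PS)
      qed
      have "(\<lambda>j. \<Sum>q\<in>J. a q * m (N (r j)) q) \<longlonglongrightarrow> (\<Sum>q\<in>J. a q * m' q)"
        unfolding m_def m'_def case_prod_beta by (intro tendsto_intros L)
      from LIMSEQ_D[OF this \<epsilon>(1)] obtain j0 where j0: "\<And>j. j \<ge> j0 \<Longrightarrow> \<bar>(\<Sum>q\<in>J. a q * m (N (r j)) q) - (\<Sum>q\<in>J. a q * m' q)\<bar> < \<epsilon>"
        by (auto simp: real_norm_def)
      show "\<exists>no. \<forall>j\<ge>no. norm ((\<integral>p. \<phi> p \<partial>N (r j)) - (\<integral>p. \<phi> p \<partial>law S K limit_fun)) < e"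
      proof (intro exI allI impI)
        fix j assume "j \<ge> j0"
        from j0[OF this] approxN[of "r j"] approxP \<epsilon>(2)
        show "norm ((\<integral>p. \<phi> p \<partial>N (r j)) - (\<integral>p. \<phi> p \<partial>law S K limit_fun)) < e"
          unfolding Il real_norm_def by linarith
      qed
    qed
  qed
qed

section \<open>Generation by functions\<close>

text \<open>Within each time slot the generating function spends in each cell exactly the time that
  \<open>N\<close> assigns to it.\<close>

lemma spacetime_generated:
  fixes K :: "'a::euclidean_space set" and N :: "(real \<times> 'a) measure"
  assumes K: "compact K" "x0 \<in> K" and S: "0 < S" and N: "spacetime S K N"
  obtains w where "\<And>j. w j \<in> borel_measurable borel" "\<And>j s. w j s \<in> K"
    "\<And>\<phi> :: real \<times> 'a \<Rightarrow> real. continuous_on ({0..S} \<times> K) \<phi> \<Longrightarrow>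
       (\<lambda>j. \<integral>s. \<phi> (s, w j s) \<partial>lebesgue_on {0..S}) \<longlonglongrightarrow> (\<integral>p. \<phi> p \<partial>N)"
proof -
  have S0: "0 \<le> S" using S by simp
  obtain c where c: "cell_coding K c" using cell_coding_exists[OF K(1)] .
  interpret N: finite_measure N by (rule spacetime_finite[OF N S0])
  note sp = spacetime_space[OF N]
  note [measurable] = cell_meas[OF N S0 c] spacetime_fst[OF N]
  let ?T = "lebesgue_on {0..S}"
  note idm[measurable] = ident_measurable_lebesgue_on[of "{0..S}"]
  define mass where "mass m l i = measure N {z\<in>space N. slot S m (fst z) = l \<and> c m (snd z) = i}" for m l i
  define Q where "Q m l i = (\<Sum>k<i. mass m l k)" for m l i
  \<comment> \<open>Inverse transform sampling again, with the offset of \<open>s\<close> from the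
    left end of its slot in the role of \<omega>. The comparison is weak because slots are closed on
    the right.\<close>
  define ix where "ix m s = (LEAST i. s - (real (slot S m s) - 1) * S / m \<le> Q m (slot S m s) (Suc i))" for m s
  define w where "w m s = cell_rep K x0 c m (ix m s)" for m s
  have ix_meas[measurable]: "ix m \<in> measurable borel (count_space UNIV)" for m
  proof -
    have [measurable]: "(\<lambda>s. Q m (slot S m s) (Suc i)) \<in> borel_measurable borel" for i
      by (rule measurable_compose[OF slot_measurable]) simp
    have [measurable]: "(\<lambda>s. real (slot S m s)) \<in> borel_measurable borel"
      by (rule measurable_compose[OF slot_measurable]) simp
    show ?thesis unfolding ix_def[abs_def] by measurable
  qed
  have w_meas: "w m \<in> borel_measurable borel" for m
    unfolding w_def[abs_def] by (rule measurable_compose[OF ix_meas]) simp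
  have w_in: "w m s \<in> K" for m s unfolding w_def by (rule cell_rep_in[OF K(2)])
  have mass0: "0 \<le> mass m l i" for m l i by (simp add: mass_def)
  have Q_mono: "i \<le> j \<Longrightarrow> Q m l i \<le> Q m l j" for m l i j
    unfolding Q_def by (rule sum_mono2) (auto simp: mass0)
  have Q_total: "Q m l (2 ^ m) = S / m" if m: "0 < m" and l: "0 < l" "l \<le> m" for m l
  proof -
    have "Q m l (2 ^ m) = measure N (\<Union>k<2 ^ m. {z\<in>space N. slot S m (fst z) = l \<and> c m (snd z) = k})"
      unfolding Q_def mass_def by (rule N.finite_measure_finite_Union[symmetric]) (auto simp: disjoint_family_on_def)
    also have "(\<Union>k<2 ^ m. {z\<in>space N. slot S m (fst z) = l \<and> c m (snd z) = k}) = {z\<in>space N. slot S m (fst z) = l}"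
      using cell_coding_less[OF c] by auto
    also have "\<dots> = {z\<in>space N. (real l - 1) * S / m < fst z \<and> fst z \<le> real l * S / m}"
    proof (rule Collect_cong)
      fix z show "(z \<in> space N \<and> slot S m (fst z) = l) \<longleftrightarrow> (z \<in> space N \<and> (real l - 1) * S / m < fst z \<and> fst z \<le> real l * S / m)"
        using slot_eq_iff[OF S m, of "fst z" l] by (cases z) (auto simp: sp)
    qed
    also have "measure N \<dots> = real l * S / m - (real l - 1) * S / m"
      using S m l by (intro spacetime_interval(2)[OF N S0] divide_right_mono mult_right_mono) (auto simp: field_simps)
    also have "\<dots> = S / m" by (simp add: left_diff_distrib diff_divide_distrib)
    finally show ?thesis .
  qed
  have ix_eq: "ix m s = i \<longleftrightarrow> (real l - 1) * S / m + Q m l i < s \<and> s \<le> (real l - 1) * S / m + Q m l (Suc i)" 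
    and ix_less: "ix m s < 2 ^ m"
    if m: "0 < m" and s: "s \<in> {0..S}" and l: "slot S m s = l" "0 < l" for m s l i
  proof -
    have lm: "l \<le> m" using slot_props(1)[OF S m s] l by simp
    define d where "d = s - (real l - 1) * S / m"
    have d: "0 < d" "d \<le> S / m"
      using slot_eq_iff[OF S m, of s l] l s unfolding d_def by (auto simp: left_diff_distrib diff_divide_distrib)
    obtain M where M: "2 ^ m = Suc M" by (metis not0_implies_Suc power_not_zero zero_neq_numeral)
    have "d \<le> Q m l (Suc M)" using Q_total[OF m l(2) lm] M d by simp
    moreover have ixd: "ix m s = (LEAST i. d \<le> Q m l (Suc i))" by (simp add: ix_def d_def l)
    ultimately have up: "d \<le> Q m l (Suc (ix m s))" and le: "ix m s \<le> M"
      by (auto intro: LeastI Least_le)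
    have low: "Q m l (ix m s) < d"
    proof (cases "ix m s")
      case 0 then show ?thesis using d by (simp add: Q_def)
    next
      case (Suc k)
      then have "\<not> d \<le> Q m l (Suc k)" unfolding ixd by (intro not_less_Least) auto
      then show ?thesis by (simp add: Suc)
    qed
    show "ix m s < 2 ^ m" using le M by simp
    have "ix m s = i \<longleftrightarrow> Q m l i < d \<and> d \<le> Q m l (Suc i)"
    proof
      assume *: "Q m l i < d \<and> d \<le> Q m l (Suc i)"
      then have "Q m l i < Q m l (Suc (ix m s))" "Q m l (ix m s) < Q m l (Suc i)"
        using up low by auto
      then show "ix m s = i"
        using Q_mono[of "Suc i" "ix m s" m l] Q_mono[of "Suc (ix m s)" i m l]
        by (metis antisym_conv not_less not_less_eq_eq)
    qed (use up low in auto)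
    then show "ix m s = i \<longleftrightarrow> (real l - 1) * S / m + Q m l i < s \<and> s \<le> (real l - 1) * S / m + Q m l (Suc i)"
      unfolding d_def by auto
  qed
  have nz: "AE s in ?T. s \<noteq> 0" by (rule AE_lebesgue_on_neq) simp
  have masses: "measure ?T {s\<in>space ?T. (slot S m s, ix m s) = (l, i)} = mass m l i"
    if m: "0 < m" and li: "l \<le> m" for m l i
  proof (cases "l = 0")
    case True
    have slot0: "slot S m s = 0 \<longleftrightarrow> s = 0" if "s \<in> {0..S}" for s
      using slot_eq_iff[OF S m, of s 0] that S m by (auto simp: zero_less_divide_iff)
    have "measure ?T {s\<in>space ?T. (slot S m s, ix m s) = (l, i)} = 0"
    proof -
      have "AE s in ?T. \<not> ((slot S m s, ix m s) = (l, i))"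
        using nz AE_space by eventually_elim (use slot0 True in \<open>auto simp: space_restrict_space\<close>)
      from emeasure_eq_0_AE[OF this] show ?thesis by (simp only: measure_def) simp
    qed
    moreover have "mass m l i = 0"
    proof -
      have "mass m l i \<le> measure N {z\<in>space N. fst z \<le> 0}"
        unfolding mass_def
      proof (rule N.finite_measure_mono)
        show "{z \<in> space N. slot S m (fst z) = l \<and> c m (snd z) = i} \<subseteq> {z \<in> space N. fst z \<le> 0}"
          using slot0 True by (auto simp: sp)
        show "{z \<in> space N. fst z \<le> 0} \<in> sets N" by measurable
      qed
      then show ?thesis using spacetime_interval(4)[OF N S0, of 0] mass0[of m l i] S by simp
    qed
    ultimately show ?thesis by simp
  next
    case False
    then have l: "0 < l" by simp
    let ?A = "(real l - 1) * S / m"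
    have Q0: "0 \<le> Q m l i" for i using Q_mono[of 0 i m l] by (simp add: Q_def)
    have A0: "0 \<le> ?A" using l S by simp
    have "1 \<le> real l" using l by simp
    have lS: "real l * S / m \<le> S" using li S m by (simp add: field_simps)
    have AS: "?A + S / m = real l * S / m" by (simp add: left_diff_distrib diff_divide_distrib)
    show ?thesis
    proof (cases "i < 2 ^ m")
      case True
      have Q1: "Q m l (Suc i) \<le> S / m" using Q_mono[of "Suc i" "2 ^ m" m l] True Q_total[OF m l li] by simp
      have "{s\<in>space ?T. (slot S m s, ix m s) = (l, i)} = {?A + Q m l i<..?A + Q m l (Suc i)}"
      proof (intro set_eqI iffI)
        fix s assume "s \<in> {s\<in>space ?T. (slot S m s, ix m s) = (l, i)}"
        then show "s \<in> {?A + Q m l i<..?A + Q m l (Suc i)}"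
          using ix_eq[OF m, of s l i] l by (simp add: space_restrict_space)
      next
        fix s assume s: "s \<in> {?A + Q m l i<..?A + Q m l (Suc i)}"
        have s1: "?A < s" "s \<le> real l * S / m" using s Q0[of i] Q1 AS by auto
        then have s2: "s \<in> {0..S}" using A0 lS by auto
        moreover have "slot S m s = l" using slot_eq_iff[OF S m, of s l] s1 s2 by auto
        ultimately show "s \<in> {s\<in>space ?T. (slot S m s, ix m s) = (l, i)}"
          using ix_eq[OF m, of s l i] l s by (simp add: space_restrict_space)
      qed
      moreover have "{?A + Q m l i<..?A + Q m l (Suc i)} \<subseteq> {0..S}" using Q0[of i] Q1 A0 lS AS by auto
      ultimately show ?thesis
        using Q_mono[of i "Suc i" m l] by (simp add: measure_restrict_space Q_def)
    next
      case False
      have "{s\<in>space ?T. (slot S m s, ix m s) = (l, i)} = {}"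
        using ix_less[OF m] l False by (auto simp: space_restrict_space)
      moreover have "{z\<in>space N. slot S m (fst z) = l \<and> c m (snd z) = i} = {}"
        using cell_coding_less[OF c] False by auto
      ultimately show ?thesis by (simp only: mass_def measure_empty)
    qed
  qed
  show thesis
  proof (rule that[of w, OF w_meas w_in])
    fix \<phi> :: "real \<times> 'a \<Rightarrow> real" assume \<phi>: "continuous_on ({0..S} \<times> K) \<phi>"
    have TS: "measure ?T (space ?T) = S" using S by (simp add: space_restrict_space measure_restrict_space)
    have int\<phi>: "integrable ?T (\<lambda>s. \<phi> (s, w m s))" for m
    proof -
      have wm: "(\<lambda>z. w m (fst z)) \<in> borel_measurable (?T \<Otimes>\<^sub>M unit_meas)"
        by (rule measurable_compose[OF measurable_time_unit_fst w_meas])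
      have m: "(\<lambda>s. (s, w m s)) \<in> measurable ?T (restrict_space borel ({0..S} \<times> K))"
      proof (rule measurable_restrict_space2)
        have "(\<lambda>s. (s, w m s)) \<in> measurable ?T (borel \<Otimes>\<^sub>M borel)"
          by (rule measurable_Pair[OF idm measurable_compose[OF idm w_meas]])
        then show "(\<lambda>s. (s, w m s)) \<in> borel_measurable ?T" by (simp add: borel_prod)
      qed (auto simp: space_restrict_space w_in)
      have "compact (\<phi> ` ({0..S} \<times> K))"
        using K \<phi> by (intro compact_continuous_image compact_Times) auto
      then obtain B where "\<And>p. p \<in> {0..S} \<times> K \<Longrightarrow> norm (\<phi> p) \<le> B"
        by (meson bounded_iff compact_imp_bounded image_eqI)
      then show ?thesis
        using measurable_compose[OF m borel_measurable_continuous_on_restrict[OF \<phi>]]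
        by (intro time_meas.integrable_const_bound[where B = B]) (auto simp: space_restrict_space w_in)
    qed
    show "(\<lambda>m. \<integral>s. \<phi> (s, w m s) \<partial>?T) \<longlonglongrightarrow> (\<integral>p. \<phi> p \<partial>N)"
    proof (rule LIMSEQ_I)
      fix e :: real assume "e > 0"
      define \<epsilon> where "\<epsilon> = e / (2 * S + 2)"
      have \<epsilon>1: "\<epsilon> > 0" "\<epsilon> * (2 * S + 2) = e" using \<open>e > 0\<close> S unfolding \<epsilon>_def by auto
      moreover have "2 * (\<epsilon> * S) = \<epsilon> * (2 * S + 2) - 2 * \<epsilon>" by (simp add: algebra_simps)
      ultimately have \<epsilon>: "\<epsilon> > 0" "2 * (\<epsilon> * S) < e" by linarith+
      obtain \<eta> n p where \<eta>: "0 < \<eta>" "0 < (p::nat)" and cell: "\<forall>x\<in>K. \<forall>y\<in>K. c n x = c n y \<longrightarrow> dist x y < \<eta>"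
        and close: "\<And>q s x y. p \<le> q \<Longrightarrow> s \<in> {0..S} \<Longrightarrow> x \<in> K \<Longrightarrow> y \<in> K \<Longrightarrow> dist x y \<le> \<eta> \<Longrightarrow>
          \<bar>\<phi> (s, x) - \<phi> (real (slot S q s) * S / q, y)\<bar> \<le> \<epsilon>"
        by (rule uniform_continuity_grid[OF K(1) \<phi> S \<epsilon>(1) c]) (rule that)
      show "\<exists>no. \<forall>m\<ge>no. norm ((\<integral>s. \<phi> (s, w m s) \<partial>?T) - (\<integral>p. \<phi> p \<partial>N)) < e"
      proof (intro exI[of _ "max n p"] allI impI)
        fix m assume "max n p \<le> m"
        then have m: "n \<le> m" "p \<le> m" "0 < m" using \<eta>(2) by auto
        define J where "J = {..m} \<times> {..<(2::nat) ^ m}"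
        define a where "a = (\<lambda>(l, i). \<phi> (real l * S / m, cell_rep K x0 c m i))"
        let ?q = "\<lambda>z. (slot S m (fst z), c m (snd z))"
        let ?q' = "\<lambda>s. (slot S m s, ix m s)"
        have qm: "?q \<in> measurable N (count_space UNIV)" by measurable
        have q'm: "?q' \<in> measurable ?T (count_space UNIV)" by measurable
        have "\<bar>(\<integral>p. \<phi> p \<partial>N) - (\<Sum>q\<in>J. a q * measure N {z\<in>space N. ?q z = q})\<bar> \<le> \<epsilon> * measure N (space N)"
        proof (rule integral_approx_by_simple_partition[OF N.finite_measure_axioms qm spacetime_integrable[OF N S0 K(1) \<phi>]])
          show "finite J" by (simp add: J_def)
          show "AE z in N. ?q z \<in> J \<and> \<bar>\<phi> z - a (?q z)\<bar> \<le> \<epsilon>"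
          proof (rule AE_I2)
            fix z assume z: "z \<in> space N"
            then obtain s x where zz: "z = (s, x)" "s \<in> {0..S}" "x \<in> K" by (auto simp: sp)
            have "c m x = c m (cell_rep K x0 c m (c m x))"
              using cell_rep_code[of x K c m "c m x"] zz by simp
            then have "c n x = c n (cell_rep K x0 c m (c m x))"
              using cell_coding_coarser[OF c m(1)] by simp
            then have "dist x (cell_rep K x0 c m (c m x)) \<le> \<eta>"
              using cell zz cell_rep_in[OF K(2)] by (metis less_imp_le)
            then show "?q z \<in> J \<and> \<bar>\<phi> z - a (?q z)\<bar> \<le> \<epsilon>"
              using close[OF m(2), of s x "cell_rep K x0 c m (c m x)"] zz slot_props(1)[OF S m(3), of s] cell_coding_less[OF c]
              by (auto simp: J_def a_def cell_rep_in[OF K(2)])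
          qed
        qed
        moreover have "\<bar>(\<integral>s. \<phi> (s, w m s) \<partial>?T) - (\<Sum>q\<in>J. a q * measure ?T {s\<in>space ?T. ?q' s = q})\<bar> \<le> \<epsilon> * measure ?T (space ?T)"
        proof (rule integral_approx_by_simple_partition[OF time_meas.finite_measure_axioms q'm int\<phi>])
          show "finite J" by (simp add: J_def)
          show "AE s in ?T. ?q' s \<in> J \<and> \<bar>\<phi> (s, w m s) - a (?q' s)\<bar> \<le> \<epsilon>"
            using nz AE_space
          proof eventually_elim
            case (elim s)
            then have s: "s \<in> {0..S}" "s \<noteq> 0" by (auto simp: space_restrict_space)
            have "slot S m s \<noteq> 0" using slot_eq_iff[OF S m(3), of s 0] s by auto
            then have "ix m s < 2 ^ m" using ix_less[OF m(3) s(1) refl] by simp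
            then show ?case
              using close[OF m(2) s(1) w_in w_in, of m s m s] slot_props(1)[OF S m(3) s(1)] \<eta>(1)
              by (auto simp: J_def a_def w_def)
          qed
        qed
        \<comment> \<open>The label masses agree exactly by \<open>masses\<close>, so the two
          partition errors are the only ones.\<close>
        moreover have "(\<Sum>q\<in>J. a q * measure ?T {s\<in>space ?T. ?q' s = q}) = (\<Sum>q\<in>J. a q * measure N {z\<in>space N. ?q z = q})"
        proof (rule sum.cong[OF refl])
          fix q assume "q \<in> J"
          then obtain l i where "q = (l, i)" "l \<le> m" by (auto simp: J_def)
          then show "a q * measure ?T {s\<in>space ?T. ?q' s = q} = a q * measure N {z\<in>space N. ?q z = q}"
            using masses[OF m(3), of l i] by (simp add: mass_def)
        qed
        ultimately show "norm ((\<integral>s. \<phi> (s, w m s) \<partial>?T) - (\<integral>p. \<phi> p \<partial>N)) < e"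
          using \<epsilon>(2) unfolding TS spacetime_finite(2)[OF N S0] real_norm_def by linarith
      qed
    qed
  qed
qed

section \<open>Young measures as laws\<close>

lemma continuous_clamp_LIMSEQ:
  fixes a b s :: real
  assumes "a \<le> b"
  shows "(\<lambda>n. max 0 (min 1 (real n * (s - a))) - max 0 (min 1 (real n * (s - b)))) \<longlonglongrightarrow> indicator {a<..b} s"
proof -
  have *: "(\<lambda>n. max 0 (min 1 (real n * (s - c)))) \<longlonglongrightarrow> (if c < s then 1 else 0)" for c
  proof (cases "c < s")
    case True
    obtain N :: nat where N: "1 / (s - c) < real N" using reals_Archimedean2 by blast
    have "\<forall>\<^sub>F n in sequentially. max 0 (min 1 (real n * (s - c))) = 1"
      using eventually_ge_at_top[of N]
    proof eventually_elim
      case (elim n)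
      then have "1 / (s - c) < real n" using N by linarith
      then have "1 < real n * (s - c)" using True by (simp add: field_simps)
      then show ?case by simp
    qed
    then show ?thesis using True by (simp add: tendsto_eventually)
  next
    case False
    then have "real n * (s - c) \<le> 0" for n by (simp add: mult_nonneg_nonpos)
    then have "max 0 (min 1 (real n * (s - c))) = 0" for n by (intro max_absorb1 min.coboundedI2)
    then show ?thesis using False by simp
  qed
  have "(\<lambda>n. max 0 (min 1 (real n * (s - a))) - max 0 (min 1 (real n * (s - b)))) \<longlonglongrightarrow> (if a < s then 1 else 0) - (if b < s then 1 else 0)"
    by (intro tendsto_diff *)
  also have "(if a < s then 1 else 0) - (if b < s then 1 else 0) = (indicator {a<..b} s :: real)"
    using assms by (auto simp: indicator_def)
  finally show ?thesis .
qed

text \<open>Steep ramps converge to the indicator of an interval; dominated convergence reduces the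
  claim to interval integrals.\<close>

lemma AE_zero_of_continuous_tests:
  fixes h :: "real \<Rightarrow> real"
  assumes int: "integrable (lebesgue_on {0..S}) h"
    and zero: "\<And>a. continuous_on UNIV a \<Longrightarrow> (\<integral>s. a s * h s \<partial>lebesgue_on {0..S}) = 0"
  shows "AE s in lebesgue_on {0..S}. h s = 0"
proof (rule AE_zero_of_interval_integrals_zero_real[OF int])
  fix a b :: real assume ab: "0 \<le> a" "a \<le> b" "b \<le> S"
  let ?a = "\<lambda>n s. max 0 (min 1 (real n * (s - a))) - max 0 (min 1 (real n * (s - b)))"
  have cont: "continuous_on UNIV (?a n)" for n by (intro continuous_intros)
  have am: "?a n \<in> borel_measurable (lebesgue_on {0..S})" for n
    by (rule continuous_imp_measurable_on_sets_lebesgue) (auto intro: continuous_on_subset[OF cont])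
  have im: "(\<lambda>s. indicator {a<..b} s :: real) \<in> borel_measurable (lebesgue_on {0..S})"
    by (rule measurable_restrict_space1) (simp add: measurable_completion)
  have [measurable]: "h \<in> borel_measurable (lebesgue_on {0..S})" using int by auto
  have "(\<lambda>n. \<integral>s. ?a n s * h s \<partial>lebesgue_on {0..S}) \<longlonglongrightarrow> (\<integral>s. indicator {a<..b} s * h s \<partial>lebesgue_on {0..S})"
  proof (rule integral_dominated_convergence[where w = "\<lambda>s. \<bar>h s\<bar>"])
    show "(\<lambda>s. ?a n s * h s) \<in> borel_measurable (lebesgue_on {0..S})" for n using am[of n] by measurable
    show "(\<lambda>s. indicator {a<..b} s * h s) \<in> borel_measurable (lebesgue_on {0..S})" using im by measurable
    show "AE s in lebesgue_on {0..S}. (\<lambda>n. ?a n s * h s) \<longlonglongrightarrow> indicator {a<..b} s * h s"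
      by (intro AE_I2 tendsto_mult_right continuous_clamp_LIMSEQ ab)
    show "AE s in lebesgue_on {0..S}. norm (?a n s * h s) \<le> \<bar>h s\<bar>" for n
    proof (rule AE_I2)
      fix s
      have "real n * (s - b) \<le> real n * (s - a)" using ab by (intro mult_left_mono) auto
      then have "\<bar>?a n s\<bar> \<le> 1" by (auto simp: max_def min_def)
      then show "norm (?a n s * h s) \<le> \<bar>h s\<bar>" by (simp add: abs_mult mult_left_le_one_le)
    qed
  qed (use int in auto)
  then show "(\<integral>s. indicator {a<..b} s * h s \<partial>lebesgue_on {0..S}) = 0"
    using zero[OF cont] by (simp add: LIMSEQ_const_iff)
qed

text \<open>Boundedness makes the complement of \<open>U\<close> nonempty; the distance to the empty
  set would be 0 by convention and the functions would not tend to 1.\<close>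

lemma bounded_open_test_LIMSEQ:
  fixes U :: "'a::euclidean_space set"
  assumes "open U" "bounded U"
  shows "(\<lambda>n. min 1 (real n * infdist x (- U))) \<longlonglongrightarrow> indicator U x"
proof (cases "x \<in> U")
  case True
  have ne: "- U \<noteq> {}" using assms(2) by (metis Compl_empty_eq double_compl not_bounded_UNIV)
  have "infdist x (- U) \<noteq> 0"
    using in_closed_iff_infdist_zero[OF _ ne, of x] assms(1) True by (simp add: closed_Compl)
  then have pos: "0 < infdist x (- U)" using infdist_nonneg[of x "- U"] by linarith
  obtain N :: nat where N: "1 / infdist x (- U) < real N" using reals_Archimedean2 by blast
  have "\<forall>\<^sub>F n in sequentially. min 1 (real n * infdist x (- U)) = 1"
    using eventually_ge_at_top[of N]
  proof eventually_elim
    case (elim n)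
    then have "1 / infdist x (- U) < real n" using N by linarith
    then have "1 < real n * infdist x (- U)" using pos by (simp add: field_simps)
    then show ?case by simp
  qed
  then show ?thesis using True by (simp add: tendsto_eventually)
qed simp

text \<open>Basis sets are cut down by balls and closed under finite intersections. Boundedness
  provides tests of compact support and finite masses for locally finite measures.\<close>

lemma countable_bounded_open_generator:
  obtains G :: "'a::euclidean_space set set" where "countable G" "Int_stable G"
    "\<And>U. U \<in> G \<Longrightarrow> open U \<and> bounded U" "sets borel = sigma_sets UNIV G" "\<Union>G = UNIV"
proof -
  obtain B :: "'a set set" where B: "countable B" "topological_basis B"
    using ex_countable_basis by blast
  define C where "C = (\<lambda>(V, n::nat). V \<inter> ball 0 (real n)) ` (B \<times> UNIV)"
  define G where "G = Inter ` {F. F \<subseteq> C \<and> finite F \<and> F \<noteq> {}}"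
  have "countable C" unfolding C_def using B(1) by (intro countable_image countable_SIGMA) auto
  then have "countable {F. finite F \<and> F \<subseteq> C}" by (rule countable_Collect_finite_subset)
  then have cG: "countable G" unfolding G_def
    by (intro countable_image) (erule countable_subset[rotated], auto)
  have C: "open U \<and> bounded U" if "U \<in> C" for U
  proof -
    obtain V n where "U = V \<inter> ball 0 (real n)" "V \<in> B" using \<open>U \<in> C\<close> by (auto simp: C_def)
    then show ?thesis using topological_basis_open[OF B(2)] by (auto intro: bounded_subset[OF bounded_ball])
  qed
  have obG: "open U \<and> bounded U" if "U \<in> G" for U
  proof -
    obtain F where F: "F \<subseteq> C" "finite F" "F \<noteq> {}" "U = \<Inter>F" using \<open>U \<in> G\<close> by (auto simp: G_def)
    then obtain V where "V \<in> F" by auto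
    then have "bounded U" using C F by (metis Inter_lower bounded_subset subsetD)
    moreover have "open U" unfolding F(4) using F C by (intro open_Inter) auto
    ultimately show ?thesis by simp
  qed
  have CG: "C \<subseteq> G"
  proof
    fix U assume "U \<in> C"
    then show "U \<in> G" unfolding G_def by (intro image_eqI[of _ _ "{U}"]) auto
  qed
  have stable: "Int_stable G"
  proof (rule Int_stableI)
    fix U V assume "U \<in> G" "V \<in> G"
    then obtain F F' where "F \<subseteq> C" "finite F" "F \<noteq> {}" "U = \<Inter>F" "F' \<subseteq> C" "finite F'" "F' \<noteq> {}" "V = \<Inter>F'"
      by (auto simp: G_def)
    then show "U \<inter> V \<in> G" unfolding G_def by (intro image_eqI[of _ _ "F \<union> F'"]) auto
  qed
  have local: "\<exists>W\<in>G. x \<in> W \<and> W \<subseteq> V" if V: "open V" "x \<in> V" for V x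
  proof -
    obtain W where W: "W \<in> B" "x \<in> W" "W \<subseteq> V" using topological_basisE[OF B(2) V] by metis
    obtain n :: nat where "norm x < real n" using reals_Archimedean2 by blast
    then have "x \<in> W \<inter> ball 0 (real n)" using W by auto
    moreover have "W \<inter> ball 0 (real n) \<in> C" unfolding C_def using W by force
    ultimately show ?thesis using W CG by (intro bexI[of _ "W \<inter> ball 0 (real n)"]) auto
  qed
  have "topological_basis G"
    by (rule topological_basisI) (use obG local in auto)
  then have "sets borel = sets (sigma UNIV G)" by (intro arg_cong[of _ _ sets] borel_eq_countable_basis[OF cG])
  also have "\<dots> = sigma_sets UNIV G" by simp
  finally have "sets borel = sigma_sets UNIV G" .
  moreover have "\<Union>G = UNIV" using local[OF open_UNIV] by auto
  ultimately show thesis using that cG stable obG by blast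
qed

text \<open>A countable family of continuous functions with bounded support determines a locally
  finite measure. Countability matters because each test will be known for almost every time
  only.\<close>

lemma measure_eqI_open_tests:
  fixes M N :: "'a::euclidean_space measure"
  assumes M: "sets M = sets borel" "\<And>K. compact K \<Longrightarrow> emeasure M K < \<infinity>"
    and N: "sets N = sets borel" "\<And>K. compact K \<Longrightarrow> emeasure N K < \<infinity>"
    and G: "countable G" "Int_stable G" "\<And>U. U \<in> G \<Longrightarrow> open U \<and> bounded U" "sets borel = sigma_sets UNIV G" "\<Union>G = UNIV"
    and eq: "\<And>U n. U \<in> G \<Longrightarrow> (\<integral>x. min 1 (real n * infdist x (- U)) \<partial>M) = (\<integral>x. min 1 (real n * infdist x (- U)) \<partial>N)"
  shows "M = N"
proof (rule measure_eqI_generator_eq_countable[OF G(2), of UNIV])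
  have fin: "emeasure P U < \<infinity>" if "sets P = sets borel" "\<And>K. compact K \<Longrightarrow> emeasure P K < \<infinity>" "U \<in> G" for P U
  proof -
    have "compact (closure U)" using G(3)[OF that(3)] by (simp add: compact_closure)
    moreover have "emeasure P U \<le> emeasure P (closure U)"
      using that(1) by (intro emeasure_mono) (auto simp: closure_subset)
    ultimately show ?thesis using that(2) by (meson le_less_trans)
  qed
  have lim: "(\<lambda>n. \<integral>x. min 1 (real n * infdist x (- U)) \<partial>P) \<longlonglongrightarrow> measure P U"
    if P: "sets P = sets borel" "\<And>K. compact K \<Longrightarrow> emeasure P K < \<infinity>" and U: "U \<in> G" for P U
  proof -
    have [measurable]: "U \<in> sets P" using P(1) G(3)[OF U] by auto
    have spP: "space P = UNIV" using sets_eq_imp_space_eq[OF P(1)] by simp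
    have "(\<lambda>n. \<integral>x. min 1 (real n * infdist x (- U)) \<partial>P) \<longlonglongrightarrow> (\<integral>x. indicator U x \<partial>P)"
    proof (rule integral_dominated_convergence[where w = "indicator U"])
      show "(\<lambda>x. min 1 (real n * infdist x (- U))) \<in> borel_measurable P" for n
      proof -
        have "(\<lambda>x. min 1 (real n * infdist x (- U))) \<in> borel_measurable borel"
          by (intro borel_measurable_continuous_onI continuous_intros)
        then show ?thesis using P(1) by (simp cong: measurable_cong_sets)
      qed
      show "integrable P (indicator U :: 'a \<Rightarrow> real)" using fin[OF P U] by (intro integrable_real_indicator) auto
      show "AE x in P. (\<lambda>n. min 1 (real n * infdist x (- U))) \<longlonglongrightarrow> indicator U x"
        using bounded_open_test_LIMSEQ G(3)[OF U] by (intro AE_I2) auto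
      show "AE x in P. norm (min 1 (real n * infdist x (- U))) \<le> indicator U x" for n
        by (intro AE_I2) (auto simp: indicator_def infdist_nonneg)
    qed auto
    also have "(\<integral>x. indicator U x \<partial>P) = measure P U" by (simp add: spP)
    finally show ?thesis .
  qed
  fix U assume U: "U \<in> G"
  have "measure M U = measure N U"
    using LIMSEQ_unique[OF lim[OF M U]] lim[OF N U] eq[OF U] by simp
  then show "emeasure M U = emeasure N U"
    using fin[OF M U] fin[OF N U] by (simp add: emeasure_eq_ennreal_measure less_top)
next
  show "\<And>a. a \<in> G \<Longrightarrow> emeasure M a \<noteq> \<infinity>"
  proof -
    fix U assume U: "U \<in> G"
    have "compact (closure U)" using G(3)[OF U] by (simp add: compact_closure)
    moreover have "emeasure M U \<le> emeasure M (closure U)"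
      using M(1) by (intro emeasure_mono) (auto simp: closure_subset)
    ultimately show "emeasure M U \<noteq> \<infinity>" using M(2) by (metis le_less_trans less_irrefl infinity_ennreal_def top.not_eq_extremum)
  qed
qed (use M N G in auto)

text \<open>The definition of a Young measure does not ask its members to be probability measures,
  or to live on \<open>K\<close>; both follow here for almost every time. The generating functions
  define spacetime measures, a subsequence of which converges to the law of some \<open>X\<close>.
  The limit of the same integrals is also given by \<open>\<mu>\<close>, so the two families agree
  on all tests.\<close>

lemma young_measure_is_law:
  fixes K :: "'a::euclidean_space set"
  assumes Y: "Linf_young_measure_on S K \<mu>" and K: "compact K" "x0 \<in> K" and S: "0 < S"
  obtains X where "X \<in> borel_measurable (borel \<Otimes>\<^sub>M borel)" "\<And>z. X z \<in> K"
    "AE s in lebesgue_on {0..S}. \<mu> s = distr unit_meas borel (\<lambda>\<omega>. X (s, \<omega>))"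
proof -
  let ?T = "lebesgue_on {0..S}"
  obtain w where gen: "generates_young S w \<mu>" and wK: "\<And>j. AE s in ?T. w j s \<in> K"
    using Y unfolding Linf_young_measure_on_def by blast
  have radon: "\<And>s. s \<in> {0..S} \<Longrightarrow> radon_measure (\<mu> s)" using Y by (simp add: Linf_young_measure_on_def)
  have wm: "w j \<in> borel_measurable ?T" for j using gen by (simp add: generates_young_def)
  have Kb[measurable]: "K \<in> sets borel" using K(1) by (rule borel_compact)
  \<comment> \<open>\<open>w j\<close> lies in \<open>K\<close> almost everywhere only, whereas
    \<open>law\<close> is fed with maps into \<open>K\<close>.\<close>
  define v where "v j s = (if w j s \<in> K then w j s else x0)" for j s
  have vm: "v j \<in> borel_measurable ?T" for j
    unfolding v_def[abs_def] using wm[of j] by measurable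
  have vK: "v j s \<in> K" for j s using K(2) by (simp add: v_def)
  define N where "N j = law S K (\<lambda>z. v j (fst z))" for j
  have Vm: "(\<lambda>z. v j (fst z)) \<in> borel_measurable (?T \<Otimes>\<^sub>M unit_meas)" for j
    by (rule measurable_compose[OF measurable_fst vm])
  have N: "spacetime S K (N j)" for j
    unfolding N_def by (rule spacetime_law[OF Vm vK Kb])
  obtain r :: "nat \<Rightarrow> nat" and X where r: "strict_mono r" and X: "X \<in> borel_measurable (borel \<Otimes>\<^sub>M borel)" "\<And>z. X z \<in> K"
    and conv: "\<And>\<phi> :: real \<times> 'a \<Rightarrow> real. continuous_on ({0..S} \<times> K) \<phi> \<Longrightarrow>
       (\<lambda>j. \<integral>p. \<phi> p \<partial>N (r j)) \<longlonglongrightarrow> (\<integral>p. \<phi> p \<partial>law S K X)"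
    by (rule spacetime_compactness[where N = N, OF K S N]) (rule that)
  have Xm: "X \<in> borel_measurable (?T \<Otimes>\<^sub>M unit_meas)" by (rule measurable_time_unit[OF X(1)])
  have int_eq: "(\<integral>s. (\<integral>x. \<phi> (s, x) \<partial>\<mu> s) \<partial>?T) = (\<integral>s. (\<integral>\<omega>. \<phi> (s, X (s, \<omega>)) \<partial>unit_meas) \<partial>?T)"
    and int_X: "integrable ?T (\<lambda>s. \<integral>\<omega>. \<phi> (s, X (s, \<omega>)) \<partial>unit_meas)"
    if \<phi>: "Cc_test S \<phi>" for \<phi> :: "real \<times> 'a \<Rightarrow> real"
  proof -
    have c: "continuous_on ({0..S} \<times> K) \<phi>"
      using \<phi> unfolding Cc_test_def by (auto intro: continuous_on_subset)
    note m = borel_measurable_continuous_on_restrict[OF c]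
    have "(\<integral>p. \<phi> p \<partial>N j) = (\<integral>s. \<phi> (s, w j s) \<partial>?T)" for j
    proof -
      have lm: "(\<lambda>z. \<phi> (fst z, v j (fst z))) \<in> borel_measurable (?T \<Otimes>\<^sub>M unit_meas)"
        by (rule measurable_compose[OF law_map_measurable[OF Vm vK] m])
      have i: "integrable (?T \<Otimes>\<^sub>M unit_meas) (\<lambda>z. \<phi> (fst z, v j (fst z)))"
        using spacetime_integrable[OF N less_imp_le[OF S] K(1) c, of j] unfolding N_def law_def
        by (subst (asm) integrable_distr_eq[OF law_map_measurable[OF Vm vK] m])
      have "(\<integral>p. \<phi> p \<partial>N j) = (\<integral>z. \<phi> (fst z, v j (fst z)) \<partial>(?T \<Otimes>\<^sub>M unit_meas))"
        unfolding N_def by (rule integral_law[OF Vm vK m])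
      also have "\<dots> = (\<integral>s. (\<integral>\<omega>. \<phi> (s, v j s) \<partial>unit_meas) \<partial>?T)"
        using time_unit.integral_fst'[OF i] by simp
      also have "\<dots> = (\<integral>s. \<phi> (s, v j s) \<partial>?T)" by (simp add: unit_meas.prob_space[simplified])
      also have "\<dots> = (\<integral>s. \<phi> (s, w j s) \<partial>?T)"
      proof (rule integral_cong_AE)
        note id = ident_measurable_lebesgue_on[of "{0..S}"]
        have mU: "\<phi> \<in> borel_measurable (restrict_space borel ({0..S} \<times> UNIV))"
          using \<phi> unfolding Cc_test_def by (intro borel_measurable_continuous_on_restrict) auto
        have "(\<lambda>s. \<phi> (s, u s)) \<in> borel_measurable ?T" if "u \<in> borel_measurable ?T" for u
        proof -
          have "(\<lambda>s. (s, u s)) \<in> measurable ?T (borel \<Otimes>\<^sub>M borel)" by (rule measurable_Pair[OF id that])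
          then have "(\<lambda>s. (s, u s)) \<in> measurable ?T (restrict_space borel ({0..S} \<times> UNIV))"
            by (intro measurable_restrict_space2) (auto simp: space_restrict_space borel_prod)
          from measurable_compose[OF this mU] show ?thesis .
        qed
        then show "(\<lambda>s. \<phi> (s, v j s)) \<in> borel_measurable ?T" "(\<lambda>s. \<phi> (s, w j s)) \<in> borel_measurable ?T"
          using vm wm by auto
        show "AE s in ?T. \<phi> (s, v j s) = \<phi> (s, w j s)"
          using wK[of j] by eventually_elim (simp add: v_def)
      qed
      finally show ?thesis .
    qed
    then have 1: "(\<lambda>j. \<integral>s. \<phi> (s, w (r j) s) \<partial>?T) \<longlonglongrightarrow> (\<integral>p. \<phi> p \<partial>law S K X)"
      using conv[OF c] by simp
    have "(\<lambda>j. \<integral>s. \<phi> (s, w j s) \<partial>?T) \<longlonglongrightarrow> (\<integral>s. (\<integral>x. \<phi> (s, x) \<partial>\<mu> s) \<partial>?T)"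
      using gen \<phi> by (simp add: generates_young_def)
    from LIMSEQ_subseq_LIMSEQ[OF this r] have 2: "(\<lambda>j. \<integral>s. \<phi> (s, w (r j) s) \<partial>?T) \<longlonglongrightarrow> (\<integral>s. (\<integral>x. \<phi> (s, x) \<partial>\<mu> s) \<partial>?T)"
      by (simp add: comp_def)
    have i: "integrable (?T \<Otimes>\<^sub>M unit_meas) (\<lambda>z. \<phi> (fst z, X z))"
      using spacetime_integrable[OF spacetime_law[OF Xm X(2) Kb] less_imp_le[OF S] K(1) c] unfolding law_def
      by (subst (asm) integrable_distr_eq[OF law_map_measurable[OF Xm X(2)] m])
    show "integrable ?T (\<lambda>s. \<integral>\<omega>. \<phi> (s, X (s, \<omega>)) \<partial>unit_meas)"
      using time_unit.integrable_fst'[OF i] by simp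
    have "(\<integral>p. \<phi> p \<partial>law S K X) = (\<integral>s. (\<integral>\<omega>. \<phi> (s, X (s, \<omega>)) \<partial>unit_meas) \<partial>?T)"
      using integral_law[OF Xm X(2) m] time_unit.integral_fst'[OF i] by simp
    then show "(\<integral>s. (\<integral>x. \<phi> (s, x) \<partial>\<mu> s) \<partial>?T) = (\<integral>s. (\<integral>\<omega>. \<phi> (s, X (s, \<omega>)) \<partial>unit_meas) \<partial>?T)"
      using LIMSEQ_unique[OF 2 1] by simp
  qed
  \<comment> \<open>Test functions of product form \<open>a s * b x\<close>: varying
    \<open>a\<close> localises the identity in time, for each fixed \<open>b\<close>.\<close>
  have test_eq: "AE s in ?T. (\<integral>x. b x \<partial>\<mu> s) = (\<integral>\<omega>. b (X (s, \<omega>)) \<partial>unit_meas)"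
    if b: "continuous_on UNIV b" "bounded {x. b x \<noteq> 0}" for b :: "'a \<Rightarrow> real"
  proof -
    have test: "Cc_test S (\<lambda>(s, x). a s * b x)" if a: "continuous_on UNIV a" for a :: "real \<Rightarrow> real"
      unfolding Cc_test_def
    proof
      show "continuous_on ({0..S} \<times> UNIV) (\<lambda>(s, x). a s * b x)"
        unfolding case_prod_beta
        by (intro continuous_intros continuous_on_compose2[OF a] continuous_on_compose2[OF b(1)]) auto
      have "{p \<in> {0..S} \<times> UNIV. (case p of (s, x) \<Rightarrow> a s * b x) \<noteq> 0} \<subseteq> {0..S} \<times> {x. b x \<noteq> 0}" by auto
      then have "bounded {p \<in> {0..S} \<times> UNIV. (case p of (s, x) \<Rightarrow> a s * b x) \<noteq> 0}"
        by (rule bounded_subset[rotated]) (intro bounded_Times b bounded_closed_interval)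
      then show "compact (closure {p \<in> {0..S} \<times> UNIV. (case p of (s, x) \<Rightarrow> a s * b x) \<noteq> 0})"
        by (simp add: compact_closure)
    qed
    have "Cc_test S (\<lambda>(s, x). 1 * b x)" by (rule test) (rule continuous_on_const)
    then have one: "Cc_test S (\<lambda>(s::real, x). b x)" by simp
    have i1: "integrable ?T (\<lambda>s. \<integral>x. b x \<partial>\<mu> s)"
      using gen one unfolding generates_young_def by (auto dest: spec[of _ "\<lambda>(s, x). b x"])
    have i2: "integrable ?T (\<lambda>s. \<integral>\<omega>. b (X (s, \<omega>)) \<partial>unit_meas)" using int_X[OF one] by simp
    have "AE s in ?T. (\<integral>x. b x \<partial>\<mu> s) - (\<integral>\<omega>. b (X (s, \<omega>)) \<partial>unit_meas) = 0"
    proof (rule AE_zero_of_continuous_tests)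
      show "integrable ?T (\<lambda>s. (\<integral>x. b x \<partial>\<mu> s) - (\<integral>\<omega>. b (X (s, \<omega>)) \<partial>unit_meas))" using i1 i2 by auto
      fix a :: "real \<Rightarrow> real" assume a: "continuous_on UNIV a"
      have j1: "integrable ?T (\<lambda>s. a s * (\<integral>x. b x \<partial>\<mu> s))"
        using gen test[OF a] unfolding generates_young_def by (auto dest: spec[of _ "\<lambda>(s, x). a s * b x"])
      have j2: "integrable ?T (\<lambda>s. a s * (\<integral>\<omega>. b (X (s, \<omega>)) \<partial>unit_meas))" using int_X[OF test[OF a]] by simp
      show "(\<integral>s. a s * ((\<integral>x. b x \<partial>\<mu> s) - (\<integral>\<omega>. b (X (s, \<omega>)) \<partial>unit_meas)) \<partial>?T) = 0"
        using int_eq[OF test[OF a]] j1 j2 by (simp add: right_diff_distrib)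
    qed
    then show ?thesis by eventually_elim simp
  qed
  obtain G :: "'a set set" where G: "countable G" "Int_stable G"
    "\<And>U. U \<in> G \<Longrightarrow> open U \<and> bounded U" "sets borel = sigma_sets UNIV G" "\<Union>G = UNIV"
    by (rule countable_bounded_open_generator) (rule that)
  have "AE s in ?T. \<forall>U\<in>G. \<forall>n::nat. (\<integral>x. min 1 (real n * infdist x (- U)) \<partial>\<mu> s) =
    (\<integral>\<omega>. min 1 (real n * infdist (X (s, \<omega>)) (- U)) \<partial>unit_meas)"
  proof (subst AE_ball_countable[OF G(1)], intro ballI AE_all_countable[THEN iffD2] allI test_eq)
    fix U n assume "U \<in> G"
    show "continuous_on UNIV (\<lambda>x. min 1 (real n * infdist x (- U)))" by (intro continuous_intros)
    have "{x. min 1 (real n * infdist x (- U)) \<noteq> 0} \<subseteq> U"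
    proof
      fix x assume "x \<in> {x. min 1 (real n * infdist x (- U)) \<noteq> 0}"
      then show "x \<in> U" by (intro ccontr[of "x \<in> U"]) simp
    qed
    then show "bounded {x. min 1 (real n * infdist x (- U)) \<noteq> 0}" using G(3)[OF \<open>U \<in> G\<close>] by (meson bounded_subset)
  qed
  with AE_space have "AE s in ?T. \<mu> s = distr unit_meas borel (\<lambda>\<omega>. X (s, \<omega>))"
  proof eventually_elim
    case (elim s)
    then have s: "s \<in> {0..S}" by (simp add: space_restrict_space)
    have xm: "(\<lambda>\<omega>. X (s, \<omega>)) \<in> borel_measurable unit_meas"
      using measurable_compose[OF measurable_Pair1'[of s borel borel] X(1)] by (simp cong: measurable_cong_sets)
    interpret D: prob_space "distr unit_meas borel (\<lambda>\<omega>. X (s, \<omega>))" by (rule unit_meas.prob_space_distr[OF xm])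
    show ?case
    proof (rule measure_eqI_open_tests[OF _ _ _ _ G])
      show "sets (\<mu> s) = sets borel" "\<And>K. compact K \<Longrightarrow> emeasure (\<mu> s) K < \<infinity>"
        using radon[OF s] by (auto simp: radon_measure_def)
      show "emeasure (distr unit_meas borel (\<lambda>\<omega>. X (s, \<omega>))) K < \<infinity>" for K
        using D.emeasure_finite by (simp add: less_top[symmetric])
      fix U n assume "U \<in> G"
      have "(\<integral>x. min 1 (real n * infdist x (- U)) \<partial>distr unit_meas borel (\<lambda>\<omega>. X (s, \<omega>))) =
        (\<integral>\<omega>. min 1 (real n * infdist (X (s, \<omega>)) (- U)) \<partial>unit_meas)"
        by (rule integral_distr[OF xm]) (intro borel_measurable_continuous_onI continuous_intros)
      then show "(\<integral>x. min 1 (real n * infdist x (- U)) \<partial>\<mu> s) = (\<integral>x. min 1 (real n * infdist x (- U)) \<partial>distr unit_meas borel (\<lambda>\<omega>. X (s, \<omega>)))"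
        using elim(2) \<open>U \<in> G\<close> by simp
    qed simp
  qed
  then show thesis using that[OF X] by blast
qed

section \<open>Lower semicontinuity and Sobolev functions\<close>

lemma compact_continuous_bound:
  fixes f :: "'a::topological_space \<Rightarrow> 'b::real_normed_vector"
  assumes "compact A" "continuous_on A f"
  obtains B where "0 \<le> B" "\<And>x. x \<in> A \<Longrightarrow> norm (f x) \<le> B"
proof -
  have "bounded (f ` A)" using assms by (intro compact_imp_bounded compact_continuous_image)
  then obtain b where "\<forall>z\<in>f ` A. norm z \<le> b" by (auto simp: bounded_iff)
  then show thesis by (intro that[of "max 0 b"]) (auto simp: max.coboundedI2)
qed

text \<open>Lipschitz regularisation: \<open>k n\<close> is the infimal convolution of
  \<open>h\<close>, truncated at height \<open>n\<close>, with \<open>n\<close> times the distance.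
  Near \<open>p\<close> semicontinuity keeps \<open>h\<close> above \<open>a\<close>; farther away
  the distance term alone exceeds \<open>a\<close> for large \<open>n\<close>.\<close>

lemma continuous_approx_of_lsc:
  fixes h :: "'a::metric_space \<Rightarrow> ennreal"
  assumes lsc: "\<And>p a. p \<in> D \<Longrightarrow> a < h p \<Longrightarrow> \<exists>\<delta>>0. \<forall>q\<in>D. dist q p < \<delta> \<longrightarrow> a < h q"
  obtains k :: "nat \<Rightarrow> 'a \<Rightarrow> real" where "\<And>n. continuous_on D (k n)"
    "\<And>n p. p \<in> D \<Longrightarrow> 0 \<le> k n p" "\<And>p. p \<in> D \<Longrightarrow> incseq (\<lambda>n. k n p)"
    "\<And>p. p \<in> D \<Longrightarrow> (SUP n. ennreal (k n p)) = h p"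
proof (cases "D = {}")
  case True
  then show ?thesis by (intro that[of "\<lambda>_ _. 0"]) auto
next
  case ne: False
  \<comment> \<open>Truncation makes the values real, so that the infimum below can be taken in the
    reals.\<close>
  define m where "m n q = enn2real (min (h q) (of_nat n))" for n :: nat and q
  have fin: "min (h q) (of_nat n) < \<top>" for n :: nat and q
    by (metis min.cobounded2 le_less_trans of_nat_less_top)
  have m0: "0 \<le> m n q" for n q by (simp add: m_def)
  have m_le: "ennreal (m n q) \<le> h q" for n q
    using fin[of q n] by (simp add: m_def less_top)
  have m_mono: "m n q \<le> m n' q" if "n \<le> n'" for n n' q
    unfolding m_def using fin[of q n'] that by (intro enn2real_mono min.mono) auto
  have m_ge: "a \<le> m n q" if "ennreal a < h q" "a \<le> real n" "0 \<le> a" for a n q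
  proof -
    have "ennreal a \<le> min (h q) (of_nat n)" using that by (auto simp: ennreal_of_nat_eq_real_of_nat)
    then show ?thesis unfolding m_def using fin[of q n] \<open>0 \<le> a\<close> by (metis enn2real_ennreal enn2real_mono)
  qed
  define k where "k n p = (INF q\<in>D. m n q + real n * dist p q)" for n p
  have bdd: "bdd_below ((\<lambda>q. m n q + real n * dist p q) ` D)" for n p
    by (rule bdd_belowI2[of _ 0]) (simp add: m0)
  have k_le: "k n p \<le> m n q + real n * dist p q" if "q \<in> D" for n p q
    unfolding k_def using bdd that by (rule cINF_lower)
  have k_geI: "a \<le> k n p" if "\<And>q. q \<in> D \<Longrightarrow> a \<le> m n q + real n * dist p q" for a n p
    unfolding k_def using ne that by (rule cINF_greatest)
  have k0: "0 \<le> k n p" for n p by (rule k_geI) (simp add: m0)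
  have k_lip: "k n p \<le> k n p' + real n * dist p p'" for n p p'
  proof -
    have "k n p - real n * dist p p' \<le> k n p'"
    proof (rule k_geI)
      fix q assume "q \<in> D"
      have "real n * dist p q \<le> real n * dist p p' + real n * dist p' q"
        using mult_left_mono[OF dist_triangle[of p q p'], of "real n"] by (simp add: algebra_simps)
      then show "k n p - real n * dist p p' \<le> m n q + real n * dist p' q" using k_le[OF \<open>q \<in> D\<close>, of n p] by simp
    qed
    then show ?thesis by simp
  qed
  have k_cont: "continuous_on D (k n)" for n
  proof (rule lipschitz_on_continuous_on)
    show "(real n)-lipschitz_on D (k n)"
    proof (rule lipschitz_onI)
      fix p p'
      show "dist (k n p) (k n p') \<le> real n * dist p p'"
        using k_lip[of n p p'] k_lip[of n p' p] by (auto simp: dist_real_def dist_commute)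
    qed simp
  qed
  have k_inc: "k n p \<le> k n' p" if "n \<le> n'" for n n' p
  proof (rule k_geI)
    fix q assume "q \<in> D"
    then have "k n p \<le> m n q + real n * dist p q" by (rule k_le)
    also have "\<dots> \<le> m n' q + real n' * dist p q"
      using m_mono[OF that] that by (intro add_mono mult_right_mono) auto
    finally show "k n p \<le> m n' q + real n' * dist p q" .
  qed
  have k_sup: "(SUP n. ennreal (k n p)) = h p" if p: "p \<in> D" for p
  proof (rule antisym)
    show "(SUP n. ennreal (k n p)) \<le> h p"
    proof (rule SUP_least)
      fix n
      have "k n p \<le> m n p" using k_le[OF p, of n p] by simp
      then show "ennreal (k n p) \<le> h p" using m_le[of n p] by (meson ennreal_leI order_trans)
    qed
    show "h p \<le> (SUP n. ennreal (k n p))"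
    proof (rule dense_le)
      fix b assume b: "b < h p"
      then obtain a where a: "b = ennreal a" "0 \<le> a" using b by (cases b) auto
      obtain \<delta> where \<delta>: "\<delta> > 0" "\<And>q. q \<in> D \<Longrightarrow> dist q p < \<delta> \<Longrightarrow> b < h q" using lsc[OF p b] by blast
      obtain n :: nat where n: "max a (a / \<delta>) < real n" using reals_Archimedean2 by blast
      have "a \<le> k n p"
      proof (rule k_geI)
        fix q assume q: "q \<in> D"
        show "a \<le> m n q + real n * dist p q"
        proof (cases "dist q p < \<delta>")
          case True
          then have "a \<le> m n q" using \<delta>(2)[OF q] a n by (intro m_ge) auto
          then show ?thesis by (simp add: add_increasing2)
        next
          case False
          have "a \<le> real n * \<delta>" using n \<delta>(1) by (simp add: field_simps)
          also have "\<dots> \<le> real n * dist p q" using False by (intro mult_left_mono) (auto simp: dist_commute)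
          finally show ?thesis using m0[of n q] by simp
        qed
      qed
      then have "b \<le> ennreal (k n p)" using a by (simp add: ennreal_leI)
      also have "\<dots> \<le> (SUP n. ennreal (k n p))" by (rule SUP_upper) simp
      finally show "b \<le> (SUP n. ennreal (k n p))" .
    qed
  qed
  show ?thesis
    by (rule that[of k]) (use k_cont k0 k_inc k_sup in \<open>auto simp: incseq_def\<close>)
qed

section \<open>Indefinite integrals of bounded functions\<close>

context
  fixes S M :: real and d :: "real \<Rightarrow> 'a::euclidean_space"
  assumes dm[measurable]: "d \<in> borel_measurable (lebesgue_on {0..S})"
    and dM: "AE s in lebesgue_on {0..S}. norm (d s) \<le> M"
begin

lemma bounded_integrable: "integrable (lebesgue_on {0..S}) d"
  by (rule time_meas.integrable_const_bound[where B = M]) (use dM in auto)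

lemma indicator_time_measurable: "(\<lambda>x. indicator A x :: real) \<in> borel_measurable (lebesgue_on {0..S})" if "A \<in> sets borel" for A
  using that by (intro measurable_restrict_space1) (simp add: measurable_completion)

lemma indicator_integrable:
  assumes "A \<in> sets borel"
  shows "integrable (lebesgue_on {0..S}) (\<lambda>s. indicator A s *\<^sub>R d s)"
proof (rule Bochner_Integration.integrable_bound[OF bounded_integrable])
  show "(\<lambda>s. indicator A s *\<^sub>R d s) \<in> borel_measurable (lebesgue_on {0..S})"
    using indicator_time_measurable[OF assms] by measurable
qed (auto simp: indicator_def)

lemma indefinite_integral_diff:
  assumes "0 \<le> a" "a \<le> b" "b \<le> S"
  shows "(\<integral>s. indicator {0..b} s *\<^sub>R d s \<partial>lebesgue_on {0..S}) - (\<integral>s. indicator {0..a} s *\<^sub>R d s \<partial>lebesgue_on {0..S})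
    = (\<integral>s. indicator {a<..b} s *\<^sub>R d s \<partial>lebesgue_on {0..S})"
proof -
  have "(\<integral>s. indicator {0..b} s *\<^sub>R d s \<partial>lebesgue_on {0..S}) - (\<integral>s. indicator {0..a} s *\<^sub>R d s \<partial>lebesgue_on {0..S})
    = (\<integral>s. indicator {0..b} s *\<^sub>R d s - indicator {0..a} s *\<^sub>R d s \<partial>lebesgue_on {0..S})"
    by (rule Bochner_Integration.integral_diff[symmetric]) (rule indicator_integrable, simp)+
  also have "\<dots> = (\<integral>s. indicator {a<..b} s *\<^sub>R d s \<partial>lebesgue_on {0..S})"
    by (rule Bochner_Integration.integral_cong) (use assms in \<open>auto simp: indicator_def\<close>)
  finally show ?thesis .
qed

lemma indefinite_integral_lipschitz:
  assumes "0 \<le> a" "a \<le> b" "b \<le> S" "0 \<le> M"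
  shows "norm ((\<integral>s. indicator {0..b} s *\<^sub>R d s \<partial>lebesgue_on {0..S}) - (\<integral>s. indicator {0..a} s *\<^sub>R d s \<partial>lebesgue_on {0..S})) \<le> M * (b - a)"
proof -
  have "norm (\<integral>s. indicator {a<..b} s *\<^sub>R d s \<partial>lebesgue_on {0..S}) \<le> (\<integral>s. M * indicator {a<..b} s \<partial>lebesgue_on {0..S})"
  proof (rule order_trans[OF integral_norm_bound integral_mono_AE])
    show "integrable (lebesgue_on {0..S}) (\<lambda>s. norm (indicator {a<..b} s *\<^sub>R d s))"
      by (rule integrable_norm, rule indicator_integrable) simp
    show "integrable (lebesgue_on {0..S}) (\<lambda>s. M * indicator {a<..b} s)"
      using indicator_time_measurable[of "{a<..b}"] assms(4)
      by (intro time_meas.integrable_const_bound[where B = M]) (auto simp: indicator_def)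
    show "AE s in lebesgue_on {0..S}. norm (indicator {a<..b} s *\<^sub>R d s) \<le> M * indicator {a<..b} s"
      using dM by eventually_elim (auto simp: indicator_def)
  qed
  also have "\<dots> = M * measure (lebesgue_on {0..S}) {a<..b}"
    using assms by (simp add: space_restrict_space Int_absorb2 subset_eq)
  also have "measure (lebesgue_on {0..S}) {a<..b} = b - a"
    using assms by (subst measure_restrict_space) auto
  finally show ?thesis by (simp only: indefinite_integral_diff[OF assms(1-3)])
qed

lemma indefinite_integral_continuous:
  assumes "0 \<le> M"
  shows "continuous_on {0..S} (\<lambda>s. \<integral>\<sigma>. indicator {0..s} \<sigma> *\<^sub>R d \<sigma> \<partial>lebesgue_on {0..S})"
proof (rule lipschitz_on_continuous_on)
  show "M-lipschitz_on {0..S} (\<lambda>s. \<integral>\<sigma>. indicator {0..s} \<sigma> *\<^sub>R d \<sigma> \<partial>lebesgue_on {0..S})"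
  proof (rule lipschitz_onI)
    fix x y assume "x \<in> {0..S}" "y \<in> {0..S}"
    then show "dist (\<integral>\<sigma>. indicator {0..x} \<sigma> *\<^sub>R d \<sigma> \<partial>lebesgue_on {0..S}) (\<integral>\<sigma>. indicator {0..y} \<sigma> *\<^sub>R d \<sigma> \<partial>lebesgue_on {0..S}) \<le> M * dist x y"
      using indefinite_integral_lipschitz[of x y] indefinite_integral_lipschitz[of y x] assms
      by (cases "x \<le> y") (auto simp: dist_norm norm_minus_commute)
  qed (rule assms)
qed

text \<open>Integration by parts through Fubini: after the order of integration is exchanged, the
  inner integral of \<open>\<phi>'\<close> from \<sigma> to \<open>S\<close> is
  \<open>- \<phi> \<sigma>\<close>, since \<phi> vanishes near \<open>S\<close>. The constant
  \<open>c\<close> drops out because \<phi> vanishes at both ends.\<close>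

lemma W1inf_indefinite_integral:
  assumes S: "0 < S" and M: "0 \<le> M"
    and y: "\<And>s. s \<in> {0..S} \<Longrightarrow> y s = c + (\<integral>\<sigma>. indicator {0..s} \<sigma> *\<^sub>R d \<sigma> \<partial>lebesgue_on {0..S})"
  shows "W1inf S y d"
  unfolding W1inf_def
proof (intro conjI allI impI)
  let ?T = "lebesgue_on {0..S}"
  let ?I = "\<lambda>s. \<integral>\<sigma>. indicator {0..s} \<sigma> *\<^sub>R d \<sigma> \<partial>?T"
  have contI: "continuous_on {0..S} ?I" by (rule indefinite_integral_continuous[OF M])
  then have "continuous_on {0..S} (\<lambda>s. c + ?I s)" by (intro continuous_intros)
  then show "continuous_on {0..S} y" by (rule continuous_on_eq) (simp add: y)
  show "d \<in> borel_measurable ?T" by (rule dm)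
  show "\<exists>M. AE s in ?T. norm (d s) \<le> M" using dM by blast
  fix \<phi> \<phi>' assume "C1c_test S \<phi> \<phi>'"
  then obtain a b where der: "\<And>x. (\<phi> has_real_derivative \<phi>' x) (at x)" and cont: "continuous_on UNIV \<phi>'"
    and ab: "0 < a" "b < S" "\<And>x. x \<notin> {a..b} \<Longrightarrow> \<phi> x = 0" unfolding C1c_test_def by blast
  have c\<phi>: "continuous_on UNIV \<phi>" using der by (meson DERIV_isCont continuous_at_imp_continuous_on)
  have [measurable]: "\<phi>' \<in> borel_measurable ?T" "\<phi> \<in> borel_measurable ?T"
    by (rule continuous_imp_measurable_on_sets_lebesgue[OF continuous_on_subset[OF cont]]; simp)
      (rule continuous_imp_measurable_on_sets_lebesgue[OF continuous_on_subset[OF c\<phi>]]; simp)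
  note idm[measurable] = ident_measurable_lebesgue_on[of "{0..S}"]
  obtain B where B: "0 \<le> B" "\<And>x. x \<in> {0..S} \<Longrightarrow> norm (\<phi>' x) \<le> B"
    by (rule compact_continuous_bound[OF compact_Icc continuous_on_subset[OF cont subset_UNIV]]) (rule that)
  have i\<phi>': "integrable ?T \<phi>'"
    by (rule time_meas.integrable_const_bound[where B = B]) (use B(2) in \<open>auto intro!: AE_I2 simp: space_restrict_space\<close>)
  have i\<sigma>: "integrable ?T (\<lambda>s. if \<sigma> \<le> s then \<phi>' s else 0)" for \<sigma>
  proof (rule Bochner_Integration.integrable_bound[OF i\<phi>'])
    show "(\<lambda>s. if \<sigma> \<le> s then \<phi>' s else 0) \<in> borel_measurable ?T" by measurable
    show "AE s in ?T. norm (if \<sigma> \<le> s then \<phi>' s else 0) \<le> norm (\<phi>' s)" by (intro AE_I2) auto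
  qed
  have ftc: "(\<integral>s. (if \<sigma> \<le> s then \<phi>' s else 0) \<partial>?T) = - \<phi> \<sigma>" if \<sigma>: "\<sigma> \<in> {0..S}" for \<sigma>
  proof -
    note i = i\<sigma>[of \<sigma>]
    have "(\<integral>s. (if \<sigma> \<le> s then \<phi>' s else 0) \<partial>?T) = integral {0..S} (\<lambda>s. if \<sigma> \<le> s then \<phi>' s else 0)"
      using i by (rule lebesgue_integral_eq_integral) simp
    also have "\<dots> = integral {0..S} (\<lambda>s. if s \<in> {\<sigma>..S} then \<phi>' s else 0)"
      by (rule Henstock_Kurzweil_Integration.integral_cong) auto
    also have "\<dots> = integral {\<sigma>..S} \<phi>'"
      using \<sigma> by (subst integral_restrict_Int) (simp add: Int_absorb1 subset_eq)
    also have "\<dots> = \<phi> S - \<phi> \<sigma>"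
      by (rule integral_unique, rule fundamental_theorem_of_calculus)
        (use \<sigma> der in \<open>auto simp: has_real_derivative_iff_has_vector_derivative[symmetric] intro: has_field_derivative_at_within\<close>)
    also have "\<phi> S = 0" using ab by auto
    finally show ?thesis by simp
  qed
  let ?F = "\<lambda>s \<sigma>. (if \<sigma> \<le> s then \<phi>' s else 0) *\<^sub>R d \<sigma>"
  interpret TT: pair_sigma_finite ?T ?T by unfold_locales
  have Fm: "case_prod ?F \<in> borel_measurable (?T \<Otimes>\<^sub>M ?T)" by measurable
  have Fint: "integrable (?T \<Otimes>\<^sub>M ?T) (case_prod ?F)"
  proof -
    interpret finite_measure "?T \<Otimes>\<^sub>M ?T"
      by (rule finite_measure_pair_measure) (auto intro: time_meas.finite_measure_axioms)
    have "AE z in ?T \<Otimes>\<^sub>M ?T. norm (d (snd z)) \<le> M"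
    proof (rule TT.AE_pair_measure)
      show "{x \<in> space (?T \<Otimes>\<^sub>M ?T). norm (d (snd x)) \<le> M} \<in> sets (?T \<Otimes>\<^sub>M ?T)" by measurable
      show "AE x in ?T. AE y in ?T. norm (d (snd (x, y))) \<le> M" using dM by simp
    qed
    with AE_space have "AE z in ?T \<Otimes>\<^sub>M ?T. norm (case_prod ?F z) \<le> B * M"
    proof eventually_elim
      case (elim z)
      then have "\<bar>\<phi>' (fst z)\<bar> \<le> B" using B(2)[of "fst z"] by (auto simp: space_pair_measure space_restrict_space)
      then show ?case using elim(2) B(1) M by (auto simp: case_prod_beta intro!: mult_mono)
    qed
    then show ?thesis using Fm by (rule integrable_const_bound)
  qed
  have "(\<integral>s. \<phi>' s *\<^sub>R ?I s \<partial>?T) = (\<integral>s. (\<integral>\<sigma>. ?F s \<sigma> \<partial>?T) \<partial>?T)"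
  proof (rule Bochner_Integration.integral_cong[OF refl])
    fix s assume "s \<in> space ?T"
    have "(\<integral>\<sigma>. ?F s \<sigma> \<partial>?T) = (\<integral>\<sigma>. \<phi>' s *\<^sub>R (indicator {0..s} \<sigma> *\<^sub>R d \<sigma>) \<partial>?T)"
      by (rule Bochner_Integration.integral_cong) (auto simp: space_restrict_space indicator_def)
    also have "\<dots> = \<phi>' s *\<^sub>R ?I s"
      by (rule integral_scaleR_right)
    finally show "\<phi>' s *\<^sub>R ?I s = (\<integral>\<sigma>. ?F s \<sigma> \<partial>?T)" by (rule sym)
  qed
  also have "\<dots> = (\<integral>\<sigma>. (\<integral>s. ?F s \<sigma> \<partial>?T) \<partial>?T)"
    using TT.Fubini_integral[OF Fint] by simp
  also have "\<dots> = (\<integral>\<sigma>. - (\<phi> \<sigma> *\<^sub>R d \<sigma>) \<partial>?T)"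
  proof (rule Bochner_Integration.integral_cong[OF refl])
    fix \<sigma> assume "\<sigma> \<in> space ?T"
    then have \<sigma>: "\<sigma> \<in> {0..S}" by (simp add: space_restrict_space)
    from i\<sigma>[of \<sigma>] show "(\<integral>s. ?F s \<sigma> \<partial>?T) = - (\<phi> \<sigma> *\<^sub>R d \<sigma>)"
      using ftc[OF \<sigma>] by simp
  qed
  finally have parts: "(\<integral>s. \<phi>' s *\<^sub>R ?I s \<partial>?T) = - (\<integral>s. \<phi> s *\<^sub>R d s \<partial>?T)" by simp
  have Im: "?I \<in> borel_measurable ?T" by (rule continuous_imp_measurable_on_sets_lebesgue[OF contI]) simp
  have "(\<integral>s. \<phi>' s *\<^sub>R y s \<partial>?T) = (\<integral>s. \<phi>' s *\<^sub>R c + \<phi>' s *\<^sub>R ?I s \<partial>?T)"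
    by (rule Bochner_Integration.integral_cong) (auto simp: y space_restrict_space scaleR_add_right)
  also have "\<dots> = (\<integral>s. \<phi>' s *\<^sub>R c \<partial>?T) + (\<integral>s. \<phi>' s *\<^sub>R ?I s \<partial>?T)"
  proof (rule Bochner_Integration.integral_add)
    show "integrable ?T (\<lambda>s. \<phi>' s *\<^sub>R c)" using i\<phi>' by simp
    obtain C where C: "\<And>x. x \<in> {0..S} \<Longrightarrow> norm (?I x) \<le> C"
      by (rule compact_continuous_bound[OF compact_Icc contI]) (rule that)
    show "integrable ?T (\<lambda>s. \<phi>' s *\<^sub>R ?I s)"
    proof (rule time_meas.integrable_const_bound[where B = "B * C"])
      show "(\<lambda>s. \<phi>' s *\<^sub>R ?I s) \<in> borel_measurable ?T" using Im by measurable
      show "AE s in ?T. norm (\<phi>' s *\<^sub>R ?I s) \<le> B * C"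
      proof (rule AE_I2)
        fix s assume "s \<in> space ?T"
        then have "s \<in> {0..S}" by (simp add: space_restrict_space)
        then show "norm (\<phi>' s *\<^sub>R ?I s) \<le> B * C" using B C by (auto intro!: mult_mono)
      qed
    qed
  qed
  also have "(\<integral>s. \<phi>' s *\<^sub>R c \<partial>?T) = 0"
  proof -
    have "(\<integral>s. \<phi>' s \<partial>?T) = (\<integral>s. (if 0 \<le> s then \<phi>' s else 0) \<partial>?T)"
      by (rule Bochner_Integration.integral_cong) (auto simp: space_restrict_space)
    also have "\<dots> = 0" using ftc[of 0] ab S by simp
    finally show ?thesis using i\<phi>' by simp
  qed
  finally show "(\<integral>s. \<phi>' s *\<^sub>R y s \<partial>?T) = - (\<integral>s. \<phi> s *\<^sub>R d s \<partial>?T)" using parts by simp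
qed

end

section \<open>From weak derivatives to integral equations\<close>

lemma has_real_derivative_positive_part_square:
  "((\<lambda>x. (max 0 x)\<^sup>2) has_real_derivative 2 * max 0 x) (at (x::real))"
proof -
  consider "x < 0" | "x > 0" | "x = 0" by linarith
  then show ?thesis
  proof cases
    case 1
    have "((\<lambda>x. (max 0 x)\<^sup>2) has_real_derivative 0) (at x)"
      by (rule DERIV_cong_ev[OF refl _ refl, THEN iffD2, of _ "\<lambda>_. 0"])
        (use 1 eventually_nhds_in_open[of "{..<0}" x] in \<open>auto elim!: eventually_mono\<close>)
    then show ?thesis using 1 by simp
  next
    case 2
    have "((\<lambda>x. (max 0 x)\<^sup>2) has_real_derivative 2 * x) (at x)"
      by (rule DERIV_cong_ev[OF refl _ refl, THEN iffD2, of _ "\<lambda>x. x\<^sup>2"])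
        (use 2 eventually_nhds_in_open[of "{0<..}" x] in \<open>auto elim!: eventually_mono intro!: derivative_eq_intros\<close>)
    then show ?thesis using 2 by simp
  next
    case 3
    have "(\<lambda>h. (max 0 (0 + h))\<^sup>2 / h) \<midarrow>0\<rightarrow> (0::real)"
    proof (rule LIM_I)
      fix r :: real assume "0 < r"
      have "norm ((max 0 (0 + h))\<^sup>2 / h - 0) < r" if "h \<noteq> 0" "norm (h - 0) < r" for h :: real
        using that \<open>0 < r\<close> by (cases "h > 0") (auto simp: power2_eq_square max_def)
      then show "\<exists>s>0. \<forall>h::real. h \<noteq> 0 \<and> norm (h - 0) < s \<longrightarrow> norm ((max 0 (0 + h))\<^sup>2 / h - 0) < r"
        using \<open>0 < r\<close> by (intro exI[of _ r]) simp
    qed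
    then show ?thesis using 3 by (simp add: DERIV_def)
  qed
qed

text \<open>A quadratic spline with knots 0, 1/2 and 1, the simplest C1 transition from 0 to 1; the
  factor 2 normalises its final value. Its derivative \<open>tent\<close> is a mollifier supported
  in [0,1].\<close>

definition step_fun :: "real \<Rightarrow> real" where
  "step_fun x = 2 * ((max 0 x)\<^sup>2 - 2 * (max 0 (x - 1/2))\<^sup>2 + (max 0 (x - 1))\<^sup>2)"

definition tent :: "real \<Rightarrow> real" where
  "tent x = 4 * (max 0 x - 2 * max 0 (x - 1/2) + max 0 (x - 1))"

lemma step_fun_has_derivative: "(step_fun has_real_derivative tent x) (at x)"
proof -
  have shift: "((\<lambda>x. (max 0 (x - c))\<^sup>2) has_real_derivative 2 * max 0 (x - c)) (at x)" for c
    using DERIV_shift[of "\<lambda>x. (max 0 x)\<^sup>2" "2 * max 0 (x - c)" x "- c"]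
      has_real_derivative_positive_part_square[of "x - c"] by simp
  have "((\<lambda>x. 2 * ((max 0 (x - 0))\<^sup>2 - 2 * (max 0 (x - 1/2))\<^sup>2 + (max 0 (x - 1))\<^sup>2)) has_real_derivative
      2 * (2 * max 0 (x - 0) - 2 * (2 * max 0 (x - 1/2)) + 2 * max 0 (x - 1))) (at x)"
    by (intro DERIV_cmult DERIV_add DERIV_diff shift)
  then show ?thesis unfolding step_fun_def[abs_def] tent_def by (simp add: algebra_simps)
qed

lemma tent_continuous: "continuous_on A tent"
  unfolding tent_def[abs_def] by (intro continuous_intros)

lemma tent_nonneg: "0 \<le> tent x"
  by (auto simp: tent_def max_def)

lemma tent_zero: "x \<le> 0 \<or> 1 \<le> x \<Longrightarrow> tent x = 0"
  by (auto simp: tent_def max_def)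

lemma step_fun_0: "x \<le> 0 \<Longrightarrow> step_fun x = 0"
  by (simp add: step_fun_def max_def)

lemma step_fun_1: "1 \<le> x \<Longrightarrow> step_fun x = 1"
  by (simp add: step_fun_def max_def power2_eq_square algebra_simps)

lemma step_fun_range: "0 \<le> step_fun x" "step_fun x \<le> 1"
proof -
  have mono: "step_fun a \<le> step_fun b" if "a \<le> b" for a b
    by (rule DERIV_nonneg_imp_nondecreasing[OF that]) (use step_fun_has_derivative tent_nonneg in blast)
  show "0 \<le> step_fun x" using mono[of "min x 0" x] step_fun_0[of "min x 0"] by simp
  show "step_fun x \<le> 1" using mono[of x "max x 1"] step_fun_1[of "max x 1"] by simp
qed

text \<open>The weak equation is tested with a steep step up at \<open>a\<close> minus one at
  \<open>b\<close>. The derivatives concentrate at \<open>a\<close> and \<open>b\<close> and produce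
  \<open>y a - y b\<close>, while the test functions tend to the indicator of
  \<open>{a<..b}\<close>. This settles interior points; the end points follow by continuity.\<close>

lemma W1inf_integral_eq:
  fixes y :: "real \<Rightarrow> 'a::euclidean_space"
  assumes W: "W1inf S y d" and S: "0 < S" and s: "s \<in> {0..S}"
  shows "y s = y 0 + (\<integral>\<sigma>. indicator {0..s} \<sigma> *\<^sub>R d \<sigma> \<partial>lebesgue_on {0..S})"
proof -
  let ?T = "lebesgue_on {0..S}"
  have yc: "continuous_on {0..S} y" and dm[measurable]: "d \<in> borel_measurable ?T"
    using W by (auto simp: W1inf_def)
  obtain M0 where M0: "AE s in ?T. norm (d s) \<le> M0" using W by (auto simp: W1inf_def)
  define M where "M = max 0 M0"
  have M: "AE s in ?T. norm (d s) \<le> M" "0 \<le> M"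
    using M0 by (auto simp: M_def elim: eventually_mono)
  let ?I = "\<lambda>s. \<integral>\<sigma>. indicator {0..s} \<sigma> *\<^sub>R d \<sigma> \<partial>?T"
  have contI: "continuous_on {0..S} ?I" by (rule indefinite_integral_continuous[OF dm M])
  have weight_lim: "(\<lambda>n. \<integral>x. (real n * tent (real n * (x - a))) *\<^sub>R y x \<partial>?T) \<longlonglongrightarrow> y a" if a: "0 < a" "a < S" for a
  proof (rule LIMSEQ_I)
    fix e :: real assume e: "0 < e"
    have "continuous_on {0..S} y" by fact
    then obtain \<delta> where \<delta>: "\<delta> > 0" "\<And>x. x \<in> {0..S} \<Longrightarrow> dist x a < \<delta> \<Longrightarrow> dist (y x) (y a) < e / 2"
      unfolding continuous_on_iff using a e by (metis atLeastAtMost_iff half_gt_zero less_imp_le)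
    obtain N :: nat where N: "1 / min \<delta> (S - a) < real N" using reals_Archimedean2 by blast
    show "\<exists>no. \<forall>n\<ge>no. norm ((\<integral>x. (real n * tent (real n * (x - a))) *\<^sub>R y x \<partial>?T) - y a) < e"
    proof (intro exI[of _ N] allI impI)
      fix n assume "N \<le> n"
      then have n1: "1 / min \<delta> (S - a) < real n" using N by linarith
      have "0 < 1 / min \<delta> (S - a)" using \<delta>(1) a by simp
      then have n0: "0 < real n" using n1 by linarith
      have n: "1 < real n * \<delta>" "1 < real n * (S - a)"
      proof -
        have *: "1 < real n * min \<delta> (S - a)" using n1 \<delta>(1) a by (simp add: field_simps min_def split: if_splits)
        have "real n * min \<delta> (S - a) \<le> real n * \<delta>" "real n * min \<delta> (S - a) \<le> real n * (S - a)"
          by (auto intro: mult_left_mono)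
        with * show "1 < real n * \<delta>" "1 < real n * (S - a)" by linarith+
      qed
      let ?k = "\<lambda>x. real n * tent (real n * (x - a))"
      have kc: "continuous_on {0..S} ?k"
        by (intro continuous_intros continuous_on_compose2[OF tent_continuous[of UNIV]]) auto
      have k0: "0 \<le> ?k x" for x using tent_nonneg by simp
      have ki: "integrable ?T ?k" by (rule continuous_imp_integrable_real[OF kc])
      have kyi: "integrable ?T (\<lambda>x. ?k x *\<^sub>R y x)"
        by (rule continuous_imp_integrable_real) (intro continuous_intros kc yc)
      have kdi: "integrable ?T (\<lambda>x. ?k x *\<^sub>R (y x - y a))"
        by (rule continuous_imp_integrable_real) (intro continuous_intros kc yc)
      have kder: "((\<lambda>x. step_fun (real n * (x - a))) has_real_derivative ?k x) (at x)" for x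
      proof -
        have "((\<lambda>x. real n * (x - a)) has_real_derivative real n) (at x)" by (auto intro!: derivative_eq_intros)
        from DERIV_chain2[OF step_fun_has_derivative this] show ?thesis by (simp add: mult.commute)
      qed
      have "(\<integral>x. ?k x \<partial>?T) = integral {0..S} ?k" by (rule lebesgue_integral_eq_integral[OF ki]) simp
      also have "\<dots> = step_fun (real n * (S - a)) - step_fun (real n * (0 - a))"
        by (rule integral_unique, rule fundamental_theorem_of_calculus)
          (use S kder in \<open>auto simp: has_real_derivative_iff_has_vector_derivative[symmetric] intro: has_field_derivative_at_within\<close>)
      also have "\<dots> = 1" using n a n0 by (simp add: step_fun_0 step_fun_1 mult_nonneg_nonpos)
      finally have k1: "(\<integral>x. ?k x \<partial>?T) = 1" .
      have "(\<integral>x. ?k x *\<^sub>R y x \<partial>?T) - y a = (\<integral>x. ?k x *\<^sub>R y x \<partial>?T) - (\<integral>x. ?k x *\<^sub>R y a \<partial>?T)"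
        using ki k1 by simp
      also have "\<dots> = (\<integral>x. ?k x *\<^sub>R (y x - y a) \<partial>?T)"
        using ki kyi by (subst Bochner_Integration.integral_diff[symmetric]) (auto simp: scaleR_diff_right)
      finally have "norm ((\<integral>x. ?k x *\<^sub>R y x \<partial>?T) - y a) \<le> (\<integral>x. norm (?k x *\<^sub>R (y x - y a)) \<partial>?T)"
        by (simp only: integral_norm_bound)
      also have "\<dots> \<le> (\<integral>x. ?k x * (e / 2) \<partial>?T)"
      proof (rule integral_mono)
        fix x assume "x \<in> space ?T"
        then have x: "x \<in> {0..S}" by (simp add: space_restrict_space)
        show "norm (?k x *\<^sub>R (y x - y a)) \<le> ?k x * (e / 2)"
        proof (cases "dist x a < \<delta>")
          case True
          then have "norm (y x - y a) \<le> e / 2" using \<delta>(2)[OF x] by (simp add: dist_norm)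
          have "norm (?k x *\<^sub>R (y x - y a)) = ?k x * norm (y x - y a)"
            using k0[of x] by (simp only: norm_scaleR abs_of_nonneg)
          also have "\<dots> \<le> ?k x * (e / 2)" using \<open>norm (y x - y a) \<le> e / 2\<close> k0[of x] by (rule mult_left_mono)
          finally show ?thesis .
        next
          case False
          then have "x \<le> a \<or> a + \<delta> \<le> x" by (auto simp: dist_real_def)
          then have "real n * (x - a) \<le> 0 \<or> 1 \<le> real n * (x - a)"
          proof
            assume "a + \<delta> \<le> x"
            then have "real n * \<delta> \<le> real n * (x - a)" using n0 by (intro mult_left_mono) auto
            then show ?thesis using n by linarith
          qed (use n0 in \<open>auto intro!: mult_nonneg_nonpos\<close>)
          then show ?thesis by (simp add: tent_zero)
        qed
      qed (rule integrable_norm[OF kdi], use ki in simp)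
      also have "\<dots> = e / 2" using k1 by simp
      also have "\<dots> < e" using e by simp
      finally show "norm ((\<integral>x. ?k x *\<^sub>R y x \<partial>?T) - y a) < e" .
    qed
  qed
  have diff: "y b - y a = ?I b - ?I a" if ab: "0 < a" "a < b" "b < S" for a b
  proof -
    define \<phi> where "\<phi> n x = step_fun (real n * (x - a)) - step_fun (real n * (x - b))" for n x
    define \<phi>' where "\<phi>' n x = real n * tent (real n * (x - a)) - real n * tent (real n * (x - b))" for n x
    have step_der: "((\<lambda>x. step_fun (real n * (x - c))) has_real_derivative real n * tent (real n * (x - c))) (at x)" for n c x
    proof -
      have "((\<lambda>x. real n * (x - c)) has_real_derivative real n) (at x)" by (auto intro!: derivative_eq_intros)
      from DERIV_chain2[OF step_fun_has_derivative this] show ?thesis by (simp add: mult.commute)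
    qed
    have der: "(\<phi> n has_real_derivative \<phi>' n x) (at x)" for n x
      unfolding \<phi>_def \<phi>'_def by (intro DERIV_diff step_der)
    have tc: "continuous_on A (\<lambda>x. real n * tent (real n * (x - c)))" for A n c
      by (intro continuous_intros continuous_on_compose2[OF tent_continuous[of UNIV]]) auto
    \<comment> \<open>The step at \<open>b\<close> ends at \<open>b + 1 / n\<close>. For these
      \<open>n\<close> that is before the midpoint of \<open>b\<close> and \<open>S\<close>, so the
      test function has compact support in the open interval.\<close>
    obtain N :: nat where N: "1 / ((S - b) / 2) < real N" using reals_Archimedean2 by blast
    have test: "C1c_test S (\<phi> n) (\<phi>' n)" if "N \<le> n" for n
      unfolding C1c_test_def
    proof (intro conjI allI der)
      show "continuous_on UNIV (\<phi>' n)" unfolding \<phi>'_def by (intro continuous_on_diff tc)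
      have n1: "1 / ((S - b) / 2) < real n" using N that by linarith
      have n2: "1 < real n * ((S - b) / 2)" using n1 ab by (simp add: field_simps)
      show "\<exists>a b. 0 < a \<and> b < S \<and> (\<forall>x. x \<notin> {a..b} \<longrightarrow> \<phi> n x = 0)"
      proof (intro exI conjI allI impI)
        show "0 < a" by fact
        show "b + (S - b) / 2 < S" using ab by (simp add: field_simps)
        fix x assume x: "x \<notin> {a..b + (S - b) / 2}"
        show "\<phi> n x = 0"
        proof (cases "x < a")
          case True
          then have "real n * (x - a) \<le> 0" "real n * (x - b) \<le> 0" using ab by (auto intro!: mult_nonneg_nonpos)
          then show ?thesis by (simp add: \<phi>_def step_fun_0)
        next
          case False
          then have "b + (S - b) / 2 < x" using x by simp
          then have "(S - b) / 2 \<le> x - b" "(S - b) / 2 \<le> x - a" using ab by linarith+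
          then have "real n * ((S - b) / 2) \<le> real n * (x - b)" "real n * ((S - b) / 2) \<le> real n * (x - a)"
            by (auto intro: mult_left_mono simp del: times_divide_eq_right)
          then have "1 \<le> real n * (x - b)" "1 \<le> real n * (x - a)" using n2 by linarith+
          then show ?thesis by (simp add: \<phi>_def step_fun_1)
        qed
      qed
    qed
    have eq: "(\<integral>s. \<phi>' n s *\<^sub>R y s \<partial>?T) = - (\<integral>s. \<phi> n s *\<^sub>R d s \<partial>?T)" if "N \<le> n" for n
      using W test[OF that] unfolding W1inf_def by blast
    have ki: "integrable ?T (\<lambda>x. (real n * tent (real n * (x - c))) *\<^sub>R y x)" for n c
      by (rule continuous_imp_integrable_real) (intro continuous_on_scaleR tc yc)
    have "(\<lambda>n. (\<integral>x. (real n * tent (real n * (x - a))) *\<^sub>R y x \<partial>?T) - (\<integral>x. (real n * tent (real n * (x - b))) *\<^sub>R y x \<partial>?T)) \<longlonglongrightarrow> y a - y b"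
      using ab by (intro tendsto_diff weight_lim) auto
    then have 1: "(\<lambda>n. \<integral>s. \<phi>' n s *\<^sub>R y s \<partial>?T) \<longlonglongrightarrow> y a - y b"
      unfolding \<phi>'_def scaleR_diff_left by (simp only: Bochner_Integration.integral_diff[OF ki ki])
    have 2: "(\<lambda>n. \<integral>s. \<phi> n s *\<^sub>R d s \<partial>?T) \<longlonglongrightarrow> (\<integral>s. indicator {a<..b} s *\<^sub>R d s \<partial>?T)"
    proof (rule integral_dominated_convergence[where w = "\<lambda>s. norm (d s)"])
      have [measurable]: "\<phi> n \<in> borel_measurable ?T" for n
        by (rule continuous_imp_measurable_on_sets_lebesgue)
          (use der in \<open>auto intro!: continuous_at_imp_continuous_on DERIV_isCont\<close>)
      show "(\<lambda>s. \<phi> n s *\<^sub>R d s) \<in> borel_measurable ?T" for n by measurable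
      show "(\<lambda>s. indicator {a<..b} s *\<^sub>R d s) \<in> borel_measurable ?T"
        using indicator_integrable[OF dm M(1), of "{a<..b}"] by auto
      show "integrable ?T (\<lambda>s. norm (d s))" using bounded_integrable[OF dm M(1)] by simp
      have step_lim: "(\<lambda>n. step_fun (real n * (s - c))) \<longlonglongrightarrow> (if c < s then 1 else 0)" for s c
      proof (cases "c < s")
        case True
        obtain N :: nat where N: "1 / (s - c) < real N" using reals_Archimedean2 by blast
        have "\<forall>\<^sub>F n in sequentially. step_fun (real n * (s - c)) = 1"
          using eventually_ge_at_top[of N]
        proof eventually_elim
          case (elim n)
          then have "1 / (s - c) < real n" using N by linarith
          then have "1 < real n * (s - c)" using True by (simp add: field_simps)
          then show ?case by (simp add: step_fun_1)
        qed
        then show ?thesis using True by (simp add: tendsto_eventually)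
      next
        case False
        then have "step_fun (real n * (s - c)) = 0" for n by (intro step_fun_0 mult_nonneg_nonpos) auto
        then show ?thesis using False by simp
      qed
      show "AE s in ?T. (\<lambda>n. \<phi> n s *\<^sub>R d s) \<longlonglongrightarrow> indicator {a<..b} s *\<^sub>R d s"
      proof (rule AE_I2)
        fix s
        have "(\<lambda>n. \<phi> n s *\<^sub>R d s) \<longlonglongrightarrow> ((if a < s then 1 else 0) - (if b < s then 1 else 0)) *\<^sub>R d s"
          unfolding \<phi>_def by (intro tendsto_intros step_lim)
        also have "(if a < s then 1 else 0) - (if b < s then 1 else 0) = (indicator {a<..b} s :: real)"
          using ab by (auto simp: indicator_def)
        finally show "(\<lambda>n. \<phi> n s *\<^sub>R d s) \<longlonglongrightarrow> indicator {a<..b} s *\<^sub>R d s" .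
      qed
      show "AE s in ?T. norm (\<phi> n s *\<^sub>R d s) \<le> norm (d s)" for n
      proof (rule AE_I2)
        fix s
        have "\<bar>\<phi> n s\<bar> \<le> 1" using step_fun_range[of "real n * (s - a)"] step_fun_range[of "real n * (s - b)"]
          unfolding \<phi>_def by linarith
        then show "norm (\<phi> n s *\<^sub>R d s) \<le> norm (d s)" by (simp add: mult_left_le_one_le)
      qed
    qed
    have "(\<lambda>n. \<integral>s. \<phi>' n s *\<^sub>R y s \<partial>?T) \<longlonglongrightarrow> - (\<integral>s. indicator {a<..b} s *\<^sub>R d s \<partial>?T)"
    proof (rule Lim_transform_eventually[OF tendsto_minus[OF 2]])
      show "\<forall>\<^sub>F n in sequentially. - (\<integral>s. \<phi> n s *\<^sub>R d s \<partial>?T) = (\<integral>s. \<phi>' n s *\<^sub>R y s \<partial>?T)"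
        using eventually_ge_at_top[of N] by eventually_elim (simp add: eq)
    qed
    from LIMSEQ_unique[OF 1 this] have "y b - y a = (\<integral>s. indicator {a<..b} s *\<^sub>R d s \<partial>?T)"
      by (simp add: algebra_simps)
    then show ?thesis using indefinite_integral_diff[OF dm M(1), of a b] ab by simp
  qed
  \<comment> \<open>\<open>y - ?I\<close> is constant in the interior; the midpoint
    \<open>S/2\<close> serves as a reference point and the closure brings in 0 and
    \<open>S\<close>.\<close>
  have const: "y x - ?I x = y (S/2) - ?I (S/2)" if x: "x \<in> {0<..<S}" for x
  proof -
    consider "x < S/2" | "x = S/2" | "S/2 < x" by linarith
    then show ?thesis
      using diff[of x "S/2"] diff[of "S/2" x] x S by cases (auto simp: algebra_simps)
  qed
  have cl: "closure {0<..<S} = {0..S}" using S by simp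
  have all: "y x - ?I x = y (S/2) - ?I (S/2)" if "x \<in> {0..S}" for x
  proof (rule continuous_constant_on_closure[where S = "{0<..<S}" and f = "\<lambda>x. y x - ?I x"])
    show "continuous_on (closure {0<..<S}) (\<lambda>x. y x - ?I x)" unfolding cl by (intro continuous_on_diff yc contI)
    show "x \<in> closure {0<..<S}" unfolding cl by (rule that)
    show "y x - ?I x = y (S/2) - ?I (S/2)" if "x \<in> {0<..<S}" for x using that by (rule const)
  qed
  have "?I 0 = 0"
  proof -
    have "?I 0 = (\<integral>\<sigma>. 0 \<partial>?T)"
    proof (rule integral_cong_AE)
      show "(\<lambda>\<sigma>. indicator {0..0} \<sigma> *\<^sub>R d \<sigma>) \<in> borel_measurable ?T"
        using indicator_integrable[OF dm M(1), of "{0..0}"] by auto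
      have "AE s in ?T. s \<noteq> 0" by (rule AE_lebesgue_on_neq) simp
      then show "AE \<sigma> in ?T. indicator {0..0} \<sigma> *\<^sub>R d \<sigma> = 0" by eventually_elim simp
    qed simp
    then show ?thesis by simp
  qed
  moreover have "y s - ?I s = y 0 - ?I 0" using all[OF s] all[of 0] S by simp
  ultimately show ?thesis by (metis add.commute diff_eq_eq diff_zero)
qed

text \<open>Picard iteration. It is applied to the single control \<open>(1, 0)\<close>, to show
  that admissible triples exist.\<close>

lemma ode_solution_exists:
  fixes F :: "real \<Rightarrow> 'a::euclidean_space \<Rightarrow> 'a"
  assumes T: "0 \<le> T" and cont: "continuous_on ({0..T} \<times> UNIV) (\<lambda>(t, y). F t y)"
    and lip: "\<And>t y z. t \<in> {0..T} \<Longrightarrow> norm (F t y - F t z) \<le> L * norm (y - z)"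
  obtains y where "continuous_on {0..T} y"
    "\<And>s. s \<in> {0..T} \<Longrightarrow> y s = y0 + integral {0..s} (\<lambda>\<sigma>. F \<sigma> (y \<sigma>))"
proof -
  \<comment> \<open>\<open>L\<close> may be 0 or negative, and the uniform estimate at the end
    divides by the constant.\<close>
  define l where "l = max 1 L"
  have l: "1 \<le> l" "\<And>t y z. t \<in> {0..T} \<Longrightarrow> norm (F t y - F t z) \<le> l * norm (y - z)"
    by (simp add: l_def, rule order_trans[OF lip mult_right_mono]) (auto simp: l_def)
  define Y where "Y n = rec_nat (\<lambda>s. y0) (\<lambda>_ y s. y0 + integral {0..s} (\<lambda>\<sigma>. F \<sigma> (y \<sigma>))) n" for n
  have Y0: "Y 0 s = y0" and YS: "Y (Suc n) s = y0 + integral {0..s} (\<lambda>\<sigma>. F \<sigma> (Y n \<sigma>))" for n s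
    by (simp_all add: Y_def)
  have contF: "continuous_on {0..T} (\<lambda>\<sigma>. F \<sigma> (y \<sigma>))" if "continuous_on {0..T} y" for y
  proof -
    have "continuous_on {0..T} (\<lambda>\<sigma>. (\<sigma>, y \<sigma>))" using that by (intro continuous_intros)
    from continuous_on_compose2[OF cont this] show ?thesis by (simp add: image_subset_iff)
  qed
  have Yc: "continuous_on {0..T} (Y n)" for n
  proof (induction n)
    case (Suc n)
    have "continuous_on {0..T} (\<lambda>s. y0 + integral {0..s} (\<lambda>\<sigma>. F \<sigma> (Y n \<sigma>)))"
      using contF[OF Suc] by (intro continuous_intros indefinite_integral_continuous_1 integrable_continuous_interval)
    then show ?case by (simp add: YS)
  qed (simp add: Y0)
  have int: "(\<lambda>\<sigma>. F \<sigma> (y \<sigma>)) integrable_on {0..s}" if "continuous_on {0..T} y" "s \<in> {0..T}" for y s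
    by (rule integrable_continuous_interval[OF continuous_on_subset[OF contF[OF that(1)]]]) (use that(2) in auto)
  obtain D where D: "0 \<le> D" "\<And>s. s \<in> {0..T} \<Longrightarrow> norm (Y 1 s - Y 0 s) \<le> D"
    by (rule compact_continuous_bound[OF compact_Icc continuous_on_diff[OF Yc Yc]]) (rule that)
  \<comment> \<open>In the norm weighted by \<open>exp (- 2 * l * s)\<close> each Picard step halves the error.\<close>
  have step: "norm (Y (Suc n) s - Y n s) \<le> D / 2 ^ n * exp (2 * l * s)" if "s \<in> {0..T}" for n s
    using that
  proof (induction n arbitrary: s)
    case 0
    have "D * 1 \<le> D * exp (2 * l * s)" using D l 0 by (intro mult_left_mono) auto
    then show ?case using D(2)[OF 0] by simp
  next
    case (Suc n)
    let ?g = "\<lambda>\<sigma>. l * (D / 2 ^ n * exp (2 * l * \<sigma>))"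
    have gint: "(?g has_integral D / 2 ^ Suc n * exp (2 * l * s) - D / 2 ^ Suc n * exp (2 * l * 0)) {0..s}"
    proof (rule fundamental_theorem_of_calculus)
      show "0 \<le> s" using Suc.prems by simp
      fix x assume "x \<in> {0..s}"
      show "((\<lambda>s. D / 2 ^ Suc n * exp (2 * l * s)) has_vector_derivative ?g x) (at x within {0..s})"
        unfolding has_real_derivative_iff_has_vector_derivative[symmetric]
        by (auto intro!: derivative_eq_intros)
    qed
    have "Y (Suc (Suc n)) s - Y (Suc n) s = integral {0..s} (\<lambda>\<sigma>. F \<sigma> (Y (Suc n) \<sigma>) - F \<sigma> (Y n \<sigma>))"
      unfolding YS[of "Suc n"] using YS[of n s] int[OF Yc Suc.prems]
      by (subst Henstock_Kurzweil_Integration.integral_diff) auto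
    also have "norm \<dots> \<le> integral {0..s} ?g"
    proof (rule integral_norm_bound_integral)
      show "(\<lambda>\<sigma>. F \<sigma> (Y (Suc n) \<sigma>) - F \<sigma> (Y n \<sigma>)) integrable_on {0..s}"
        using int[OF Yc Suc.prems] by (intro integrable_diff)
      show "?g integrable_on {0..s}" using gint by blast
      fix x assume "x \<in> {0..s}"
      then have x: "x \<in> {0..T}" using Suc.prems by auto
      have "norm (F x (Y (Suc n) x) - F x (Y n x)) \<le> l * norm (Y (Suc n) x - Y n x)" by (rule l(2)[OF x])
      also have "\<dots> \<le> ?g x" using Suc.IH[OF x] l(1) by (intro mult_left_mono) auto
      finally show "norm (F x (Y (Suc n) x) - F x (Y n x)) \<le> ?g x" .
    qed
    also have "\<dots> \<le> D / 2 ^ Suc n * exp (2 * l * s)"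
      using integral_unique[OF gint] D(1) by simp
    finally show ?case .
  qed
  have "\<exists>y. uniform_limit {0..T} Y y sequentially"
  proof -
    have z: "uniform_limit {0..T} (\<lambda>n s. \<Sum>i<n. (Y (Suc i) s - Y i s)) (\<lambda>s. \<Sum>i. (Y (Suc i) s - Y i s)) sequentially"
    proof (rule Weierstrass_m_test)
      show "norm (Y (Suc n) s - Y n s) \<le> (D * exp (2 * l * T)) * (1 / 2) ^ n" if "s \<in> {0..T}" for n s
      proof -
        have "norm (Y (Suc n) s - Y n s) \<le> D / 2 ^ n * exp (2 * l * s)" by (rule step[OF that])
        also have "\<dots> \<le> D / 2 ^ n * exp (2 * l * T)" using D l that by (intro mult_left_mono) auto
        finally show ?thesis by (simp add: power_divide field_simps)
      qed
      show "summable (\<lambda>n. (D * exp (2 * l * T)) * (1 / 2) ^ n)" by (intro summable_mult summable_geometric) simp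
    qed
    let ?z = "\<lambda>s. \<Sum>i. (Y (Suc i) s - Y i s)"
    have "(\<Sum>i<n. (Y (Suc i) s - Y i s)) = Y n s - y0" for n s
      by (subst sum_lessThan_telescope) (simp add: Y0)
    with z have "uniform_limit {0..T} (\<lambda>n s. Y n s - y0) ?z sequentially" by simp
    then have "uniform_limit {0..T} (\<lambda>n s. (Y n s - y0) + y0) (\<lambda>s. ?z s + y0) sequentially"
      by (rule uniform_limit_add) (rule uniform_limit_const)
    then have "uniform_limit {0..T} Y (\<lambda>s. ?z s + y0) sequentially" by simp
    then show ?thesis by blast
  qed
  then obtain y where y: "uniform_limit {0..T} Y y sequentially" by blast
  have yc: "continuous_on {0..T} y"
    by (rule uniform_limit_theorem[OF _ y]) (auto intro: always_eventually Yc)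
  show thesis
  proof (rule that[OF yc])
    fix s assume s: "s \<in> {0..T}"
    have "uniform_limit {0..T} (\<lambda>n \<sigma>. F \<sigma> (Y n \<sigma>)) (\<lambda>\<sigma>. F \<sigma> (y \<sigma>)) sequentially"
    proof (rule uniform_limitI)
      fix e :: real assume "0 < e"
      then have "0 < e / l" using l by simp
      from uniform_limitD[OF y this] show "\<forall>\<^sub>F n in sequentially. \<forall>x\<in>{0..T}. dist (F x (Y n x)) (F x (y x)) < e"
      proof eventually_elim
        case (elim n)
        show ?case
        proof
          fix x assume x: "x \<in> {0..T}"
          have "dist (F x (Y n x)) (F x (y x)) \<le> l * dist (Y n x) (y x)" unfolding dist_norm by (rule l(2)[OF x])
          also have "\<dots> < e" using elim x l by (simp add: field_simps)
          finally show "dist (F x (Y n x)) (F x (y x)) < e" .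
        qed
      qed
    qed
    then have "uniform_limit {0..s} (\<lambda>n \<sigma>. F \<sigma> (Y n \<sigma>)) (\<lambda>\<sigma>. F \<sigma> (y \<sigma>)) sequentially"
      by (rule uniform_limit_on_subset) (use s in auto)
    moreover have "continuous_on {0..s} (\<lambda>\<sigma>. F \<sigma> (Y n \<sigma>))" for n
      by (rule continuous_on_subset[OF contF[OF Yc]]) (use s in auto)
    ultimately obtain I J where IJ: "\<And>n. ((\<lambda>\<sigma>. F \<sigma> (Y n \<sigma>)) has_integral I n) {0..s}"
      "((\<lambda>\<sigma>. F \<sigma> (y \<sigma>)) has_integral J) {0..s}" "I \<longlonglongrightarrow> J"
      by (rule uniform_limit_integral) auto
    then have "(\<lambda>n. Y (Suc n) s) \<longlonglongrightarrow> y0 + integral {0..s} (\<lambda>\<sigma>. F \<sigma> (y \<sigma>))"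
      unfolding YS integral_unique[OF IJ(1)] integral_unique[OF IJ(2)] by (intro tendsto_intros)
    moreover have "(\<lambda>n. Y (Suc n) s) \<longlonglongrightarrow> y s"
      using tendsto_uniform_limitI[OF y s] by (rule LIMSEQ_Suc)
    ultimately show "y s = y0 + integral {0..s} (\<lambda>\<sigma>. F \<sigma> (y \<sigma>))" by (metis LIMSEQ_unique)
  qed
qed

section \<open>The relaxed control system\<close>

context
  fixes K :: "'c::euclidean_space set" and S :: real and N :: "(real \<times> 'c) measure"
  assumes S: "0 < S" and N: "spacetime S K N"
begin

interpretation N: finite_measure N by (rule spacetime_finite[OF N less_imp_le[OF S]])

lemma spacetime_cut_integrable:
  fixes f :: "real \<times> 'c \<Rightarrow> 'd::{banach, second_countable_topology}"
  assumes "integrable N f" "A \<in> sets borel"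
  shows "integrable N (\<lambda>p. indicator A (fst p) *\<^sub>R f p)"
proof (rule Bochner_Integration.integrable_bound[OF assms(1)])
  have [measurable]: "fst \<in> borel_measurable N" by (rule spacetime_fst[OF N])
  have [measurable]: "f \<in> borel_measurable N" using assms by auto
  have "(\<lambda>p. indicator A (fst p) :: real) \<in> borel_measurable N" using assms(2) by measurable
  then show "(\<lambda>p. indicator A (fst p) *\<^sub>R f p) \<in> borel_measurable N" by measurable
qed (auto simp: indicator_def)

lemma spacetime_cut_diff:
  fixes f :: "real \<times> 'c \<Rightarrow> 'd::{banach, second_countable_topology}"
  assumes f: "integrable N f" and ab: "a \<le> b"
  shows "(\<integral>p. indicator {..b} (fst p) *\<^sub>R f p \<partial>N) - (\<integral>p. indicator {..a} (fst p) *\<^sub>R f p \<partial>N)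
    = (\<integral>p. indicator {a<..b} (fst p) *\<^sub>R f p \<partial>N)"
proof -
  have "(\<integral>p. indicator {..b} (fst p) *\<^sub>R f p \<partial>N) - (\<integral>p. indicator {..a} (fst p) *\<^sub>R f p \<partial>N)
    = (\<integral>p. indicator {..b} (fst p) *\<^sub>R f p - indicator {..a} (fst p) *\<^sub>R f p \<partial>N)"
    by (rule Bochner_Integration.integral_diff[symmetric]) (intro spacetime_cut_integrable[OF f]; simp)+
  also have "\<dots> = (\<integral>p. indicator {a<..b} (fst p) *\<^sub>R f p \<partial>N)"
    using ab by (intro Bochner_Integration.integral_cong) (auto simp: indicator_def)
  finally show ?thesis .
qed

lemma spacetime_cut_norm_bound:
  fixes f :: "real \<times> 'c \<Rightarrow> 'd::{banach, second_countable_topology}"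
  assumes f: "integrable N f" and g: "integrable N g" and le: "\<And>p. p \<in> {0..S} \<times> K \<Longrightarrow> norm (f p) \<le> g p" and ab: "a \<le> b"
  shows "norm ((\<integral>p. indicator {..b} (fst p) *\<^sub>R f p \<partial>N) - (\<integral>p. indicator {..a} (fst p) *\<^sub>R f p \<partial>N))
    \<le> (\<integral>p. indicator {..b} (fst p) *\<^sub>R g p \<partial>N) - (\<integral>p. indicator {..a} (fst p) *\<^sub>R g p \<partial>N)"
  unfolding spacetime_cut_diff[OF f ab] spacetime_cut_diff[OF g ab]
proof (rule order_trans[OF integral_norm_bound integral_mono_AE])
  show "integrable N (\<lambda>p. norm (indicator {a<..b} (fst p) *\<^sub>R f p))" by (rule integrable_norm, rule spacetime_cut_integrable[OF f]) simp
  show "integrable N (\<lambda>p. indicator {a<..b} (fst p) *\<^sub>R g p)" by (rule spacetime_cut_integrable[OF g]) simp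
  show "AE p in N. norm (indicator {a<..b} (fst p) *\<^sub>R f p) \<le> indicator {a<..b} (fst p) *\<^sub>R g p"
    by (rule AE_I2) (use le in \<open>auto simp: spacetime_space[OF N] indicator_def\<close>)
qed

lemma spacetime_cut_const:
  assumes "0 \<le> a" "a \<le> b" "b \<le> S"
  shows "(\<integral>p. indicator {..b} (fst p) *\<^sub>R k \<partial>N) - (\<integral>p. indicator {..a} (fst p) *\<^sub>R k \<partial>N) = k * (b - a)"
proof -
  have [measurable]: "fst \<in> borel_measurable N" by (rule spacetime_fst[OF N])
  have "(\<integral>p. indicator {..b} (fst p) *\<^sub>R k \<partial>N) - (\<integral>p. indicator {..a} (fst p) *\<^sub>R k \<partial>N)
    = (\<integral>p. indicator {a<..b} (fst p) *\<^sub>R k \<partial>N)" by (rule spacetime_cut_diff) (use assms in auto)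
  also have "\<dots> = (\<integral>p. k * indicator {p\<in>space N. a < fst p \<and> fst p \<le> b} p \<partial>N)"
    by (rule Bochner_Integration.integral_cong) (auto simp: indicator_def)
  also have "\<dots> = k * measure N {p\<in>space N. a < fst p \<and> fst p \<le> b}"
    by (subst integral_mult_right_zero) (simp add: Int_absorb2 subset_eq)
  also have "\<dots> = k * (b - a)" using spacetime_interval(2)[OF N less_imp_le[OF S] assms] by simp
  finally show ?thesis .
qed

lemma spacetime_cut_0: 
  fixes f :: "real \<times> 'c \<Rightarrow> 'd::{banach, second_countable_topology}"
  assumes "s \<le> 0"
  shows "(\<integral>p. indicator {..s} (fst p) *\<^sub>R f p \<partial>N) = 0"
proof -
  have [measurable]: "fst \<in> borel_measurable N" by (rule spacetime_fst[OF N])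
  have "measure N {p\<in>space N. fst p \<le> s} = 0" using spacetime_interval(4)[OF N less_imp_le[OF S], of s] assms S by simp
  then have "{p\<in>space N. fst p \<le> s} \<in> null_sets N"
    by (auto simp: null_sets_def N.emeasure_eq_measure)
  from AE_not_in[OF this] AE_space have ae: "AE p in N. \<not> fst p \<le> s"
    by eventually_elim auto
  show ?thesis by (rule integral_eq_zero_AE) (use ae in \<open>auto elim!: eventually_mono\<close>)
qed

end

section \<open>The control problem in abstract form\<close>

abbreviation control_box :: "(real \<times> 'u::euclidean_space) set" where
  "control_box \<equiv> {0..1} \<times> cball 0 1"

text \<open>The sum is chosen because its two parts are controlled separately: \<open>v\<close> has
  integral \<open>T\<close> and \<open>norm u\<close> is bounded by the cost. It also dominates both
  coordinates, so nonnegative \<open>v\<close> and size at most 1 put a control into the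
  box.\<close>

definition ctrl_size :: "real \<times> 'u::real_normed_vector \<Rightarrow> real" where
  "ctrl_size x = fst x + norm (snd x)"

text \<open>\<open>Fp\<close> stands for the integrand made nonnegative, which allows
  \<open>ennreal\<close> and free use of monotone convergence. Semicontinuity is required in the
  control only and not at the origin; \<open>Fp_equicont\<close>, uniform in the control, takes care
  of \<open>t\<close> and \<open>y\<close>.\<close>

locale relaxed_control =
  fixes T :: real and y0 :: "'b::euclidean_space"
    and Ap :: "real \<Rightarrow> 'b \<Rightarrow> real \<times> 'u::euclidean_space \<Rightarrow> 'b"
    and Fp :: "real \<Rightarrow> 'b \<Rightarrow> real \<times> 'u \<Rightarrow> ennreal"
    and C c :: real
  assumes T_pos: "0 < T" and C_nonneg: "0 \<le> C" and c_pos: "0 < c"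
    and Ap_cont: "continuous_on ({0..T} \<times> UNIV \<times> control_box) (\<lambda>(t, y, x). Ap t y x)"
    and Ap_bound: "\<And>t y x. t \<in> {0..T} \<Longrightarrow> x \<in> control_box \<Longrightarrow> norm (Ap t y x) \<le> C * ctrl_size x"
    and Ap_homog: "\<And>t y x l. t \<in> {0..T} \<Longrightarrow> x \<in> control_box \<Longrightarrow> 0 < l \<Longrightarrow> l *\<^sub>R x \<in> control_box \<Longrightarrow> Ap t y (l *\<^sub>R x) = l *\<^sub>R Ap t y x"
    and Fp_homog: "\<And>t y x l. t \<in> {0..T} \<Longrightarrow> x \<in> control_box \<Longrightarrow> 0 < l \<Longrightarrow> l *\<^sub>R x \<in> control_box \<Longrightarrow> Fp t y (l *\<^sub>R x) = ennreal l * Fp t y x"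
    and Fp_coercive: "\<And>t y x. t \<in> {0..T} \<Longrightarrow> x \<in> control_box \<Longrightarrow> ennreal (c * norm (snd x)) \<le> Fp t y x"
    and Fp_equicont: "\<And>t y \<epsilon>. t \<in> {0..T} \<Longrightarrow> 0 < \<epsilon> \<Longrightarrow> \<exists>\<delta>>0. \<forall>t'\<in>{0..T}. \<forall>y'. dist (t', y') (t, y) < \<delta> \<longrightarrow>
        (\<forall>x\<in>control_box. Fp t' y' x \<le> Fp t y x + ennreal \<epsilon> \<and> Fp t y x \<le> Fp t' y' x + ennreal \<epsilon>)"
    and Fp_lsc: "\<And>t y x a. t \<in> {0..T} \<Longrightarrow> x \<in> control_box \<Longrightarrow> x \<noteq> 0 \<Longrightarrow> a < Fp t y x \<Longrightarrow>
        \<exists>\<delta>>0. \<forall>x'\<in>control_box. dist x' x < \<delta> \<longrightarrow> a < Fp t y x'"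
begin

lemma ctrl_size_cont: "continuous_on A ctrl_size"
  unfolding ctrl_size_def[abs_def] by (intro continuous_intros)

lemma ctrl_size_bounds: "x \<in> control_box \<Longrightarrow> 0 \<le> ctrl_size x \<and> ctrl_size x \<le> 2"
  by (auto simp: ctrl_size_def)

lemma ctrl_size_eq_0: "x \<in> control_box \<Longrightarrow> ctrl_size x = 0 \<longleftrightarrow> x = 0"
  by (cases x) (auto simp: ctrl_size_def zero_prod_def add_nonneg_eq_0_iff)

lemma fst_le_ctrl_size: "x \<in> control_box \<Longrightarrow> norm (fst x) \<le> ctrl_size x"
  by (auto simp: ctrl_size_def)

lemma compact_box: "compact control_box"
  by (intro compact_Times) auto

text \<open>The initial values are implicit, as the time 0 carries no mass. The control set
  \<open>K\<close> is a parameter because trajectories start on the whole box and are moved to a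
  part of it that avoids the origin.\<close>

definition sol :: "(real \<times> 'u) set \<Rightarrow> real \<Rightarrow> (real \<times> real \<times> 'u) measure \<Rightarrow> (real \<Rightarrow> real) \<Rightarrow> (real \<Rightarrow> 'b) \<Rightarrow> bool" where
  "sol K S N t y \<longleftrightarrow> 0 < S \<and> spacetime S K N \<and> continuous_on {0..S} t \<and> continuous_on {0..S} y \<and>
     t ` {0..S} \<subseteq> {0..T} \<and> t S = T \<and>
     (\<forall>s\<in>{0..S}. t s = (\<integral>p. indicator {..s} (fst p) *\<^sub>R fst (snd p) \<partial>N)) \<and>
     (\<forall>s\<in>{0..S}. y s = y0 + (\<integral>p. indicator {..s} (fst p) *\<^sub>R Ap (t (fst p)) (y (fst p)) (snd p) \<partial>N))"

definition cost :: "(real \<times> real \<times> 'u) measure \<Rightarrow> (real \<Rightarrow> real) \<Rightarrow> (real \<Rightarrow> 'b) \<Rightarrow> ennreal" where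
  "cost N t y = (\<integral>\<^sup>+p. Fp (t (fst p)) (y (fst p)) (snd p) \<partial>N)"

lemma Ap_along_cont:
  fixes S :: real
  assumes "continuous_on {0..S} t" "continuous_on {0..S} y" "t ` {0..S} \<subseteq> {0..T}" "K \<subseteq> control_box"
  shows "continuous_on ({0..S} \<times> K) (\<lambda>p. Ap (t (fst p)) (y (fst p)) (snd p))"
proof -
  have "continuous_on ({0..S} \<times> K) (\<lambda>p. (t (fst p), y (fst p), snd p))"
    by (intro continuous_intros continuous_on_compose2[OF assms(1)] continuous_on_compose2[OF assms(2)]) auto
  from continuous_on_compose2[OF Ap_cont this] show ?thesis using assms(3,4) by (auto simp: image_subset_iff)
qed

text \<open>A value \<open>b\<close> strictly between \<open>a\<close> and \<open>Fp\<close> leaves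
  room for two perturbations: semicontinuity keeps \<open>Fp\<close> above \<open>b\<close> when the
  control moves, and equicontinuity loses at most \<open>b - a\<close> when clock and state
  move.\<close>

lemma joint_lsc:
  fixes S :: real
  assumes t: "continuous_on {0..S} t" "t ` {0..S} \<subseteq> {0..T}" and y: "continuous_on {0..S} y" and K: "K \<subseteq> control_box"
    and lsc: "\<And>t y x a. t \<in> {0..T} \<Longrightarrow> x \<in> K \<Longrightarrow> a < Fp t y x \<Longrightarrow> \<exists>\<delta>>0. \<forall>x'\<in>K. dist x' x < \<delta> \<longrightarrow> a < Fp t y x'"
    and p: "p \<in> {0..S} \<times> K" and a: "a < Fp (t (fst p)) (y (fst p)) (snd p)"
  shows "\<exists>\<delta>>0. \<forall>q\<in>{0..S} \<times> K. dist q p < \<delta> \<longrightarrow> a < Fp (t (fst q)) (y (fst q)) (snd q)"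
proof -
  obtain s x where sx: "p = (s, x)" "s \<in> {0..S}" "x \<in> K" using p by auto
  have ts: "t s \<in> {0..T}" using t(2) sx(2) by blast
  have a': "a < Fp (t s) (y s) x" using a sx by simp
  then obtain b where b: "a < b" "b < Fp (t s) (y s) x" using dense by blast
  obtain ra where ra: "a = ennreal ra" "0 \<le> ra" using b by (cases a) auto
  obtain rb where rb: "b = ennreal rb" "0 \<le> rb" using b by (cases b) auto
  have rab: "ra < rb" using b ra rb by (simp add: ennreal_less_iff)
  define \<epsilon> where "\<epsilon> = rb - ra"
  have \<epsilon>: "0 < \<epsilon>" using rab by (simp add: \<epsilon>_def)
  obtain \<delta>1 where \<delta>1: "\<delta>1 > 0" "\<And>x'. x' \<in> K \<Longrightarrow> dist x' x < \<delta>1 \<Longrightarrow> b < Fp (t s) (y s) x'"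
    using lsc[OF ts sx(3) b(2)] by blast
  obtain \<delta>2 where \<delta>2: "\<delta>2 > 0" "\<And>t' y' x. t' \<in> {0..T} \<Longrightarrow> dist (t', y') (t s, y s) < \<delta>2 \<Longrightarrow> x \<in> control_box \<Longrightarrow>
      Fp (t s) (y s) x \<le> Fp t' y' x + ennreal \<epsilon>"
    using Fp_equicont[OF ts \<epsilon>, of "y s"] by blast
  have "continuous_on {0..S} (\<lambda>s. (t s, y s))" using t y by (intro continuous_intros)
  then obtain \<delta>3 where \<delta>3: "\<delta>3 > 0" "\<And>s'. s' \<in> {0..S} \<Longrightarrow> dist s' s < \<delta>3 \<Longrightarrow> dist (t s', y s') (t s, y s) < \<delta>2"
    using \<delta>2(1) sx(2) unfolding continuous_on_iff by blast
  show ?thesis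
  proof (intro exI[of _ "min \<delta>1 \<delta>3"] conjI ballI impI)
    show "0 < min \<delta>1 \<delta>3" using \<delta>1 \<delta>3 by simp
    fix q assume q: "q \<in> {0..S} \<times> K" "dist q p < min \<delta>1 \<delta>3"
    obtain s' x' where q': "q = (s', x')" "s' \<in> {0..S}" "x' \<in> K" using q by auto
    have "dist s' s \<le> dist q p" "dist x' x \<le> dist q p"
      using dist_fst_le[of q p] dist_snd_le[of q p] by (simp_all add: q' sx)
    then have d: "dist s' s < \<delta>3" "dist x' x < \<delta>1" using q by auto
    have "t s' \<in> {0..T}" using t(2) q'(2) by blast
    then have "Fp (t s) (y s) x' \<le> Fp (t s') (y s') x' + ennreal \<epsilon>"
      using \<delta>2(2) \<delta>3(2)[OF q'(2) d(1)] q' K by blast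
    with \<delta>1(2)[OF q'(3) d(2)] have "b < Fp (t s') (y s') x' + ennreal \<epsilon>" by (rule less_le_trans)
    moreover have "b = a + ennreal \<epsilon>" using ra rb rab by (simp add: \<epsilon>_def ennreal_plus[symmetric] del: ennreal_plus)
    ultimately have "a + ennreal \<epsilon> < Fp (t s') (y s') x' + ennreal \<epsilon>" by simp
    then have "a < Fp (t s') (y s') x'" by (metis add_right_mono not_less)
    then show "a < Fp (t (fst q)) (y (fst q)) (snd q)" by (simp add: q')
  qed
qed

text \<open>A lower semicontinuous function is a countable supremum of continuous ones.\<close>

lemma Fp_along_measurable_aux:
  fixes S :: real
  assumes t: "continuous_on {0..S} t" "t ` {0..S} \<subseteq> {0..T}" and y: "continuous_on {0..S} y" and K: "K \<subseteq> control_box"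
    and lsc: "\<And>t y x a. t \<in> {0..T} \<Longrightarrow> x \<in> K \<Longrightarrow> a < Fp t y x \<Longrightarrow> \<exists>\<delta>>0. \<forall>x'\<in>K. dist x' x < \<delta> \<longrightarrow> a < Fp t y x'"
  shows "(\<lambda>p. Fp (t (fst p)) (y (fst p)) (snd p)) \<in> borel_measurable (restrict_space borel ({0..S} \<times> K))"
proof -
  let ?h = "\<lambda>p. Fp (t (fst p)) (y (fst p)) (snd p)"
  obtain k :: "nat \<Rightarrow> real \<times> real \<times> 'u \<Rightarrow> real" where k: "\<And>n. continuous_on ({0..S} \<times> K) (k n)"
    and ksup: "\<And>p. p \<in> {0..S} \<times> K \<Longrightarrow> (SUP n. ennreal (k n p)) = ?h p"
  proof (rule continuous_approx_of_lsc[of "{0..S} \<times> K" ?h])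
    show "\<exists>\<delta>>0. \<forall>q\<in>{0..S} \<times> K. dist q p < \<delta> \<longrightarrow> a < ?h q" if "p \<in> {0..S} \<times> K" "a < ?h p" for p a
      by (rule joint_lsc[OF t y K lsc that])
  qed (rule that)
  have [measurable]: "k n \<in> borel_measurable (restrict_space borel ({0..S} \<times> K))" for n
    by (rule borel_measurable_continuous_on_restrict[OF k])
  have "(\<lambda>p. SUP n. ennreal (k n p)) \<in> borel_measurable (restrict_space borel ({0..S} \<times> K))" by measurable
  then show ?thesis
    by (rule measurable_cong[THEN iffD1, rotated]) (auto simp: space_restrict_space ksup)
qed

lemma Fp_lsc_subset:
  assumes "K \<subseteq> control_box - {0}" "t \<in> {0..T}" "x \<in> K" "a < Fp t y x"
  shows "\<exists>\<delta>>0. \<forall>x'\<in>K. dist x' x < \<delta> \<longrightarrow> a < Fp t y x'"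
proof -
  have "x \<in> control_box" "x \<noteq> 0" using assms by auto
  from Fp_lsc[OF assms(2) this assms(4)] show ?thesis using assms(1) by (meson DiffD1 subsetD)
qed

text \<open>Semicontinuity may fail at the origin, so the control 0 is split off. On that single
  control, semicontinuity in the control is trivial.\<close>

lemma Fp_along_measurable:
  fixes S :: real
  assumes t: "continuous_on {0..S} t" "t ` {0..S} \<subseteq> {0..T}" and y: "continuous_on {0..S} y"
    and K: "K \<subseteq> control_box" "K \<in> sets borel"
  shows "(\<lambda>p. Fp (t (fst p)) (y (fst p)) (snd p)) \<in> borel_measurable (restrict_space borel ({0..S} \<times> K))"
proof -
  let ?h = "\<lambda>p. Fp (t (fst p)) (y (fst p)) (snd p)"
  let ?D = "\<lambda>K :: (real \<times> 'u) set. {0..S} \<times> K"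
  have D: "A \<in> sets borel \<Longrightarrow> ?D A \<in> sets borel" for A
    by (subst borel_prod[symmetric]) (rule pair_measureI, auto)
  have part: "(\<lambda>p. ?h p * indicator (?D A) p) \<in> borel_measurable borel"
    if "A \<in> sets borel" "?h \<in> borel_measurable (restrict_space borel (?D A))" for A
    using that D by (subst borel_measurable_restrict_space_iff_ennreal[symmetric]) auto
  have 1: "?h \<in> borel_measurable (restrict_space borel (?D (K - {0})))"
  proof (rule Fp_along_measurable_aux[OF t y])
    show "K - {0} \<subseteq> control_box" using K by auto
    show "\<exists>\<delta>>0. \<forall>x'\<in>K - {0}. dist x' x < \<delta> \<longrightarrow> a < Fp t y x'"
      if "t \<in> {0..T}" "x \<in> K - {0}" "a < Fp t y x" for t y x a
      by (rule Fp_lsc_subset[OF _ that]) (use K in auto)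
  qed
  have 2: "?h \<in> borel_measurable (restrict_space borel (?D (K \<inter> {0})))"
  proof (rule Fp_along_measurable_aux[OF t y])
    show "K \<inter> {0} \<subseteq> control_box" using K by auto
    show "\<exists>\<delta>>0. \<forall>x'\<in>K \<inter> {0}. dist x' x < \<delta> \<longrightarrow> a < Fp t y x'" if "x \<in> K \<inter> {0}" "a < Fp t y x" for t y x a
      using that by (intro exI[of _ 1]) auto
  qed
  have "(\<lambda>p. ?h p * indicator (?D (K - {0})) p + ?h p * indicator (?D (K \<inter> {0})) p) \<in> borel_measurable borel"
    using part[OF _ 1] part[OF _ 2] K(2) by (intro borel_measurable_add) auto
  also have "(\<lambda>p. ?h p * indicator (?D (K - {0})) p + ?h p * indicator (?D (K \<inter> {0})) p) = (\<lambda>p. ?h p * indicator (?D K) p)"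
    by (auto simp: indicator_def fun_eq_iff)
  finally show ?thesis using D[OF K(2)] by (subst borel_measurable_restrict_space_iff_ennreal) auto
qed

end

section \<open>Reparametrisation\<close>

context relaxed_control begin

definition outer_box :: "real \<Rightarrow> (real \<times> 'u) set" where
  "outer_box \<delta> = {x \<in> control_box. \<delta> \<le> ctrl_size x}"

lemma compact_outer_box: "compact (outer_box \<delta>)"
proof -
  have "closed {x :: real \<times> 'u. \<delta> \<le> ctrl_size x}"
    by (intro closed_Collect_le continuous_on_const ctrl_size_cont)
  moreover have "outer_box \<delta> = control_box \<inter> {x. \<delta> \<le> ctrl_size x}" by (auto simp: outer_box_def)
  ultimately show ?thesis using compact_Int_closed[OF compact_box] by simp
qed

lemma outer_box_subset: "outer_box \<delta> \<subseteq> control_box" and outer_box_nonzero: "0 < \<delta> \<Longrightarrow> 0 \<notin> outer_box \<delta>"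
  by (auto simp: outer_box_def ctrl_size_def)

lemma Ap_zero: "t \<in> {0..T} \<Longrightarrow> Ap t y 0 = 0"
  using Ap_bound[of t 0 y] by (simp add: ctrl_size_def zero_prod_def[symmetric]) (simp add: zero_prod_def ctrl_size_def)

text \<open>\<open>R\<close> plays the role of arc length: it dominates the increments of clock and
  state, so both stand still where \<open>R\<close> is constant. The constant 2 bounds
  \<open>ctrl_size\<close> on the box.\<close>

lemma sol_increments:
  assumes sol: "sol K S N t y" and K: "K \<subseteq> control_box" "compact K" and ab: "0 \<le> a" "a \<le> b" "b \<le> S"
  defines "R \<equiv> \<lambda>s. \<integral>p. indicator {..s} (fst p) *\<^sub>R ctrl_size (snd p) \<partial>N"
  shows "integrable N (\<lambda>p. ctrl_size (snd p))" "integrable N (\<lambda>p. fst (snd p))"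
    "integrable N (\<lambda>p. Ap (t (fst p)) (y (fst p)) (snd p))"
    "R b - R a \<le> 2 * (b - a)" "R a \<le> R b" "\<bar>t b - t a\<bar> \<le> R b - R a" "norm (y b - y a) \<le> C * (R b - R a)"
proof -
  have S: "0 < S" and N: "spacetime S K N" and t: "continuous_on {0..S} t" "t ` {0..S} \<subseteq> {0..T}"
    and y: "continuous_on {0..S} y"
    and teq: "\<And>s. s \<in> {0..S} \<Longrightarrow> t s = (\<integral>p. indicator {..s} (fst p) *\<^sub>R fst (snd p) \<partial>N)"
    and yeq: "\<And>s. s \<in> {0..S} \<Longrightarrow> y s = y0 + (\<integral>p. indicator {..s} (fst p) *\<^sub>R Ap (t (fst p)) (y (fst p)) (snd p) \<partial>N)"
    using sol by (auto simp: sol_def)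
  have S0: "0 \<le> S" using S by simp
  show g: "integrable N (\<lambda>p. ctrl_size (snd p))"
    by (rule spacetime_integrable[OF N S0 K(2)]) (intro continuous_on_compose2[OF ctrl_size_cont[of UNIV]] continuous_intros, simp)
  show f: "integrable N (\<lambda>p. fst (snd p))"
    by (rule spacetime_integrable[OF N S0 K(2)]) (intro continuous_intros)
  show A: "integrable N (\<lambda>p. Ap (t (fst p)) (y (fst p)) (snd p))"
    by (rule spacetime_integrable[OF N S0 K(2) Ap_along_cont[OF t(1) y t(2) K(1)]])
  have const: "integrable N (\<lambda>p. k)" for k :: real
    by (rule spacetime_integrable[OF N S0 K(2)]) (intro continuous_intros)
  have "norm (R b - R a) \<le> (\<integral>p. indicator {..b} (fst p) *\<^sub>R 2 \<partial>N) - (\<integral>p. indicator {..a} (fst p) *\<^sub>R 2 \<partial>N)"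
    unfolding R_def by (rule spacetime_cut_norm_bound[OF S N g const _ ab(2)]) (use K ctrl_size_bounds in fastforce)
  also have "\<dots> = 2 * (b - a)" by (rule spacetime_cut_const[OF S N ab])
  finally show "R b - R a \<le> 2 * (b - a)" by simp
  have "norm (t b - t a) \<le> R b - R a"
  proof -
    have e: "t b - t a = (\<integral>p. indicator {..b} (fst p) *\<^sub>R fst (snd p) \<partial>N) - (\<integral>p. indicator {..a} (fst p) *\<^sub>R fst (snd p) \<partial>N)"
      using teq[of a] teq[of b] ab by simp
    show ?thesis unfolding e R_def
      by (rule spacetime_cut_norm_bound[OF S N f g _ ab(2)]) (use K fst_le_ctrl_size in fastforce)
  qed
  then show "\<bar>t b - t a\<bar> \<le> R b - R a" by simp
  then show "R a \<le> R b" by linarith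
  have "norm (y b - y a) \<le> (\<integral>p. indicator {..b} (fst p) *\<^sub>R (C * ctrl_size (snd p)) \<partial>N) - (\<integral>p. indicator {..a} (fst p) *\<^sub>R (C * ctrl_size (snd p)) \<partial>N)"
  proof -
    have e: "y b - y a = (\<integral>p. indicator {..b} (fst p) *\<^sub>R Ap (t (fst p)) (y (fst p)) (snd p) \<partial>N) - (\<integral>p. indicator {..a} (fst p) *\<^sub>R Ap (t (fst p)) (y (fst p)) (snd p) \<partial>N)"
      using yeq[of a] yeq[of b] ab by simp
    show ?thesis unfolding e
    proof (rule spacetime_cut_norm_bound[OF S N A _ _ ab(2)])
      show "integrable N (\<lambda>p. C * ctrl_size (snd p))" using g by simp
      show "norm (Ap (t (fst p)) (y (fst p)) (snd p)) \<le> C * ctrl_size (snd p)" if "p \<in> {0..S} \<times> K" for p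
        using that t(2) K(1) by (intro Ap_bound) auto
    qed
  qed
  also have "\<dots> = C * (R b - R a)"
    unfolding R_def by (simp add: right_diff_distrib mult.left_commute[of _ C])
  finally show "norm (y b - y a) \<le> C * (R b - R a)" .
qed

text \<open>Reparametrisation: time is rescaled so that the ctrl_size of the control becomes constant.
  Time spent at the control 0, where neither state nor clock moves, is cut out.\<close>

lemma rescale:
  assumes sol: "sol control_box S N t y" and B: "(\<integral>p. ctrl_size (snd p) \<partial>N) \<le> B"
  obtains N' t' y' where "sol (outer_box (T / B)) B N' t' y'" "cost N' t' y' \<le> cost N t y" "y' B = y S"
proof -
  have S: "0 < S" and N: "spacetime S control_box N" and t: "continuous_on {0..S} t" "t ` {0..S} \<subseteq> {0..T}" "t S = T"
    and y: "continuous_on {0..S} y"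
    and teq: "\<And>s. s \<in> {0..S} \<Longrightarrow> t s = (\<integral>p. indicator {..s} (fst p) *\<^sub>R fst (snd p) \<partial>N)"
    and yeq: "\<And>s. s \<in> {0..S} \<Longrightarrow> y s = y0 + (\<integral>p. indicator {..s} (fst p) *\<^sub>R Ap (t (fst p)) (y (fst p)) (snd p) \<partial>N)"
    using sol by (auto simp: sol_def)
  have S0: "0 \<le> S" using S by simp
  interpret N: finite_measure N by (rule spacetime_finite[OF N S0])
  note sp = spacetime_space[OF N]
  define R where "R s = (\<integral>p. indicator {..s} (fst p) *\<^sub>R ctrl_size (snd p) \<partial>N)" for s
  define \<Lambda> where "\<Lambda> = (\<integral>p. ctrl_size (snd p) \<partial>N)"
  note inc = sol_increments[OF sol order_refl compact_box, folded R_def]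
  have gi: "integrable N (\<lambda>p. ctrl_size (snd p))" using inc(1)[of 0 0] S by simp
  have R0: "R 0 = 0" unfolding R_def by (rule spacetime_cut_0[OF S N]) simp
  have RS: "R S = \<Lambda>" unfolding R_def \<Lambda>_def
    by (rule Bochner_Integration.integral_cong) (auto simp: sp)
  have "t 0 = 0" using teq[of 0] S spacetime_cut_0[OF S N, of 0 "\<lambda>p. fst (snd p)"] by simp
  then have T\<Lambda>: "T \<le> \<Lambda>" using inc(6)[of 0 S] S t(3) R0 RS by simp
  \<comment> \<open>The constant size of the new control: the total \<open>\<Lambda>\<close> spread
    over an interval of length \<open>B\<close>. From \<open>\<Lambda> \<le> B\<close> follows
    \<open>r \<le> 1\<close>, which keeps the control in the box; from
    \<open>T \<le> \<Lambda>\<close> follows \<open>T / B \<le> r\<close>.\<close>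
  define r where "r = \<Lambda> / B"
  have B0: "0 < B" using T_pos T\<Lambda> B by (simp add: \<Lambda>_def)
  have r: "0 < r" "r \<le> 1" "T / B \<le> r"
    using T_pos T\<Lambda> B B0 by (auto simp: r_def \<Lambda>_def[symmetric] divide_right_mono)
  define \<sigma> where "\<sigma> s = R s / r" for s
  have \<sigma>0: "\<sigma> 0 = 0" and \<sigma>S: "\<sigma> S = B" using R0 RS T\<Lambda> T_pos B0 by (auto simp: \<sigma>_def r_def)
  have \<sigma>_mono: "\<sigma> a \<le> \<sigma> b" if "0 \<le> a" "a \<le> b" "b \<le> S" for a b
    using inc(5)[OF that] r by (simp add: \<sigma>_def divide_right_mono)
  have \<sigma>_cont: "continuous_on {0..S} \<sigma>"
  proof -
    have "2-lipschitz_on {0..S} R"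
    proof (rule lipschitz_onI)
      fix a b assume "a \<in> {0..S}" "b \<in> {0..S}"
      then show "dist (R a) (R b) \<le> 2 * dist a b"
        using inc(4,5)[of a b] inc(4,5)[of b a] by (cases "a \<le> b") (auto simp: dist_real_def)
    qed simp
    then have "continuous_on {0..S} R" by (rule lipschitz_on_continuous_on)
    then show ?thesis unfolding \<sigma>_def using r by (intro continuous_intros) auto
  qed
  \<comment> \<open>\<sigma> may have flat pieces. Its generalised inverse picks the last time with
    value at most \<tau>; the equivalence turns a cut in new time into a cut in old time.\<close>
  have ex: "\<exists>m\<in>{0..S}. \<sigma> m = \<tau> \<and> (\<forall>s\<in>{0..S}. \<sigma> s \<le> \<tau> \<longleftrightarrow> s \<le> m)" if \<tau>: "\<tau> \<in> {0..B}" for \<tau>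
  proof -
    let ?A = "{s \<in> {0..S}. \<sigma> s \<le> \<tau>}"
    have "?A = {0..S} \<inter> \<sigma> -` {..\<tau>}" by auto
    then have "closed ?A" using continuous_closed_preimage[OF \<sigma>_cont closed_atLeastAtMost closed_atMost] by simp
    moreover have "bounded ?A" by (rule bounded_subset[OF bounded_closed_interval[of 0 S]]) auto
    ultimately have "compact ?A" by (simp only: compact_eq_bounded_closed)
    moreover have "0 \<in> ?A" using S \<sigma>0 \<tau> by simp
    ultimately obtain m where m: "m \<in> ?A" "\<And>s. s \<in> ?A \<Longrightarrow> s \<le> m" using compact_attains_sup[of ?A] by blast
    obtain m' where m': "m \<le> m'" "m' \<le> S" "\<sigma> m' = \<tau>"
      using IVT'[of \<sigma> m \<tau> S] m \<tau> \<sigma>S continuous_on_subset[OF \<sigma>_cont, of "{m..S}"] by auto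
    have "m' \<in> ?A" using m' m by auto
    then have "m' = m" using m(2)[of m'] m'(1) by simp
    then have \<sigma>m: "\<sigma> m = \<tau>" using m'(3) by simp
    have mS: "m \<in> {0..S}" using m(1) by simp
    show ?thesis
    proof (intro bexI[OF _ mS] conjI ballI iffI)
      show "\<sigma> m = \<tau>" by (rule \<sigma>m)
      show "s \<le> m" if "s \<in> {0..S}" "\<sigma> s \<le> \<tau>" for s using that by (intro m(2)) simp
      show "\<sigma> s \<le> \<tau>" if "s \<in> {0..S}" "s \<le> m" for s using \<sigma>_mono[of s m] that mS \<sigma>m by simp
    qed
  qed
  have "\<forall>\<tau>\<in>{0..B}. \<exists>m. m \<in> {0..S} \<and> \<sigma> m = \<tau> \<and> (\<forall>s\<in>{0..S}. \<sigma> s \<le> \<tau> \<longleftrightarrow> s \<le> m)"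
    using ex by blast
  from bchoice[OF this] obtain h where
    "\<forall>\<tau>\<in>{0..B}. h \<tau> \<in> {0..S} \<and> \<sigma> (h \<tau>) = \<tau> \<and> (\<forall>s\<in>{0..S}. \<sigma> s \<le> \<tau> \<longleftrightarrow> s \<le> h \<tau>)" by blast
  then have h: "\<And>\<tau>. \<tau> \<in> {0..B} \<Longrightarrow> h \<tau> \<in> {0..S}" "\<And>\<tau>. \<tau> \<in> {0..B} \<Longrightarrow> \<sigma> (h \<tau>) = \<tau>"
    "\<And>\<tau> s. \<tau> \<in> {0..B} \<Longrightarrow> s \<in> {0..S} \<Longrightarrow> \<sigma> s \<le> \<tau> \<longleftrightarrow> s \<le> h \<tau>"
    by blast+
  have \<sigma>_in: "\<sigma> s \<in> {0..B}" if "s \<in> {0..S}" for s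
    using \<sigma>_mono[of 0 s] \<sigma>_mono[of s S] that \<sigma>0 \<sigma>S by auto
  have h_mono: "h a \<le> h b" if "a \<le> b" "a \<in> {0..B}" "b \<in> {0..B}" for a b
    using h(3)[of b "h a"] h(1,2)[of a] that by simp
  define t' where "t' \<tau> = t (h \<tau>)" for \<tau>
  define y' where "y' \<tau> = y (h \<tau>)" for \<tau>
  \<comment> \<open>\<open>h (\<sigma> s)\<close> may be later than \<open>s\<close>, but
    \<open>R\<close> has not grown in between, hence neither clock nor state has moved.\<close>
  have at_\<sigma>: "t' (\<sigma> s) = t s" "y' (\<sigma> s) = y s" if s: "s \<in> {0..S}" for s
  proof -
    note hs = h(1,2)[OF \<sigma>_in[OF s]]
    have le: "s \<le> h (\<sigma> s)" using h(3)[OF \<sigma>_in[OF s] s] by simp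
    have "R (h (\<sigma> s)) = R s" using hs(2) r by (simp add: \<sigma>_def)
    then show "t' (\<sigma> s) = t s" "y' (\<sigma> s) = y s"
      using inc(6,7)[of s "h (\<sigma> s)"] le hs s by (auto simp: t'_def y'_def)
  qed
  have R_h: "R (h \<tau>) = r * \<tau>" if "\<tau> \<in> {0..B}" for \<tau>
    using h(2)[OF that] r by (simp add: \<sigma>_def field_simps)
  have t'_lip: "\<bar>t' b - t' a\<bar> \<le> r * (b - a)" and y'_lip: "norm (y' b - y' a) \<le> C * r * (b - a)"
    if "a \<le> b" "a \<in> {0..B}" "b \<in> {0..B}" for a b
    using inc(6,7)[of "h a" "h b"] h(1)[OF that(2)] h(1)[OF that(3)] h_mono[OF that] R_h[OF that(2)] R_h[OF that(3)]
    by (auto simp: t'_def y'_def right_diff_distrib mult.assoc)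
  have t'_cont: "continuous_on {0..B} t'"
  proof (rule lipschitz_on_continuous_on)
    show "r-lipschitz_on {0..B} t'"
    proof (rule lipschitz_onI)
      fix a b assume "a \<in> {0..B}" "b \<in> {0..B}"
      then show "dist (t' a) (t' b) \<le> r * dist a b"
        using t'_lip[of a b] t'_lip[of b a] by (cases "a \<le> b") (auto simp: dist_real_def abs_minus_commute)
    qed (use r in simp)
  qed
  have y'_cont: "continuous_on {0..B} y'"
  proof (rule lipschitz_on_continuous_on)
    show "(C * r)-lipschitz_on {0..B} y'"
    proof (rule lipschitz_onI)
      fix a b assume "a \<in> {0..B}" "b \<in> {0..B}"
      then show "dist (y' a) (y' b) \<le> C * r * dist a b"
        using y'_lip[of a b] y'_lip[of b a] by (cases "a \<le> b") (auto simp: dist_real_def dist_norm norm_minus_commute)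
    qed (use r C_nonneg in simp)
  qed
  have hB: "h B = S" using h(1)[of B] h(3)[of B S] B0 S \<sigma>S by simp
  let ?K = "outer_box (T / B)"
  let ?D = "restrict_space borel ({0..B} \<times> ?K)"
  \<comment> \<open>The value \<open>(r, 0)\<close> at size 0 is an arbitrary point of the outer
    box: the density \<open>G\<close> gives such controls no weight.\<close>
  define rad where "rad x = (if ctrl_size x = 0 then (r, 0) else (r / ctrl_size x) *\<^sub>R x)" for x :: "real \<times> 'u"
  have rad_in: "rad x \<in> ?K" if x: "x \<in> control_box" for x
  proof (cases "ctrl_size x = 0")
    case True then show ?thesis using r by (auto simp: rad_def outer_box_def ctrl_size_def)
  next
    case False
    obtain v u where vu: "x = (v, u)" by (cases x)
    have v: "0 \<le> v" "v \<le> ctrl_size x" and u: "norm u \<le> ctrl_size x" using x by (auto simp: vu ctrl_size_def)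
    have g: "0 < ctrl_size x" using False ctrl_size_bounds[OF x] by simp
    define q where "q = r / ctrl_size x"
    have q: "0 < q" "q * ctrl_size x = r" using g r by (auto simp: q_def)
    have "q * v \<le> 1" "q * norm u \<le> 1"
      using mult_left_mono[OF v(2), of q] mult_left_mono[OF u, of q] q r by linarith+
    then have "q *\<^sub>R x \<in> control_box" using q v by (simp add: vu)
    moreover have "ctrl_size (q *\<^sub>R x) = q * ctrl_size x" using q by (simp add: ctrl_size_def distrib_left)
    ultimately show ?thesis using False q r by (simp add: rad_def outer_box_def q_def)
  qed
  define \<Psi> where "\<Psi> p = (\<sigma> (fst p), rad (snd p))" for p
  \<comment> \<open>The speed of new time relative to old time. By one-homogeneity it cancels the
    factor \<open>r / ctrl_size x\<close> in \<open>rad\<close>, and it vanishes at the control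
    0.\<close>
  define G where "G p = ctrl_size (snd p) / r" for p :: "real \<times> real \<times> 'u"
  have G0: "0 \<le> G p" if "p \<in> space N" for p
    using that r ctrl_size_bounds[of "snd p"] by (auto simp: sp G_def)
  have [measurable]: "snd \<in> borel_measurable N" by (rule spacetime_snd[OF N])
  have [measurable]: "ctrl_size \<in> borel_measurable (borel :: (real \<times> 'u) measure)"
    by (rule borel_measurable_continuous_onI) (rule ctrl_size_cont)
  have Gm[measurable]: "G \<in> borel_measurable N" unfolding G_def[abs_def] by measurable
  have Gi: "integrable N G" unfolding G_def[abs_def] using gi by simp
  have \<Psi>m: "\<Psi> \<in> measurable N ?D"
  proof (rule measurable_restrict_space2)
    show "\<Psi> \<in> space N \<rightarrow> {0..B} \<times> ?K" using \<sigma>_in rad_in unfolding \<Psi>_def sp by auto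
    have 1: "(\<lambda>p. \<sigma> (fst p)) \<in> borel_measurable N"
      by (rule spacetime_measurable_continuous[OF N]) (intro continuous_on_compose2[OF \<sigma>_cont] continuous_intros, auto)
    have "rad \<in> borel_measurable borel" unfolding rad_def[abs_def] by measurable
    then have 2: "(\<lambda>p. rad (snd p)) \<in> borel_measurable N" by measurable
    have "(\<lambda>p. (\<sigma> (fst p), rad (snd p))) \<in> measurable N (borel \<Otimes>\<^sub>M borel)" by (rule measurable_Pair[OF 1 2])
    then show "\<Psi> \<in> borel_measurable N" unfolding \<Psi>_def[abs_def] by (simp add: borel_prod)
  qed
  define N' where "N' = distr (density N (\<lambda>p. ennreal (G p))) ?D \<Psi>"
  have \<Psi>m': "\<Psi> \<in> measurable (density N (\<lambda>p. ennreal (G p))) ?D" using \<Psi>m by simp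
  have int': "(\<integral>q. f q \<partial>N') = (\<integral>p. G p *\<^sub>R f (\<Psi> p) \<partial>N)"
    if f: "f \<in> borel_measurable ?D" for f :: "real \<times> real \<times> 'u \<Rightarrow> 'd::{banach, second_countable_topology}"
  proof -
    have fm: "(\<lambda>p. f (\<Psi> p)) \<in> borel_measurable N" by (rule measurable_compose[OF \<Psi>m f])
    have "(\<integral>q. f q \<partial>N') = (\<integral>p. f (\<Psi> p) \<partial>density N (\<lambda>p. ennreal (G p)))"
      unfolding N'_def by (rule integral_distr[OF \<Psi>m' f])
    also have "\<dots> = (\<integral>p. G p *\<^sub>R f (\<Psi> p) \<partial>N)"
      by (rule integral_density[OF fm Gm]) (use G0 in \<open>auto intro: AE_I2\<close>)
    finally show ?thesis .
  qed
  have Rm: "(\<integral>p. indicator {..s} (fst p) *\<^sub>R G p \<partial>N) = R s / r" for s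
    unfolding R_def G_def by simp
  have spN': "spacetime B ?K N'"
    unfolding spacetime_def
  proof (intro conjI ballI)
    show "sets N' = sets ?D" by (simp add: N'_def)
    fix \<tau> assume \<tau>: "\<tau> \<in> {0..B}"
    have Kb: "?K \<in> sets borel" by (rule borel_compact[OF compact_outer_box])
    have D: "{0..\<tau>} \<times> ?K \<in> sets ?D"
    proof -
      have "{0..\<tau>} \<times> ?K \<in> sets borel" "{0..B} \<times> ?K \<in> sets borel"
        using Kb by (subst borel_prod[symmetric], intro pair_measureI, auto)+
      then show ?thesis using \<tau> by (auto simp: sets_restrict_space_iff)
    qed
    have [measurable]: "fst \<in> borel_measurable N" by (rule spacetime_fst[OF N])
    have pre: "\<Psi> -` ({0..\<tau>} \<times> ?K) \<inter> space N = {p \<in> space N. fst p \<le> h \<tau>}"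
      using \<sigma>_in rad_in h(3)[OF \<tau>] unfolding \<Psi>_def sp by auto
    have "emeasure N' ({0..\<tau>} \<times> ?K) = emeasure (density N (\<lambda>p. ennreal (G p))) {p \<in> space N. fst p \<le> h \<tau>}"
      unfolding N'_def by (subst emeasure_distr[OF \<Psi>m' D]) (simp add: pre)
    also have "\<dots> = (\<integral>\<^sup>+p. ennreal (G p) * indicator {p \<in> space N. fst p \<le> h \<tau>} p \<partial>N)"
      by (rule emeasure_density) measurable
    also have "\<dots> = (\<integral>\<^sup>+p. ennreal (indicator {..h \<tau>} (fst p) *\<^sub>R G p) \<partial>N)"
      by (rule nn_integral_cong) (auto simp: indicator_def)
    also have "\<dots> = ennreal (\<integral>p. indicator {..h \<tau>} (fst p) *\<^sub>R G p \<partial>N)"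
      by (rule nn_integral_eq_integral[OF spacetime_cut_integrable[OF S N Gi]]) (use G0 in \<open>auto intro!: AE_I2\<close>)
    also have "\<dots> = ennreal \<tau>" using Rm[of "h \<tau>"] R_h[OF \<tau>] r by simp
    finally show "emeasure N' ({0..\<tau>} \<times> ?K) = ennreal \<tau>" .
  qed
  have fstm: "(\<lambda>q. indicator {..\<tau>} (fst q) :: real) \<in> borel_measurable ?D" for \<tau> :: real
  proof -
    have [measurable]: "fst \<in> borel_measurable ?D"
      by (rule borel_measurable_continuous_on_restrict) (intro continuous_intros)
    show ?thesis by measurable
  qed
  have cut: "indicator {..\<tau>} (\<sigma> (fst p)) = (indicator {..h \<tau>} (fst p) :: real)" if "p \<in> space N" "\<tau> \<in> {0..B}" for p \<tau>
    using h(3)[OF that(2), of "fst p"] that(1) by (auto simp: sp indicator_def)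
  have zero: "x = 0" if "x \<in> control_box" "ctrl_size x = 0" for x :: "real \<times> 'u" using that ctrl_size_eq_0 by blast
  have t'_range: "t' ` {0..B} \<subseteq> {0..T}" using t(2) h(1) by (auto simp: t'_def)
  have sol': "sol ?K B N' t' y'"
    unfolding sol_def
  proof (intro conjI ballI)
    show "0 < B" "spacetime B ?K N'" "continuous_on {0..B} t'" "continuous_on {0..B} y'" "t' ` {0..B} \<subseteq> {0..T}" "t' B = T"
      using B0 spN' t'_cont y'_cont t'_range t(3) hB by (auto simp: t'_def)
    fix \<tau> assume \<tau>: "\<tau> \<in> {0..B}"
    have fm: "(\<lambda>q. indicator {..\<tau>} (fst q) *\<^sub>R fst (snd q)) \<in> borel_measurable ?D"
    proof -
      have [measurable]: "(\<lambda>q. fst (snd q)) \<in> borel_measurable ?D"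
        by (rule borel_measurable_continuous_on_restrict) (intro continuous_intros)
      show ?thesis using fstm by measurable
    qed
    have "t' \<tau> = (\<integral>p. indicator {..h \<tau>} (fst p) *\<^sub>R fst (snd p) \<partial>N)"
      unfolding t'_def by (rule teq[OF h(1)[OF \<tau>]])
    also have "\<dots> = (\<integral>p. G p *\<^sub>R (indicator {..\<tau>} (fst (\<Psi> p)) *\<^sub>R fst (snd (\<Psi> p))) \<partial>N)"
    proof (rule Bochner_Integration.integral_cong[OF refl])
      fix p assume p: "p \<in> space N"
      then have x: "snd p \<in> control_box" by (auto simp: sp)
      have "G p * fst (rad (snd p)) = fst (snd p)"
        using zero[OF x] r by (cases "ctrl_size (snd p) = 0") (auto simp: G_def rad_def)
      then show "indicator {..h \<tau>} (fst p) *\<^sub>R fst (snd p) = G p *\<^sub>R (indicator {..\<tau>} (fst (\<Psi> p)) *\<^sub>R fst (snd (\<Psi> p)))"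
        using cut[OF p \<tau>] by (simp add: \<Psi>_def mult.left_commute[of "G p"])
    qed
    also have "\<dots> = (\<integral>q. indicator {..\<tau>} (fst q) *\<^sub>R fst (snd q) \<partial>N')" by (rule int'[OF fm, symmetric])
    finally show "t' \<tau> = (\<integral>q. indicator {..\<tau>} (fst q) *\<^sub>R fst (snd q) \<partial>N')" .
    have am: "(\<lambda>q. indicator {..\<tau>} (fst q) *\<^sub>R Ap (t' (fst q)) (y' (fst q)) (snd q)) \<in> borel_measurable ?D"
    proof -
      have [measurable]: "(\<lambda>q. Ap (t' (fst q)) (y' (fst q)) (snd q)) \<in> borel_measurable ?D"
        by (rule borel_measurable_continuous_on_restrict[OF Ap_along_cont[OF t'_cont y'_cont t'_range outer_box_subset]])
      show ?thesis using fstm by measurable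
    qed
    have "y' \<tau> = y0 + (\<integral>p. indicator {..h \<tau>} (fst p) *\<^sub>R Ap (t (fst p)) (y (fst p)) (snd p) \<partial>N)"
      unfolding y'_def by (rule yeq[OF h(1)[OF \<tau>]])
    also have "(\<integral>p. indicator {..h \<tau>} (fst p) *\<^sub>R Ap (t (fst p)) (y (fst p)) (snd p) \<partial>N) =
      (\<integral>p. G p *\<^sub>R (indicator {..\<tau>} (fst (\<Psi> p)) *\<^sub>R Ap (t' (fst (\<Psi> p))) (y' (fst (\<Psi> p))) (snd (\<Psi> p))) \<partial>N)"
    proof (rule Bochner_Integration.integral_cong[OF refl])
      fix p assume p: "p \<in> space N"
      then have x: "snd p \<in> control_box" and s: "fst p \<in> {0..S}" by (auto simp: sp)
      have ts: "t (fst p) \<in> {0..T}" using t(2) s by blast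
      have "G p *\<^sub>R Ap (t (fst p)) (y (fst p)) (rad (snd p)) = Ap (t (fst p)) (y (fst p)) (snd p)"
      proof (cases "ctrl_size (snd p) = 0")
        case True
        then show ?thesis using zero[OF x] Ap_zero[OF ts] by (simp add: G_def)
      next
        case False
        then have g: "0 < ctrl_size (snd p)" using ctrl_size_bounds[OF x] by simp
        have "rad (snd p) \<in> control_box" using rad_in[OF x] outer_box_subset by blast
        then show ?thesis
          using Ap_homog[OF ts x, of "r / ctrl_size (snd p)" "y (fst p)"] g r by (simp add: rad_def G_def)
      qed
      then show "indicator {..h \<tau>} (fst p) *\<^sub>R Ap (t (fst p)) (y (fst p)) (snd p) =
        G p *\<^sub>R (indicator {..\<tau>} (fst (\<Psi> p)) *\<^sub>R Ap (t' (fst (\<Psi> p))) (y' (fst (\<Psi> p))) (snd (\<Psi> p)))"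
        using cut[OF p \<tau>] at_\<sigma>[OF s] by (cases "fst p \<le> h \<tau>") (simp_all add: \<Psi>_def)
    qed
    also have "\<dots> = (\<integral>q. indicator {..\<tau>} (fst q) *\<^sub>R Ap (t' (fst q)) (y' (fst q)) (snd q) \<partial>N')"
      by (rule int'[OF am, symmetric])
    finally show "y' \<tau> = y0 + (\<integral>q. indicator {..\<tau>} (fst q) *\<^sub>R Ap (t' (fst q)) (y' (fst q)) (snd q) \<partial>N')" .
  qed
  have "cost N' t' y' \<le> cost N t y"
  proof -
    let ?h = "\<lambda>q. Fp (t' (fst q)) (y' (fst q)) (snd q)"
    have hm: "?h \<in> borel_measurable ?D"
      by (rule Fp_along_measurable[OF t'_cont t'_range y'_cont outer_box_subset borel_compact[OF compact_outer_box]])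
    have "cost N' t' y' = (\<integral>\<^sup>+p. ?h (\<Psi> p) \<partial>density N (\<lambda>p. ennreal (G p)))"
      unfolding cost_def N'_def by (rule nn_integral_distr[OF \<Psi>m']) (simp add: hm)
    also have "\<dots> = (\<integral>\<^sup>+p. ennreal (G p) * ?h (\<Psi> p) \<partial>N)"
      by (rule nn_integral_density) (use measurable_compose[OF \<Psi>m hm] in auto)
    \<comment> \<open>Equality holds away from the control 0. There the left side is 0 whatever the
      value of \<open>Fp\<close>, so the cost can only drop.\<close>
    also have "\<dots> \<le> (\<integral>\<^sup>+p. Fp (t (fst p)) (y (fst p)) (snd p) \<partial>N)"
    proof (rule nn_integral_mono)
      fix p assume p: "p \<in> space N"
      then have x: "snd p \<in> control_box" and s: "fst p \<in> {0..S}" by (auto simp: sp)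
      have ts: "t (fst p) \<in> {0..T}" using t(2) s by blast
      show "ennreal (G p) * ?h (\<Psi> p) \<le> Fp (t (fst p)) (y (fst p)) (snd p)"
      proof (cases "ctrl_size (snd p) = 0")
        case True
        then show ?thesis by (simp add: G_def)
      next
        case False
        then have g: "0 < ctrl_size (snd p)" using ctrl_size_bounds[OF x] by simp
        have "rad (snd p) \<in> control_box" using rad_in[OF x] outer_box_subset by blast
        then have "?h (\<Psi> p) = ennreal (r / ctrl_size (snd p)) * Fp (t (fst p)) (y (fst p)) (snd p)"
          using Fp_homog[OF ts x, of "r / ctrl_size (snd p)" "y (fst p)"] g r at_\<sigma>[OF s] by (simp add: rad_def \<Psi>_def)
        moreover have "ennreal (G p) * ennreal (r / ctrl_size (snd p)) = 1"
          using g r by (simp add: G_def ennreal_mult[symmetric])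
        ultimately show ?thesis by (simp add: mult.assoc[symmetric])
      qed
    qed
    finally show ?thesis by (simp add: cost_def)
  qed
  then show thesis using that[OF sol'] hB by (simp add: y'_def)
qed

end

section \<open>Closure of the set of trajectories\<close>

text \<open>A cut at time \<open>s\<close> is discontinuous and no admissible test for weak
  convergence. A linear ramp over \<open>[s, s + \<delta>]\<close> differs from it on a strip whose
  mass is at most \<delta>, because the time marginal is Lebesgue measure.\<close>

lemma spacetime_cut_smoothing:
  fixes \<Psi> :: "real \<times> 'c::euclidean_space \<Rightarrow> real"
  assumes N: "spacetime S K N" and S: "0 < S" and K: "compact K" and \<Psi>: "continuous_on ({0..S} \<times> K) \<Psi>"
    and B: "0 \<le> B" "\<And>p. p \<in> {0..S} \<times> K \<Longrightarrow> \<bar>\<Psi> p\<bar> \<le> B" and \<delta>: "0 < \<delta>"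
  shows "\<bar>(\<integral>p. indicator {..s} (fst p) * \<Psi> p \<partial>N) - (\<integral>p. max 0 (min 1 (1 - (fst p - s) / \<delta>)) * \<Psi> p \<partial>N)\<bar> \<le> B * \<delta>"
proof -
  interpret finite_measure N by (rule spacetime_finite[OF N less_imp_le[OF S]])
  note sp = spacetime_space[OF N]
  let ?a = "\<lambda>\<tau>. max 0 (min 1 (1 - (\<tau> - s) / \<delta>))"
  have [measurable]: "fst \<in> borel_measurable N" by (rule spacetime_fst[OF N])
  have i1: "integrable N \<Psi>" by (rule spacetime_integrable[OF N less_imp_le[OF S] K \<Psi>])
  have i2: "integrable N (\<lambda>p. indicator {..s} (fst p) * \<Psi> p)"
    using spacetime_cut_integrable[OF S N i1, of "{..s}"] by simp
  have i3: "integrable N (\<lambda>p. ?a (fst p) * \<Psi> p)"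
    by (rule spacetime_integrable[OF N less_imp_le[OF S] K]) (use \<delta> in \<open>intro continuous_intros \<Psi>; simp\<close>)
  have "\<bar>(\<integral>p. indicator {..s} (fst p) * \<Psi> p \<partial>N) - (\<integral>p. ?a (fst p) * \<Psi> p \<partial>N)\<bar>
      = \<bar>\<integral>p. indicator {..s} (fst p) * \<Psi> p - ?a (fst p) * \<Psi> p \<partial>N\<bar>"
    by (simp only: Bochner_Integration.integral_diff[OF i2 i3])
  also have "\<dots> \<le> (\<integral>p. \<bar>indicator {..s} (fst p) * \<Psi> p - ?a (fst p) * \<Psi> p\<bar> \<partial>N)" by (rule integral_abs_bound)
  also have "\<dots> \<le> (\<integral>p. B * indicator {p \<in> space N. s < fst p \<and> fst p \<le> s + \<delta>} p \<partial>N)"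
  proof (rule integral_mono)
    show "integrable N (\<lambda>p. \<bar>indicator {..s} (fst p) * \<Psi> p - ?a (fst p) * \<Psi> p\<bar>)" using i2 i3 by auto
    show "integrable N (\<lambda>p. B * indicator {p \<in> space N. s < fst p \<and> fst p \<le> s + \<delta>} p)"
      by (intro integrable_mult_right integrable_real_indicator) (auto simp: emeasure_eq_measure)
    fix p assume p: "p \<in> space N"
    consider "fst p \<le> s" | "s < fst p" "fst p \<le> s + \<delta>" | "s + \<delta> < fst p" by linarith
    then show "\<bar>indicator {..s} (fst p) * \<Psi> p - ?a (fst p) * \<Psi> p\<bar> \<le> B * indicator {p \<in> space N. s < fst p \<and> fst p \<le> s + \<delta>} p"
    proof cases
      case 1
      then have "?a (fst p) = 1" using \<delta> by (simp add: divide_nonpos_pos)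
      then show ?thesis using 1 B(1) by (simp add: indicator_def)
    next
      case 2
      have "\<bar>?a (fst p) * \<Psi> p\<bar> \<le> 1 * B" unfolding abs_mult using B(2)[of p] p by (intro mult_mono) (auto simp: sp)
      then show ?thesis using 2 p by (simp add: indicator_def)
    next
      case 3
      then have "1 \<le> (fst p - s) / \<delta>" using \<delta> by (simp add: field_simps)
      then have "?a (fst p) = 0" by simp
      then show ?thesis using 3 B(1) \<delta> by (simp add: indicator_def)
    qed
  qed
  also have "\<dots> = B * measure N {p \<in> space N. s < fst p \<and> fst p \<le> s + \<delta>}"
    by (subst integral_mult_right_zero) (simp add: Int_absorb2 subset_eq)
  also have "\<dots> \<le> B * \<delta>"
    using spacetime_interval(1)[OF N less_imp_le[OF S], of s "s + \<delta>"] \<delta> B(1) by (intro mult_left_mono) auto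
  finally show ?thesis .
qed

text \<open>The smoothing error depends only on the time marginal, which all these measures share;
  so it is uniform in \<open>j\<close>.\<close>

lemma spacetime_cut_tendsto_real:
  fixes \<Psi> :: "real \<times> 'c::euclidean_space \<Rightarrow> real"
  assumes N: "\<And>j. spacetime S K (N j)" and M: "spacetime S K M" and S: "0 < S" and K: "compact K"
    and weak: "\<And>\<phi> :: real \<times> 'c \<Rightarrow> real. continuous_on ({0..S} \<times> K) \<phi> \<Longrightarrow> (\<lambda>j. \<integral>p. \<phi> p \<partial>N j) \<longlonglongrightarrow> (\<integral>p. \<phi> p \<partial>M)"
    and \<Psi>: "continuous_on ({0..S} \<times> K) \<Psi>"
  shows "(\<lambda>j. \<integral>p. indicator {..s} (fst p) * \<Psi> p \<partial>N j) \<longlonglongrightarrow> (\<integral>p. indicator {..s} (fst p) * \<Psi> p \<partial>M)"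
proof (rule LIMSEQ_I)
  fix e :: real assume e: "0 < e"
  obtain B where B: "0 \<le> B" "\<And>p. p \<in> {0..S} \<times> K \<Longrightarrow> norm (\<Psi> p) \<le> B"
    by (rule compact_continuous_bound[OF compact_Times[OF compact_Icc K] \<Psi>]) (rule that)
  \<comment> \<open>One smoothing error for \<open>N j\<close>, one for \<open>M\<close> and one
    error from weak convergence, each at most \<open>e / 4\<close>. \<open>B + 1\<close> avoids a
    division by 0.\<close>
  define \<delta> where "\<delta> = (e / 4) / (B + 1)"
  have \<delta>: "0 < \<delta>" and \<delta>B: "B * \<delta> \<le> e / 4"
  proof -
    show "0 < \<delta>" using e B by (simp add: \<delta>_def)
    have "B + 1 \<noteq> 0" using B(1) by simp
    then have "(B + 1) * \<delta> = e / 4" unfolding \<delta>_def by (rule nonzero_mult_div_cancel_left[THEN trans[rotated]]) (simp only: times_divide_eq_right)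
    then show "B * \<delta> \<le> e / 4" using \<open>0 < \<delta>\<close> by (simp add: distrib_right)
  qed
  let ?a = "\<lambda>\<tau>. max 0 (min 1 (1 - (\<tau> - s) / \<delta>))"
  have B': "\<And>p. p \<in> {0..S} \<times> K \<Longrightarrow> \<bar>\<Psi> p\<bar> \<le> B" using B(2) by simp
  note est = spacetime_cut_smoothing[OF _ S K \<Psi> B(1) B' \<delta>]
  have "continuous_on ({0..S} \<times> K) (\<lambda>p. ?a (fst p) * \<Psi> p)"
    using \<delta> by (intro continuous_intros \<Psi>) simp
  from LIMSEQ_D[OF weak[OF this], of "e / 4"] e obtain n0 where
    n0: "\<And>j. j \<ge> n0 \<Longrightarrow> \<bar>(\<integral>p. ?a (fst p) * \<Psi> p \<partial>N j) - (\<integral>p. ?a (fst p) * \<Psi> p \<partial>M)\<bar> < e / 4" by auto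
  show "\<exists>no. \<forall>j\<ge>no. norm ((\<integral>p. indicator {..s} (fst p) * \<Psi> p \<partial>N j) - (\<integral>p. indicator {..s} (fst p) * \<Psi> p \<partial>M)) < e"
  proof (intro exI allI impI)
    fix j assume "n0 \<le> j"
    from n0[OF this] est[OF N[of j], of s] est[OF M, of s] \<delta>B e
    show "norm ((\<integral>p. indicator {..s} (fst p) * \<Psi> p \<partial>N j) - (\<integral>p. indicator {..s} (fst p) * \<Psi> p \<partial>M)) < e"
      unfolding real_norm_def by linarith
  qed
qed

lemma spacetime_cut_tendsto:
  fixes \<Psi> :: "real \<times> 'c::euclidean_space \<Rightarrow> 'd::euclidean_space"
  assumes N: "\<And>j. spacetime S K (N j)" and M: "spacetime S K M" and S: "0 < S" and K: "compact K"
    and weak: "\<And>\<phi> :: real \<times> 'c \<Rightarrow> real. continuous_on ({0..S} \<times> K) \<phi> \<Longrightarrow> (\<lambda>j. \<integral>p. \<phi> p \<partial>N j) \<longlonglongrightarrow> (\<integral>p. \<phi> p \<partial>M)"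
    and \<Psi>: "continuous_on ({0..S} \<times> K) \<Psi>"
  shows "(\<lambda>j. \<integral>p. indicator {..s} (fst p) *\<^sub>R \<Psi> p \<partial>N j) \<longlonglongrightarrow> (\<integral>p. indicator {..s} (fst p) *\<^sub>R \<Psi> p \<partial>M)"
proof (subst tendsto_componentwise_iff, intro ballI)
  fix i :: 'd assume "i \<in> Basis"
  have inner: "(\<integral>p. indicator {..s} (fst p) *\<^sub>R \<Psi> p \<partial>P) \<bullet> i = (\<integral>p. indicator {..s} (fst p) * (\<Psi> p \<bullet> i) \<partial>P)"
    if P: "spacetime S K P" for P
  proof -
    have "integrable P (\<lambda>p. indicator {..s} (fst p) *\<^sub>R \<Psi> p)"
      by (rule spacetime_cut_integrable[OF S P spacetime_integrable[OF P less_imp_le[OF S] K \<Psi>]]) simp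
    then show ?thesis by (subst integral_inner_left[symmetric]) auto
  qed
  have "continuous_on ({0..S} \<times> K) (\<lambda>p. \<Psi> p \<bullet> i)" by (intro continuous_intros \<Psi>)
  from spacetime_cut_tendsto_real[OF N M S K weak this]
  show "(\<lambda>j. (\<integral>p. indicator {..s} (fst p) *\<^sub>R \<Psi> p \<partial>N j) \<bullet> i) \<longlonglongrightarrow> (\<integral>p. indicator {..s} (fst p) *\<^sub>R \<Psi> p \<partial>M) \<bullet> i"
    by (simp only: inner[OF N] inner[OF M])
qed

context relaxed_control begin

text \<open>Equicontinuity is given point by point. The curve traced by clock and state is compact,
  so a Lebesgue number of its cover by the given balls works along the whole curve. The two points
  are compared through the centre of a ball, hence \<open>\<epsilon>/2\<close>.\<close>

lemma Fp_uniform: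
  fixes S :: real
  assumes t: "continuous_on {0..S} t" "t ` {0..S} \<subseteq> {0..T}" and y: "continuous_on {0..S} y" and \<epsilon>: "0 < \<epsilon>"
  obtains \<delta> where "0 < \<delta>" "\<And>s t1 y1 x. s \<in> {0..S} \<Longrightarrow> t1 \<in> {0..T} \<Longrightarrow> dist (t1, y1) (t s, y s) < \<delta> \<Longrightarrow> x \<in> control_box \<Longrightarrow>
    Fp (t s) (y s) x \<le> Fp t1 y1 x + ennreal \<epsilon>"
proof -
  let ?Q = "(\<lambda>s. (t s, y s)) ` {0..S}"
  have Q: "compact ?Q" by (rule compact_continuous_image) (intro continuous_intros t y, simp)
  have QT: "fst q \<in> {0..T}" if "q \<in> ?Q" for q using that t(2) by auto
  have ex: "\<exists>\<delta>>0. \<forall>t'\<in>{0..T}. \<forall>y'. dist (t', y') q < \<delta> \<longrightarrow>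
        (\<forall>x\<in>control_box. Fp t' y' x \<le> Fp (fst q) (snd q) x + ennreal (\<epsilon>/2) \<and> Fp (fst q) (snd q) x \<le> Fp t' y' x + ennreal (\<epsilon>/2))"
    if "q \<in> ?Q" for q
    using Fp_equicont[OF QT[OF that], of "\<epsilon>/2" "snd q"] \<epsilon> by simp
  have "\<forall>q\<in>?Q. \<exists>\<delta>. 0 < \<delta> \<and> (\<forall>t'\<in>{0..T}. \<forall>y'. dist (t', y') q < \<delta> \<longrightarrow>
        (\<forall>x\<in>control_box. Fp t' y' x \<le> Fp (fst q) (snd q) x + ennreal (\<epsilon>/2) \<and> Fp (fst q) (snd q) x \<le> Fp t' y' x + ennreal (\<epsilon>/2)))"
    using ex by (rule ballI)
  from bchoice[OF this] obtain d where d0: "\<forall>q\<in>?Q. 0 < d q \<and> (\<forall>t'\<in>{0..T}. \<forall>y'. dist (t', y') q < d q \<longrightarrow>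
        (\<forall>x\<in>control_box. Fp t' y' x \<le> Fp (fst q) (snd q) x + ennreal (\<epsilon>/2) \<and> Fp (fst q) (snd q) x \<le> Fp t' y' x + ennreal (\<epsilon>/2)))" ..
  have d: "0 < d q" if "q \<in> ?Q" for q using bspec[OF d0 that] by (rule conjunct1)
  have d': "Fp t' y' x \<le> Fp (fst q) (snd q) x + ennreal (\<epsilon>/2) \<and> Fp (fst q) (snd q) x \<le> Fp t' y' x + ennreal (\<epsilon>/2)"
    if "q \<in> ?Q" "t' \<in> {0..T}" "dist (t', y') q < d q" "x \<in> control_box" for q t' y' x
    using conjunct2[OF bspec[OF d0 that(1)]] that(2-4) by blast
  obtain e where e: "0 < e" "\<And>q. q \<in> ?Q \<Longrightarrow> \<exists>G\<in>(\<lambda>q. ball q (d q)) ` ?Q. ball q e \<subseteq> G"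
    by (rule Heine_Borel_lemma[OF Q, of "(\<lambda>q. ball q (d q)) ` ?Q"]) (use d in auto)
  show thesis
  proof (rule that[OF e(1)])
    fix s t1 y1 and x :: "real \<times> 'u" assume s: "s \<in> {0..S}" and t1: "t1 \<in> {0..T}" and dist: "dist (t1, y1) (t s, y s) < e" and x: "x \<in> control_box"
    obtain q where q: "q \<in> ?Q" "ball (t s, y s) e \<subseteq> ball q (d q)" using e(2)[of "(t s, y s)"] s by blast
    have 1: "dist (t1, y1) q < d q" using q(2) dist by (auto simp: subset_eq dist_commute)
    have "(t s, y s) \<in> ball (t s, y s) e" using e(1) by simp
    then have "(t s, y s) \<in> ball q (d q)" using q(2) by blast
    then have 2: "dist (t s, y s) q < d q" by (simp only: mem_ball dist_commute)
    have ts: "t s \<in> {0..T}" using t(2) s by blast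
    have "Fp (t s) (y s) x \<le> Fp (fst q) (snd q) x + ennreal (\<epsilon>/2)" using d'[OF q(1) ts 2 x] by blast
    also have "\<dots> \<le> (Fp t1 y1 x + ennreal (\<epsilon>/2)) + ennreal (\<epsilon>/2)"
      using d'[OF q(1) t1 1 x] by (intro add_right_mono) blast
    also have "\<dots> = Fp t1 y1 x + ennreal \<epsilon>"
      using \<epsilon> by (simp add: add.assoc ennreal_plus[symmetric] del: ennreal_plus)
    finally show "Fp (t s) (y s) x \<le> Fp t1 y1 x + ennreal \<epsilon>" .
  qed
qed

text \<open>Clocks and states are uniformly Lipschitz and converge uniformly along a subsequence,
  measures weakly along a further one. As \<open>0 \<notin> K\<close>, the integrand is lower
  semicontinuous on all of \<open>K\<close>. The last clause is lower semicontinuity of the cost,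
  phrased through eventual upper bounds, the form in which a minimising sequence supplies
  them.\<close>

lemma sol_compactness:
  assumes K: "K \<subseteq> control_box" "compact K" "x0 \<in> K" "0 \<notin> K" and B: "0 < B"
    and sol: "\<And>j. sol K B (N j) (t j) (y j)"
  obtains r :: "nat \<Rightarrow> nat" and X t' y' where "strict_mono r" "X \<in> borel_measurable (borel \<Otimes>\<^sub>M borel)" "\<And>z. X z \<in> K"
    "sol K B (law B K X) t' y'" "(\<lambda>j. y (r j) B) \<longlonglongrightarrow> y' B"
    "\<And>l. \<forall>\<^sub>F j in sequentially. cost (N (r j)) (t (r j)) (y (r j)) \<le> l \<Longrightarrow> cost (law B K X) t' y' \<le> l"
proof -
  have N: "\<And>j. spacetime B K (N j)" and tc: "\<And>j. continuous_on {0..B} (t j)" and yc: "\<And>j. continuous_on {0..B} (y j)"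
    and tr: "\<And>j. t j ` {0..B} \<subseteq> {0..T}" and tB: "\<And>j. t j B = T"
    and teq: "\<And>j s. s \<in> {0..B} \<Longrightarrow> t j s = (\<integral>p. indicator {..s} (fst p) *\<^sub>R fst (snd p) \<partial>N j)"
    and yeq: "\<And>j s. s \<in> {0..B} \<Longrightarrow> y j s = y0 + (\<integral>p. indicator {..s} (fst p) *\<^sub>R Ap (t j (fst p)) (y j (fst p)) (snd p) \<partial>N j)"
    using sol unfolding sol_def by blast+
  have B0: "0 \<le> B" using B by simp
  note inc = sol_increments[OF sol K(1,2)]
  have tl: "\<bar>t j b - t j a\<bar> \<le> 2 * (b - a)" and yl: "norm (y j b - y j a) \<le> C * (2 * (b - a))"
    if "0 \<le> a" "a \<le> b" "b \<le> B" for j a b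
    using inc(4,6)[OF that, of j] order_trans[OF inc(7)[OF that, of j] mult_left_mono[OF inc(4)[OF that, of j] C_nonneg]] by simp_all
  have y_0: "y j 0 = y0" for j using yeq[of 0 j] B spacetime_cut_0[OF B N[of j], of 0] by simp
  define M where "M = norm y0 + C * (2 * B)"
  have yM: "norm (y j s) \<le> M" if "s \<in> {0..B}" for j s
  proof -
    have "norm (y j s) \<le> norm (y j 0) + norm (y j s - y j 0)" by (metis norm_triangle_sub)
    also have "\<dots> \<le> norm y0 + C * (2 * (s - 0))" using yl[of 0 s j] that by (simp add: y_0)
    also have "\<dots> \<le> M" unfolding M_def using that C_nonneg by (intro add_left_mono mult_left_mono) auto
    finally show ?thesis .
  qed
  have tT: "\<bar>t j s\<bar> \<le> T" if "s \<in> {0..B}" for j s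
  proof -
    have "t j s \<in> {0..T}" using tr that by blast
    then show ?thesis by simp
  qed
  \<comment> \<open>Clock and state are paired so that one extraction serves both.\<close>
  define F where "F j s = (t j s, y j s)" for j s
  have F_lip: "norm (F j a - F j b) \<le> (2 + 2 * C) * \<bar>a - b\<bar>" if "a \<in> {0..B}" "b \<in> {0..B}" for j a b
  proof -
    have "norm (F j a - F j b) \<le> \<bar>t j a - t j b\<bar> + norm (y j a - y j b)"
      using norm_Pair_le[of "t j a - t j b" "y j a - y j b"] by (simp add: F_def)
    also have "\<dots> \<le> 2 * \<bar>a - b\<bar> + C * (2 * \<bar>a - b\<bar>)"
      using tl[of a b j] tl[of b a j] yl[of a b j] yl[of b a j] that
      by (cases "a \<le> b") (auto simp: abs_minus_commute norm_minus_commute intro!: add_mono)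
    finally show ?thesis by (simp add: algebra_simps)
  qed
  obtain G k where G: "continuous_on {0..B} G" and k: "strict_mono (k :: nat \<Rightarrow> nat)"
    and conv0: "\<And>e. 0 < e \<Longrightarrow> \<exists>N. \<forall>n x. n \<ge> N \<and> x \<in> {0..B} \<longrightarrow> norm (F (k n) x - G x) < e"
  proof (rule Arzela_Ascoli[of "{0..B}" F "T + M"])
    show "norm (F j s) \<le> T + M" if "s \<in> {0..B}" for j s
      using norm_Pair_le[of "t j s" "y j s"] tT[OF that, of j] yM[OF that, of j] by (simp add: F_def)
    show "\<exists>d>0. \<forall>n y. y \<in> {0..B} \<and> norm (x - y) < d \<longrightarrow> norm (F n x - F n y) < e" if "x \<in> {0..B}" "0 < e" for x e
    proof (intro exI[of _ "e / (2 + 2 * C)"] conjI allI impI)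
      show "0 < e / (2 + 2 * C)" using \<open>0 < e\<close> C_nonneg by simp
      fix n y assume "y \<in> {0..B} \<and> norm (x - y) < e / (2 + 2 * C)"
      then have "(2 + 2 * C) * \<bar>x - y\<bar> < e" using C_nonneg by (simp add: field_simps)
      with F_lip[OF that(1), of y n] show "norm (F n x - F n y) < e"
        using \<open>y \<in> {0..B} \<and> norm (x - y) < e / (2 + 2 * C)\<close> by simp
    qed
  qed (simp, rule that)
  obtain r0 :: "nat \<Rightarrow> nat" and X where r0: "strict_mono r0" and X: "X \<in> borel_measurable (borel \<Otimes>\<^sub>M borel)" "\<And>z. X z \<in> K"
    and weak: "\<And>\<phi> :: real \<times> real \<times> 'u \<Rightarrow> real. continuous_on ({0..B} \<times> K) \<phi> \<Longrightarrow>
       (\<lambda>j. \<integral>p. \<phi> p \<partial>N (k (r0 j))) \<longlonglongrightarrow> (\<integral>p. \<phi> p \<partial>law B K X)"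
    by (rule spacetime_compactness[where N = "\<lambda>j. N (k j)", OF K(2,3) B N]) (rule that)
  define r where "r = k \<circ> r0"
  have r: "strict_mono r" unfolding r_def by (rule strict_mono_o[OF k r0])
  have conv: "\<forall>\<^sub>F j in sequentially. \<forall>x\<in>{0..B}. dist (F (r j) x) (G x) < e" if e: "0 < e" for e
  proof -
    obtain N0 where "\<forall>n x. n \<ge> N0 \<and> x \<in> {0..B} \<longrightarrow> norm (F (k n) x - G x) < e" using conv0[OF e] by blast
    then have "\<forall>x\<in>{0..B}. dist (F (r j) x) (G x) < e" if "j \<ge> N0" for j
      using that seq_suble[OF r0, of j] by (auto simp: r_def dist_norm)
    then show ?thesis unfolding eventually_sequentially by blast
  qed
  define t' where "t' s = fst (G s)" for s
  define y' where "y' s = snd (G s)" for s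
  have G_eq: "G s = (t' s, y' s)" for s by (simp add: t'_def y'_def)
  have t'c: "continuous_on {0..B} t'" and y'c: "continuous_on {0..B} y'"
    unfolding t'_def y'_def by (intro continuous_intros G)+
  have ptG: "(\<lambda>j. F (r j) s) \<longlonglongrightarrow> G s" if "s \<in> {0..B}" for s
    unfolding tendsto_iff
  proof (intro allI impI)
    fix e :: real assume "0 < e"
    from conv[OF this] show "\<forall>\<^sub>F j in sequentially. dist (F (r j) s) (G s) < e"
      by eventually_elim (use that in blast)
  qed
  have pt: "(\<lambda>j. t (r j) s) \<longlonglongrightarrow> t' s" and py: "(\<lambda>j. y (r j) s) \<longlonglongrightarrow> y' s" if "s \<in> {0..B}" for s
    using tendsto_fst[OF ptG[OF that]] tendsto_snd[OF ptG[OF that]] by (simp_all add: F_def t'_def y'_def)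
  have t'r: "t' s \<in> {0..T}" if "s \<in> {0..B}" for s
    by (rule closed_sequentially[OF closed_atLeastAtMost _ pt[OF that]]) (use tr that in blast)
  have t'B: "t' B = T" using pt[of B] B by (simp add: tB LIMSEQ_const_iff)
  have y'M: "norm (y' s) \<le> M" if "s \<in> {0..B}" for s
    by (rule LIMSEQ_le_const2[OF tendsto_norm[OF py[OF that]]]) (use yM[OF that] in auto)
  have Xm: "X \<in> borel_measurable (lebesgue_on {0..B} \<Otimes>\<^sub>M unit_meas)" by (rule measurable_time_unit[OF X(1)])
  let ?L = "law B K X"
  have L: "spacetime B K ?L" by (rule spacetime_law[OF Xm X(2) borel_compact[OF K(2)]])
  have Nr: "spacetime B K (N (r j))" for j by (rule N)
  have weak': "(\<lambda>j. \<integral>p. \<phi> p \<partial>N (r j)) \<longlonglongrightarrow> (\<integral>p. \<phi> p \<partial>?L)"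
    if "continuous_on ({0..B} \<times> K) \<phi>" for \<phi> :: "real \<times> real \<times> 'u \<Rightarrow> real"
    using weak[OF that] by (simp add: r_def)
  have t'_range: "t' ` {0..B} \<subseteq> {0..T}" using t'r by blast
  let ?P = "\<lambda>p. Ap (t' (fst p)) (y' (fst p)) (snd p)"
  let ?Pj = "\<lambda>j p. Ap (t (r j) (fst p)) (y (r j) (fst p)) (snd p)"
  have Pc: "continuous_on ({0..B} \<times> K) ?P" by (rule Ap_along_cont[OF t'c y'c t'_range K(1)])
  have Pjc: "continuous_on ({0..B} \<times> K) (?Pj j)" for j by (rule Ap_along_cont[OF tc yc tr K(1)])
  \<comment> \<open>All states lie in the ball of radius \<open>M\<close>, so only the values of
    \<open>Ap\<close> on a compact set enter, where it is uniformly continuous.\<close>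
  have P_unif: "\<forall>\<^sub>F j in sequentially. \<forall>p\<in>{0..B} \<times> K. norm (?Pj j p - ?P p) \<le> e" if e: "0 < e" for e
  proof -
    let ?Q = "{0..T} \<times> cball (0::'b) M \<times> K"
    have "continuous_on ?Q (\<lambda>(t, y, x). Ap t y x)" by (rule continuous_on_subset[OF Ap_cont]) (use K(1) in auto)
    then have "uniformly_continuous_on ?Q (\<lambda>(t, y, x). Ap t y x)"
      by (rule compact_uniformly_continuous) (intro compact_Times K(2) compact_Icc compact_cball)
    then obtain \<delta> where \<delta>: "0 < \<delta>" "\<And>q q'. q \<in> ?Q \<Longrightarrow> q' \<in> ?Q \<Longrightarrow> dist q' q < \<delta> \<Longrightarrow>
        dist ((\<lambda>(t, y, x). Ap t y x) q') ((\<lambda>(t, y, x). Ap t y x) q) < e"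
      using e unfolding uniformly_continuous_on_def by metis
    from conv[OF \<delta>(1)] show ?thesis
    proof eventually_elim
      case (elim j)
      show ?case
      proof
        fix p assume p: "p \<in> {0..B} \<times> K"
        then obtain s x where sx: "p = (s, x)" "s \<in> {0..B}" "x \<in> K" by auto
        have d: "dist (t (r j) s, y (r j) s) (t' s, y' s) < \<delta>" using elim sx(2) by (simp add: F_def G_eq)
        have "dist (t (r j) s, y (r j) s, x) (t' s, y' s, x) = dist (t (r j) s, y (r j) s) (t' s, y' s)"
          by (simp add: dist_Pair_Pair)
        with d have "dist (t (r j) s, y (r j) s, x) (t' s, y' s, x) < \<delta>" by simp
        moreover have "t (r j) s \<in> {0..T}" using tr sx(2) by blast
        then have "(t (r j) s, y (r j) s, x) \<in> ?Q" "(t' s, y' s, x) \<in> ?Q"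
          using sx yM[OF sx(2)] t'r[OF sx(2)] y'M[OF sx(2)] by auto
        ultimately show "norm (?Pj j p - ?P p) \<le> e"
          using \<delta>(2)[of "(t' s, y' s, x)" "(t (r j) s, y (r j) s, x)"] by (simp add: sx dist_norm)
      qed
    qed
  qed
  have sol': "sol K B ?L t' y'"
    unfolding sol_def
  proof (intro conjI ballI)
    fix s assume s: "s \<in> {0..B}"
    have "continuous_on ({0..B} \<times> K) (\<lambda>p. fst (snd p))" by (intro continuous_intros)
    from spacetime_cut_tendsto[OF Nr L B K(2) weak' this, of s]
    have "(\<lambda>j. t (r j) s) \<longlonglongrightarrow> (\<integral>p. indicator {..s} (fst p) *\<^sub>R fst (snd p) \<partial>?L)"
      by (simp only: teq[OF s, symmetric])
    from LIMSEQ_unique[OF pt[OF s] this] show "t' s = (\<integral>p. indicator {..s} (fst p) *\<^sub>R fst (snd p) \<partial>?L)" .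
    have 1: "(\<lambda>j. \<integral>p. indicator {..s} (fst p) *\<^sub>R ?P p \<partial>N (r j)) \<longlonglongrightarrow> (\<integral>p. indicator {..s} (fst p) *\<^sub>R ?P p \<partial>?L)"
      by (rule spacetime_cut_tendsto[OF Nr L B K(2) weak' Pc])
    \<comment> \<open>Integrand and measure vary together. The change of the integrand is uniformly
      small and every measure has mass \<open>B\<close>; the fixed integrand was treated in
      \<open>1\<close>.\<close>
    have 2: "(\<lambda>j. (\<integral>p. indicator {..s} (fst p) *\<^sub>R ?Pj j p \<partial>N (r j)) - (\<integral>p. indicator {..s} (fst p) *\<^sub>R ?P p \<partial>N (r j))) \<longlonglongrightarrow> 0"
    proof (rule tendstoI)
      fix e :: real assume e: "0 < e"
      then have "0 < e / (B + 1)" using B by simp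
      from P_unif[OF this]
      show "\<forall>\<^sub>F j in sequentially. dist ((\<integral>p. indicator {..s} (fst p) *\<^sub>R ?Pj j p \<partial>N (r j)) - (\<integral>p. indicator {..s} (fst p) *\<^sub>R ?P p \<partial>N (r j))) 0 < e"
      proof eventually_elim
        case (elim j)
        interpret Nj: finite_measure "N (r j)" by (rule spacetime_finite[OF Nr B0])
        have i: "integrable (N (r j)) (\<lambda>p. indicator {..s} (fst p) *\<^sub>R ?Pj j p)" "integrable (N (r j)) (\<lambda>p. indicator {..s} (fst p) *\<^sub>R ?P p)"
          by (rule spacetime_cut_integrable[OF B Nr spacetime_integrable[OF Nr B0 K(2) Pjc]], simp)
            (rule spacetime_cut_integrable[OF B Nr spacetime_integrable[OF Nr B0 K(2) Pc]], simp)
        have "norm ((\<integral>p. indicator {..s} (fst p) *\<^sub>R ?Pj j p \<partial>N (r j)) - (\<integral>p. indicator {..s} (fst p) *\<^sub>R ?P p \<partial>N (r j)))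
          = norm (\<integral>p. indicator {..s} (fst p) *\<^sub>R ?Pj j p - indicator {..s} (fst p) *\<^sub>R ?P p \<partial>N (r j))"
          by (simp only: Bochner_Integration.integral_diff[OF i])
        also have "\<dots> \<le> (\<integral>p. e / (B + 1) \<partial>N (r j))"
        proof (rule order_trans[OF integral_norm_bound integral_mono])
          show "integrable (N (r j)) (\<lambda>p. norm (indicator {..s} (fst p) *\<^sub>R ?Pj j p - indicator {..s} (fst p) *\<^sub>R ?P p))"
            by (rule integrable_norm, rule Bochner_Integration.integrable_diff[OF i])
          fix p assume "p \<in> space (N (r j))"
          then have p: "p \<in> {0..B} \<times> K" using spacetime_space[OF Nr] by simp
          show "norm (indicator {..s} (fst p) *\<^sub>R ?Pj j p - indicator {..s} (fst p) *\<^sub>R ?P p) \<le> e / (B + 1)"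
            using bspec[OF elim p] \<open>0 < e / (B + 1)\<close> by (cases "fst p \<le> s") simp_all
        qed simp
        also have "\<dots> = e / (B + 1) * B" by (simp add: spacetime_finite(2)[OF Nr B0])
        also have "\<dots> < e" using B e by (simp add: field_simps)
        finally show ?case by (simp add: dist_norm)
      qed
    qed
    from tendsto_add[OF tendsto_const[of y0] tendsto_add[OF 1 2]]
    have "(\<lambda>j. y (r j) s) \<longlonglongrightarrow> y0 + (\<integral>p. indicator {..s} (fst p) *\<^sub>R ?P p \<partial>?L)"
      by (simp add: yeq[OF s])
    from LIMSEQ_unique[OF py[OF s] this] show "y' s = y0 + (\<integral>p. indicator {..s} (fst p) *\<^sub>R ?P p \<partial>?L)" .
  qed (use B L t'c y'c t'_range t'B in auto)
  have cost_le: "cost ?L t' y' \<le> l" if l: "\<forall>\<^sub>F j in sequentially. cost (N (r j)) (t (r j)) (y (r j)) \<le> l" for l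
  proof -
    let ?h = "\<lambda>p. Fp (t' (fst p)) (y' (fst p)) (snd p)"
    \<comment> \<open>Weak convergence handles each continuous minorant of the limit integrand;
      monotone convergence then recovers the cost.\<close>
    obtain q :: "nat \<Rightarrow> real \<times> real \<times> 'u \<Rightarrow> real" where q: "\<And>n. continuous_on ({0..B} \<times> K) (q n)"
      "\<And>n p. p \<in> {0..B} \<times> K \<Longrightarrow> 0 \<le> q n p" "\<And>p. p \<in> {0..B} \<times> K \<Longrightarrow> incseq (\<lambda>n. q n p)"
      "\<And>p. p \<in> {0..B} \<times> K \<Longrightarrow> (SUP n. ennreal (q n p)) = ?h p"
    proof (rule continuous_approx_of_lsc[of "{0..B} \<times> K" ?h])
      fix p a assume "p \<in> {0..B} \<times> K" "a < ?h p"
      then show "\<exists>\<delta>>0. \<forall>q\<in>{0..B} \<times> K. dist q p < \<delta> \<longrightarrow> a < ?h q"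
        by (rule joint_lsc[OF t'c t'_range y'c K(1), rotated])
          (rule Fp_lsc_subset, use K(1,4) in auto)
    qed (rule that)
    have qm: "q n \<in> borel_measurable P" if "spacetime B K P" for n P
      by (rule spacetime_measurable_continuous[OF that q(1)])
    have q_int: "(\<integral>\<^sup>+p. ennreal (q n p) \<partial>P) = ennreal (\<integral>p. q n p \<partial>P)" if P: "spacetime B K P" for n P
      by (rule nn_integral_eq_integral[OF spacetime_integrable[OF P B0 K(2) q(1)]])
        (use q(2) spacetime_space[OF P] in \<open>auto intro!: AE_I2\<close>)
    have q_le: "(\<integral>\<^sup>+p. ennreal (q n p) \<partial>?L) \<le> l" for n
    proof (rule ennreal_le_epsilon)
      fix e :: real assume e: "0 < e"
      \<comment> \<open>An error \<epsilon> in the integrand, against a measure of mass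
        \<open>B\<close>, costs \<open>e\<close>.\<close>
      define \<epsilon> where "\<epsilon> = e / B"
      have \<epsilon>: "0 < \<epsilon>" using e B by (simp add: \<epsilon>_def)
      obtain \<delta> where \<delta>: "0 < \<delta>" "\<And>s t1 y1 x. s \<in> {0..B} \<Longrightarrow> t1 \<in> {0..T} \<Longrightarrow> dist (t1, y1) (t' s, y' s) < \<delta> \<Longrightarrow> x \<in> control_box \<Longrightarrow>
          Fp (t' s) (y' s) x \<le> Fp t1 y1 x + ennreal \<epsilon>"
        by (rule Fp_uniform[OF t'c t'_range y'c \<epsilon>]) (rule that)
      have ev: "\<forall>\<^sub>F j in sequentially. ennreal (\<integral>p. q n p \<partial>N (r j)) \<le> l + ennreal e"
        using conv[OF \<delta>(1)] l
      proof eventually_elim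
        case (elim j)
        have "ennreal (\<integral>p. q n p \<partial>N (r j)) = (\<integral>\<^sup>+p. ennreal (q n p) \<partial>N (r j))" by (rule q_int[OF Nr, symmetric])
        also have "\<dots> \<le> (\<integral>\<^sup>+p. Fp (t (r j) (fst p)) (y (r j) (fst p)) (snd p) + ennreal \<epsilon> \<partial>N (r j))"
        proof (rule nn_integral_mono)
          fix p assume "p \<in> space (N (r j))"
          then have p: "p \<in> {0..B} \<times> K" using spacetime_space[OF Nr] by simp
          then obtain s x where sx: "p = (s, x)" "s \<in> {0..B}" "x \<in> K" by auto
          have "ennreal (q n p) \<le> (SUP n. ennreal (q n p))" by (rule SUP_upper) simp
          also have "\<dots> = Fp (t' s) (y' s) x" using q(4)[OF p] by (simp add: sx)
          also have "\<dots> \<le> Fp (t (r j) s) (y (r j) s) x + ennreal \<epsilon>"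
          proof (rule \<delta>(2)[OF sx(2)])
            show "t (r j) s \<in> {0..T}" using tr sx(2) by blast
            show "dist (t (r j) s, y (r j) s) (t' s, y' s) < \<delta>" using elim(1) sx(2) by (simp add: F_def G_eq)
            show "x \<in> control_box" using sx(3) K(1) by blast
          qed
          finally show "ennreal (q n p) \<le> Fp (t (r j) (fst p)) (y (r j) (fst p)) (snd p) + ennreal \<epsilon>" by (simp add: sx)
        qed
        also have "\<dots> = cost (N (r j)) (t (r j)) (y (r j)) + ennreal \<epsilon> * emeasure (N (r j)) (space (N (r j)))"
          unfolding cost_def
          by (subst nn_integral_add) (use spacetime_measurable[OF Nr Fp_along_measurable[OF tc tr yc K(1) borel_compact[OF K(2)]]] in auto)
        also have "emeasure (N (r j)) (space (N (r j))) = ennreal B"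
          using spacetime_finite[OF Nr B0, of j] by (metis finite_measure.emeasure_eq_measure)
        also have "ennreal \<epsilon> * ennreal B = ennreal e" using B e by (simp add: \<epsilon>_def ennreal_mult[symmetric])
        also have "cost (N (r j)) (t (r j)) (y (r j)) + ennreal e \<le> l + ennreal e" using elim(2) by (rule add_right_mono)
        finally show ?case .
      qed
      have lim: "(\<lambda>j. ennreal (\<integral>p. q n p \<partial>N (r j))) \<longlonglongrightarrow> ennreal (\<integral>p. q n p \<partial>?L)"
        by (intro tendsto_ennrealI weak' q(1))
      show "(\<integral>\<^sup>+p. ennreal (q n p) \<partial>?L) \<le> l + ennreal e"
        unfolding q_int[OF L] by (rule tendsto_upperbound[OF lim ev]) simp
    qed
    have "cost ?L t' y' = (\<integral>\<^sup>+p. (SUP n. ennreal (q n p)) \<partial>?L)"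
      unfolding cost_def by (rule nn_integral_cong) (use q(4) spacetime_space[OF L] in simp)
    also have "\<dots> = (SUP n. \<integral>\<^sup>+p. ennreal (q n p) \<partial>?L)"
    proof (rule nn_integral_monotone_convergence_SUP_AE)
      show "AE p in ?L. ennreal (q n p) \<le> ennreal (q (Suc n) p)" for n
        by (rule AE_I2) (use q(3) spacetime_space[OF L] in \<open>auto intro!: ennreal_leI simp: incseq_Suc_iff\<close>)
      show "(\<lambda>p. ennreal (q n p)) \<in> borel_measurable ?L" for n using qm[OF L, of n] by measurable
    qed
    also have "\<dots> \<le> l" by (rule SUP_least) (rule q_le)
    finally show ?thesis .
  qed
  show thesis
    by (rule that[OF r X sol' py cost_le]) (use B in auto)
qed

end

section \<open>The relaxed data\<close>

lemma filterlim_divide_at_right_0: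
  assumes "0 < (l::real)"
  shows "filterlim (\<lambda>v. v / l) (at_right 0) (at_right 0)"
proof (rule filterlim_at_withinI)
  have "((\<lambda>v. v / l) \<longlongrightarrow> 0 / l) (at_right 0)" using assms by (intro tendsto_intros) auto
  then show "((\<lambda>v. v / l) \<longlongrightarrow> 0) (at_right 0)" by simp
  show "\<forall>\<^sub>F v in at_right 0. v / l \<in> {0<..} - {0}"
    using eventually_at_right_less[of 0] by eventually_elim (use assms in simp)
qed

locale relaxed_data =
  fixes T :: real and y0 :: "real^'n" and A :: "real \<Rightarrow> real^'n \<Rightarrow> real^'k \<Rightarrow> real^'n" and f :: "real \<Rightarrow> real^'n \<Rightarrow> real^'k \<Rightarrow> ereal"
    and L C c :: real
  assumes T_pos: "0 < T" and L_nonneg: "0 \<le> L" and C_pos: "0 < C" and c_pos: "0 < c"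
    and f_recession: "\<And>t y u. t \<in> {0..T} \<Longrightarrow> norm u = 1 \<Longrightarrow> \<exists>l. ((\<lambda>r. f t y (r *\<^sub>R u) / ereal r) \<longlongrightarrow> l) at_top"
    and A_lipschitz: "\<And>t u y1 y2. t \<in> {0..T} \<Longrightarrow> norm (A t y1 u - A t y2 u) \<le> L * norm (y1 - y2)"
    and A_growth: "\<And>t y u. t \<in> {0..T} \<Longrightarrow> norm (A t y u) \<le> C * (norm u + 1)"
    and f_equicont: "equicontinuous_ty T f"
    and f_coercive: "\<And>t y u. t \<in> {0..T} \<Longrightarrow> ereal (c * (norm u - 1)) \<le> f t y u"
    and rhs_cont: "\<And>y. continuous_on ({0..T} \<times> {0..1} \<times> cball 0 1) (\<lambda>(t, v, u). relaxed_rhs A t y v u)"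
    and integrand_lsc: "\<And>t y. t \<in> {0..T} \<Longrightarrow> lsc_on ({0..1} \<times> cball 0 1 - {(0, 0)}) (\<lambda>(v, u). relaxed_integrand f t y v u)"
begin

abbreviation rhs :: "real \<Rightarrow> real^'n \<Rightarrow> real \<times> (real^'k) \<Rightarrow> real^'n" where
  "rhs t y x \<equiv> relaxed_rhs A t y (fst x) (snd x)"

abbreviation integrand :: "real \<Rightarrow> real^'n \<Rightarrow> real \<times> (real^'k) \<Rightarrow> ereal" where
  "integrand t y x \<equiv> relaxed_integrand f t y (fst x) (snd x)"

text \<open>The summand \<open>c * v\<close> makes the integrand nonnegative and keeps it one-homogeneous.  As \<open>v\<close> has
  integral \<open>T\<close> along every trajectory, it shifts the cost by the constant \<open>c * T\<close>.\<close>

definition shifted :: "real \<Rightarrow> real^'n \<Rightarrow> real \<times> (real^'k) \<Rightarrow> ennreal" where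
  "shifted t y x = e2ennreal (integrand t y x + ereal (c * fst x))"

text \<open>\<open>Lim\<close> in the definition says nothing until the limit is known to exist.
  Continuity of the relaxed right-hand side up to \<open>v = 0\<close> provides it, for
  \<open>u\<close> in the unit ball.\<close>

lemma rhs_limit_unit:
  assumes t: "t \<in> {0..T}" and u: "norm u \<le> 1"
  shows "((\<lambda>v. v *\<^sub>R A t y (u /\<^sub>R v)) \<longlongrightarrow> relaxed_rhs A t y 0 u) (at_right 0)"
proof -
  have "continuous_on {0..1} (\<lambda>v. (t, v, u))" by (intro continuous_intros)
  from continuous_on_compose2[OF rhs_cont this]
  have "continuous_on {0..1} (\<lambda>v. relaxed_rhs A t y v u)" using t u by (simp add: image_subset_iff)
  then have "((\<lambda>v. relaxed_rhs A t y v u) \<longlongrightarrow> relaxed_rhs A t y 0 u) (at 0 within {0..1})"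
    by (simp add: continuous_on)
  then have *: "((\<lambda>v. relaxed_rhs A t y v u) \<longlongrightarrow> relaxed_rhs A t y 0 u) (at_right 0)"
    by (simp add: at_within_Icc_at_right)
  have "\<forall>\<^sub>F v in at_right 0. relaxed_rhs A t y v u = v *\<^sub>R A t y (u /\<^sub>R v)"
    using eventually_at_right_less[of 0] by eventually_elim (simp add: relaxed_rhs_def)
  from Lim_transform_eventually[OF * this] show ?thesis .
qed

lemma rhs_limit_scale:
  assumes "((\<lambda>v. v *\<^sub>R A t y (u /\<^sub>R v)) \<longlongrightarrow> z) (at_right 0)" "0 < l"
  shows "((\<lambda>v. v *\<^sub>R A t y ((l *\<^sub>R u) /\<^sub>R v)) \<longlongrightarrow> l *\<^sub>R z) (at_right 0)"
proof -
  have "((\<lambda>v. l *\<^sub>R ((v / l) *\<^sub>R A t y (u /\<^sub>R (v / l)))) \<longlongrightarrow> l *\<^sub>R z) (at_right 0)"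
    by (intro tendsto_intros filterlim_compose[OF assms(1) filterlim_divide_at_right_0] assms(2))
  moreover have "u /\<^sub>R (v / l) = (l *\<^sub>R u) /\<^sub>R v" "l *\<^sub>R ((v / l) *\<^sub>R w) = v *\<^sub>R w" for v and w :: "real^'n"
    using assms(2) by (simp_all add: divide_inverse mult.commute)
  ultimately show ?thesis by (simp only:)
qed

text \<open>Scaling reduces an arbitrary \<open>u\<close> to the unit ball;
  \<open>norm u + 1\<close> is a factor that is positive for \<open>u = 0\<close> as well.\<close>

lemma rhs_limit:
  assumes t: "t \<in> {0..T}"
  shows "((\<lambda>v. v *\<^sub>R A t y (u /\<^sub>R v)) \<longlongrightarrow> relaxed_rhs A t y 0 u) (at_right 0)"
proof -
  define l where "l = norm u + 1"
  have l: "0 < l" by (simp add: l_def add_nonneg_pos)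
  have "norm (u /\<^sub>R l) \<le> 1" using l by (simp add: l_def field_simps)
  from rhs_limit_scale[OF rhs_limit_unit[OF t this] l]
  have lim: "((\<lambda>v. v *\<^sub>R A t y (u /\<^sub>R v)) \<longlongrightarrow> l *\<^sub>R relaxed_rhs A t y 0 (u /\<^sub>R l)) (at_right 0)"
    using l by simp
  then have "Lim (at_right 0) (\<lambda>v. v *\<^sub>R A t y (u /\<^sub>R v)) = l *\<^sub>R relaxed_rhs A t y 0 (u /\<^sub>R l)"
    by (intro tendsto_Lim) auto
  then have "relaxed_rhs A t y 0 u = l *\<^sub>R relaxed_rhs A t y 0 (u /\<^sub>R l)" by (simp add: relaxed_rhs_def)
  with lim show ?thesis by simp
qed

lemma rhs_homog:
  assumes t: "t \<in> {0..T}" and l: "0 < l" and x: "0 \<le> fst x"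
  shows "rhs t y (l *\<^sub>R x) = l *\<^sub>R rhs t y x"
proof (cases "fst x = 0")
  case True
  have "((\<lambda>v. v *\<^sub>R A t y ((l *\<^sub>R snd x) /\<^sub>R v)) \<longlongrightarrow> l *\<^sub>R relaxed_rhs A t y 0 (snd x)) (at_right 0)"
    by (rule rhs_limit_scale[OF rhs_limit[OF t] l])
  from tendsto_unique[OF _ rhs_limit[OF t] this] show ?thesis by (simp add: True)
next
  case False
  have "inverse (l * fst x) * l = inverse (fst x)" using l False by (simp add: field_simps)
  then have "(l *\<^sub>R snd x) /\<^sub>R (l * fst x) = snd x /\<^sub>R fst x" by (simp only: scaleR_scaleR)
  moreover have "rhs t y (l *\<^sub>R x) = (l * fst x) *\<^sub>R A t y ((l *\<^sub>R snd x) /\<^sub>R (l * fst x))"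
    using False l x by (simp add: relaxed_rhs_def zero_less_mult_iff del: scaleR_scaleR inverse_mult_distrib)
  moreover have "rhs t y x = fst x *\<^sub>R A t y (snd x /\<^sub>R fst x)" using False x by (simp add: relaxed_rhs_def)
  ultimately show ?thesis by (simp only: scaleR_scaleR)
qed

text \<open>Multiplied by \<open>v\<close>, the growth bound \<open>C * (norm u / v + 1)\<close>
  becomes \<open>C * (norm u + v)\<close>, with no additive constant left; hence the value at the
  origin is 0.\<close>

lemma rhs_bound:
  assumes t: "t \<in> {0..T}" and x: "0 \<le> fst x"
  shows "norm (rhs t y x) \<le> C * ctrl_size x"
proof (cases "fst x = 0")
  case False
  then have v: "0 < fst x" using x by simp
  have "norm (rhs t y x) = fst x * norm (A t y (snd x /\<^sub>R fst x))" using v by (simp add: relaxed_rhs_def)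
  also have "\<dots> \<le> fst x * (C * (norm (snd x /\<^sub>R fst x) + 1))" by (rule mult_left_mono[OF A_growth[OF t]]) (use v in simp)
  also have "\<dots> = C * ctrl_size x" using v by (simp add: ctrl_size_def field_simps)
  finally show ?thesis .
next
  case True
  have ev: "\<forall>\<^sub>F v in at_right 0. norm (v *\<^sub>R A t y (snd x /\<^sub>R v)) \<le> C * (norm (snd x) + v)"
    using eventually_at_right_less[of 0]
  proof eventually_elim
    case (elim v)
    have "norm (v *\<^sub>R A t y (snd x /\<^sub>R v)) = v * norm (A t y (snd x /\<^sub>R v))" using elim by simp
    also have "\<dots> \<le> v * (C * (norm (snd x /\<^sub>R v) + 1))" by (rule mult_left_mono[OF A_growth[OF t]]) (use elim in simp)
    also have "\<dots> = C * (norm (snd x) + v)" using elim by (simp add: field_simps)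
    finally show ?case .
  qed
  have "((\<lambda>v. C * (norm (snd x) + v)) \<longlongrightarrow> C * (norm (snd x) + 0)) (at_right 0)" by (intro tendsto_intros)
  from tendsto_le[OF _ this tendsto_norm[OF rhs_limit[OF t]] ev] show ?thesis
    using True by (simp add: ctrl_size_def)
qed

text \<open>The factor \<open>v \<le> 1\<close> can only shrink the Lipschitz constant, and the
  estimate survives the limit at \<open>v = 0\<close>.\<close>

lemma rhs_lipschitz:
  assumes t: "t \<in> {0..T}" and x: "x \<in> control_box"
  shows "norm (rhs t y x - rhs t z x) \<le> L * norm (y - z)"
proof (cases "fst x = 0")
  case False
  then have v: "0 < fst x" "fst x \<le> 1" using x by auto
  have "norm (rhs t y x - rhs t z x) = fst x * norm (A t y (snd x /\<^sub>R fst x) - A t z (snd x /\<^sub>R fst x))"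
    using v by (simp add: relaxed_rhs_def scaleR_diff_right[symmetric])
  also have "\<dots> \<le> 1 * (L * norm (y - z))" using v A_lipschitz[OF t] L_nonneg by (intro mult_mono) auto
  finally show ?thesis by simp
next
  case True
  have ev: "\<forall>\<^sub>F v in at_right 0. norm (v *\<^sub>R A t y (snd x /\<^sub>R v) - v *\<^sub>R A t z (snd x /\<^sub>R v)) \<le> L * norm (y - z)"
    using eventually_at_right_real[OF zero_less_one]
  proof eventually_elim
    case (elim v)
    have "norm (v *\<^sub>R A t y (snd x /\<^sub>R v) - v *\<^sub>R A t z (snd x /\<^sub>R v)) = v * norm (A t y (snd x /\<^sub>R v) - A t z (snd x /\<^sub>R v))"
      using elim by (simp add: scaleR_diff_right[symmetric])
    also have "\<dots> \<le> 1 * (L * norm (y - z))" using elim A_lipschitz[OF t] L_nonneg by (intro mult_mono) auto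
    finally show ?case by simp
  qed
  from tendsto_le[OF _ tendsto_const tendsto_norm[OF tendsto_diff[OF rhs_limit[OF t] rhs_limit[OF t]]] ev]
  show ?thesis using True by simp
qed

text \<open>For fixed \<open>y\<close> continuity is assumed; the Lipschitz bound in
  \<open>y\<close>, uniform in the other arguments, makes it joint.\<close>

lemma rhs_continuous: "continuous_on ({0..T} \<times> UNIV \<times> control_box) (\<lambda>(t, y, x). rhs t y x)"
proof (subst continuous_on_iff, intro ballI allI impI)
  fix q :: "real \<times> (real^'n) \<times> real \<times> (real^'k)" and e :: real
  assume q: "q \<in> {0..T} \<times> UNIV \<times> control_box" and e: "0 < e"
  obtain t y x where tyx: "q = (t, y, x)" "t \<in> {0..T}" "x \<in> control_box" using q by (cases q) auto
  have "(t, x) \<in> {0..T} \<times> {0..1} \<times> cball 0 1" using tyx by (cases x) auto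
  with rhs_cont[of y] obtain d1 where d1: "0 < d1" "\<And>p. p \<in> {0..T} \<times> {0..1} \<times> cball 0 1 \<Longrightarrow> dist p (t, x) < d1 \<Longrightarrow>
      dist ((\<lambda>(t, v, u). relaxed_rhs A t y v u) p) ((\<lambda>(t, v, u). relaxed_rhs A t y v u) (t, x)) < e / 2"
    unfolding continuous_on_iff using e by (meson half_gt_zero)
  \<comment> \<open>The second bound makes the Lipschitz error at most \<open>e / 2\<close>;
    \<open>L + 1\<close> avoids a division by 0.\<close>
  define d where "d = min d1 (e / (2 * (L + 1)))"
  have d: "0 < d" using d1 e L_nonneg by (simp add: d_def)
  show "\<exists>d>0. \<forall>q'\<in>{0..T} \<times> UNIV \<times> control_box. dist q' q < d \<longrightarrow>
    dist (case q' of (t, y, x) \<Rightarrow> rhs t y x) (case q of (t, y, x) \<Rightarrow> rhs t y x) < e"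
  proof (intro exI[of _ d] conjI ballI impI d)
    fix q' assume q': "q' \<in> {0..T} \<times> UNIV \<times> control_box" "dist q' q < d"
    obtain t' y' x' where tyx': "q' = (t', y', x')" "t' \<in> {0..T}" "x' \<in> control_box" using q' by (cases q') auto
    have dy: "dist y' y \<le> dist q' q"
      using dist_fst_le[of "snd q'" "snd q"] dist_snd_le[of q' q] by (simp add: tyx tyx')
    have "dist (t', x') (t, x) \<le> dist q' q"
      by (simp add: tyx tyx' dist_Pair_Pair)
    then have "dist (t', x') (t, x) < d1" using q'(2) by (simp add: d_def)
    then have 1: "dist (rhs t' y x') (rhs t y x) < e / 2"
      using d1(2)[of "(t', x')"] tyx' by (cases x, cases x') auto
    have "L * norm (y' - y) \<le> L * (e / (2 * (L + 1)))"
      using dy q'(2) L_nonneg by (intro mult_left_mono) (auto simp: d_def dist_norm)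
    also have "\<dots> \<le> e / 2" using L_nonneg e by (simp add: field_simps)
    finally have 2: "dist (rhs t' y' x') (rhs t' y x') \<le> e / 2"
      using rhs_lipschitz[OF tyx'(2,3), of y' y] by (simp add: dist_norm)
    have "dist (rhs t' y' x') (rhs t y x) \<le> dist (rhs t' y' x') (rhs t' y x') + dist (rhs t' y x') (rhs t y x)"
      by (rule dist_triangle)
    with 1 2 show "dist (case q' of (t, y, x) \<Rightarrow> rhs t y x) (case q of (t, y, x) \<Rightarrow> rhs t y x) < e"
      by (simp add: tyx tyx')
  qed
qed

text \<open>The measures only charge the control box, but a Bochner integral vanishes unless the
  integrand is measurable on the whole space.\<close>

lemma rhs_measurable:
  assumes t: "t \<in> {0..T}"
  shows "(\<lambda>(v, u). relaxed_rhs A t y v u) \<in> borel_measurable borel"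
proof -
  \<comment> \<open>\<open>relaxed_rhs\<close> does not depend on \<open>v\<close> for
    \<open>v \<le> 0\<close>, so negative \<open>v\<close> may be replaced by 0. One-homogeneity
    then scales the point to size 1, into the box, where continuity is known.\<close>
  define P where "P x = (max 0 (fst x), snd x)" for x :: "real \<times> (real^'k)"
  define n where "n x = ctrl_size (P x)" for x :: "real \<times> (real^'k)"
  have Pc: "continuous_on UNIV P" unfolding P_def[abs_def] by (intro continuous_intros)
  have [measurable]: "P \<in> borel_measurable borel" by (rule borel_measurable_continuous_onI[OF Pc])
  have [measurable]: "n \<in> borel_measurable borel"
    unfolding n_def[abs_def] ctrl_size_def P_def by (intro borel_measurable_continuous_onI continuous_intros)
  have eq: "relaxed_rhs A t y v u = rhs t y (P (v, u))" for v u
    by (auto simp: relaxed_rhs_def P_def max_def)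
  have n0: "0 \<le> n x" for x by (simp add: n_def ctrl_size_def P_def)
  have Pin: "P x /\<^sub>R n x \<in> control_box" if "n x \<noteq> 0" for x
  proof -
    have "0 < n x" using that n0[of x] by simp
    moreover have "max 0 (fst x) \<le> n x" "norm (snd x) \<le> n x" by (auto simp: n_def ctrl_size_def P_def)
    ultimately show ?thesis by (auto simp: P_def field_simps)
  qed
  have rc: "continuous_on control_box (rhs t y)"
  proof -
    have "continuous_on control_box (\<lambda>x. (t, y, x))" by (intro continuous_intros)
    from continuous_on_compose2[OF rhs_continuous this] show ?thesis using t by (simp add: image_subset_iff)
  qed
  have cb: "(control_box :: (real \<times> (real^'k)) set) \<in> sets borel"
    by (rule borel_compact) (intro compact_Times compact_Icc compact_cball)
  have [measurable]: "(\<lambda>x. indicator control_box x *\<^sub>R rhs t y x) \<in> borel_measurable borel"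
    using borel_measurable_continuous_on_indicator[OF cb rc] by (simp add: scaleR_conv_of_real)
  have main: "rhs t y (P x) = n x *\<^sub>R (indicator control_box (P x /\<^sub>R n x) *\<^sub>R rhs t y (P x /\<^sub>R n x))" for x
  proof (cases "n x = 0")
    case True
    then show ?thesis using rhs_bound[OF t, of "P x" y] by (simp add: n_def P_def)
  next
    case False
    then have "0 < inverse (n x)" using n0[of x] by (simp add: order_less_le)
    from rhs_homog[OF t this, of "P x" y] show ?thesis using False Pin[OF False] by (simp add: P_def)
  qed
  have "(\<lambda>(v, u). relaxed_rhs A t y v u) =
    (\<lambda>x. n x *\<^sub>R (indicator control_box (P x /\<^sub>R n x) *\<^sub>R rhs t y (P x /\<^sub>R n x)))"
  proof
    fix x show "(\<lambda>(v, u). relaxed_rhs A t y v u) x =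
      n x *\<^sub>R (indicator control_box (P x /\<^sub>R n x) *\<^sub>R rhs t y (P x /\<^sub>R n x))"
    proof (rule trans[OF _ main])
      obtain v u where x: "x = (v, u)" by (cases x)
      show "(\<lambda>(v, u). relaxed_rhs A t y v u) x = rhs t y (P x)"
        unfolding x prod.case by (rule eq)
    qed
  qed
  also have "\<dots> \<in> borel_measurable borel"
  proof -
    have "(\<lambda>x. P x /\<^sub>R n x) \<in> borel_measurable borel" by measurable
    from measurable_compose[OF this, of "\<lambda>x. indicator control_box x *\<^sub>R rhs t y x"]
    have "(\<lambda>x. indicator control_box (P x /\<^sub>R n x) *\<^sub>R rhs t y (P x /\<^sub>R n x)) \<in> borel_measurable borel" by simp
    then show ?thesis by (rule borel_measurable_scaleR[rotated]) simp
  qed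
  finally show ?thesis .
qed

section \<open>The relaxed integrand up to \<open>v = 0\<close>\<close>

lemma f_not_MInf: "t \<in> {0..T} \<Longrightarrow> f t y u \<noteq> -\<infinity>"
  using f_coercive[of t u y] by auto

text \<open>The substitution \<open>r = norm u / v\<close> turns the recession limit in the
  direction of \<open>u\<close> into a limit at \<open>v = 0\<close>. For \<open>u = 0\<close> the
  limit is 0 or \<infinity>, according to whether \<open>f t y 0\<close> is finite.\<close>

lemma integrand_limit:
  assumes t: "t \<in> {0..T}"
  shows "((\<lambda>v. ereal v * f t y (u /\<^sub>R v)) \<longlongrightarrow> relaxed_integrand f t y 0 u) (at_right 0)"
proof -
  have "\<exists>l. ((\<lambda>v. ereal v * f t y (u /\<^sub>R v)) \<longlongrightarrow> l) (at_right 0)"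
  proof (cases "u = 0")
    case True
    show ?thesis
    proof (cases "f t y 0")
      case (real r)
      have "((\<lambda>v. ereal (v * r)) \<longlongrightarrow> ereal (0 * r)) (at_right 0)" by (intro tendsto_intros)
      then show ?thesis using True real by auto
    next
      case PInf
      have "\<forall>\<^sub>F v in at_right 0. ereal v * f t y (u /\<^sub>R v) = \<infinity>"
        using eventually_at_right_less[of 0] by eventually_elim (simp add: True PInf)
      then show ?thesis by (intro exI[of _ \<infinity>] tendsto_eventually)
    qed (use f_not_MInf[OF t] in auto)
  next
    case False
    define n where "n = norm u"
    have n: "0 < n" using False by (simp add: n_def)
    have "norm (u /\<^sub>R n) = 1" using n by (simp add: n_def)
    from f_recession[OF t this, of y] obtain l where l: "((\<lambda>r. f t y (r *\<^sub>R (u /\<^sub>R n)) / ereal r) \<longlongrightarrow> l) at_top" by blast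
    have "filterlim (\<lambda>v. n / v) at_top (at_right 0)"
      using filterlim_tendsto_pos_mult_at_top[OF tendsto_const n filterlim_inverse_at_top_right]
      by (simp add: divide_inverse)
    from filterlim_compose[OF l this]
    have "((\<lambda>v. f t y ((n / v) *\<^sub>R (u /\<^sub>R n)) / ereal (n / v)) \<longlongrightarrow> l) (at_right 0)" .
    then have lim: "((\<lambda>v. ereal n * (f t y ((n / v) *\<^sub>R (u /\<^sub>R n)) / ereal (n / v))) \<longlongrightarrow> ereal n * l) (at_right 0)"
      by (intro tendsto_cmult_ereal) auto
    have "\<forall>\<^sub>F v in at_right 0. ereal n * (f t y ((n / v) *\<^sub>R (u /\<^sub>R n)) / ereal (n / v)) = ereal v * f t y (u /\<^sub>R v)"
      using eventually_at_right_less[of 0]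
    proof eventually_elim
      case (elim v)
      have "(n / v) *\<^sub>R (u /\<^sub>R n) = u /\<^sub>R v" using n by (simp add: divide_inverse mult.commute)
      moreover have "ereal n * (z / ereal (n / v)) = ereal v * z" for z
        using n elim by (cases z) (auto simp: field_simps)
      ultimately show ?case by (simp only:)
    qed
    from Lim_transform_eventually[OF lim this] show ?thesis by blast
  qed
  then obtain l where l: "((\<lambda>v. ereal v * f t y (u /\<^sub>R v)) \<longlongrightarrow> l) (at_right 0)" by blast
  then have "Lim (at_right 0) (\<lambda>v. ereal v * f t y (u /\<^sub>R v)) = l" by (intro tendsto_Lim) auto
  then show ?thesis using l by (simp add: relaxed_integrand_def)
qed

lemma integrand_pos: "0 < fst x \<Longrightarrow> integrand t y x = ereal (fst x) * f t y (snd x /\<^sub>R fst x)"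
  by (simp add: relaxed_integrand_def)

lemma integrand_homog:
  assumes t: "t \<in> {0..T}" and l: "0 < l" and x: "0 \<le> fst x"
  shows "integrand t y (l *\<^sub>R x) = ereal l * integrand t y x"
proof (cases "fst x = 0")
  case True
  have "((\<lambda>v. ereal l * (ereal (v / l) * f t y (snd x /\<^sub>R (v / l)))) \<longlongrightarrow> ereal l * relaxed_integrand f t y 0 (snd x)) (at_right 0)"
    by (intro tendsto_cmult_ereal filterlim_compose[OF integrand_limit[OF t] filterlim_divide_at_right_0] l) simp
  moreover have "ereal l * (ereal (v / l) * f t y (snd x /\<^sub>R (v / l))) = ereal v * f t y ((l *\<^sub>R snd x) /\<^sub>R v)" for v
  proof -
    have "snd x /\<^sub>R (v / l) = (l *\<^sub>R snd x) /\<^sub>R v" by (simp add: divide_inverse mult.commute)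
    moreover have "ereal l * (ereal (v / l) * z) = ereal v * z" for z
      using l by (simp add: mult.assoc[symmetric])
    ultimately show ?thesis by (simp only:)
  qed
  ultimately have "((\<lambda>v. ereal v * f t y ((l *\<^sub>R snd x) /\<^sub>R v)) \<longlongrightarrow> ereal l * relaxed_integrand f t y 0 (snd x)) (at_right 0)"
    by simp
  from tendsto_unique[OF _ integrand_limit[OF t] this] show ?thesis by (simp add: True)
next
  case False
  have "inverse (l * fst x) * l = inverse (fst x)" using l False by (simp add: field_simps)
  then have "(l *\<^sub>R snd x) /\<^sub>R (l * fst x) = snd x /\<^sub>R fst x" by (simp only: scaleR_scaleR)
  moreover have "integrand t y (l *\<^sub>R x) = (ereal l * ereal (fst x)) * f t y ((l *\<^sub>R snd x) /\<^sub>R (l * fst x))"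
    using False l x by (simp add: relaxed_integrand_def zero_less_mult_iff del: scaleR_scaleR inverse_mult_distrib)
  moreover have "integrand t y x = ereal (fst x) * f t y (snd x /\<^sub>R fst x)" using False x by (simp add: relaxed_integrand_def)
  ultimately show ?thesis by (simp only: mult.assoc)
qed

lemma integrand_coercive:
  assumes t: "t \<in> {0..T}" and x: "0 \<le> fst x"
  shows "ereal (c * (norm (snd x) - fst x)) \<le> integrand t y x"
proof -
  have pos: "ereal (c * (norm u - v)) \<le> ereal v * f t y (u /\<^sub>R v)" if v: "0 < v" for u v
  proof -
    have "ereal (c * (norm u - v)) = ereal v * ereal (c * (norm (u /\<^sub>R v) - 1))"
      using v by (simp add: field_simps)
    also have "\<dots> \<le> ereal v * f t y (u /\<^sub>R v)" by (rule ereal_mult_left_mono[OF f_coercive[OF t]]) (use v in simp)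
    finally show ?thesis .
  qed
  show ?thesis
  proof (cases "fst x = 0")
    case True
    have "((\<lambda>v. ereal (c * (norm (snd x) - v))) \<longlongrightarrow> ereal (c * (norm (snd x) - 0))) (at_right 0)" by (intro tendsto_intros)
    moreover have "\<forall>\<^sub>F v in at_right 0. ereal (c * (norm (snd x) - v)) \<le> ereal v * f t y (snd x /\<^sub>R v)"
      using eventually_at_right_less[of 0] by eventually_elim (rule pos)
    ultimately show ?thesis using tendsto_le[OF _ integrand_limit[OF t]] True by force
  next
    case False
    then show ?thesis using pos[of "fst x" "snd x"] x by (simp add: integrand_pos)
  qed
qed

text \<open>\<open>e2ennreal\<close> would cut off negative values. Coercivity shows that there are
  none, so algebra on \<open>shifted\<close> can be carried out in \<open>ereal\<close>.\<close>

lemma enn2ereal_shifted: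
  assumes t: "t \<in> {0..T}" and x: "0 \<le> fst x"
  shows "enn2ereal (shifted t y x) = integrand t y x + ereal (c * fst x)"
    and "ereal (c * norm (snd x)) \<le> integrand t y x + ereal (c * fst x)"
proof -
  have "ereal (c * norm (snd x)) = ereal (c * (norm (snd x) - fst x)) + ereal (c * fst x)"
    by (simp add: right_diff_distrib)
  also have "\<dots> \<le> integrand t y x + ereal (c * fst x)" by (intro add_right_mono integrand_coercive t x)
  finally show *: "ereal (c * norm (snd x)) \<le> integrand t y x + ereal (c * fst x)" .
  have "0 \<le> ereal (c * norm (snd x))" using c_pos by simp
  from order_trans[OF this *] show "enn2ereal (shifted t y x) = integrand t y x + ereal (c * fst x)"
    unfolding shifted_def by (rule enn2ereal_e2ennreal)
qed

lemma shifted_coercive: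
  assumes t: "t \<in> {0..T}" and x: "0 \<le> fst x"
  shows "ennreal (c * norm (snd x)) \<le> shifted t y x"
  using enn2ereal_shifted[OF t x, of y] c_pos by (simp add: less_eq_ennreal.rep_eq)

lemma shifted_homog:
  assumes t: "t \<in> {0..T}" and l: "0 < l" and x: "0 \<le> fst x"
  shows "shifted t y (l *\<^sub>R x) = ennreal l * shifted t y x"
proof -
  have "enn2ereal (shifted t y (l *\<^sub>R x)) = ereal l * integrand t y x + ereal l * ereal (c * fst x)"
    using enn2ereal_shifted(1)[OF t, of "l *\<^sub>R x" y] x l integrand_homog[OF t l x, of y]
    by (simp add: mult.left_commute)
  also have "\<dots> = ereal l * (integrand t y x + ereal (c * fst x))"
    using l by (intro ereal_pos_distrib[symmetric]) auto
  also have "\<dots> = enn2ereal (ennreal l * shifted t y x)"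
    using l enn2ereal_shifted(1)[OF t x, of y] by (simp add: times_ennreal.rep_eq)
  finally show ?thesis by (simp add: enn2ereal_inject)
qed

text \<open>The \<delta> for \<open>f\<close> serves here too: the factor \<open>v \<le> 1\<close>
  shrinks \<epsilon>, the case \<open>v = 0\<close> is a limit, and \<open>c * v\<close> is the same
  on both sides.\<close>

lemma shifted_equicont:
  assumes t: "t \<in> {0..T}" and \<epsilon>: "0 < \<epsilon>"
  shows "\<exists>\<delta>>0. \<forall>t'\<in>{0..T}. \<forall>y'. dist (t', y') (t, y) < \<delta> \<longrightarrow>
        (\<forall>x\<in>control_box. shifted t' y' x \<le> shifted t y x + ennreal \<epsilon> \<and> shifted t y x \<le> shifted t' y' x + ennreal \<epsilon>)"
proof -
  have "\<exists>\<delta>>0. \<forall>t'\<in>{0..T}. \<forall>y'. dist (t', y') (t, y) < \<delta> \<longrightarrow>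
        (\<forall>u. f t' y' u \<le> f t y u + ereal \<epsilon> \<and> f t y u \<le> f t' y' u + ereal \<epsilon>)"
    using f_equicont[unfolded equicontinuous_ty_def, THEN bspec[OF _ t], THEN spec[of _ y], THEN spec[of _ \<epsilon>], THEN mp[OF _ \<epsilon>]] .
  then obtain \<delta> where \<delta>0: "0 < \<delta>" and \<delta>1: "\<forall>t'\<in>{0..T}. \<forall>y'. dist (t', y') (t, y) < \<delta> \<longrightarrow>
        (\<forall>u. f t' y' u \<le> f t y u + ereal \<epsilon> \<and> f t y u \<le> f t' y' u + ereal \<epsilon>)" by (elim exE conjE)
  have key: "shifted t1 y1 x \<le> shifted t2 y2 x + ennreal \<epsilon>"
    if t12: "t1 \<in> {0..T}" "t2 \<in> {0..T}" and le: "\<And>u. f t1 y1 u \<le> f t2 y2 u + ereal \<epsilon>" and x: "x \<in> control_box" for t1 t2 y1 y2 x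
  proof -
    have pos: "ereal v * f t1 y1 u \<le> ereal v * f t2 y2 u + ereal \<epsilon>" if v: "0 < v" "v \<le> 1" for u v
    proof -
      have "ereal v * f t1 y1 u \<le> ereal v * (f t2 y2 u + ereal \<epsilon>)" by (rule ereal_mult_left_mono[OF le]) (use v in simp)
      also have "\<dots> = ereal v * f t2 y2 u + ereal v * ereal \<epsilon>" using v by (intro ereal_pos_distrib) auto
      also have "\<dots> \<le> ereal v * f t2 y2 u + ereal \<epsilon>" using v \<epsilon> by (intro add_left_mono) (simp add: mult_left_le_one_le)
      finally show ?thesis .
    qed
    have x0: "0 \<le> fst x" "fst x \<le> 1" using x by auto
    have "integrand t1 y1 x \<le> integrand t2 y2 x + ereal \<epsilon>"
    proof (cases "fst x = 0")
      case True
      have "((\<lambda>v. ereal v * f t2 y2 (snd x /\<^sub>R v) + ereal \<epsilon>) \<longlongrightarrow> relaxed_integrand f t2 y2 0 (snd x) + ereal \<epsilon>) (at_right 0)"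
        by (intro tendsto_add_ereal_general integrand_limit t12 tendsto_const) simp_all
      moreover have "\<forall>\<^sub>F v in at_right 0. ereal v * f t1 y1 (snd x /\<^sub>R v) \<le> ereal v * f t2 y2 (snd x /\<^sub>R v) + ereal \<epsilon>"
        using eventually_at_right_real[OF zero_less_one]
        by eventually_elim (simp add: pos)
      ultimately show ?thesis using tendsto_le[OF _ _ integrand_limit[OF t12(1)]] True by force
    next
      case False
      then show ?thesis using pos[of "fst x" "snd x /\<^sub>R fst x"] x0 by (simp add: integrand_pos)
    qed
    then have "integrand t1 y1 x + ereal (c * fst x) \<le> (integrand t2 y2 x + ereal \<epsilon>) + ereal (c * fst x)"
      by (rule add_right_mono)
    also have "\<dots> = (integrand t2 y2 x + ereal (c * fst x)) + ereal \<epsilon>" by (simp add: ac_simps)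
    finally show ?thesis
      using \<epsilon> enn2ereal_shifted(1)[OF t12(1) x0(1), of y1] enn2ereal_shifted(1)[OF t12(2) x0(1), of y2]
      by (simp add: less_eq_ennreal.rep_eq plus_ennreal.rep_eq)
  qed
  show ?thesis
  proof (intro exI[of _ \<delta>] conjI ballI allI impI \<delta>0)
    fix t' y' and x :: "real \<times> (real^'k)"
    assume t': "t' \<in> {0..T}" and d: "dist (t', y') (t, y) < \<delta>" and x: "x \<in> control_box"
    have le: "f t' y' u \<le> f t y u + ereal \<epsilon>" "f t y u \<le> f t' y' u + ereal \<epsilon>" for u
      using \<delta>1[THEN bspec[OF _ t'], THEN spec[of _ y'], THEN mp[OF _ d]] by simp_all
    show "shifted t' y' x \<le> shifted t y x + ennreal \<epsilon>" by (rule key[OF t' t le(1) x])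
    show "shifted t y x \<le> shifted t' y' x + ennreal \<epsilon>" by (rule key[OF t t' le(2) x])
  qed
qed

text \<open>A real \<open>b\<close> below the integrand leaves room for the continuous summand
  \<open>c * v\<close> to decrease.\<close>

lemma shifted_lsc:
  assumes t: "t \<in> {0..T}" and x: "x \<in> control_box" "x \<noteq> 0" and a: "a < shifted t y x"
  shows "\<exists>\<delta>>0. \<forall>x'\<in>control_box. dist x' x < \<delta> \<longrightarrow> a < shifted t y x'"
proof -
  have x0: "0 \<le> fst x" using x by auto
  have "a < \<top>" using a by (metis less_top less_trans top.not_eq_extremum)
  then obtain ra where ra: "a = ennreal ra" "0 \<le> ra" by (cases a) auto
  have "ereal ra < integrand t y x + ereal (c * fst x)"
    using a ra enn2ereal_shifted(1)[OF t x0, of y] by (simp add: less_ennreal.rep_eq)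
  then have "ereal (ra - c * fst x) < integrand t y x" by (cases "integrand t y x") auto
  then obtain b where b: "ereal (ra - c * fst x) < ereal b" "ereal b < integrand t y x" using ereal_dense2 by blast
  let ?X = "{0..1} \<times> cball 0 1 - {(0, 0)} :: (real \<times> (real^'k)) set"
  have xX: "x \<in> ?X" using x by (auto simp: zero_prod_def)
  have "integrand t y x \<le> Liminf (at x within ?X) (integrand t y)"
    using integrand_lsc[OF t, of y] xX unfolding lsc_on_def case_prod_unfold by blast
  with b(2) have "ereal b < Liminf (at x within ?X) (integrand t y)" by simp
  from less_LiminfD[OF this] obtain d1 where d1: "0 < d1" "\<And>x'. x' \<in> ?X \<Longrightarrow> x' \<noteq> x \<Longrightarrow> dist x' x < d1 \<Longrightarrow> ereal b < integrand t y x'"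
    unfolding eventually_at by blast
  define d2 where "d2 = (b - (ra - c * fst x)) / c"
  have d2: "0 < d2" "c * d2 = b - (ra - c * fst x)" using b(1) c_pos by (auto simp: d2_def)
  show ?thesis
  \<comment> \<open>\<open>norm x\<close> keeps \<open>x'\<close> away from the origin,
    \<open>d1\<close> keeps the integrand above \<open>b\<close>, and \<open>d2\<close> bounds the
    loss in \<open>c * v\<close> by \<open>b - (ra - c * fst x)\<close>.\<close>
  proof (intro exI[of _ "min (norm x) (min d1 d2)"] conjI ballI impI)
    show "0 < min (norm x) (min d1 d2)" using d1 d2 x by simp
    fix x' assume x': "x' \<in> control_box" "dist x' x < min (norm x) (min d1 d2)"
    have "x' \<noteq> 0" using x'(2) by (auto simp: dist_norm)
    then have "x' \<in> ?X" using x'(1) by (auto simp: zero_prod_def)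
    then have b': "ereal b < integrand t y x'" using d1(2)[of x'] x'(2) b(2) by (cases "x' = x") auto
    have "dist (fst x') (fst x) < d2" using dist_fst_le[of x' x] x'(2) by linarith
    then have "c * (fst x - fst x') < c * d2" using c_pos by (intro mult_strict_left_mono) (auto simp: dist_real_def)
    then have r: "ra < b + c * fst x'" using d2(2) by (simp add: right_diff_distrib)
    have "ereal ra < integrand t y x' + ereal (c * fst x')"
      using b' r by (cases "integrand t y x'") auto
    moreover have "0 \<le> fst x'" using x' by auto
    ultimately show "a < shifted t y x'"
      using ra enn2ereal_shifted(1)[OF t, of x' y] by (simp add: less_ennreal.rep_eq)
  qed
qed

end

sublocale relaxed_data \<subseteq> relaxed_control T y0 rhs shifted C c
proof
  show "0 < T" "0 \<le> C" "0 < c" using T_pos C_pos c_pos by auto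
  show "continuous_on ({0..T} \<times> UNIV \<times> control_box) (\<lambda>(t, y, x). rhs t y x)" by (rule rhs_continuous)
  show "norm (rhs t y x) \<le> C * ctrl_size x" if "t \<in> {0..T}" "x \<in> control_box" for t y x
    using that by (intro rhs_bound) auto
  show "rhs t y (l *\<^sub>R x) = l *\<^sub>R rhs t y x"
    if "t \<in> {0..T}" "x \<in> control_box" "0 < l" "l *\<^sub>R x \<in> control_box" for t y x l
    using that by (intro rhs_homog) auto
  show "shifted t y (l *\<^sub>R x) = ennreal l * shifted t y x"
    if "t \<in> {0..T}" "x \<in> control_box" "0 < l" "l *\<^sub>R x \<in> control_box" for t y x l
    using that by (intro shifted_homog) auto
  show "ennreal (c * norm (snd x)) \<le> shifted t y x" if "t \<in> {0..T}" "x \<in> control_box" for t y x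
    using that by (intro shifted_coercive) auto
qed (use shifted_equicont shifted_lsc in blast)+

section \<open>Admissible triples and trajectories\<close>

text \<open>\<open>ereal_integral\<close> is not additive in general, because of infinities of both
  signs. Here the negative part \<open>b\<close> of \<open>k - p\<close> is at most
  \<open>p\<close>, and \<open>k + b = a + p\<close> with the positive part \<open>a\<close>. This
  identity can be integrated in \<open>ennreal\<close> and rearranged afterwards, all terms but
  \<open>k\<close> and \<open>a\<close> having finite integrals.\<close>

lemma ereal_integral_shift:
  assumes M: "finite_measure M" and k[measurable]: "k \<in> borel_measurable M"
    and p: "integrable M p" "\<And>x. x \<in> space M \<Longrightarrow> 0 \<le> p x"
    and h: "AE x in M. h x = enn2ereal (k x) - ereal (p x)"
  shows "ereal_integral M h = enn2ereal (\<integral>\<^sup>+x. k x \<partial>M) - ereal (\<integral>x. p x \<partial>M)"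
proof -
  have [measurable]: "p \<in> borel_measurable M" using p by auto
  define a where "a x = e2ennreal (enn2ereal (k x) - ereal (p x))" for x
  define b where "b x = e2ennreal (- (enn2ereal (k x) - ereal (p x)))" for x
  have [measurable]: "a \<in> borel_measurable M" "b \<in> borel_measurable M"
    unfolding a_def[abs_def] b_def[abs_def] by measurable
  have ab: "k x + b x = a x + ennreal (p x) \<and> b x \<le> ennreal (p x)" if "x \<in> space M" for x
  proof (cases "k x")
    case (real r)
    have "a x = ennreal (r - p x)" "b x = ennreal (p x - r)"
      unfolding a_def b_def using real by (simp_all add: e2ennreal_ereal enn2ereal_ennreal)
    then show ?thesis using real p(2)[OF that]
      by (cases "p x \<le> r") (auto simp: ennreal_neg ennreal_plus[symmetric] simp del: ennreal_plus intro!: ennreal_leI)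
  next
    case top
    then show ?thesis by (simp add: a_def b_def e2ennreal_neg)
  qed
  have P: "(\<integral>\<^sup>+x. ennreal (p x) \<partial>M) = ennreal (\<integral>x. p x \<partial>M)"
    by (rule nn_integral_eq_integral[OF p(1)]) (use p(2) in \<open>auto intro: AE_I2\<close>)
  have p0: "0 \<le> (\<integral>x. p x \<partial>M)" by (rule Bochner_Integration.integral_nonneg) (rule p(2))
  have "(\<integral>\<^sup>+x. k x \<partial>M) + (\<integral>\<^sup>+x. b x \<partial>M) = (\<integral>\<^sup>+x. k x + b x \<partial>M)" by (rule nn_integral_add[symmetric]) measurable
  also have "\<dots> = (\<integral>\<^sup>+x. a x + ennreal (p x) \<partial>M)" by (rule nn_integral_cong) (use ab in blast)
  also have "\<dots> = (\<integral>\<^sup>+x. a x \<partial>M) + (\<integral>\<^sup>+x. ennreal (p x) \<partial>M)" by (rule nn_integral_add) measurable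
  finally have eq: "(\<integral>\<^sup>+x. k x \<partial>M) + (\<integral>\<^sup>+x. b x \<partial>M) = (\<integral>\<^sup>+x. a x \<partial>M) + ennreal (\<integral>x. p x \<partial>M)" by (simp only: P)
  have "(\<integral>\<^sup>+x. b x \<partial>M) \<le> (\<integral>\<^sup>+x. ennreal (p x) \<partial>M)" by (rule nn_integral_mono) (use ab in blast)
  then obtain rb where rb: "(\<integral>\<^sup>+x. b x \<partial>M) = ennreal rb" "0 \<le> rb"
    unfolding P by (cases "\<integral>\<^sup>+x. b x \<partial>M") (auto simp: top_unique)
  have "(\<integral>\<^sup>+x. e2ennreal (h x) \<partial>M) = (\<integral>\<^sup>+x. a x \<partial>M)"
    by (rule nn_integral_cong_AE) (use h in eventually_elim, simp add: a_def)
  moreover have "(\<integral>\<^sup>+x. e2ennreal (- h x) \<partial>M) = (\<integral>\<^sup>+x. b x \<partial>M)"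
    by (rule nn_integral_cong_AE) (use h in eventually_elim, simp add: b_def)
  moreover have "enn2ereal (\<integral>\<^sup>+x. a x \<partial>M) - ereal rb = enn2ereal (\<integral>\<^sup>+x. k x \<partial>M) - ereal (\<integral>x. p x \<partial>M)"
  proof (cases "\<integral>\<^sup>+x. k x \<partial>M")
    case (real rk)
    then have "(\<integral>\<^sup>+x. a x \<partial>M) + ennreal (\<integral>x. p x \<partial>M) = ennreal (rk + rb)" using eq rb by simp
    then obtain ra where ra: "(\<integral>\<^sup>+x. a x \<partial>M) = ennreal ra" "0 \<le> ra"
      by (cases "\<integral>\<^sup>+x. a x \<partial>M") auto
    then have "ennreal (rk + rb) = ennreal (ra + (\<integral>x. p x \<partial>M))" using eq real rb p0 by simp
    then have "rk + rb = ra + (\<integral>x. p x \<partial>M)" using real rb ra p0 by (subst (asm) ennreal_inj) auto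
    then show ?thesis using real ra by (simp add: enn2ereal_ennreal)
  next
    case top
    have "(\<integral>\<^sup>+x. a x \<partial>M) = \<top>"
    proof -
      have "(\<integral>\<^sup>+x. a x \<partial>M) + ennreal (\<integral>x. p x \<partial>M) = \<top>" by (subst eq[symmetric]) (simp add: top)
      then show ?thesis by (simp add: ennreal_add_eq_top)
    qed
    then show ?thesis using top by simp
  qed
  ultimately show ?thesis unfolding ereal_integral_def using rb by (simp add: enn2ereal_ennreal)
qed

section \<open>Integrals against the law of a map\<close>

context
  fixes S :: real and K :: "'c::euclidean_space set" and X :: "real \<times> real \<Rightarrow> 'c"
  assumes S: "0 < S" and K: "compact K" and X: "X \<in> borel_measurable (borel \<Otimes>\<^sub>M borel)" "\<And>z. X z \<in> K"
begin

lemma law_X_measurable: "X \<in> borel_measurable (lebesgue_on {0..S} \<Otimes>\<^sub>M unit_meas)"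
  by (rule measurable_time_unit[OF X(1)])

lemma law_section_measurable: "(\<lambda>\<omega>. X (s, \<omega>)) \<in> borel_measurable unit_meas"
  using measurable_compose[OF measurable_Pair1'[of s borel borel] X(1)] by (simp cong: measurable_cong_sets)

lemma law_spacetime: "spacetime S K (law S K X)"
  by (rule spacetime_law[OF law_X_measurable X(2) borel_compact[OF K]])

lemma law_integrable:
  fixes \<Psi> :: "real \<times> 'c \<Rightarrow> 'd::{banach, second_countable_topology}"
  assumes "continuous_on ({0..S} \<times> K) \<Psi>"
  shows "integrable (lebesgue_on {0..S} \<Otimes>\<^sub>M unit_meas) (\<lambda>z. \<Psi> (fst z, X z))"
  using spacetime_integrable[OF law_spacetime less_imp_le[OF S] K assms] unfolding law_def
  by (subst (asm) integrable_distr_eq[OF law_map_measurable[OF law_X_measurable X(2)] borel_measurable_continuous_on_restrict[OF assms]])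

lemma law_average_integrable:
  fixes \<Psi> :: "real \<times> 'c \<Rightarrow> 'd::{banach, second_countable_topology}"
  assumes "continuous_on ({0..S} \<times> K) \<Psi>"
  shows "integrable (lebesgue_on {0..S}) (\<lambda>s. \<integral>\<omega>. \<Psi> (s, X (s, \<omega>)) \<partial>unit_meas)"
  using time_unit.integrable_fst'[OF law_integrable[OF assms]] by simp

lemma law_integral:
  fixes \<Psi> :: "real \<times> 'c \<Rightarrow> 'd::{banach, second_countable_topology}"
  assumes "continuous_on ({0..S} \<times> K) \<Psi>"
  shows "(\<integral>p. \<Psi> p \<partial>law S K X) = (\<integral>s. (\<integral>\<omega>. \<Psi> (s, X (s, \<omega>)) \<partial>unit_meas) \<partial>lebesgue_on {0..S})"
  using integral_law[OF law_X_measurable X(2) borel_measurable_continuous_on_restrict[OF assms]]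
    time_unit.integral_fst'[OF law_integrable[OF assms]] by simp

lemma law_cut_integral:
  fixes \<Psi> :: "real \<times> 'c \<Rightarrow> 'd::{banach, second_countable_topology}"
  assumes \<Psi>: "continuous_on ({0..S} \<times> K) \<Psi>"
  shows "(\<integral>p. indicator {..s} (fst p) *\<^sub>R \<Psi> p \<partial>law S K X) =
    (\<integral>\<sigma>. indicator {0..s} \<sigma> *\<^sub>R (\<integral>\<omega>. \<Psi> (\<sigma>, X (\<sigma>, \<omega>)) \<partial>unit_meas) \<partial>lebesgue_on {0..S})"
proof -
  let ?P = "lebesgue_on {0..S} \<Otimes>\<^sub>M unit_meas"
  have fm[measurable]: "fst \<in> borel_measurable ?P" by (rule measurable_time_unit_fst)
  have im: "(\<lambda>z. indicator {..s} (fst z) :: real) \<in> borel_measurable ?P" by measurable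
  have int: "integrable ?P (\<lambda>z. indicator {..s} (fst z) *\<^sub>R \<Psi> (fst z, X z))"
  proof (rule Bochner_Integration.integrable_bound[OF law_integrable[OF \<Psi>]])
    show "(\<lambda>z. indicator {..s} (fst z) *\<^sub>R \<Psi> (fst z, X z)) \<in> borel_measurable ?P"
      using im law_integrable[OF \<Psi>] by (intro borel_measurable_scaleR) auto
  qed (auto simp: indicator_def)
  have "(\<lambda>p. indicator {..s} (fst p) *\<^sub>R \<Psi> p) \<in> borel_measurable (restrict_space borel ({0..S} \<times> K))"
  proof -
    have [measurable]: "fst \<in> borel_measurable (restrict_space (borel :: (real \<times> 'c) measure) ({0..S} \<times> K))"
      by (rule borel_measurable_continuous_on_restrict) (intro continuous_intros)
    have [measurable]: "\<Psi> \<in> borel_measurable (restrict_space borel ({0..S} \<times> K))"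
      by (rule borel_measurable_continuous_on_restrict[OF \<Psi>])
    show ?thesis by measurable
  qed
  from integral_law[OF law_X_measurable X(2) this]
  have "(\<integral>p. indicator {..s} (fst p) *\<^sub>R \<Psi> p \<partial>law S K X) = (\<integral>z. indicator {..s} (fst z) *\<^sub>R \<Psi> (fst z, X z) \<partial>?P)" by simp
  also have "\<dots> = (\<integral>\<sigma>. (\<integral>\<omega>. indicator {..s} \<sigma> *\<^sub>R \<Psi> (\<sigma>, X (\<sigma>, \<omega>)) \<partial>unit_meas) \<partial>lebesgue_on {0..S})"
    using time_unit.integral_fst'[OF int] by simp
  also have "\<dots> = (\<integral>\<sigma>. indicator {0..s} \<sigma> *\<^sub>R (\<integral>\<omega>. \<Psi> (\<sigma>, X (\<sigma>, \<omega>)) \<partial>unit_meas) \<partial>lebesgue_on {0..S})"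
    by (rule Bochner_Integration.integral_cong) (auto simp: space_restrict_space indicator_def)
  finally show ?thesis .
qed

lemma law_average_bound:
  fixes \<Psi> :: "real \<times> 'c \<Rightarrow> 'd::{banach, second_countable_topology}"
  assumes \<Psi>: "continuous_on ({0..S} \<times> K) \<Psi>"
  obtains M where "0 \<le> M" "AE s in lebesgue_on {0..S}. norm (\<integral>\<omega>. \<Psi> (s, X (s, \<omega>)) \<partial>unit_meas) \<le> M"
proof -
  obtain M where M: "0 \<le> M" "\<And>p. p \<in> {0..S} \<times> K \<Longrightarrow> norm (\<Psi> p) \<le> M"
    by (rule compact_continuous_bound[OF compact_Times[OF compact_Icc K] \<Psi>]) (rule that)
  have le: "norm (\<integral>\<omega>. \<Psi> (s, X (s, \<omega>)) \<partial>unit_meas) \<le> M" if "s \<in> {0..S}" for s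
  \<comment> \<open>A section could fail to be integrable; its integral is then 0 by convention and
    obeys the bound all the same.\<close>
  proof (cases "integrable unit_meas (\<lambda>\<omega>. \<Psi> (s, X (s, \<omega>)))")
    case True
    have "norm (\<integral>\<omega>. \<Psi> (s, X (s, \<omega>)) \<partial>unit_meas) \<le> (\<integral>\<omega>. M \<partial>unit_meas)"
      by (rule order_trans[OF integral_norm_bound integral_mono]) (use True M X(2) that in auto)
    then show ?thesis by (simp add: unit_meas.prob_space[simplified])
  qed (use M in \<open>simp add: not_integrable_integral_eq\<close>)
  have "AE s in lebesgue_on {0..S}. norm (\<integral>\<omega>. \<Psi> (s, X (s, \<omega>)) \<partial>unit_meas) \<le> M"
    by (rule AE_I2, rule le) (simp add: space_restrict_space)
  then show thesis by (rule that[OF M(1)])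
qed

end

context relaxed_data begin

text \<open>The shift is removed twice, under the integral over the controls and under the one over
  time; \<open>clock\<close> gives the constant \<open>c * T\<close>.\<close>

lemma relaxed_cost_law:
  fixes S :: real
  assumes S: "0 < S" and K: "compact K" "K \<subseteq> control_box"
    and X: "X \<in> borel_measurable (borel \<Otimes>\<^sub>M borel)" "\<And>z. X z \<in> K"
    and t: "continuous_on {0..S} t" "t ` {0..S} \<subseteq> {0..T}" and y: "continuous_on {0..S} y"
    and \<mu>: "AE s in lebesgue_on {0..S}. \<mu> s = distr unit_meas borel (\<lambda>\<omega>. X (s, \<omega>))"
    and clock: "(\<integral>p. fst (snd p) \<partial>law S K X) = T"
  shows "relaxed_cost f g S t y \<mu> = enn2ereal (cost (law S K X) t y) - ereal (c * T) + g (y S)"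
proof -
  let ?T = "lebesgue_on {0..S}"
  note Xm = law_X_measurable[OF S K(1) X] and Xs = law_section_measurable[OF S K(1) X]
  have Kb: "K \<in> sets borel" by (rule borel_compact[OF K(1)])
  have fst_X: "0 \<le> fst (X z)" for z
    using subsetD[OF K(2) X(2)[of z]] by auto
  define k where "k s = (\<integral>\<^sup>+\<omega>. shifted (t s) (y s) (X (s, \<omega>)) \<partial>unit_meas)" for s
  define p where "p s = (\<integral>\<omega>. c * fst (X (s, \<omega>)) \<partial>unit_meas)" for s
  have inner: "ereal_integral (distr unit_meas borel (\<lambda>\<omega>. X (s, \<omega>))) (\<lambda>(v, u). relaxed_integrand f (t s) (y s) v u)
      = enn2ereal (k s) - ereal (p s)" if s: "s \<in> {0..S}" for s
  proof -
    let ?D = "distr unit_meas borel (\<lambda>\<omega>. X (s, \<omega>))"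
    interpret D: prob_space ?D by (rule unit_meas.prob_space_distr[OF Xs])
    have ts: "t s \<in> {0..T}" using t(2) s by blast
    \<comment> \<open>The law of the section is a measure on the whole space, but measurability of
      the integrand is known on \<open>K\<close> only. The cut-off does no harm, as the law is
      carried by \<open>K\<close>.\<close>
    define k0 where "k0 x = shifted (t s) (y s) x * indicator K x" for x
    define p0 where "p0 x = indicator K x * (c * fst x)" for x :: "real \<times> (real^'k)"
    have k0m: "k0 \<in> borel_measurable borel"
    proof -
      have 1: "(\<lambda>q. shifted (t s) (y s) (snd q)) \<in> borel_measurable (restrict_space borel ({0..S} \<times> K))"
        by (rule Fp_along_measurable[of S "\<lambda>_. t s" "\<lambda>_. y s" K])
          (use ts K(2) Kb in \<open>simp_all add: image_subset_iff\<close>)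
      have 2: "(\<lambda>x. (s, x)) \<in> measurable (restrict_space borel K) (restrict_space borel ({0..S} \<times> K))"
      proof (rule measurable_restrict_space2)
        show "(\<lambda>x. (s, x)) \<in> borel_measurable (restrict_space borel K)"
          by (rule borel_measurable_continuous_on_restrict) (intro continuous_intros)
        show "(\<lambda>x. (s, x)) \<in> space (restrict_space borel K) \<rightarrow> {0..S} \<times> K"
          using s by (simp add: space_restrict_space)
      qed
      have "(\<lambda>x. shifted (t s) (y s) x) \<in> borel_measurable (restrict_space borel K)"
        using measurable_compose[OF 2 1] by simp
      then show ?thesis using Kb unfolding k0_def[abs_def]
        by (subst borel_measurable_restrict_space_iff_ennreal[symmetric]) simp_all
    qed
    have p0m: "p0 \<in> borel_measurable borel"
    proof -
      have [measurable]: "(fst :: real \<times> (real^'k) \<Rightarrow> real) \<in> borel_measurable borel"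
        by (intro borel_measurable_continuous_onI continuous_intros)
      note Kb[measurable]
      show ?thesis unfolding p0_def[abs_def] by measurable
    qed
    have p0b: "0 \<le> p0 x \<and> p0 x \<le> c" for x
      using K(2) c_pos by (cases "x \<in> K") (auto simp: p0_def mult_left_le)
    have "ereal_integral ?D (\<lambda>(v, u). relaxed_integrand f (t s) (y s) v u) = enn2ereal (\<integral>\<^sup>+x. k0 x \<partial>?D) - ereal (\<integral>x. p0 x \<partial>?D)"
    proof (rule ereal_integral_shift[OF D.finite_measure_axioms])
      show "k0 \<in> borel_measurable ?D" using k0m by simp
      show "integrable ?D p0"
        by (rule D.integrable_const_bound[where B = c]) (use p0b p0m in \<open>auto intro!: AE_I2\<close>)
      show "0 \<le> p0 x" for x using p0b by blast
      have "AE x in ?D. x \<in> K"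
        by (subst AE_distr_iff[OF Xs]) (use Kb X(2) in auto)
      then show "AE x in ?D. (\<lambda>(v, u). relaxed_integrand f (t s) (y s) v u) x = enn2ereal (k0 x) - ereal (p0 x)"
      proof eventually_elim
        case (elim x)
        then have "0 \<le> fst x" using K(2) by auto
        from enn2ereal_shifted(1)[OF ts this, of "y s"]
        have "enn2ereal (k0 x) - ereal (p0 x) = (integrand (t s) (y s) x + ereal (c * fst x)) - ereal (c * fst x)"
          using elim by (simp add: k0_def p0_def)
        also have "\<dots> = integrand (t s) (y s) x" by (cases "integrand (t s) (y s) x") auto
        finally show ?case by (simp add: case_prod_unfold)
      qed
    qed
    moreover have "(\<integral>\<^sup>+x. k0 x \<partial>?D) = k s"
      unfolding k_def by (subst nn_integral_distr[OF Xs]) (use k0m X(2) in \<open>simp_all add: k0_def\<close>)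
    moreover have "(\<integral>x. p0 x \<partial>?D) = p s"
      unfolding p_def by (subst integral_distr[OF Xs p0m]) (use X(2) in \<open>simp add: p0_def\<close>)
    ultimately show ?thesis by simp
  qed
  have c1: "continuous_on ({0..S} \<times> K) (\<lambda>q. c * fst (snd q))" by (intro continuous_intros)
  have Fm: "(\<lambda>q. shifted (t (fst q)) (y (fst q)) (snd q)) \<in> borel_measurable (restrict_space borel ({0..S} \<times> K))"
    by (rule Fp_along_measurable[OF t y K(2) Kb])
  have "ereal_integral ?T (\<lambda>s. ereal_integral (\<mu> s) (\<lambda>(v, u). relaxed_integrand f (t s) (y s) v u))
      = enn2ereal (\<integral>\<^sup>+s. k s \<partial>?T) - ereal (\<integral>s. p s \<partial>?T)"
  proof (rule ereal_integral_shift[OF time_meas.finite_measure_axioms])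
    have "(\<lambda>z. shifted (t (fst z)) (y (fst z)) (X z)) \<in> borel_measurable (?T \<Otimes>\<^sub>M unit_meas)"
      using measurable_compose[OF law_map_measurable[OF Xm X(2)] Fm] by simp
    from unit_meas.borel_measurable_nn_integral_fst[OF this] show "k \<in> borel_measurable ?T"
      unfolding k_def[abs_def] by simp
    show "integrable ?T p" using law_average_integrable[OF S K(1) X c1] unfolding p_def[abs_def] by simp
    show "0 \<le> p s" for s
      unfolding p_def by (rule Bochner_Integration.integral_nonneg) (use fst_X c_pos in simp)
    show "AE s in ?T. ereal_integral (\<mu> s) (\<lambda>(v, u). relaxed_integrand f (t s) (y s) v u) = enn2ereal (k s) - ereal (p s)"
      using \<mu> AE_space by eventually_elim (simp add: inner space_restrict_space)
  qed
  moreover have "(\<integral>\<^sup>+s. k s \<partial>?T) = cost (law S K X) t y"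
    unfolding cost_def k_def by (simp add: nn_integral_law[OF Xm X(2) Fm])
  moreover have "(\<integral>s. p s \<partial>?T) = c * T"
  proof -
    have "(\<integral>s. p s \<partial>?T) = (\<integral>q. c * fst (snd q) \<partial>law S K X)"
      unfolding p_def law_integral[OF S K(1) X c1] by simp
    then show ?thesis by (simp add: clock)
  qed
  ultimately show ?thesis unfolding relaxed_cost_def by simp
qed

lemma rhs_along_cont:
  fixes S :: real
  assumes "continuous_on {0..S} t" "t ` {0..S} \<subseteq> {0..T}" "continuous_on {0..S} y" "K \<subseteq> control_box"
  shows "continuous_on ({0..S} \<times> K) (\<lambda>p. rhs (t (fst p)) (y (fst p)) (snd p))"
  by (rule Ap_along_cont[OF assms(1,3,2,4)])

lemma sol_clock:
  assumes "sol K S N t y" shows "(\<integral>p. fst (snd p) \<partial>N) = T"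
proof -
  have S: "0 < S" and N: "spacetime S K N" and "t S = T"
    and "t S = (\<integral>p. indicator {..S} (fst p) *\<^sub>R fst (snd p) \<partial>N)"
    using assms by (auto simp: sol_def)
  moreover have "(\<integral>p. indicator {..S} (fst p) *\<^sub>R fst (snd p) \<partial>N) = (\<integral>p. fst (snd p) \<partial>N)"
    by (rule Bochner_Integration.integral_cong) (auto simp: spacetime_space[OF N])
  ultimately show ?thesis by simp
qed

lemma measure_averages:
  fixes X :: "real \<times> real \<Rightarrow> real \<times> (real^'k)" and s :: real
  assumes X: "(\<lambda>\<omega>. X (s, \<omega>)) \<in> borel_measurable unit_meas" and t: "t \<in> {0..T}"
  shows "(\<integral>(v, u). relaxed_rhs A t y v u \<partial>distr unit_meas borel (\<lambda>\<omega>. X (s, \<omega>))) = (\<integral>\<omega>. rhs t y (X (s, \<omega>)) \<partial>unit_meas)"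
    and "(\<integral>(v, u). v \<partial>distr unit_meas borel (\<lambda>\<omega>. X (s, \<omega>))) = (\<integral>\<omega>. fst (X (s, \<omega>)) \<partial>unit_meas)"
proof -
  show "(\<integral>(v, u). relaxed_rhs A t y v u \<partial>distr unit_meas borel (\<lambda>\<omega>. X (s, \<omega>))) = (\<integral>\<omega>. rhs t y (X (s, \<omega>)) \<partial>unit_meas)"
    by (subst integral_distr[OF X rhs_measurable[OF t]]) (simp add: case_prod_unfold)
  have "(\<lambda>(v, u). v) \<in> borel_measurable (borel :: (real \<times> (real^'k)) measure)"
    unfolding case_prod_unfold by (intro borel_measurable_continuous_onI continuous_intros)
  then show "(\<integral>(v, u). v \<partial>distr unit_meas borel (\<lambda>\<omega>. X (s, \<omega>))) = (\<integral>\<omega>. fst (X (s, \<omega>)) \<partial>unit_meas)"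
    by (subst integral_distr[OF X]) (simp_all add: case_prod_unfold)
qed

text \<open>Off a null set of times the Young measure is a law, so the weak derivatives may be
  replaced by averages over \<omega> under the time integral.\<close>

lemma admissible_imp_sol:
  assumes adm: "relaxed_admissible T y0 A S t y \<mu>"
  obtains X where "X \<in> borel_measurable (borel \<Otimes>\<^sub>M borel)" "\<And>z. X z \<in> control_box"
    "AE s in lebesgue_on {0..S}. \<mu> s = distr unit_meas borel (\<lambda>\<omega>. X (s, \<omega>))"
    "sol control_box S (law S control_box X) t y"
proof -
  let ?T = "lebesgue_on {0..S}"
  obtain t' y' where S: "0 < S" and Y: "Linf_young_measure_on S control_box \<mu>" and tr: "t ` {0..S} \<subseteq> {0..T}"
    and Wt: "W1inf S t t'" and Wy: "W1inf S y y'"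
    and ae: "AE s in ?T. y' s = (\<integral>(v, u). relaxed_rhs A (t s) (y s) v u \<partial>\<mu> s) \<and> t' s = (\<integral>(v, u). v \<partial>\<mu> s)"
    and y00: "y 0 = y0" and t00: "t 0 = 0" and tS: "t S = T"
    using adm unfolding relaxed_admissible_def by blast
  have x0: "(1, 0) \<in> (control_box :: (real \<times> (real^'k)) set)" by simp
  obtain X where X: "X \<in> borel_measurable (borel \<Otimes>\<^sub>M borel)" "\<And>z. X z \<in> control_box"
    and \<mu>: "AE s in ?T. \<mu> s = distr unit_meas borel (\<lambda>\<omega>. X (s, \<omega>))"
    by (rule young_measure_is_law[OF Y compact_box x0 S]) (rule that)
  have tc: "continuous_on {0..S} t" and yc: "continuous_on {0..S} y" using Wt Wy by (auto simp: W1inf_def)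
  note Xs = law_section_measurable[OF S compact_box X]
  have ct: "continuous_on ({0..S} \<times> control_box) (\<lambda>p :: real \<times> real \<times> (real^'k). fst (snd p))" by (intro continuous_intros)
  note cy = rhs_along_cont[OF tc tr yc order_refl]
  have ae': "AE s in ?T. y' s = (\<integral>\<omega>. rhs (t s) (y s) (X (s, \<omega>)) \<partial>unit_meas) \<and> t' s = (\<integral>\<omega>. fst (X (s, \<omega>)) \<partial>unit_meas)"
    using ae \<mu> AE_space
  proof eventually_elim
    case (elim s)
    then have "s \<in> {0..S}" by (simp add: space_restrict_space)
    then have ts: "t s \<in> {0..T}" using tr by blast
    show ?case using elim measure_averages(1)[OF Xs ts] measure_averages(2)[OF Xs ts] by simp
  qed
  have cong: "(\<integral>\<sigma>. indicator {0..s} \<sigma> *\<^sub>R d \<sigma> \<partial>?T) = (\<integral>\<sigma>. indicator {0..s} \<sigma> *\<^sub>R e \<sigma> \<partial>?T)"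
    if "d \<in> borel_measurable ?T" "e \<in> borel_measurable ?T" "AE s in ?T. d s = e s" for d e :: "real \<Rightarrow> 'd::euclidean_space" and s
  proof (rule integral_cong_AE)
    have im: "(\<lambda>x. indicator {0..s} x :: real) \<in> borel_measurable ?T"
      by (intro measurable_restrict_space1) (simp add: measurable_completion)
    show "(\<lambda>\<sigma>. indicator {0..s} \<sigma> *\<^sub>R d \<sigma>) \<in> borel_measurable ?T" "(\<lambda>\<sigma>. indicator {0..s} \<sigma> *\<^sub>R e \<sigma>) \<in> borel_measurable ?T"
      by (intro borel_measurable_scaleR im that)+
    show "AE \<sigma> in ?T. indicator {0..s} \<sigma> *\<^sub>R d \<sigma> = indicator {0..s} \<sigma> *\<^sub>R e \<sigma>"
      using that(3) by eventually_elim simp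
  qed
  have "sol control_box S (law S control_box X) t y"
    unfolding sol_def
  proof (intro conjI ballI S law_spacetime[OF S compact_box X] tc yc tr tS)
    fix s assume s: "s \<in> {0..S}"
    have "t s = (\<integral>\<sigma>. indicator {0..s} \<sigma> *\<^sub>R t' \<sigma> \<partial>?T)" using W1inf_integral_eq[OF Wt S s] t00 by simp
    also have "\<dots> = (\<integral>\<sigma>. indicator {0..s} \<sigma> *\<^sub>R (\<integral>\<omega>. fst (X (\<sigma>, \<omega>)) \<partial>unit_meas) \<partial>?T)"
    proof (rule cong)
      show "t' \<in> borel_measurable ?T" using Wt by (simp add: W1inf_def)
      show "(\<lambda>\<sigma>. \<integral>\<omega>. fst (X (\<sigma>, \<omega>)) \<partial>unit_meas) \<in> borel_measurable ?T"
        using law_average_integrable[OF S compact_box X ct] by auto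
      show "AE \<sigma> in ?T. t' \<sigma> = (\<integral>\<omega>. fst (X (\<sigma>, \<omega>)) \<partial>unit_meas)" using ae' by eventually_elim simp
    qed
    also have "\<dots> = (\<integral>p. indicator {..s} (fst p) *\<^sub>R fst (snd p) \<partial>law S control_box X)"
      using law_cut_integral[OF S compact_box X ct, of s] by simp
    finally show "t s = (\<integral>p. indicator {..s} (fst p) *\<^sub>R fst (snd p) \<partial>law S control_box X)" .
    have "y s = y0 + (\<integral>\<sigma>. indicator {0..s} \<sigma> *\<^sub>R y' \<sigma> \<partial>?T)" using W1inf_integral_eq[OF Wy S s] y00 by simp
    also have "(\<integral>\<sigma>. indicator {0..s} \<sigma> *\<^sub>R y' \<sigma> \<partial>?T) =
      (\<integral>\<sigma>. indicator {0..s} \<sigma> *\<^sub>R (\<integral>\<omega>. rhs (t \<sigma>) (y \<sigma>) (X (\<sigma>, \<omega>)) \<partial>unit_meas) \<partial>?T)"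
    proof (rule cong)
      show "y' \<in> borel_measurable ?T" using Wy by (simp add: W1inf_def)
      show "(\<lambda>\<sigma>. \<integral>\<omega>. rhs (t \<sigma>) (y \<sigma>) (X (\<sigma>, \<omega>)) \<partial>unit_meas) \<in> borel_measurable ?T"
        using law_average_integrable[OF S compact_box X cy] by auto
      show "AE \<sigma> in ?T. y' \<sigma> = (\<integral>\<omega>. rhs (t \<sigma>) (y \<sigma>) (X (\<sigma>, \<omega>)) \<partial>unit_meas)" using ae' by eventually_elim simp
    qed
    also have "\<dots> = (\<integral>p. indicator {..s} (fst p) *\<^sub>R rhs (t (fst p)) (y (fst p)) (snd p) \<partial>law S control_box X)"
      using law_cut_integral[OF S compact_box X cy, of s] by simp
    finally show "y s = y0 + (\<integral>p. indicator {..s} (fst p) *\<^sub>R rhs (t (fst p)) (y (fst p)) (snd p) \<partial>law S control_box X)" .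
  qed
  then show thesis using that X \<mu> by blast
qed

text \<open>The averages over \<omega> serve as weak derivatives; they are bounded because the
  integrands are continuous on the compact set \<open>{0..S} \<times> K\<close>. The generating
  functions come from \<open>spacetime_generated\<close>.\<close>

lemma sol_imp_admissible:
  assumes K: "compact K" "K \<subseteq> control_box" and X: "X \<in> borel_measurable (borel \<Otimes>\<^sub>M borel)" "\<And>z. X z \<in> K"
    and sol: "sol K S (law S K X) t y"
  shows "relaxed_admissible T y0 A S t y (\<lambda>s. distr unit_meas borel (\<lambda>\<omega>. X (s, \<omega>)))"
proof -
  let ?T = "lebesgue_on {0..S}"
  let ?\<mu> = "\<lambda>s. distr unit_meas borel (\<lambda>\<omega>. X (s, \<omega>))"
  have S: "0 < S" and tc: "continuous_on {0..S} t" and yc: "continuous_on {0..S} y" and tr: "t ` {0..S} \<subseteq> {0..T}" and tS: "t S = T"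
    and teq: "\<And>s. s \<in> {0..S} \<Longrightarrow> t s = (\<integral>p. indicator {..s} (fst p) *\<^sub>R fst (snd p) \<partial>law S K X)"
    and yeq: "\<And>s. s \<in> {0..S} \<Longrightarrow> y s = y0 + (\<integral>p. indicator {..s} (fst p) *\<^sub>R rhs (t (fst p)) (y (fst p)) (snd p) \<partial>law S K X)"
    using sol unfolding sol_def by blast+
  note sp = law_spacetime[OF S K(1) X] and Xs = law_section_measurable[OF S K(1) X]
  have ct: "continuous_on ({0..S} \<times> K) (\<lambda>p. fst (snd p))" by (intro continuous_intros)
  note cy = rhs_along_cont[OF tc tr yc K(2)]
  let ?t' = "\<lambda>s. \<integral>\<omega>. fst (X (s, \<omega>)) \<partial>unit_meas"
  let ?y' = "\<lambda>s. \<integral>\<omega>. rhs (t s) (y s) (X (s, \<omega>)) \<partial>unit_meas"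
  have Wt: "W1inf S t ?t'"
  proof -
    obtain M where M: "0 \<le> M" "AE s in ?T. norm (?t' s) \<le> M"
      using law_average_bound[OF S K(1) X ct] by auto
    show ?thesis
    proof (rule W1inf_indefinite_integral[OF _ M(2) S M(1)])
      show "?t' \<in> borel_measurable ?T" using law_average_integrable[OF S K(1) X ct] by auto
      show "t s = 0 + (\<integral>\<sigma>. indicator {0..s} \<sigma> *\<^sub>R ?t' \<sigma> \<partial>?T)" if "s \<in> {0..S}" for s
        using teq[OF that] law_cut_integral[OF S K(1) X ct, of s] by simp
    qed
  qed
  have Wy: "W1inf S y ?y'"
  proof -
    obtain M where M: "0 \<le> M" "AE s in ?T. norm (?y' s) \<le> M"
      using law_average_bound[OF S K(1) X cy] by auto
    show ?thesis
    proof (rule W1inf_indefinite_integral[OF _ M(2) S M(1)])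
      show "?y' \<in> borel_measurable ?T" using law_average_integrable[OF S K(1) X cy] by auto
      show "y s = y0 + (\<integral>\<sigma>. indicator {0..s} \<sigma> *\<^sub>R ?y' \<sigma> \<partial>?T)" if "s \<in> {0..S}" for s
        using yeq[OF that] law_cut_integral[OF S K(1) X cy, of s] by simp
    qed
  qed
  have young: "Linf_young_measure_on S control_box ?\<mu>"
    unfolding Linf_young_measure_on_def
  proof (intro conjI ballI)
    fix s assume "s \<in> {0..S}"
    interpret D: prob_space "?\<mu> s" by (rule unit_meas.prob_space_distr[OF Xs])
    show "radon_measure (?\<mu> s)"
      unfolding radon_measure_def using D.emeasure_finite by (auto simp: less_top[symmetric])
  next
    \<comment> \<open>Any value of \<open>X\<close> serves as the point of \<open>K\<close> that the
      construction asks for.\<close>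
    obtain w where w: "\<And>j. w j \<in> borel_measurable borel" "\<And>j s. w j s \<in> K"
      and conv: "\<And>\<phi> :: real \<times> real \<times> (real^'k) \<Rightarrow> real. continuous_on ({0..S} \<times> K) \<phi> \<Longrightarrow>
       (\<lambda>j. \<integral>s. \<phi> (s, w j s) \<partial>?T) \<longlonglongrightarrow> (\<integral>p. \<phi> p \<partial>law S K X)"
      by (rule spacetime_generated[OF K(1) X(2)[of undefined] S sp]) (rule that)
    show "\<exists>w. generates_young S w ?\<mu> \<and> (\<forall>j. AE s in ?T. w j s \<in> control_box)"
    proof (intro exI[of _ w] conjI allI)
      show "AE s in ?T. w j s \<in> control_box" for j using w(2) K(2) by (intro AE_I2) blast
      show "generates_young S w ?\<mu>"
        unfolding generates_young_def
      proof (intro conjI allI impI)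
        from measurable_compose[OF ident_measurable_lebesgue_on w(1)] show "w j \<in> borel_measurable ?T" for j by simp
        obtain M where "\<And>x. x \<in> K \<Longrightarrow> norm x \<le> M"
          by (rule compact_continuous_bound[OF K(1) continuous_on_id]) (rule that)
        then show "\<exists>M. \<forall>j. AE s in ?T. norm (w j s) \<le> M" using w(2) by (intro exI[of _ M] allI AE_I2) blast
        fix \<phi> :: "real \<times> real \<times> (real^'k) \<Rightarrow> real" assume "Cc_test S \<phi>"
        then have cU: "continuous_on ({0..S} \<times> UNIV) \<phi>" by (simp add: Cc_test_def)
        then have cK: "continuous_on ({0..S} \<times> K) \<phi>" by (rule continuous_on_subset) auto
        have sec: "(\<integral>x. \<phi> (s, x) \<partial>?\<mu> s) = (\<integral>\<omega>. \<phi> (s, X (s, \<omega>)) \<partial>unit_meas)" if s: "s \<in> {0..S}" for s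
        proof (rule integral_distr[OF Xs])
          have "continuous_on UNIV (\<lambda>x. \<phi> (s, x))"
            by (rule continuous_on_compose2[OF cU]) (use s in \<open>auto intro!: continuous_intros\<close>)
          then show "(\<lambda>x. \<phi> (s, x)) \<in> borel_measurable borel" by (rule borel_measurable_continuous_onI)
        qed
        have "integrable ?T (\<lambda>s. \<integral>x. \<phi> (s, x) \<partial>?\<mu> s) \<longleftrightarrow> integrable ?T (\<lambda>s. \<integral>\<omega>. \<phi> (s, X (s, \<omega>)) \<partial>unit_meas)"
          by (rule Bochner_Integration.integrable_cong) (simp_all add: sec space_restrict_space)
        then show "integrable ?T (\<lambda>s. \<integral>x. \<phi> (s, x) \<partial>?\<mu> s)" using law_average_integrable[OF S K(1) X cK] by simp
        have "(\<integral>s. (\<integral>x. \<phi> (s, x) \<partial>?\<mu> s) \<partial>?T) = (\<integral>s. (\<integral>\<omega>. \<phi> (s, X (s, \<omega>)) \<partial>unit_meas) \<partial>?T)"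
          by (rule Bochner_Integration.integral_cong) (simp_all add: sec space_restrict_space)
        also have "\<dots> = (\<integral>p. \<phi> p \<partial>law S K X)" by (rule law_integral[OF S K(1) X cK, symmetric])
        finally show "(\<lambda>j. \<integral>s. \<phi> (s, w j s) \<partial>?T) \<longlonglongrightarrow> (\<integral>s. (\<integral>x. \<phi> (s, x) \<partial>?\<mu> s) \<partial>?T)"
          using conv[OF cK] by simp
      qed
    qed
  qed
  have "AE s in ?T. ?y' s = (\<integral>(v, u). relaxed_rhs A (t s) (y s) v u \<partial>?\<mu> s) \<and> ?t' s = (\<integral>(v, u). v \<partial>?\<mu> s)"
    using AE_space
  proof eventually_elim
    case (elim s)
    then have "s \<in> {0..S}" by (simp add: space_restrict_space)
    then have ts: "t s \<in> {0..T}" using tr by blast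
    show ?case using measure_averages(1)[OF Xs ts] measure_averages(2)[OF Xs ts] by simp
  qed
  moreover have "t 0 = 0" using teq[of 0] S spacetime_cut_0[OF S sp, of 0 "\<lambda>p. fst (snd p)"] by simp
  moreover have "y 0 = y0"
    using yeq[of 0] S spacetime_cut_0[OF S sp, of 0 "\<lambda>p. rhs (t (fst p)) (y (fst p)) (snd p)"] by simp
  ultimately show ?thesis
    unfolding relaxed_admissible_def using S young tr Wt Wy tS by blast
qed

end

section \<open>Existence of a minimizer\<close>

context relaxed_data begin

lemma unit_control: "(1, 0) \<in> (control_box :: (real \<times> (real^'k)) set)"
  by simp

text \<open>The constant control \<open>(1, 0)\<close> on \<open>[0, T]\<close>: the clock shows the
  time itself, and the state follows the original equation with zero control.\<close>

lemma admissible_exists: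
  obtains S t y \<mu> where "relaxed_admissible T y0 A S t y \<mu>"
proof -
  let ?x = "(1, 0) :: real \<times> (real^'k)"
  let ?T = "lebesgue_on {0..T}"
  let ?X = "\<lambda>z :: real \<times> real. ?x"
  have cF: "continuous_on ({0..T} \<times> UNIV) (\<lambda>(t, y). rhs t y ?x)"
  proof -
    have "continuous_on ({0..T} \<times> UNIV) (\<lambda>q. (fst q, snd q, ?x))" by (intro continuous_intros)
    from continuous_on_compose2[OF rhs_continuous this] show ?thesis
      by (simp add: case_prod_unfold image_subset_iff)
  qed
  obtain y where y: "continuous_on {0..T} y" "\<And>s. s \<in> {0..T} \<Longrightarrow> y s = y0 + integral {0..s} (\<lambda>\<sigma>. rhs \<sigma> (y \<sigma>) ?x)"
    by (rule ode_solution_exists[OF less_imp_le[OF T_pos] cF rhs_lipschitz[OF _ unit_control]]) (simp, rule that)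
  have X: "?X \<in> borel_measurable (borel \<Otimes>\<^sub>M borel)" "\<And>z. ?X z \<in> control_box" by simp_all
  have tr: "(\<lambda>s. s) ` {0..T} \<subseteq> {0..T}" by simp
  note cy = rhs_along_cont[OF continuous_on_id tr y(1) order_refl]
  have ct: "continuous_on ({0..T} \<times> control_box) (\<lambda>p :: real \<times> real \<times> (real^'k). fst (snd p))" by (intro continuous_intros)
  have cut: "(\<integral>\<sigma>. indicator {0..s} \<sigma> *\<^sub>R h \<sigma> \<partial>?T) = integral {0..s} h"
    if s: "s \<in> {0..T}" and h: "continuous_on {0..T} h" for s and h :: "real \<Rightarrow> 'd::euclidean_space"
  proof -
    have "continuous_on {0..s} h" by (rule continuous_on_subset[OF h]) (use s in auto)
    then have int: "integrable (lebesgue_on {0..s}) h" by (rule continuous_imp_integrable_real)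
    have "(\<integral>\<sigma>. indicator {0..s} \<sigma> *\<^sub>R h \<sigma> \<partial>?T) = (\<integral>\<sigma>. indicator {0..T} \<sigma> *\<^sub>R indicator {0..s} \<sigma> *\<^sub>R h \<sigma> \<partial>lebesgue)"
      by (rule integral_restrict_space) simp
    also have "\<dots> = (\<integral>\<sigma>. indicator {0..s} \<sigma> *\<^sub>R h \<sigma> \<partial>lebesgue)"
      using s by (intro Bochner_Integration.integral_cong) (auto simp: indicator_def)
    also have "\<dots> = (\<integral>\<sigma>. h \<sigma> \<partial>lebesgue_on {0..s})"
      by (rule integral_restrict_space[symmetric]) simp
    also have "\<dots> = integral {0..s} h" by (rule lebesgue_integral_eq_integral[OF int]) simp
    finally show ?thesis .
  qed
  have "sol control_box T (law T control_box ?X) (\<lambda>s. s) y"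
    unfolding sol_def
  proof (intro conjI ballI T_pos law_spacetime[OF T_pos compact_box X] continuous_on_id y(1) tr refl)
    fix s assume s: "s \<in> {0..T}"
    have "(\<integral>p. indicator {..s} (fst p) *\<^sub>R fst (snd p) \<partial>law T control_box ?X) = (\<integral>\<sigma>. indicator {0..s} \<sigma> *\<^sub>R (1::real) \<partial>?T)"
      using law_cut_integral[OF T_pos compact_box X ct, of s] by (simp add: unit_meas.prob_space[simplified])
    also have "\<dots> = integral {0..s} (\<lambda>_. 1)" by (rule cut[OF s continuous_on_const])
    also have "\<dots> = s" using s by simp
    finally show "s = (\<integral>p. indicator {..s} (fst p) *\<^sub>R fst (snd p) \<partial>law T control_box ?X)" by simp
    have "continuous_on {0..T} (\<lambda>\<sigma>. rhs \<sigma> (y \<sigma>) ?x)"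
    proof -
      have "continuous_on {0..T} (\<lambda>\<sigma>. (\<sigma>, y \<sigma>))" by (intro continuous_intros y(1))
      from continuous_on_compose2[OF cF this] show ?thesis by (simp add: image_subset_iff)
    qed
    from cut[OF s this]
    have "(\<integral>p. indicator {..s} (fst p) *\<^sub>R rhs (fst p) (y (fst p)) (snd p) \<partial>law T control_box ?X) = integral {0..s} (\<lambda>\<sigma>. rhs \<sigma> (y \<sigma>) ?x)"
      using law_cut_integral[OF T_pos compact_box X cy, of s] by (simp add: unit_meas.prob_space[simplified])
    then show "y s = y0 + (\<integral>p. indicator {..s} (fst p) *\<^sub>R rhs (fst p) (y (fst p)) (snd p) \<partial>law T control_box ?X)"
      using y(2)[OF s] by simp
  qed
  from sol_imp_admissible[OF compact_box order_refl X this] show thesis by (rule that)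
qed

text \<open>Coercivity turns a bound \<open>b\<close> on the cost into the bound
  \<open>b / c\<close> for the total of \<open>norm u\<close>; the total of \<open>v\<close> is
  \<open>T\<close>.\<close>

lemma sol_ctrl_size_bound:
  assumes sol: "sol control_box S N t y" and J: "cost N t y \<le> ennreal b" "0 \<le> b"
  shows "(\<integral>p. ctrl_size (snd p) \<partial>N) \<le> T + b / c"
proof -
  have S: "0 < S" and N: "spacetime S control_box N" and tr: "t ` {0..S} \<subseteq> {0..T}" using sol by (auto simp: sol_def)
  note sp = spacetime_space[OF N]
  have i1: "integrable N (\<lambda>p. fst (snd p))"
    by (rule spacetime_integrable[OF N less_imp_le[OF S] compact_box]) (intro continuous_intros)
  have i2: "integrable N (\<lambda>p. norm (snd (snd p)))"
    by (rule spacetime_integrable[OF N less_imp_le[OF S] compact_box]) (intro continuous_intros)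
  have "ennreal (\<integral>p. c * norm (snd (snd p)) \<partial>N) = (\<integral>\<^sup>+p. ennreal (c * norm (snd (snd p))) \<partial>N)"
    by (rule nn_integral_eq_integral[symmetric]) (use i2 c_pos in auto)
  also have "\<dots> \<le> cost N t y"
    unfolding cost_def
  proof (rule nn_integral_mono)
    fix p assume p: "p \<in> space N"
    then have "t (fst p) \<in> {0..T}" using tr by (auto simp: sp)
    moreover have "0 \<le> fst (snd p)" using p by (auto simp: sp)
    ultimately show "ennreal (c * norm (snd (snd p))) \<le> shifted (t (fst p)) (y (fst p)) (snd p)" by (rule shifted_coercive)
  qed
  also have "\<dots> \<le> ennreal b" by (rule J)
  finally have "c * (\<integral>p. norm (snd (snd p)) \<partial>N) \<le> b" using J(2) by simp
  then have "(\<integral>p. norm (snd (snd p)) \<partial>N) \<le> b / c" using c_pos by (simp add: field_simps)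
  moreover have "(\<integral>p. ctrl_size (snd p) \<partial>N) = T + (\<integral>p. norm (snd (snd p)) \<partial>N)"
    unfolding ctrl_size_def using i1 i2 sol_clock[OF sol] by simp
  ultimately show ?thesis by simp
qed

lemma relaxed_cost_sol:
  assumes K: "compact K" "K \<subseteq> control_box" and X: "X \<in> borel_measurable (borel \<Otimes>\<^sub>M borel)" "\<And>z. X z \<in> K"
    and sol: "sol K S (law S K X) t y"
    and \<mu>: "AE s in lebesgue_on {0..S}. \<mu> s = distr unit_meas borel (\<lambda>\<omega>. X (s, \<omega>))"
  shows "relaxed_cost f g S t y \<mu> = enn2ereal (cost (law S K X) t y) - ereal (c * T) + g (y S)"
proof -
  have "0 < S" "continuous_on {0..S} t" "t ` {0..S} \<subseteq> {0..T}" "continuous_on {0..S} y"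
    using sol unfolding sol_def by blast+
  from relaxed_cost_law[OF this(1) K X this(2-4) \<mu> sol_clock[OF sol]] show ?thesis .
qed

text \<open>If the infimum is \<infinity>, every admissible triple is a minimizer. Otherwise it is
  finite, since \<open>m - c * T\<close> bounds all costs from below, and the direct method applies
  on a fixed interval.\<close>

lemma relaxed_minimizer_exists:
  assumes g_cont: "continuous_on UNIV g" and g_bound: "\<And>y. ereal m \<le> g y"
  shows "\<exists>S t y \<mu>. relaxed_minimizer T y0 A f g S t y \<mu>"
proof -
  define V where "V = {relaxed_cost f g S t y \<mu> | S t y \<mu>. relaxed_admissible T y0 A S t y \<mu>}"
  define I where "I = Inf V"
  have I_le: "I \<le> relaxed_cost f g S t y \<mu>" if "relaxed_admissible T y0 A S t y \<mu>" for S t y \<mu>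
    unfolding I_def V_def by (rule Inf_lower) (use that in blast)
  have minI: ?thesis if "relaxed_admissible T y0 A S t y \<mu>" "relaxed_cost f g S t y \<mu> \<le> I" for S t y \<mu>
    unfolding relaxed_minimizer_def using that I_le order_trans by blast
  show ?thesis
  proof (cases "I = \<infinity>")
    case True
    obtain S t y \<mu> where "relaxed_admissible T y0 A S t y \<mu>" by (rule admissible_exists)
    then show ?thesis by (rule minI) (simp add: True)
  next
    case False
    have lower: "ereal (m - c * T) \<le> relaxed_cost f g S t y \<mu>" if adm: "relaxed_admissible T y0 A S t y \<mu>" for S t y \<mu>
    proof -
      obtain X where X: "X \<in> borel_measurable (borel \<Otimes>\<^sub>M borel)" "\<And>z. X z \<in> control_box"
        and \<mu>: "AE s in lebesgue_on {0..S}. \<mu> s = distr unit_meas borel (\<lambda>\<omega>. X (s, \<omega>))"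
        and sol: "sol control_box S (law S control_box X) t y" by (rule admissible_imp_sol[OF adm]) (rule that)
      have "relaxed_cost f g S t y \<mu> = enn2ereal (cost (law S control_box X) t y) - ereal (c * T) + g (y S)"
        by (rule relaxed_cost_sol[OF compact_box order_refl X sol \<mu>])
      moreover have "0 - ereal (c * T) + ereal m \<le> enn2ereal (cost (law S control_box X) t y) - ereal (c * T) + g (y S)"
        by (intro add_mono ereal_minus_mono g_bound) simp_all
      ultimately show ?thesis by (simp add: algebra_simps)
    qed
    have "ereal (m - c * T) \<le> I" unfolding I_def V_def by (rule Inf_greatest) (use lower in blast)
    with False obtain i where i: "I = ereal i" by (cases I) auto
    have "\<exists>S N t y. sol control_box S N t y \<and> enn2ereal (cost N t y) - ereal (c * T) + g (y S) < ereal (i + 1 / real (Suc j))" for j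
    proof -
      have "I < ereal (i + 1 / real (Suc j))" by (simp add: i)
      then obtain S t y \<mu> where adm: "relaxed_admissible T y0 A S t y \<mu>"
        and less: "relaxed_cost f g S t y \<mu> < ereal (i + 1 / real (Suc j))"
        unfolding I_def V_def Inf_less_iff by blast
      obtain X where X: "X \<in> borel_measurable (borel \<Otimes>\<^sub>M borel)" "\<And>z. X z \<in> control_box"
        and \<mu>: "AE s in lebesgue_on {0..S}. \<mu> s = distr unit_meas borel (\<lambda>\<omega>. X (s, \<omega>))"
        and sol: "sol control_box S (law S control_box X) t y" by (rule admissible_imp_sol[OF adm]) (rule that)
      have "relaxed_cost f g S t y \<mu> = enn2ereal (cost (law S control_box X) t y) - ereal (c * T) + g (y S)"
        by (rule relaxed_cost_sol[OF compact_box order_refl X sol \<mu>])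
      with less have "enn2ereal (cost (law S control_box X) t y) - ereal (c * T) + g (y S) < ereal (i + 1 / real (Suc j))" by simp
      with sol show ?thesis by blast
    qed
    then have "\<forall>j. \<exists>S N t y. sol control_box S N t y \<and> enn2ereal (cost N t y) - ereal (c * T) + g (y S) < ereal (i + 1 / real (Suc j))" ..
    then obtain S N t y where *: "\<forall>j. sol control_box (S j) (N j) (t j) (y j) \<and>
        enn2ereal (cost (N j) (t j) (y j)) - ereal (c * T) + g (y j (S j)) < ereal (i + 1 / real (Suc j))"
      unfolding choice_iff by (elim exE)
    have sol: "sol control_box (S j) (N j) (t j) (y j)"
      and less: "enn2ereal (cost (N j) (t j) (y j)) - ereal (c * T) + g (y j (S j)) < ereal (i + 1 / real (Suc j))" for j
      using spec[OF *, of j] by (rule conjunct1, rule conjunct2)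
    \<comment> \<open>Bounds the shifted cost of the whole sequence: total cost below
      \<open>i + 1\<close>, minus the least value \<open>m\<close> of \<open>g\<close>, plus the
      shift. The maximum makes it nonnegative.\<close>
    define b where "b = max 0 (i + 1 + c * T - m)"
    \<comment> \<open>The bound on the total cost is solved for the shifted cost. As the latter is
      nonnegative, so is its bound: \<open>ennreal\<close> truncates nothing, and an infinite limit
      of \<open>g\<close> can be excluded later.\<close>
    have J_le: "cost P \<tau> \<eta> \<le> ennreal (e - \<gamma> + c * T)" and e_ge: "0 \<le> e - \<gamma> + c * T"
      if "enn2ereal (cost P \<tau> \<eta>) - ereal (c * T) + z < ereal e" "ereal \<gamma> \<le> z" for P \<tau> \<eta> e \<gamma> and z :: ereal
    proof -
      have "enn2ereal (cost P \<tau> \<eta>) - ereal (c * T) + ereal \<gamma> \<le> enn2ereal (cost P \<tau> \<eta>) - ereal (c * T) + z"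
        using that(2) by (rule add_left_mono)
      with that(1) have l: "enn2ereal (cost P \<tau> \<eta>) - ereal (c * T) + ereal \<gamma> < ereal e" by simp
      then obtain q where q: "cost P \<tau> \<eta> = ennreal q" "0 \<le> q" by (cases "cost P \<tau> \<eta>") auto
      then have "q \<le> e - \<gamma> + c * T" using l by (simp add: enn2ereal_ennreal)
      then show "cost P \<tau> \<eta> \<le> ennreal (e - \<gamma> + c * T)" "0 \<le> e - \<gamma> + c * T" using q by (simp_all add: ennreal_leI)
    qed
    have cost_b: "cost (N j) (t j) (y j) \<le> ennreal b" for j
    proof -
      have "cost (N j) (t j) (y j) \<le> ennreal ((i + 1 / real (Suc j)) - m + c * T)" by (rule J_le[OF less g_bound])
      also have "\<dots> \<le> ennreal b" unfolding b_def by (intro ennreal_leI) (simp add: field_simps max.coboundedI2)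
      finally show ?thesis .
    qed
    \<comment> \<open>A common bound for the total control sizes, hence a common length for all
      rescaled trajectories.\<close>
    define B where "B = T + b / c"
    have B: "T \<le> B" "0 < B" using T_pos c_pos by (auto simp: B_def b_def add_pos_nonneg)
    define K where "K = (outer_box (T / B) :: (real \<times> (real^'k)) set)"
    have K: "compact K" "K \<subseteq> control_box" "(1, 0) \<in> K" "0 \<notin> K"
    proof -
      show "compact K" unfolding K_def by (rule compact_outer_box)
      show "K \<subseteq> control_box" unfolding K_def by (rule outer_box_subset)
      show "(1, 0) \<in> K" using B by (simp add: K_def outer_box_def ctrl_size_def)
      show "0 \<notin> K" unfolding K_def by (rule outer_box_nonzero) (use B T_pos in simp)
    qed
    have "\<exists>N' t' y'. sol K B N' t' y' \<and> enn2ereal (cost N' t' y') - ereal (c * T) + g (y' B) < ereal (i + 1 / real (Suc j))" for j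
    proof -
      obtain N' t' y' where r: "sol (outer_box (T / B)) B N' t' y'" "cost N' t' y' \<le> cost (N j) (t j) (y j)" "y' B = y j (S j)"
        by (rule rescale[OF sol[of j], of B]) (use sol_ctrl_size_bound[OF sol cost_b, of j] in \<open>simp add: B_def b_def\<close>, rule that)
      have "enn2ereal (cost N' t' y') - ereal (c * T) + g (y' B) \<le> enn2ereal (cost (N j) (t j) (y j)) - ereal (c * T) + g (y j (S j))"
        unfolding r(3) using r(2) by (intro add_right_mono ereal_minus_mono) (simp_all add: less_eq_ennreal.rep_eq)
      with less[of j] have "enn2ereal (cost N' t' y') - ereal (c * T) + g (y' B) < ereal (i + 1 / real (Suc j))" by simp
      with r(1) show ?thesis unfolding K_def by blast
    qed
    then have "\<forall>j. \<exists>N' t' y'. sol K B N' t' y' \<and> enn2ereal (cost N' t' y') - ereal (c * T) + g (y' B) < ereal (i + 1 / real (Suc j))" ..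
    then obtain N' t' y' where **: "\<forall>j. sol K B (N' j) (t' j) (y' j) \<and>
        enn2ereal (cost (N' j) (t' j) (y' j)) - ereal (c * T) + g (y' j B) < ereal (i + 1 / real (Suc j))"
      unfolding choice_iff by (elim exE)
    have sol': "sol K B (N' j) (t' j) (y' j)"
      and less': "enn2ereal (cost (N' j) (t' j) (y' j)) - ereal (c * T) + g (y' j B) < ereal (i + 1 / real (Suc j))" for j
      using spec[OF **, of j] by (rule conjunct1, rule conjunct2)
    obtain r :: "nat \<Rightarrow> nat" and X t'' y'' where r: "strict_mono r" and X: "X \<in> borel_measurable (borel \<Otimes>\<^sub>M borel)" "\<And>z. X z \<in> K"
      and sol'': "sol K B (law B K X) t'' y''" and yB: "(\<lambda>j. y' (r j) B) \<longlonglongrightarrow> y'' B"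
      and cost_le: "\<And>l. \<forall>\<^sub>F j in sequentially. cost (N' (r j)) (t' (r j)) (y' (r j)) \<le> l \<Longrightarrow> cost (law B K X) t'' y'' \<le> l"
      by (rule sol_compactness[where N = N' and t = t' and y = y', OF K(2,1,3,4) B(2) sol']) (rule that)
    let ?\<mu> = "\<lambda>s. distr unit_meas borel (\<lambda>\<omega>. X (s, \<omega>))"
    have adm: "relaxed_admissible T y0 A B t'' y'' ?\<mu>" by (rule sol_imp_admissible[OF K(1,2) X sol''])
    have cost_eq: "relaxed_cost f g B t'' y'' ?\<mu> = enn2ereal (cost (law B K X) t'' y'') - ereal (c * T) + g (y'' B)"
      by (rule relaxed_cost_sol[OF K(1,2) X sol'']) simp
    have glim: "(\<lambda>j. g (y' (r j) B)) \<longlonglongrightarrow> g (y'' B)"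
      using g_cont yB by (intro continuous_on_tendsto_compose[OF g_cont]) auto
    have g_ge: "\<forall>\<^sub>F j in sequentially. ereal \<gamma> \<le> g (y' (r j) B)" if "ereal \<gamma> < g (y'' B)" for \<gamma>
      using order_tendstoD(1)[OF glim that] by eventually_elim simp
    \<comment> \<open>Otherwise \<open>g\<close> would exceed \<open>i + 2 + c * T\<close> along the
      sequence, and a nonnegative shifted cost could not bring the total below
      \<open>i + 1\<close>.\<close>
    have "g (y'' B) \<noteq> \<infinity>"
    proof
      assume "g (y'' B) = \<infinity>"
      then have "\<forall>\<^sub>F j in sequentially. ereal (i + 2 + c * T) \<le> g (y' (r j) B)" by (intro g_ge) simp
      then obtain j where j: "ereal (i + 2 + c * T) \<le> g (y' (r j) B)" by (auto simp: eventually_sequentially)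
      have "0 \<le> (i + 1 / real (Suc (r j))) - (i + 2 + c * T) + c * T" by (rule e_ge[OF less' j])
      moreover have "1 / real (Suc (r j)) \<le> 1" by simp
      ultimately show False by linarith
    qed
    moreover have "g (y'' B) \<noteq> -\<infinity>" using g_bound[of "y'' B"] by auto
    ultimately obtain \<gamma> where \<gamma>: "g (y'' B) = ereal \<gamma>" by (cases "g (y'' B)") auto
    have "relaxed_cost f g B t'' y'' ?\<mu> \<le> I"
    \<comment> \<open>Half of \<open>e\<close> pays for replacing \<open>g\<close> along the
      sequence by its limit, the other half for the distance of the sequence from the
      infimum.\<close>
    proof (rule ereal_le_epsilon2)
      fix e :: real assume e: "0 < e"
      have "\<forall>\<^sub>F j in sequentially. ereal (\<gamma> - e / 2) \<le> g (y' (r j) B)" by (intro g_ge) (use e \<gamma> in simp)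
      moreover have "\<forall>\<^sub>F j in sequentially. 1 / real (Suc (r j)) < e / 2"
      proof -
        have "(\<lambda>j. 1 / real (Suc j)) \<longlonglongrightarrow> 0" by (rule LIMSEQ_Suc[OF lim_1_over_n])
        from LIMSEQ_subseq_LIMSEQ[OF this r] have "(\<lambda>j. 1 / real (Suc (r j))) \<longlonglongrightarrow> 0" by (simp add: comp_def)
        then show ?thesis using order_tendstoD(2) e half_gt_zero by blast
      qed
      ultimately have ev: "\<forall>\<^sub>F j in sequentially. cost (N' (r j)) (t' (r j)) (y' (r j)) \<le> ennreal (i + e - \<gamma> + c * T) \<and> 0 \<le> i + e - \<gamma> + c * T"
      proof eventually_elim
        case (elim j)
        have 1: "cost (N' (r j)) (t' (r j)) (y' (r j)) \<le> ennreal ((i + 1 / real (Suc (r j))) - (\<gamma> - e / 2) + c * T)"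
          and 2: "0 \<le> (i + 1 / real (Suc (r j))) - (\<gamma> - e / 2) + c * T"
          by (rule J_le[OF less' elim(1)], rule e_ge[OF less' elim(1)])
        have 3: "(i + 1 / real (Suc (r j))) - (\<gamma> - e / 2) + c * T \<le> i + e - \<gamma> + c * T" using elim(2) by simp
        show ?case using order_trans[OF 1 ennreal_leI[OF 3]] 2 3 by simp
      qed
      have nonneg: "0 \<le> i + e - \<gamma> + c * T" using eventually_happens[OF ev] by auto
      have "cost (law B K X) t'' y'' \<le> ennreal (i + e - \<gamma> + c * T)"
        by (rule cost_le) (use ev in \<open>auto elim: eventually_mono\<close>)
      then have "enn2ereal (cost (law B K X) t'' y'') \<le> ereal (i + e - \<gamma> + c * T)"
        using nonneg by (simp add: less_eq_ennreal.rep_eq)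
      then have "enn2ereal (cost (law B K X) t'' y'') - ereal (c * T) + ereal \<gamma> \<le> ereal (i + e - \<gamma> + c * T) - ereal (c * T) + ereal \<gamma>"
        by (intro add_right_mono ereal_minus_mono) simp_all
      also have "\<dots> = I + ereal e" by (simp add: i)
      finally show "relaxed_cost f g B t'' y'' ?\<mu> \<le> I + ereal e" by (simp add: cost_eq \<gamma>)
    qed
    with adm show ?thesis by (rule minI)
  qed
qed

end

theorem theorem4p13:
  fixes T :: real
    and y0 :: "real^'n"
    and A :: "real \<Rightarrow> real^'n \<Rightarrow> real^'k \<Rightarrow> real^'n"
    and f :: "real \<Rightarrow> real^'n \<Rightarrow> real^'k \<Rightarrow> ereal"
    and g :: "real^'n \<Rightarrow> ereal"
  assumes T_pos: "T > 0"
    and f_range: "\<And>t y u. t \<in> {0..T} \<Longrightarrow> f t y u \<noteq> -\<infinity>"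
    and g_range: "\<And>y. g y \<noteq> -\<infinity>"
    and f_recession: "\<And>t y u. t \<in> {0..T} \<Longrightarrow> norm u = 1 \<Longrightarrow>
          \<exists>l. ((\<lambda>r. f t y (r *\<^sub>R u) / ereal r) \<longlongrightarrow> l) at_top"
    and A_recession: "\<And>t y u. t \<in> {0..T} \<Longrightarrow> norm u = 1 \<Longrightarrow>
          \<exists>l. ((\<lambda>r. A t y (r *\<^sub>R u) /\<^sub>R r) \<longlongrightarrow> l) at_top"
    and A_cont: "\<And>y u. continuous_on {0..T} (\<lambda>t. A t y u)"
    and A_lipschitz: "\<exists>L. \<forall>t\<in>{0..T}. \<forall>u y1 y2. norm (A t y1 u - A t y2 u) \<le> L * norm (y1 - y2)"
    and A_growth: "\<exists>C>0. \<forall>t\<in>{0..T}. \<forall>y u. norm (A t y u) \<le> C * (norm u + 1)"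
    and f_equicont: "equicontinuous_ty T f"
    and f_coercive: "\<exists>c>0. \<forall>t\<in>{0..T}. \<forall>y u. f t y u \<ge> ereal (c * (norm u - 1))"
    and g_cont: "continuous_on UNIV g"
    and g_bounded_below: "\<exists>m::real. \<forall>y. g y \<ge> ereal m"
    and relaxed_rhs_cont: "\<And>y. continuous_on ({0..T} \<times> {0..1} \<times> cball 0 1)
          (\<lambda>(t, v, u). relaxed_rhs A t y v u)"
    and relaxed_integrand_lsc: "\<And>t y. t \<in> {0..T} \<Longrightarrow>
          lsc_on ({0..1} \<times> cball 0 1 - {(0, 0)}) (\<lambda>(v, u). relaxed_integrand f t y v u)"
  shows "\<exists>S t y \<mu>. relaxed_minimizer T y0 A f g S t y \<mu>"
proof -
  obtain L0 where L0: "\<forall>t\<in>{0..T}. \<forall>u y1 y2. norm (A t y1 u - A t y2 u) \<le> L0 * norm (y1 - y2)" using A_lipschitz ..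
  \<comment> \<open>The given constant may be negative, while the locale asks for a nonnegative
    one.\<close>
  have L: "norm (A t y1 u - A t y2 u) \<le> max 0 L0 * norm (y1 - y2)" if "t \<in> {0..T}" for t u y1 y2
    using L0 that by (meson max.cobounded2 mult_right_mono norm_ge_zero order_trans)
  obtain C where C: "0 < C" "\<forall>t\<in>{0..T}. \<forall>y u. norm (A t y u) \<le> C * (norm u + 1)" using A_growth by blast
  obtain c where c: "0 < c" "\<forall>t\<in>{0..T}. \<forall>y u. f t y u \<ge> ereal (c * (norm u - 1))" using f_coercive by blast
  obtain m where m: "\<forall>y. ereal m \<le> g y" using g_bounded_below by blast
  interpret relaxed_data T y0 A f "max 0 L0" C c
  proof
    show "norm (A t y1 u - A t y2 u) \<le> max 0 L0 * norm (y1 - y2)" if "t \<in> {0..T}" for t u y1 y2 by (rule L[OF that])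
    show "norm (A t y u) \<le> C * (norm u + 1)" if "t \<in> {0..T}" for t y u using C(2) that by blast
    show "ereal (c * (norm u - 1)) \<le> f t y u" if "t \<in> {0..T}" for t y u using c(2) that by blast
  qed (fact T_pos C(1) c(1) f_recession f_equicont relaxed_rhs_cont relaxed_integrand_lsc | simp)+
  show ?thesis by (rule relaxed_minimizer_exists[OF g_cont]) (use m in blast)
qed

end
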